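(* Let $\Gamma=\mathbb{Z}\oplus i\mathbb{Z}$, let $\overline M=\mathbb{C}/2\Gamma$, and let $p_1,p_2,p_3,p_4\in\overline M$ be the points represented by $0,1,1+i,i$. Let $\wp$ be the Weierstrass $\wp$-function with respect to the lattice $\Gamma$ and $Q=(\wp'(z))^2dz^2$. Then there exists a one-parameter family $\{f_t\}$ ($0<|t|<\varepsilon$ for some $\varepsilon>0$) of complete conformal CMC-$1$ immersions of finite total curvature $$f_t:\overline M\setminus\{p_1,p_2,p_3,p_4\}\to H^3$$ with Hopf differential $tQ$, such that all four ends $p_1,p_2,p_3,p_4$ are irregular. In particular there are CMC-$1$ surfaces of genus one in $H^3$ with four ends, all of them irregular.
   Context: $H^3=\{aa^*: a\in \mathrm{SL}(2,\mathbb{C})\}$ (with $a^*={}^t\bar a$) is hyperbolic $3$-space of constant curvature $-1$, realized as the upper sheet of the hyperboloid in Minkowski $4$-space, identified with the $2\times2$ Hermitian matrices. CMC-$1$ means constant mean curvature $1$. A holomorphic map $F$ into $\mathrm{SL}(2,\mathbb{C})$ is null if $\det(F_z)\equiv0$. Any conformal CMC-$1$ immersion $f:M\to H^3$ of a Riemann surface has a lift: a null holomorphic immersion $F=(F_{ij}):\widetilde M\to \mathrm{SL}(2,\mathbb{C})$ on the universal cover with $f=FF^*$, unique up to $F\mapsto Fb^{-1}$, $b\in \mathrm{SU}(2)$. Write $F^{-1}dF=\begin{pmatrix} g&-g^2\\1&-g\end{pmatrix}\omega$. Then $g$ is the secondary Gauss map, $Q=\omega\cdot dg$ is the Hopf differential,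 and $G=dF_{11}/dF_{21}=dF_{12}/dF_{22}$ is the hyperbolic Gauss map. The total curvature is finite if $\int_M(-K)\,dA<\infty$. The ends of a complete finite-total-curvature CMC-$1$ surface are the punctures of the domain (a compact Riemann surface minus finitely many points). An end is irregular if $G$ has an essential singularity there, and regular otherwise (at most a pole). *)

theory Defs
  imports "HOL-Complex_Analysis.Complex_Analysis"
begin

no_notation fps_nth (infixl "$" 75)

section \<open>Hyperbolic 3-space in Minkowski 4-space\<close>

type_synonym cmat2 = "complex ^ 2 ^ 2"

definition mat2 :: "complex \<Rightarrow> complex \<Rightarrow> complex \<Rightarrow> complex \<Rightarrow> cmat2" where
  "mat2 a b c d = vector [vector [a, b], vector [c, d]]"

definition conj_transpose :: "cmat2 \<Rightarrow> cmat2" where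
  "conj_transpose A = (\<chi> i j. cnj (A $ j $ i))"

definition hyperbolic_space :: "cmat2 set" where
  "hyperbolic_space = {a ** conj_transpose a | a. det a = 1}"

text \<open>On the Hermitian matrices this is the Lorentzian inner product of signature (-,+,+,+),
  obtained by polarizing the quadratic form \<open>- det\<close>.\<close>

definition mink :: "cmat2 \<Rightarrow> cmat2 \<Rightarrow> real" where
  "mink X Y = - Re (X$1$1 * Y$2$2 + X$2$2 * Y$1$1 - X$1$2 * Y$2$1 - X$2$1 * Y$1$2) / 2"

lemma mink_self: "mink X X = - Re (det X)"
  by (simp add: mink_def det_2 field_simps)


section \<open>Complex tori and punctured tori\<close>

definition lattice :: "complex \<Rightarrow> complex \<Rightarrow> complex set" where
  "lattice w1 w2 = {of_int m * w1 + of_int n * w2 | m n. True}"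

definition lattice_rel :: "complex \<Rightarrow> complex \<Rightarrow> (complex \<times> complex) set" where
  "lattice_rel w1 w2 = {(z, w). w - z \<in> lattice w1 w2}"

definition torus :: "complex \<Rightarrow> complex \<Rightarrow> complex set set" where
  "torus w1 w2 = UNIV // lattice_rel w1 w2"

definition proj :: "complex \<Rightarrow> complex \<Rightarrow> complex \<Rightarrow> complex set" where
  "proj w1 w2 z = lattice_rel w1 w2 `` {z}"

text \<open>A map \<open>f\<close> on the torus minus \<open>P\<close> is studied through its composition with the holomorphic
  covering \<open>proj\<close>, whose local inverses are the conformal charts of the torus. The composition lives
  on the following subset of the plane.\<close>

definition cover_domain :: "complex \<Rightarrow> complex \<Rightarrow> complex set set \<Rightarrow> complex set" where
  "cover_domain w1 w2 P = {z. proj w1 w2 z \<notin> P}"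

definition fundamental_parallelogram :: "complex \<Rightarrow> complex \<Rightarrow> complex set" where
  "fundamental_parallelogram w1 w2 =
     {of_real a * w1 + of_real b * w2 | a b. 0 \<le> a \<and> a < 1 \<and> 0 \<le> b \<and> b < 1}"

definition weierstrass_p :: "complex \<Rightarrow> complex \<Rightarrow> complex \<Rightarrow> complex" where
  "weierstrass_p w1 w2 z =
     1 / z ^ 2 + (\<Sum>\<^sub>\<infinity>w\<in>lattice w1 w2 - {0}. 1 / (z - w) ^ 2 - 1 / w ^ 2)"


section \<open>Conformal immersions of constant mean curvature one\<close>

text \<open>Directional derivatives; \<open>pd 1\<close> and \<open>pd \<i>\<close> are the partial derivatives in x and y,
  where z = x + iy.\<close>

definition pd :: "complex \<Rightarrow> (complex \<Rightarrow> 'a::real_normed_vector) \<Rightarrow> complex \<Rightarrow> 'a" where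
  "pd v X z = frechet_derivative X (at z) v"

primrec Ck_on :: "nat \<Rightarrow> (complex \<Rightarrow> 'a::real_normed_vector) \<Rightarrow> complex set \<Rightarrow> bool" where
  "Ck_on 0 X S \<longleftrightarrow> continuous_on S X"
| "Ck_on (Suc k) X S \<longleftrightarrow> (\<forall>z\<in>S. X differentiable (at z)) \<and> (\<forall>v. Ck_on k (pd v X) S)"

definition smooth_on :: "(complex \<Rightarrow> 'a::real_normed_vector) \<Rightarrow> complex set \<Rightarrow> bool" where
  "smooth_on X S \<longleftrightarrow> (\<forall>k. Ck_on k X S)"

definition first_form :: "(complex \<Rightarrow> cmat2) \<Rightarrow> complex \<Rightarrow> complex \<Rightarrow> complex \<Rightarrow> real" where
  "first_form X z u v = mink (pd u X z) (pd v X z)"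

definition conformal_immersion_on :: "(complex \<Rightarrow> cmat2) \<Rightarrow> complex set \<Rightarrow> bool" where
  "conformal_immersion_on X S \<longleftrightarrow>
     smooth_on X S \<and> X ` S \<subseteq> hyperbolic_space \<and>
     (\<forall>z\<in>S. first_form X z 1 1 > 0 \<and> first_form X z 1 1 = first_form X z \<i> \<i> \<and>
            first_form X z 1 \<i> = 0)"

text \<open>The tangent space of hyperbolic space at X is the Lorentz-orthogonal complement of X.\<close>

definition unit_normal_at :: "(complex \<Rightarrow> cmat2) \<Rightarrow> complex \<Rightarrow> cmat2 \<Rightarrow> bool" where
  "unit_normal_at X z N \<longleftrightarrow>
     conj_transpose N = N \<and> mink N N = 1 \<and> mink N (X z) = 0 \<and>
     mink N (pd 1 X z) = 0 \<and> mink N (pd \<i> X z) = 0"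

text \<open>The covariant derivative of hyperbolic space differs from the flat one by a multiple of X,
  which is orthogonal to N.\<close>

definition second_form ::
    "(complex \<Rightarrow> cmat2) \<Rightarrow> cmat2 \<Rightarrow> complex \<Rightarrow> complex \<Rightarrow> complex \<Rightarrow> real" where
  "second_form X N z u v = mink (pd u (pd v X) z) N"

definition mean_curvature :: "(complex \<Rightarrow> cmat2) \<Rightarrow> cmat2 \<Rightarrow> complex \<Rightarrow> real" where
  "mean_curvature X N z =
     (first_form X z 1 1 * second_form X N z \<i> \<i>
        - 2 * first_form X z 1 \<i> * second_form X N z 1 \<i>
        + first_form X z \<i> \<i> * second_form X N z 1 1)
     / (2 * (first_form X z 1 1 * first_form X z \<i> \<i> - (first_form X z 1 \<i>)\<^sup>2))"

definition cmc1_on :: "(complex \<Rightarrow> cmat2) \<Rightarrow> complex set \<Rightarrow> bool" where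
  "cmc1_on X S \<longleftrightarrow>
     (\<exists>N. continuous_on S N \<and> (\<forall>z\<in>S. unit_normal_at X z (N z) \<and> mean_curvature X (N z) z = 1))"

text \<open>Gaussian curvature of the induced metric in the conformal coordinate z.\<close>

definition gauss_curvature :: "(complex \<Rightarrow> cmat2) \<Rightarrow> complex \<Rightarrow> real" where
  "gauss_curvature X z =
     (let l = (\<lambda>w. ln (first_form X w 1 1)) in
        - (pd 1 (pd 1 l) z + pd \<i> (pd \<i> l) z) / (2 * first_form X z 1 1))"

text \<open>A surface of constant mean curvature one has nonpositive Gaussian curvature, so that Lebesgue
  integrability of \<open>(-K) dA\<close> is finiteness of the total curvature.\<close>

definition finite_total_curvature ::
    "complex \<Rightarrow> complex \<Rightarrow> complex set set \<Rightarrow> (complex \<Rightarrow> cmat2) \<Rightarrow> bool" where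
  "finite_total_curvature w1 w2 P X \<longleftrightarrow>
     set_integrable lborel (fundamental_parallelogram w1 w2 \<inter> cover_domain w1 w2 P)
       (\<lambda>z. - gauss_curvature X z * first_form X z 1 1)"

text \<open>Completeness: every divergent curve has infinite length. A curve in the punctured torus is
  represented by a lift to the covering domain; it is divergent if it eventually leaves each compact
  subset of the punctured torus (these are the projections of compact subsets of the covering
  domain).\<close>

definition complete_metric ::
    "complex \<Rightarrow> complex \<Rightarrow> complex set set \<Rightarrow> (complex \<Rightarrow> cmat2) \<Rightarrow> bool" where
  "complete_metric w1 w2 P X \<longleftrightarrow>
     (\<forall>\<gamma>::real \<Rightarrow> complex.
        \<gamma> C1_differentiable_on {0..<1} \<longrightarrow> \<gamma> ` {0..<1} \<subseteq> cover_domain w1 w2 P \<longrightarrow>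
        (\<forall>K. compact K \<longrightarrow> K \<subseteq> cover_domain w1 w2 P \<longrightarrow>
             (\<forall>\<^sub>F s in at_left 1. proj w1 w2 (\<gamma> s) \<notin> proj w1 w2 ` K)) \<longrightarrow>
        (\<integral>\<^sup>+s\<in>{0..<1}. ennreal (sqrt (first_form X (\<gamma> s)
           (vector_derivative \<gamma> (at s)) (vector_derivative \<gamma> (at s)))) \<partial>lborel) = \<infinity>)"

definition complete_cmc1_ftc ::
    "complex \<Rightarrow> complex \<Rightarrow> complex set set \<Rightarrow> (complex set \<Rightarrow> cmat2) \<Rightarrow> bool" where
  "complete_cmc1_ftc w1 w2 P f \<longleftrightarrow>
     (let X = (\<lambda>z. f (proj w1 w2 z)); S = cover_domain w1 w2 P in
        conformal_immersion_on X S \<and> cmc1_on X S \<and>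
        complete_metric w1 w2 P X \<and> finite_total_curvature w1 w2 P X)"


section \<open>Null lifts, Hopf differential and hyperbolic Gauss map\<close>

definition mat_deriv :: "(complex \<Rightarrow> cmat2) \<Rightarrow> complex \<Rightarrow> cmat2" where
  "mat_deriv F z = (\<chi> i j. deriv (\<lambda>w. F w $ i $ j) z)"

definition null_lift_on :: "complex set \<Rightarrow> (complex \<Rightarrow> cmat2) \<Rightarrow> (complex \<Rightarrow> cmat2) \<Rightarrow> bool" where
  "null_lift_on U X F \<longleftrightarrow>
     (\<forall>i j. (\<lambda>z. F z $ i $ j) holomorphic_on U) \<and>
     (\<forall>z\<in>U. det (F z) = 1 \<and> det (mat_deriv F z) = 0 \<and> mat_deriv F z \<noteq> 0 \<and>
            X z = F z ** conj_transpose (F z))"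

text \<open>The null lift is defined on the universal cover; its branches over small open sets are used
  here. Two branches differ by a right factor in SU(2), which changes neither the Hopf differential
  nor the hyperbolic Gauss map, so it does not matter which branch is taken. The secondary
  Gauss map \<open>g\<close> may have poles; the identities are stated off the poles.\<close>

definition weierstrass_data_on ::
    "complex set \<Rightarrow> (complex \<Rightarrow> cmat2) \<Rightarrow> (complex \<Rightarrow> complex) \<Rightarrow> (complex \<Rightarrow> complex) \<Rightarrow> bool" where
  "weierstrass_data_on U F g \<omega> \<longleftrightarrow>
     g nicely_meromorphic_on U \<and> \<omega> holomorphic_on U \<and>
     (\<forall>z\<in>U. \<not> is_pole g z \<longrightarrow>
        matrix_inv (F z) ** mat_deriv F z =
          mat2 (g z * \<omega> z) (- (g z)\<^sup>2 * \<omega> z) (\<omega> z) (- g z * \<omega> z))"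

text \<open>\<open>q\<close> is the coefficient of the Hopf differential \<open>q(z) dz\<^sup>2 = \<omega> dg\<close>.\<close>

definition hopf_differential ::
    "complex \<Rightarrow> complex \<Rightarrow> complex set set \<Rightarrow> (complex set \<Rightarrow> cmat2) \<Rightarrow> (complex \<Rightarrow> complex) \<Rightarrow> bool" where
  "hopf_differential w1 w2 P f q \<longleftrightarrow>
     (let X = (\<lambda>z. f (proj w1 w2 z)); S = cover_domain w1 w2 P in
        q holomorphic_on S \<and>
        (\<forall>z\<in>S. \<exists>U F g \<omega>. open U \<and> z \<in> U \<and> U \<subseteq> S \<and>
           null_lift_on U X F \<and> weierstrass_data_on U F g \<omega> \<and>
           (\<forall>w\<in>U. \<not> is_pole g w \<longrightarrow> \<omega> w * deriv g w = q w)))"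

text \<open>\<open>G = dF\<^sub>1\<^sub>1 / dF\<^sub>2\<^sub>1 = dF\<^sub>1\<^sub>2 / dF\<^sub>2\<^sub>2\<close>, with the denominators cleared because one of them may
  vanish at points that are not poles of \<open>G\<close>.\<close>

definition hyperbolic_gauss_map ::
    "complex \<Rightarrow> complex \<Rightarrow> complex set set \<Rightarrow> (complex set \<Rightarrow> cmat2) \<Rightarrow> (complex \<Rightarrow> complex) \<Rightarrow> bool" where
  "hyperbolic_gauss_map w1 w2 P f G \<longleftrightarrow>
     (let X = (\<lambda>z. f (proj w1 w2 z)); S = cover_domain w1 w2 P in
        G nicely_meromorphic_on S \<and>
        (\<forall>z\<in>S. \<exists>U F. open U \<and> z \<in> U \<and> U \<subseteq> S \<and> null_lift_on U X F \<and>
           (\<forall>w\<in>U. \<not> is_pole G w \<longrightarrow>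
              mat_deriv F w $ 1 $ 1 = G w * mat_deriv F w $ 2 $ 1 \<and>
              mat_deriv F w $ 1 $ 2 = G w * mat_deriv F w $ 2 $ 2)))"

text \<open>An essential singularity of the meromorphic function \<open>G\<close> means that \<open>G\<close> does not extend
  meromorphically over the puncture. The poles of \<open>G\<close> may accumulate there, so the library notion
  of an isolated singularity does not apply. The constant \<open>G = \<infinity>\<close> is not represented by a
  complex-valued \<open>G\<close>; it has no essential singularity.\<close>

definition irregular_end ::
    "complex \<Rightarrow> complex \<Rightarrow> complex set set \<Rightarrow> (complex set \<Rightarrow> cmat2) \<Rightarrow> complex set \<Rightarrow> bool" where
  "irregular_end w1 w2 P f p \<longleftrightarrow>
     (\<exists>G. hyperbolic_gauss_map w1 w2 P f G \<and> (\<forall>z\<in>p. \<not> G meromorphic_on {z}))"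

end

theory Submission
  imports Defs
begin

text \<open>Bryant's representation is used with both Gauss maps at once. A null lift \<open>F\<close> with secondary Gauss
  map \<open>a1 / a2\<close>, hyperbolic Gauss map \<open>Y1 / Y2\<close> and Hopf differential \<open>t wp'\<^sup>2\<close> is the quotient
  \<open>F = W\<^sub>t W\<^sub>0\<^sup>-\<^sup>1\<close> of fundamental matrices of a linear system whose coefficients depend on \<open>t\<close> and on an
  accessory parameter \<open>b\<close>; the first columns of \<open>W\<^sub>0\<close> and \<open>W\<^sub>t\<close> are \<open>(a1, a2)\<close> and \<open>(Y1, Y2)\<close>. The system is
  regular off the lattice, and the rotation by a right angle about the centre of the unit square together
  with a reflection determines its monodromy from a single real number \<open>disc b t\<close>.
  If \<open>disc b t = 0\<close>, the monodromy of \<open>W\<^sub>t\<close> is generated, up to conjugation, by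
  two anticommuting matrices of square \<open>-1\<close>, so it becomes trivial up to sign on the torus of the doubled
  lattice; if \<open>\<bar>disc b 0\<bar> < 1\<close>, the monodromy of \<open>W\<^sub>0\<close> is unitary after a diagonal rescaling, and then \<open>F F\<^sup>*\<close>
  is well defined. As \<open>disc b 0\<close> runs from \<open>1\<close> to \<open>-1\<close>, the intermediate value theorem yields such a \<open>b\<close> for
  every small \<open>t\<close>.

  Near the lattice points the solutions for \<open>t = 0\<close> are of Frobenius type, and the dominant one makes
  the metric complete and the total curvature density bounded. For \<open>t \<noteq> 0\<close> the singularity is irregular:
  if \<open>Y1 / Y2\<close> were meromorphic at a lattice point, then so would be \<open>Y2\<^sup>2\<close>, and its logarithmic derivative could
  not balance the pole of \<open>t wp'\<^sup>2\<close> in the second-order equation.\<close>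

section \<open>The Gaussian lattice\<close>

text \<open>Eliminating the second unknown gives
  \<open>psi'' - 2 (wp''/wp') psi' = (t wp'^2 + 4 b wp_e^2 wp) psi\<close>, whose solution pairs
  have Wronskian proportional to \<open>wp'^2\<close>. The half-periods off the lattice are singular
  points with exponents 0 and 3; passing to the first-order system removes them. The parameter
  \<open>t\<close> occurs in one off-diagonal entry of the coefficient matrix only, so the
  derivative of \<open>W_t W_0^-1\<close> is \<open>W_t N W_0^-1\<close> with a constant nilpotent
  \<open>N\<close>: the lift is null for every \<open>b\<close>, and only the periods remain to be
  closed. Along a period \<open>F\<close> is multiplied on the left by the monodromy of
  \<open>W_t\<close> and on the right by the inverse of that of \<open>W_0\<close>.
  \<open>F F^*\<close> forgets a unitary right factor, which is an open condition on
  \<open>b\<close>, but in general it forgets a left factor only if that factor is a sign, which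
  without symmetry amounts to several equations. The symmetries of the square leave the single real
  equation \<open>disc b t = 0\<close>, under which the translations by \<open>1\<close> and
  \<open>\<i>\<close> act by elements of order four; doubling the lattice turns them into
  signs.\<close>

abbreviation gaussL :: "complex set" where
  "gaussL \<equiv> lattice 1 \<i>"

lemma gaussL_iff: "z \<in> gaussL \<longleftrightarrow> Re z \<in> \<int> \<and> Im z \<in> \<int>"
proof
  assume "z \<in> gaussL"
  then show "Re z \<in> \<int> \<and> Im z \<in> \<int>"
    by (auto simp: lattice_def)
next
  assume "Re z \<in> \<int> \<and> Im z \<in> \<int>"
  then obtain m n where "Re z = of_int m" "Im z = of_int n"
    by (auto elim!: Ints_cases)
  then have "z = of_int m * 1 + of_int n * \<i>"
    by (simp add: complex_eq_iff)
  then show "z \<in> gaussL"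
    unfolding lattice_def by blast
qed

lemma gaussL_0 [simp]: "0 \<in> gaussL"
  by (simp add: gaussL_iff)

lemma gaussL_add: "z \<in> gaussL \<Longrightarrow> w \<in> gaussL \<Longrightarrow> z + w \<in> gaussL"
  by (simp add: gaussL_iff)

lemma gaussL_diff: "z \<in> gaussL \<Longrightarrow> w \<in> gaussL \<Longrightarrow> z - w \<in> gaussL"
  by (simp add: gaussL_iff)

lemma gaussL_minus_iff [simp]: "- z \<in> gaussL \<longleftrightarrow> z \<in> gaussL"
  by (simp add: gaussL_iff)

lemma gaussL_times_i_iff [simp]: "\<i> * z \<in> gaussL \<longleftrightarrow> z \<in> gaussL"
  by (auto simp add: gaussL_iff)

lemma gaussL_cnj_iff [simp]: "cnj z \<in> gaussL \<longleftrightarrow> z \<in> gaussL"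
  by (auto simp add: gaussL_iff)

lemma gaussL_add_iff: "w \<in> gaussL \<Longrightarrow> z + w \<in> gaussL \<longleftrightarrow> z \<in> gaussL"
  using gaussL_add gaussL_diff by fastforce

lemma gaussL_norm_ge_1:
  assumes "z \<in> gaussL" "z \<noteq> 0"
  shows "1 \<le> norm z"
proof (cases "Re z = 0")
  case False
  then have "1 \<le> \<bar>Re z\<bar>"
    using assms by (auto simp: gaussL_iff elim!: Ints_cases)
  also have "\<dots> \<le> norm z" by (rule abs_Re_le_cmod)
  finally show ?thesis .
next
  case True
  then have "Im z \<noteq> 0" using assms by (simp add: complex_eq_iff)
  then have "1 \<le> \<bar>Im z\<bar>"
    using assms by (auto simp: gaussL_iff elim!: Ints_cases)
  also have "\<dots> \<le> norm z" by (rule abs_Im_le_cmod)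
  finally show ?thesis .
qed

lemma gaussL_eq_image: "gaussL = (\<lambda>(m, n). of_int m + of_int n * \<i>) ` UNIV"
  by (auto simp: lattice_def image_iff)

lemma inj_gauss: "inj (\<lambda>(m, n). of_int m + of_int n * \<i>)"
  by (auto simp: inj_def complex_eq_iff)

lemma countable_gaussL: "countable gaussL"
  unfolding gaussL_eq_image by simp

lemma closed_gaussL: "closed gaussL"
proof -
  have "gaussL = Re -` \<int> \<inter> Im -` \<int>"
    by (auto simp: gaussL_iff)
  moreover have "closed (Re -` (\<int>::real set))" "closed (Im -` (\<int>::real set))"
    by (auto intro!: closed_vimage closed_Ints continuous_intros)
  ultimately show ?thesis by (simp add: closed_Int)
qed

lemma open_compl_gaussL: "open (- gaussL)"
  using closed_gaussL by (simp add: open_Compl)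

lemma connected_compl_gaussL: "connected (- gaussL)"
  using connected_open_diff_countable[of "UNIV::complex set" gaussL] countable_gaussL connected_UNIV
  by (simp add: Compl_eq_Diff_UNIV)

lemma finite_gaussL_bounded: "finite {w \<in> gaussL. norm w < R}"
proof -
  have "{w \<in> gaussL. norm w < R} \<subseteq>
      (\<lambda>(m, n). of_int m + of_int n * \<i>) ` ({- \<lceil>R\<rceil>..\<lceil>R\<rceil>} \<times> {- \<lceil>R\<rceil>..\<lceil>R\<rceil>})"
  proof
    fix w assume "w \<in> {w \<in> gaussL. norm w < R}"
    then obtain m n where w: "w = of_int m + of_int n * \<i>" and R: "norm w < R"
      by (auto simp: lattice_def)
    have "\<bar>real_of_int m\<bar> < R" "\<bar>real_of_int n\<bar> < R"
      using abs_Re_le_cmod[of w] abs_Im_le_cmod[of w] R by (auto simp: w)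
    then have "m \<in> {- \<lceil>R\<rceil>..\<lceil>R\<rceil>}" "n \<in> {- \<lceil>R\<rceil>..\<lceil>R\<rceil>}"
      by (auto simp: abs_less_iff) linarith+
    then show "w \<in> (\<lambda>(m, n). of_int m + of_int n * \<i>) ` ({- \<lceil>R\<rceil>..\<lceil>R\<rceil>} \<times> {- \<lceil>R\<rceil>..\<lceil>R\<rceil>})"
      unfolding w by (intro image_eqI[of _ _ "(m, n)"]) auto
  qed
  then show ?thesis by (rule finite_subset) auto
qed

text \<open>The cubic decay of \<open>1 / norm w ^ 3\<close> is shared equally between the two
  coordinates; the exponent \<open>3/2 > 1\<close> makes each one-dimensional sum finite.\<close>

lemma summable_on_int_powr:
  "(\<lambda>m::int. (1 + \<bar>real_of_int m\<bar>) powr (-3/2)) summable_on UNIV"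
proof -
  let ?f = "\<lambda>m::int. (1 + \<bar>real_of_int m\<bar>) powr (-3/2)"
  have "summable (\<lambda>n::nat. real n powr (-3/2))"
    by (subst summable_real_powr_iff) simp
  then have "summable (\<lambda>n::nat. real (Suc n) powr (-3/2))"
    by (subst summable_Suc_iff)
  then have nat: "(\<lambda>n::nat. (1 + real n) powr (-3/2)) summable_on UNIV"
    by (subst summable_on_UNIV_nonneg_real_iff) (auto simp: add.commute)
  have "?f summable_on (int ` UNIV)"
    using nat by (subst summable_on_reindex) (auto simp: o_def)
  moreover have "?f summable_on ((\<lambda>n. - int n) ` UNIV)"
    using nat by (subst summable_on_reindex) (auto simp: o_def inj_def)
  ultimately have "?f summable_on (int ` UNIV \<union> (\<lambda>n. - int n) ` UNIV)"
    by (rule summable_on_union)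
  moreover have "int ` UNIV \<union> (\<lambda>n. - int n) ` UNIV = UNIV"
    by (metis (no_types, lifting) UNIV_eq_I UnI1 UnI2 int_cases2 rangeI)
  ultimately show ?thesis by simp
qed

lemma summable_on_gaussL: "(\<lambda>w. 1 / norm w ^ 3) summable_on (gaussL - {0})"
proof -
  let ?h = "\<lambda>m::int. (1 + \<bar>real_of_int m\<bar>) powr (-3/2)"
  let ?e = "\<lambda>(m, n). (of_int m + of_int n * \<i> :: complex)"
  have "(\<lambda>(m, n). ?h m * ?h n) summable_on (UNIV \<times> UNIV)"
  proof (rule summable_on_SigmaI)
    show "((\<lambda>n. case (m, n) of (m, n) \<Rightarrow> ?h m * ?h n) has_sum ?h m * infsum ?h UNIV) UNIV"
      if "m \<in> UNIV" for m
      unfolding prod.case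
      by (intro has_sum_cmult_right has_sum_infsum summable_on_int_powr)
    show "(\<lambda>m. ?h m * infsum ?h UNIV) summable_on UNIV"
      by (intro summable_on_cmult_left summable_on_int_powr)
  qed auto
  then have "(\<lambda>p. 8 * (case p of (m, n) \<Rightarrow> ?h m * ?h n)) summable_on UNIV"
    by (intro summable_on_cmult_right) simp
  then have "(\<lambda>p. 8 * (case p of (m, n) \<Rightarrow> ?h m * ?h n)) summable_on (UNIV - {(0,0)})"
    by (rule summable_on_subset_banach) auto
  then have "(\<lambda>p. 1 / norm (?e p) ^ 3) summable_on (UNIV - {(0,0)})"
  proof (rule summable_on_comparison_test)
    fix p :: "int \<times> int" assume p: "p \<in> UNIV - {(0,0)}"
    obtain m n where mn: "p = (m, n)" by fastforce
    define w where "w = ?e p"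
    have w0: "w \<noteq> 0" "w \<in> gaussL"
      using p by (auto simp: w_def mn complex_eq_iff gaussL_iff)
    then have w1: "1 \<le> norm w" using gaussL_norm_ge_1 by blast
    have "\<bar>real_of_int m\<bar> \<le> norm w" "\<bar>real_of_int n\<bar> \<le> norm w"
      using abs_Re_le_cmod[of w] abs_Im_le_cmod[of w] by (auto simp: w_def mn)
    \<comment> \<open>Nonzero lattice points have norm at least 1, so the summand 1 is absorbed at
      the price of a factor 2 per coordinate; it returns as \<open>8 = 2 ^ 3\<close>.\<close>
    then have le: "1 + \<bar>real_of_int m\<bar> \<le> 2 * norm w" "1 + \<bar>real_of_int n\<bar> \<le> 2 * norm w"
      using w1 by auto
    have "(2 * norm w) powr (-3/2) \<le> ?h m" "(2 * norm w) powr (-3/2) \<le> ?h n"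
      using le w1 by (auto intro!: powr_mono2')
    then have "(2 * norm w) powr (-3/2) * (2 * norm w) powr (-3/2) \<le> ?h m * ?h n"
      by (intro mult_mono) auto
    also have "(2 * norm w) powr (-3/2) * (2 * norm w) powr (-3/2) = (2 * norm w) powr (-3)"
      by (simp flip: powr_add)
    also have "\<dots> = 1 / (8 * norm w ^ 3)"
      using w1 by (simp add: powr_minus powr_numeral power_mult_distrib divide_simps)
    finally have "8 * (1 / (8 * norm w ^ 3)) \<le> 8 * (?h m * ?h n)" by linarith
    then show "1 / norm (?e p) ^ 3 \<le> 8 * (case p of (m, n) \<Rightarrow> ?h m * ?h n)"
      unfolding w_def[symmetric] by (simp add: mn)
  qed auto
  then have "(\<lambda>w. 1 / norm w ^ 3) summable_on (?e ` (UNIV - {(0,0)}))"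
    by (subst summable_on_reindex) (auto simp: o_def intro: inj_on_subset[OF inj_gauss])
  also have "?e ` (UNIV - {(0,0)}) = gaussL - {0}"
    using inj_gauss by (simp add: gaussL_eq_image image_set_diff)
  finally show ?thesis .
qed

section \<open>The Weierstrass function of the Gaussian lattice\<close>

abbreviation wp :: "complex \<Rightarrow> complex" where
  "wp \<equiv> weierstrass_p 1 \<i>"

text \<open>The part of the lattice sum that is holomorphic on the disc of radius \<open>R\<close>.\<close>

definition wp_tail :: "real \<Rightarrow> complex \<Rightarrow> complex" where
  "wp_tail R z = (\<Sum>\<^sub>\<infinity>w\<in>{w \<in> gaussL - {0}. 2 * R \<le> norm w}. 1 / (z - w) ^ 2 - 1 / w ^ 2)"

text \<open>The cutoff at \<open>2 * R\<close> keeps \<open>norm (z - w)\<close> above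
  \<open>norm w / 2\<close>, and the correction \<open>1 / w ^ 2\<close> lowers the numerator to
  \<open>z * (2 * w - z)\<close>. Both bounds are uniform in \<open>z\<close>, as the Weierstrass
  test requires.\<close>

lemma wp_term_bound:
  fixes z w :: complex
  assumes "norm z \<le> R" "2 * R \<le> norm w" "w \<noteq> 0"
  shows "norm (1 / (z - w) ^ 2 - 1 / w ^ 2) \<le> 10 * R * (1 / norm w ^ 3)"
    and "norm (1 / (z - w) ^ 3) \<le> 8 * (1 / norm w ^ 3)"
proof -
  have R: "R \<ge> 0" using assms norm_ge_zero order_trans by blast
  have w: "norm w > 0" using assms by simp
  have half: "norm w / 2 \<le> norm (z - w)"
    using norm_triangle_ineq2[of w z] assms by (simp add: norm_minus_commute)
  then have zw: "z \<noteq> w" using w by auto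
  have "1 / (z - w) ^ 2 - 1 / w ^ 2 = z * (2 * w - z) / ((z - w) ^ 2 * w ^ 2)"
    using zw assms(3) by (simp add: divide_simps) (simp add: power2_eq_square algebra_simps)
  also have "norm \<dots> = norm z * norm (2 * w - z) / (norm (z - w) ^ 2 * norm w ^ 2)"
    by (simp add: norm_mult norm_divide norm_power)
  also have "\<dots> \<le> R * (5 / 2 * norm w) / ((norm w / 2) ^ 2 * norm w ^ 2)"
  proof (intro frac_le mult_mono power_mono half)
    show "norm (2 * w - z) \<le> 5 / 2 * norm w"
      using norm_triangle_ineq4[of "2 * w" z] assms by (simp add: norm_mult)
  qed (use assms w R in auto)
  also have "\<dots> = 10 * R * (1 / norm w ^ 3)"
    using w by (simp add: field_simps power2_eq_square power3_eq_cube)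
  finally show "norm (1 / (z - w) ^ 2 - 1 / w ^ 2) \<le> 10 * R * (1 / norm w ^ 3)" .
  have "norm (1 / (z - w) ^ 3) = 1 / norm (z - w) ^ 3"
    by (simp add: norm_divide norm_power)
  also have "\<dots> \<le> 1 / (norm w / 2) ^ 3"
    using half w by (intro divide_left_mono power_mono mult_pos_pos zero_less_power) auto
  finally show "norm (1 / (z - w) ^ 3) \<le> 8 * (1 / norm w ^ 3)"
    by (simp add: power_divide)
qed

lemma summable_wp_tail:
  assumes "norm z \<le> R"
  shows "(\<lambda>w. 1 / (z - w) ^ 2 - 1 / w ^ 2) summable_on {w \<in> gaussL - {0}. 2 * R \<le> norm w}"
    and "(\<lambda>w. 1 / (z - w) ^ 3) summable_on {w \<in> gaussL - {0}. 2 * R \<le> norm w}"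
proof -
  have s: "(\<lambda>w. 1 / norm w ^ 3) summable_on {w \<in> gaussL - {0}. 2 * R \<le> norm w}"
    by (rule summable_on_subset_banach[OF summable_on_gaussL]) auto
  have "(\<lambda>w. norm (1 / (z - w) ^ 2 - 1 / w ^ 2)) summable_on {w \<in> gaussL - {0}. 2 * R \<le> norm w}"
    by (rule summable_on_comparison_test[OF summable_on_cmult_right[OF s, of "10 * R"]])
       (use wp_term_bound(1) assms in auto)
  then show "(\<lambda>w. 1 / (z - w) ^ 2 - 1 / w ^ 2) summable_on {w \<in> gaussL - {0}. 2 * R \<le> norm w}"
    by (rule abs_summable_summable)
  have "(\<lambda>w. norm (1 / (z - w) ^ 3)) summable_on {w \<in> gaussL - {0}. 2 * R \<le> norm w}"
    by (rule summable_on_comparison_test[OF summable_on_cmult_right[OF s, of 8]])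
       (use wp_term_bound(2) assms in auto)
  then show "(\<lambda>w. 1 / (z - w) ^ 3) summable_on {w \<in> gaussL - {0}. 2 * R \<le> norm w}"
    by (rule abs_summable_summable)
qed

lemma inverse_square_deriv:
  fixes w y :: complex
  assumes "y \<noteq> w"
  shows "((\<lambda>y. 1 / (y - w) ^ 2 - c) has_field_derivative - 2 / (y - w) ^ 3) (at y)"
proof -
  have "((\<lambda>x. 1 / x ^ 2) has_field_derivative - 2 / x ^ 3) (at x)" if "x \<noteq> 0" for x :: complex
    using that by (auto intro!: derivative_eq_intros simp: field_simps power2_eq_square power3_eq_cube)
  note d = this
  have "((\<lambda>y. 1 / (y - w) ^ 2) has_field_derivative - 2 / (y - w) ^ 3 * 1) (at y)"
    by (rule DERIV_chain2[where f = "\<lambda>x. 1 / x ^ 2"])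
       (use d[of "y - w"] assms in \<open>auto intro!: derivative_eq_intros\<close>)
  from DERIV_diff[OF this DERIV_const[of c]] show ?thesis by simp
qed

text \<open>Termwise differentiation: locally uniform limits of holomorphic functions may be
  differentiated, and convergence along the filter of finite subsets is what the unordered sum
  means.\<close>

lemma wp_tail_deriv:
  assumes "norm z < R"
  shows "(wp_tail R has_field_derivative
      (\<Sum>\<^sub>\<infinity>w\<in>{w \<in> gaussL - {0}. 2 * R \<le> norm w}. - 2 / (z - w) ^ 3)) (at z)"
proof -
  let ?A = "{w \<in> gaussL - {0}. 2 * R \<le> norm w}"
  have R: "R > 0" using assms norm_ge_zero order_le_less_trans by blast
  have s: "(\<lambda>w. 1 / norm w ^ 3) summable_on ?A"
    by (rule summable_on_subset_banach[OF summable_on_gaussL]) auto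
  have ul: "uniform_limit (cball 0 R) (\<lambda>X y. \<Sum>w\<in>X. 1 / (y - w) ^ 2 - 1 / w ^ 2) (wp_tail R)
      (finite_subsets_at_top ?A)"
    unfolding wp_tail_def
    by (rule Weierstrass_m_test_general[where M = "\<lambda>w. 10 * R * (1 / norm w ^ 3)"])
       (use wp_term_bound(1) summable_on_cmult_right[OF s] in auto)
  have nz: "y - w \<noteq> 0" if "norm y \<le> R" "w \<in> ?A" for y w
    using that R by auto
  have der: "((\<lambda>y. \<Sum>w\<in>X. 1 / (y - w) ^ 2 - 1 / w ^ 2) has_field_derivative (\<Sum>w\<in>X. - 2 / (y - w) ^ 3)) (at y)"
    if "X \<subseteq> ?A" "norm y \<le> R" for X y
  proof (rule DERIV_sum)
    fix w assume "w \<in> X"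
    then have "y - w \<noteq> 0" using nz that by auto
    then show "((\<lambda>y. 1 / (y - w) ^ 2 - 1 / w ^ 2) has_field_derivative - 2 / (y - w) ^ 3) (at y)"
      by (intro inverse_square_deriv) simp
  qed
  have ev: "\<forall>\<^sub>F X in finite_subsets_at_top ?A.
      continuous_on (cball 0 R) (\<lambda>y. \<Sum>w\<in>X. 1 / (y - w) ^ 2 - 1 / w ^ 2) \<and>
      (\<forall>y\<in>ball 0 R. ((\<lambda>y. \<Sum>w\<in>X. 1 / (y - w) ^ 2 - 1 / w ^ 2) has_field_derivative
          (\<Sum>w\<in>X. - 2 / (y - w) ^ 3)) (at y))"
  proof (rule eventually_finite_subsets_at_top_weakI)
    fix X assume X: "finite X" "X \<subseteq> ?A"
    show "continuous_on (cball 0 R) (\<lambda>y. \<Sum>w\<in>X. 1 / (y - w) ^ 2 - 1 / w ^ 2) \<and>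
      (\<forall>y\<in>ball 0 R. ((\<lambda>y. \<Sum>w\<in>X. 1 / (y - w) ^ 2 - 1 / w ^ 2) has_field_derivative
          (\<Sum>w\<in>X. - 2 / (y - w) ^ 3)) (at y))"
    proof (intro conjI ballI)
      show "continuous_on (cball 0 R) (\<lambda>y. \<Sum>w\<in>X. 1 / (y - w) ^ 2 - 1 / w ^ 2)"
        by (intro continuous_on_sum continuous_on_diff continuous_on_divide continuous_on_power
            continuous_on_const continuous_on_id ballI) (use nz X in \<open>fastforce+\<close>)
    qed (use X der in auto)
  qed
  obtain g' where g': "\<And>w. w \<in> ball 0 R \<Longrightarrow> (wp_tail R has_field_derivative (g' w)) (at w) \<and>
      ((\<lambda>X. \<Sum>v\<in>X. - 2 / (w - v) ^ 3) \<longlongrightarrow> g' w) (finite_subsets_at_top ?A)"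
    by (rule has_complex_derivative_uniform_limit[OF ev ul _ R]) auto
  have "((\<lambda>v. - 2 / (z - v) ^ 3) has_sum g' z) ?A"
    using g'[of z] assms by (simp add: has_sum_def)
  then have "(\<Sum>\<^sub>\<infinity>w\<in>?A. - 2 / (z - w) ^ 3) = g' z"
    by (rule infsumI)
  then show ?thesis using g'[of z] assms by simp
qed

lemma wp_split:
  assumes "norm z \<le> R"
  shows "wp z = 1 / z ^ 2 + (\<Sum>w\<in>{w \<in> gaussL - {0}. norm w < 2 * R}. 1 / (z - w) ^ 2 - 1 / w ^ 2)
       + wp_tail R z"
proof -
  let ?A = "{w \<in> gaussL - {0}. 2 * R \<le> norm w}" and ?B = "{w \<in> gaussL - {0}. norm w < 2 * R}"
  have fin: "finite ?B"
    by (rule finite_subset[OF _ finite_gaussL_bounded[of "2 * R"]]) auto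
  have eq: "gaussL - {0} = ?B \<union> ?A" by auto
  have "(\<Sum>\<^sub>\<infinity>w\<in>gaussL - {0}. 1 / (z - w) ^ 2 - 1 / w ^ 2)
      = (\<Sum>\<^sub>\<infinity>w\<in>?B. 1 / (z - w) ^ 2 - 1 / w ^ 2) + (\<Sum>\<^sub>\<infinity>w\<in>?A. 1 / (z - w) ^ 2 - 1 / w ^ 2)"
    by (subst eq, intro infsum_Un_disjoint) (use summable_wp_tail(1)[OF assms] fin in auto)
  then show ?thesis
    using fin by (simp add: weierstrass_p_def wp_tail_def)
qed

text \<open>The finitely many terms with small \<open>w\<close> are differentiated directly and the
  tail by \<open>wp_tail_deriv\<close>. The pole \<open>1 / z ^ 2\<close> contributes the term
  \<open>w = 0\<close>, so the result is one sum over the whole lattice.\<close>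

lemma wp_has_derivative:
  assumes "z \<notin> gaussL"
  shows "(wp has_field_derivative (\<Sum>\<^sub>\<infinity>w\<in>gaussL. - 2 / (z - w) ^ 3)) (at z)"
proof -
  define R where "R = norm z + 1"
  let ?A = "{w \<in> gaussL - {0}. 2 * R \<le> norm w}" and ?B = "{w \<in> gaussL - {0}. norm w < 2 * R}"
  have fin: "finite ?B"
    by (rule finite_subset[OF _ finite_gaussL_bounded[of "2 * R"]]) auto
  have zR: "norm z < R" by (simp add: R_def)
  have z0: "z \<noteq> 0" using assms by auto
  have 1: "((\<lambda>z. 1 / z ^ 2) has_field_derivative - 2 / z ^ 3) (at z)"
    using z0 by (auto intro!: derivative_eq_intros simp: field_simps power2_eq_square power3_eq_cube)
  have 2: "((\<lambda>z. \<Sum>w\<in>?B. 1 / (z - w) ^ 2 - 1 / w ^ 2) has_field_derivative (\<Sum>w\<in>?B. - 2 / (z - w) ^ 3)) (at z)"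
  proof (rule DERIV_sum)
    fix w assume "w \<in> ?B"
    then have "z - w \<noteq> 0" using assms by auto
    then show "((\<lambda>y. 1 / (y - w) ^ 2 - 1 / w ^ 2) has_field_derivative - 2 / (z - w) ^ 3) (at z)"
      by (intro inverse_square_deriv) simp
  qed
  have 3: "((\<lambda>z. 1 / z ^ 2 + (\<Sum>w\<in>?B. 1 / (z - w) ^ 2 - 1 / w ^ 2) + wp_tail R z) has_field_derivative
      (- 2 / z ^ 3 + (\<Sum>w\<in>?B. - 2 / (z - w) ^ 3) + (\<Sum>\<^sub>\<infinity>w\<in>?A. - 2 / (z - w) ^ 3))) (at z)"
    by (intro DERIV_add 1 2 wp_tail_deriv zR)
  have "- 2 / z ^ 3 + (\<Sum>w\<in>?B. - 2 / (z - w) ^ 3) + (\<Sum>\<^sub>\<infinity>w\<in>?A. - 2 / (z - w) ^ 3)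
      = (\<Sum>\<^sub>\<infinity>w\<in>gaussL. - 2 / (z - w) ^ 3)"
  proof -
    have eq: "gaussL = insert 0 ?B \<union> ?A" by auto
    have s: "(\<lambda>w. - 2 / (z - w) ^ 3) summable_on ?A"
      using summable_on_cmult_right[OF summable_wp_tail(2)[of z R], of "-2"] zR by simp
    have "(\<Sum>\<^sub>\<infinity>w\<in>insert 0 ?B \<union> ?A. - 2 / (z - w) ^ 3)
        = (\<Sum>\<^sub>\<infinity>w\<in>insert 0 ?B. - 2 / (z - w) ^ 3) + (\<Sum>\<^sub>\<infinity>w\<in>?A. - 2 / (z - w) ^ 3)"
      by (rule infsum_Un_disjoint) (use s fin in auto)
    also have "(\<Sum>\<^sub>\<infinity>w\<in>insert 0 ?B. - 2 / (z - w) ^ 3) = - 2 / z ^ 3 + (\<Sum>w\<in>?B. - 2 / (z - w) ^ 3)"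
      using fin by simp
    finally show ?thesis by (subst eq) simp
  qed
  with 3 have "((\<lambda>z. 1 / z ^ 2 + (\<Sum>w\<in>?B. 1 / (z - w) ^ 2 - 1 / w ^ 2) + wp_tail R z) has_field_derivative
      (\<Sum>\<^sub>\<infinity>w\<in>gaussL. - 2 / (z - w) ^ 3)) (at z)" by simp
  then show ?thesis
  proof (rule has_field_derivative_transform_within_open[where S = "ball 0 R"])
    fix y :: complex assume "y \<in> ball 0 R"
    then show "1 / y ^ 2 + (\<Sum>w\<in>?B. 1 / (y - w) ^ 2 - 1 / w ^ 2) + wp_tail R y = wp y"
      by (subst wp_split[of y R]) auto
  qed (use zR in auto)
qed

lemma wp_holomorphic: "wp holomorphic_on - gaussL"
  using wp_has_derivative open_compl_gaussL by (auto simp: holomorphic_on_open)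

lemma wp_minus: "wp (- z) = wp z"
proof -
  have "(\<Sum>\<^sub>\<infinity>w\<in>gaussL - {0}. 1 / (- z - w) ^ 2 - 1 / w ^ 2)
      = (\<Sum>\<^sub>\<infinity>w\<in>gaussL - {0}. 1 / (- z - (- w)) ^ 2 - 1 / (- w) ^ 2)"
    by (rule infsum_reindex_bij_witness[of _ uminus uminus]) auto
  also have "\<dots> = (\<Sum>\<^sub>\<infinity>w\<in>gaussL - {0}. 1 / (z - w) ^ 2 - 1 / w ^ 2)"
    by (intro infsum_cong) (simp add: power2_commute)
  finally show ?thesis by (simp add: weierstrass_p_def)
qed

text \<open>Multiplication by \<open>\<i>\<close> permutes the Gaussian lattice and every term is
  homogeneous of degree -2. This symmetry is special to the square lattice and forces the cubic in
  the differential equation of \<open>wp\<close> to be odd.\<close>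

lemma wp_times_i: "wp (\<i> * z) = - wp z"
proof -
  have "(\<Sum>\<^sub>\<infinity>w\<in>gaussL - {0}. 1 / (\<i> * z - w) ^ 2 - 1 / w ^ 2)
      = (\<Sum>\<^sub>\<infinity>w\<in>gaussL - {0}. 1 / (\<i> * z - \<i> * w) ^ 2 - 1 / (\<i> * w) ^ 2)"
    by (rule infsum_reindex_bij_witness[of _ "\<lambda>w. \<i> * w" "\<lambda>w. - \<i> * w"]) auto
  also have "\<dots> = (\<Sum>\<^sub>\<infinity>w\<in>gaussL - {0}. - (1 / (z - w) ^ 2 - 1 / w ^ 2))"
    by (intro infsum_cong) (simp add: power_mult_distrib flip: right_diff_distrib)
  also have "\<dots> = - (\<Sum>\<^sub>\<infinity>w\<in>gaussL - {0}. 1 / (z - w) ^ 2 - 1 / w ^ 2)"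
    by (rule infsum_uminus)
  finally show ?thesis by (simp add: weierstrass_p_def power_mult_distrib)
qed

lemma wp_cnj: "wp (cnj z) = cnj (wp z)"
proof -
  have "(\<Sum>\<^sub>\<infinity>w\<in>gaussL - {0}. 1 / (cnj z - w) ^ 2 - 1 / w ^ 2)
      = (\<Sum>\<^sub>\<infinity>w\<in>gaussL - {0}. 1 / (cnj z - cnj w) ^ 2 - 1 / (cnj w) ^ 2)"
    by (rule infsum_reindex_bij_witness[of _ cnj cnj]) auto
  also have "\<dots> = (\<Sum>\<^sub>\<infinity>w\<in>gaussL - {0}. cnj (1 / (z - w) ^ 2 - 1 / w ^ 2))"
    by (intro infsum_cong) simp
  also have "\<dots> = cnj (\<Sum>\<^sub>\<infinity>w\<in>gaussL - {0}. 1 / (z - w) ^ 2 - 1 / w ^ 2)"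
    by (rule infsum_cnj)
  finally show ?thesis by (simp add: weierstrass_p_def)
qed

text \<open>The differentiated series has no correction terms, so a translation by a lattice vector
  only reindexes it.\<close>

lemma deriv_wp_periodic:
  assumes "w \<in> gaussL" "z \<notin> gaussL"
  shows "deriv wp (z + w) = deriv wp z"
proof -
  have "deriv wp (z + w) = (\<Sum>\<^sub>\<infinity>v\<in>gaussL. - 2 / (z + w - v) ^ 3)"
    using assms by (intro DERIV_imp_deriv wp_has_derivative) (simp add: gaussL_add_iff)
  also have "\<dots> = (\<Sum>\<^sub>\<infinity>v\<in>gaussL. - 2 / (z - v) ^ 3)"
    by (rule infsum_reindex_bij_witness[of _ "\<lambda>v. v + w" "\<lambda>v. v - w"])
       (use assms gaussL_add gaussL_diff in \<open>auto simp: algebra_simps\<close>)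
  also have "\<dots> = deriv wp z"
    using assms by (intro DERIV_imp_deriv[symmetric] wp_has_derivative)
  finally show ?thesis .
qed

section \<open>Trace-free linear systems\<close>

text \<open>The row vector \<open>(\<psi>, \<eta>)\<close> solves the system with coefficient matrix
  \<open>[[\<alpha>, \<beta>], [\<gamma>, - \<alpha>]]\<close> acting from the right.\<close>

definition lin_sol :: "(complex \<Rightarrow> complex) \<Rightarrow> (complex \<Rightarrow> complex) \<Rightarrow> (complex \<Rightarrow> complex) \<Rightarrow>
    complex set \<Rightarrow> (complex \<Rightarrow> complex) \<Rightarrow> (complex \<Rightarrow> complex) \<Rightarrow> bool" where
  "lin_sol \<alpha> \<beta> \<gamma> S \<psi> \<eta> \<longleftrightarrow> (\<forall>z\<in>S.
     (\<psi> has_field_derivative \<alpha> z * \<psi> z + \<gamma> z * \<eta> z) (at z) \<and>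
     (\<eta> has_field_derivative \<beta> z * \<psi> z - \<alpha> z * \<eta> z) (at z))"

lemma lin_sol_subset: "lin_sol \<alpha> \<beta> \<gamma> S \<psi> \<eta> \<Longrightarrow> T \<subseteq> S \<Longrightarrow> lin_sol \<alpha> \<beta> \<gamma> T \<psi> \<eta>"
  by (auto simp: lin_sol_def)

lemma lin_sol_holomorphic:
  assumes "lin_sol \<alpha> \<beta> \<gamma> S \<psi> \<eta>" "open S"
  shows "\<psi> holomorphic_on S" "\<eta> holomorphic_on S"
  using assms by (auto simp: lin_sol_def holomorphic_on_open)

lemma lin_sol_comb:
  assumes "lin_sol \<alpha> \<beta> \<gamma> S \<psi>1 \<eta>1" "lin_sol \<alpha> \<beta> \<gamma> S \<psi>2 \<eta>2"
  shows "lin_sol \<alpha> \<beta> \<gamma> S (\<lambda>z. k1 * \<psi>1 z + k2 * \<psi>2 z) (\<lambda>z. k1 * \<eta>1 z + k2 * \<eta>2 z)"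
  unfolding lin_sol_def
proof (intro ballI conjI)
  fix z assume "z \<in> S"
  then have d: "(\<psi>1 has_field_derivative \<alpha> z * \<psi>1 z + \<gamma> z * \<eta>1 z) (at z)"
    "(\<eta>1 has_field_derivative \<beta> z * \<psi>1 z - \<alpha> z * \<eta>1 z) (at z)"
    "(\<psi>2 has_field_derivative \<alpha> z * \<psi>2 z + \<gamma> z * \<eta>2 z) (at z)"
    "(\<eta>2 has_field_derivative \<beta> z * \<psi>2 z - \<alpha> z * \<eta>2 z) (at z)"
    using assms by (auto simp: lin_sol_def)
  show "((\<lambda>z. k1 * \<psi>1 z + k2 * \<psi>2 z) has_field_derivative
      \<alpha> z * (k1 * \<psi>1 z + k2 * \<psi>2 z) + \<gamma> z * (k1 * \<eta>1 z + k2 * \<eta>2 z)) (at z)"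
    using DERIV_add[OF DERIV_cmult[OF d(1), of k1] DERIV_cmult[OF d(3), of k2]]
    by (rule DERIV_cong) (simp add: algebra_simps)
  show "((\<lambda>z. k1 * \<eta>1 z + k2 * \<eta>2 z) has_field_derivative
      \<beta> z * (k1 * \<psi>1 z + k2 * \<psi>2 z) - \<alpha> z * (k1 * \<eta>1 z + k2 * \<eta>2 z)) (at z)"
    using DERIV_add[OF DERIV_cmult[OF d(2), of k1] DERIV_cmult[OF d(4), of k2]]
    by (rule DERIV_cong) (simp add: algebra_simps)
qed

text \<open>The coefficient matrix has trace zero.\<close>

lemma lin_sol_wronskian:
  assumes "lin_sol \<alpha> \<beta> \<gamma> S \<psi>1 \<eta>1" "lin_sol \<alpha> \<beta> \<gamma> S \<psi>2 \<eta>2" "open S" "connected S"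
    and "z \<in> S" "w \<in> S"
  shows "\<psi>1 z * \<eta>2 z - \<eta>1 z * \<psi>2 z = \<psi>1 w * \<eta>2 w - \<eta>1 w * \<psi>2 w"
proof -
  have der: "((\<lambda>z. \<psi>1 z * \<eta>2 z - \<eta>1 z * \<psi>2 z) has_field_derivative 0) (at z)" if "z \<in> S" for z
  proof -
    have d: "(\<psi>1 has_field_derivative \<alpha> z * \<psi>1 z + \<gamma> z * \<eta>1 z) (at z)"
      "(\<eta>1 has_field_derivative \<beta> z * \<psi>1 z - \<alpha> z * \<eta>1 z) (at z)"
      "(\<psi>2 has_field_derivative \<alpha> z * \<psi>2 z + \<gamma> z * \<eta>2 z) (at z)"
      "(\<eta>2 has_field_derivative \<beta> z * \<psi>2 z - \<alpha> z * \<eta>2 z) (at z)"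
      using assms that by (auto simp: lin_sol_def)
    from DERIV_diff[OF DERIV_mult[OF d(1,4)] DERIV_mult[OF d(2,3)]] show ?thesis
      by (rule DERIV_cong) (simp add: algebra_simps)
  qed
  have "(\<lambda>z. \<psi>1 z * \<eta>2 z - \<eta>1 z * \<psi>2 z) constant_on S"
    by (rule has_field_derivative_0_imp_constant_on[OF der assms(4,3)])
  then show ?thesis using assms(5,6) unfolding constant_on_def by fastforce
qed

text \<open>Cramer's rule: the coefficients are Wronskians with the solution to be expanded, hence
  constant. This also serves as the uniqueness theorem for initial values.\<close>

lemma lin_sol_expand:
  assumes f1: "lin_sol \<alpha> \<beta> \<gamma> S \<psi>1 \<eta>1" and f2: "lin_sol \<alpha> \<beta> \<gamma> S \<psi>2 \<eta>2"
    and f: "lin_sol \<alpha> \<beta> \<gamma> S \<psi> \<eta>" and S: "open S" "connected S" "c \<in> S"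
    and det: "\<psi>1 c * \<eta>2 c - \<eta>1 c * \<psi>2 c = 1" and z: "z \<in> S"
  shows "\<psi> z = (\<psi> c * \<eta>2 c - \<eta> c * \<psi>2 c) * \<psi>1 z + (\<psi>1 c * \<eta> c - \<eta>1 c * \<psi> c) * \<psi>2 z"
    and "\<eta> z = (\<psi> c * \<eta>2 c - \<eta> c * \<psi>2 c) * \<eta>1 z + (\<psi>1 c * \<eta> c - \<eta>1 c * \<psi> c) * \<eta>2 z"
proof -
  have d: "\<psi>1 z * \<eta>2 z - \<eta>1 z * \<psi>2 z = 1"
    using lin_sol_wronskian[OF f1 f2 S(1,2) z S(3)] det by simp
  have k: "\<psi> c * \<eta>2 c - \<eta> c * \<psi>2 c = \<psi> z * \<eta>2 z - \<eta> z * \<psi>2 z"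
    "\<psi>1 c * \<eta> c - \<eta>1 c * \<psi> c = \<psi>1 z * \<eta> z - \<eta>1 z * \<psi> z"
    using lin_sol_wronskian[OF f f2 S(1,2,3) z] lin_sol_wronskian[OF f1 f S(1,2,3) z] by auto
  have "(\<psi> z * \<eta>2 z - \<eta> z * \<psi>2 z) * \<psi>1 z + (\<psi>1 z * \<eta> z - \<eta>1 z * \<psi> z) * \<psi>2 z
      = \<psi> z * (\<psi>1 z * \<eta>2 z - \<eta>1 z * \<psi>2 z)"
    by (simp add: algebra_simps)
  then show "\<psi> z = (\<psi> c * \<eta>2 c - \<eta> c * \<psi>2 c) * \<psi>1 z + (\<psi>1 c * \<eta> c - \<eta>1 c * \<psi> c) * \<psi>2 z"
    by (simp add: k d)
  have "(\<psi> z * \<eta>2 z - \<eta> z * \<psi>2 z) * \<eta>1 z + (\<psi>1 z * \<eta> z - \<eta>1 z * \<psi> z) * \<eta>2 z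
      = \<eta> z * (\<psi>1 z * \<eta>2 z - \<eta>1 z * \<psi>2 z)"
    by (simp add: algebra_simps)
  then show "\<eta> z = (\<psi> c * \<eta>2 c - \<eta> c * \<psi>2 c) * \<eta>1 z + (\<psi>1 c * \<eta> c - \<eta>1 c * \<psi> c) * \<eta>2 z"
    by (simp add: k d)
qed

text \<open>Integration of \<open>s ^ n\<close> along the segment supplies the divisor
  \<open>n + 1\<close> of one Picard step, and thus the factorials.\<close>

lemma segment_growth_bound:
  fixes f :: "complex \<Rightarrow> complex"
  assumes der: "\<And>w. w \<in> closed_segment c z \<Longrightarrow> (f has_field_derivative f' w) (at w)"
    and bnd: "\<And>s. 0 \<le> s \<Longrightarrow> s \<le> 1 \<Longrightarrow> norm (f' (c + of_real s * (z - c))) \<le> K * s ^ n"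
    and fc: "f c = 0"
  shows "norm (f z) \<le> K * norm (z - c) / real (Suc n)"
proof -
  let ?g = "\<lambda>s::real. c + of_real s * (z - c)"
  have seg: "?g s \<in> closed_segment c z" if "0 \<le> s" "s \<le> 1" for s
    using that unfolding closed_segment_def by (auto intro!: exI[of _ s] simp: algebra_simps scaleR_conv_of_real)
  have vd: "((\<lambda>s. f (?g s)) has_vector_derivative (z - c) * f' (?g s)) (at s)" if "0 \<le> s" "s \<le> 1" for s
  proof -
    have "(?g has_vector_derivative (z - c)) (at s)"
      by (auto intro!: derivative_eq_intros)
    then show ?thesis
      using field_vector_diff_chain_at[of ?g "z - c" s f "f' (?g s)"] der[OF seg[OF that]]
      by (simp add: o_def mult.commute)
  qed
  have "norm (f (?g 1) - f (?g 0)) \<le> K * norm (z - c) / real (Suc n) * 1 ^ Suc n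
      - K * norm (z - c) / real (Suc n) * 0 ^ Suc n"
  proof (rule differentiable_bound_general[where \<phi>' = "\<lambda>s. K * norm (z - c) * s ^ n" and
        f' = "\<lambda>s. (z - c) * f' (?g s)"])
    show "continuous_on {0..1} (\<lambda>s. f (?g s))"
      by (intro continuous_at_imp_continuous_on ballI has_vector_derivative_continuous[OF vd]) auto
    show "continuous_on {0..1} (\<lambda>s. K * norm (z - c) / real (Suc n) * s ^ Suc n)"
      by (intro continuous_intros)
    show "((\<lambda>s. K * norm (z - c) / real (Suc n) * s ^ Suc n) has_vector_derivative K * norm (z - c) * s ^ n) (at s)"
      for s :: real
      using DERIV_cmult[OF DERIV_pow[of "Suc n" s UNIV], of "K * norm (z - c) / real (Suc n)"]
      by (simp add: has_real_derivative_iff_has_vector_derivative mult.assoc del: of_nat_Suc power_Suc)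
    show "norm ((z - c) * f' (?g s)) \<le> K * norm (z - c) * s ^ n" if "0 < s" "s < 1" for s
    proof -
      have "norm (z - c) * norm (f' (?g s)) \<le> norm (z - c) * (K * s ^ n)"
        by (intro mult_left_mono bnd) (use that in auto)
      then show ?thesis by (simp add: norm_mult mult_ac)
    qed
  qed (use vd in auto)
  then show ?thesis using fc by simp
qed

text \<open>Picard iteration on a star-shaped domain, where holomorphic functions have primitives.
  The majorant \<open>(2 * M * norm (z - c)) ^ n / fact n\<close> gives locally uniform convergence
  and, after summation, the explicit bound; the latter allows estimates that are uniform in
  parameters of the coefficients.\<close>

theorem lin_sol_exists:
  assumes S: "open S" "c \<in> S" and star: "\<And>z. z \<in> S \<Longrightarrow> closed_segment c z \<subseteq> S"
    and hol: "\<alpha> holomorphic_on S" "\<beta> holomorphic_on S" "\<gamma> holomorphic_on S"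
  obtains \<psi> \<eta> where "lin_sol \<alpha> \<beta> \<gamma> S \<psi> \<eta>" "\<psi> c = x0" "\<eta> c = y0"
    "\<And>z M. z \<in> S \<Longrightarrow> (\<And>w. w \<in> closed_segment c z \<Longrightarrow> norm (\<alpha> w) \<le> M \<and> norm (\<beta> w) \<le> M \<and> norm (\<gamma> w) \<le> M) \<Longrightarrow>
       norm (\<psi> z) + norm (\<eta> z) \<le> (norm x0 + norm y0) * exp (2 * M * norm (z - c))"
proof -
  have starl: "starlike S" using S star by (auto simp: starlike_def)
  \<comment> \<open>A primitive normalized to vanish at \<open>c\<close>, so that only the zeroth
    iterate carries the initial values.\<close>
  define prim where "prim = (\<lambda>f. SOME g. (\<forall>z\<in>S. (g has_field_derivative f z) (at z)) \<and> g c = (0::complex))"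
  have prim: "(\<forall>z\<in>S. (prim f has_field_derivative f z) (at z)) \<and> prim f c = 0" if f: "f holomorphic_on S" for f
  proof -
    obtain g where g: "\<forall>z\<in>S. (g has_field_derivative f z) (at z)"
      using holomorphic_starlike_primitive[OF holomorphic_on_imp_continuous_on[OF f] starl S(1), of "{}"]
        f S(1) holomorphic_on_imp_differentiable_at by blast
    then have "(\<forall>z\<in>S. ((\<lambda>z. g z - g c) has_field_derivative f z) (at z)) \<and> g c - g c = 0"
      by (auto intro!: derivative_eq_intros)
    then show ?thesis unfolding prim_def by (rule someI[where P = "\<lambda>g. (\<forall>z\<in>S. (g has_field_derivative f z) (at z)) \<and> g c = 0"])
  qed
  define pq where "pq = rec_nat (\<lambda>z. x0, \<lambda>z. y0) (\<lambda>n (p, q).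
      (prim (\<lambda>z. \<alpha> z * p z + \<gamma> z * q z), prim (\<lambda>z. \<beta> z * p z - \<alpha> z * q z)))"
  define p where "p = (\<lambda>n. fst (pq n))"
  define q where "q = (\<lambda>n. snd (pq n))"
  have p0: "p 0 = (\<lambda>z. x0)" and q0: "q 0 = (\<lambda>z. y0)"
    and ps: "\<And>n. p (Suc n) = prim (\<lambda>z. \<alpha> z * p n z + \<gamma> z * q n z)"
    and qs: "\<And>n. q (Suc n) = prim (\<lambda>z. \<beta> z * p n z - \<alpha> z * q n z)"
    by (simp_all add: p_def q_def pq_def case_prod_unfold)
  have hol_pq: "p n holomorphic_on S \<and> q n holomorphic_on S" for n
  proof (induction n)
    case 0 then show ?case by (simp add: p0 q0)
  next
    case (Suc n)
    then have "(\<lambda>z. \<alpha> z * p n z + \<gamma> z * q n z) holomorphic_on S" "(\<lambda>z. \<beta> z * p n z - \<alpha> z * q n z) holomorphic_on S"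
      using hol by (auto intro!: holomorphic_intros)
    from this[THEN prim] show ?case
      using S(1) unfolding ps qs by (auto simp: holomorphic_on_open)
  qed
  have der: "(p (Suc n) has_field_derivative \<alpha> z * p n z + \<gamma> z * q n z) (at z)"
    "(q (Suc n) has_field_derivative \<beta> z * p n z - \<alpha> z * q n z) (at z)"
    "p (Suc n) c = 0" "q (Suc n) c = 0" if "z \<in> S" for n z
  proof -
    have "(\<lambda>z. \<alpha> z * p n z + \<gamma> z * q n z) holomorphic_on S" "(\<lambda>z. \<beta> z * p n z - \<alpha> z * q n z) holomorphic_on S"
      using hol hol_pq by (auto intro!: holomorphic_intros)
    from this[THEN prim] that show "(p (Suc n) has_field_derivative \<alpha> z * p n z + \<gamma> z * q n z) (at z)"
      "(q (Suc n) has_field_derivative \<beta> z * p n z - \<alpha> z * q n z) (at z)"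
      "p (Suc n) c = 0" "q (Suc n) c = 0" by (auto simp: ps qs)
  qed
  define N where "N = norm x0 + norm y0"
  have bound: "norm (p n z) + norm (q n z) \<le> N * (2 * M * norm (z - c)) ^ n / fact n"
    if "z \<in> S" "\<And>w. w \<in> closed_segment c z \<Longrightarrow> norm (\<alpha> w) \<le> M \<and> norm (\<beta> w) \<le> M \<and> norm (\<gamma> w) \<le> M" for n z M
    using that
  proof (induction n arbitrary: z)
    case 0 then show ?case by (simp add: p0 q0 N_def)
  next
    case (Suc n)
    let ?g = "\<lambda>s::real. c + of_real s * (z - c)"
    have M: "0 \<le> M" using Suc.prems(2)[of c] norm_ge_zero order_trans by blast
    have seg: "?g s \<in> closed_segment c z" if "0 \<le> s" "s \<le> 1" for s
      using that unfolding closed_segment_def by (auto intro!: exI[of _ s] simp: algebra_simps scaleR_conv_of_real)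
    have sub: "closed_segment c z \<subseteq> S" using star Suc.prems by blast
    have IH: "norm (p n (?g s)) + norm (q n (?g s)) \<le> N * (2 * M * norm (z - c)) ^ n / fact n * s ^ n"
      if s: "0 \<le> s" "s \<le> 1" for s
    proof -
      have "closed_segment c (?g s) \<subseteq> closed_segment c z"
        using seg[OF s] by (simp add: subset_closed_segment)
      then have "norm (p n (?g s)) + norm (q n (?g s)) \<le> N * (2 * M * norm (?g s - c)) ^ n / fact n"
        using Suc.prems(2) sub seg[OF s] by (intro Suc.IH) blast+
      also have "norm (?g s - c) = s * norm (z - c)" using s by (simp add: norm_mult)
      finally show ?thesis by (simp add: power_mult_distrib mult_ac)
    qed
    define K where "K = M * (N * (2 * M * norm (z - c)) ^ n / fact n)"
    have Kb: "M * norm (p n (?g s)) + M * norm (q n (?g s)) \<le> K * s ^ n" if "0 \<le> s" "s \<le> 1" for s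
      using mult_left_mono[OF IH[OF that] M] by (simp add: K_def algebra_simps)
    have 1: "norm (p (Suc n) z) \<le> K * norm (z - c) / real (Suc n)"
    proof (rule segment_growth_bound[where f' = "\<lambda>z. \<alpha> z * p n z + \<gamma> z * q n z"])
      fix s :: real assume s: "0 \<le> s" "s \<le> 1"
      have "norm (\<alpha> (?g s) * p n (?g s) + \<gamma> (?g s) * q n (?g s)) \<le> M * norm (p n (?g s)) + M * norm (q n (?g s))"
        using Suc.prems(2)[OF seg[OF s]] M
        by (intro norm_triangle_le add_mono) (auto simp: norm_mult intro!: mult_right_mono)
      then show "norm (\<alpha> (?g s) * p n (?g s) + \<gamma> (?g s) * q n (?g s)) \<le> K * s ^ n"
        using Kb[OF s] by linarith
    qed (use der sub S in auto)
    have 2: "norm (q (Suc n) z) \<le> K * norm (z - c) / real (Suc n)"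
    proof (rule segment_growth_bound[where f' = "\<lambda>z. \<beta> z * p n z - \<alpha> z * q n z"])
      fix s :: real assume s: "0 \<le> s" "s \<le> 1"
      have "norm (\<beta> (?g s) * p n (?g s) - \<alpha> (?g s) * q n (?g s)) \<le> M * norm (p n (?g s)) + M * norm (q n (?g s))"
        using Suc.prems(2)[OF seg[OF s]] M
        by (intro norm_triangle_le_diff add_mono) (auto simp: norm_mult intro!: mult_right_mono)
      then show "norm (\<beta> (?g s) * p n (?g s) - \<alpha> (?g s) * q n (?g s)) \<le> K * s ^ n"
        using Kb[OF s] by linarith
    qed (use der sub S in auto)
    have "norm (p (Suc n) z) + norm (q (Suc n) z) \<le> 2 * (K * norm (z - c) / real (Suc n))"
      using 1 2 by linarith
    also have "\<dots> = N * (2 * M * norm (z - c)) ^ Suc n / fact (Suc n)"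
      by (simp add: K_def field_simps)
    finally show ?case .
  qed
  have loc: "\<exists>d h. 0 < d \<and> summable h \<and> (\<forall>\<^sub>F n in sequentially. \<forall>y\<in>ball x d \<inter> S. norm (p n y) \<le> h n \<and> norm (q n y) \<le> h n)"
    if x: "x \<in> S" for x
  proof -
    obtain d where d: "d > 0" "cball x d \<subseteq> S" using S(1) x open_contains_cball by blast
    \<comment> \<open>All segments from \<open>c\<close> to points of a closed ball form one compact
      set, so a single \<open>M\<close> bounds the coefficients for all of them.\<close>
    define K where "K = (\<lambda>(s, w). c + of_real s * (w - c)) ` ({0..1::real} \<times> cball x d)"
    have "compact K"
      unfolding K_def by (intro compact_continuous_image compact_Times)
        (auto intro!: continuous_intros simp: case_prod_unfold)
    have KS: "K \<subseteq> S"
    proof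
      fix y assume "y \<in> K"
      then obtain s w where sw: "s \<in> {0..1::real}" "w \<in> cball x d" "y = c + of_real s * (w - c)"
        by (auto simp: K_def)
      then have "y \<in> closed_segment c w"
        unfolding closed_segment_def by (auto intro!: exI[of _ s] simp: algebra_simps scaleR_conv_of_real)
      then show "y \<in> S" using star d sw by blast
    qed
    have segK: "closed_segment c w \<subseteq> K" if "w \<in> cball x d" for w
    proof
      fix y assume "y \<in> closed_segment c w"
      then obtain s where "s \<in> {0..1::real}" "y = c + of_real s * (w - c)"
        unfolding closed_segment_def by (auto simp: algebra_simps scaleR_conv_of_real)
      then show "y \<in> K" unfolding K_def using that by (auto intro!: image_eqI[of _ _ "(s, w)"])
    qed
    have "bounded (\<alpha> ` K)" "bounded (\<beta> ` K)" "bounded (\<gamma> ` K)"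
      using hol KS \<open>compact K\<close>
      by (auto intro!: compact_imp_bounded compact_continuous_image
          intro: continuous_on_subset holomorphic_on_imp_continuous_on)
    then obtain M1 M2 M3 where M123: "\<forall>w\<in>K. norm (\<alpha> w) \<le> M1" "\<forall>w\<in>K. norm (\<beta> w) \<le> M2" "\<forall>w\<in>K. norm (\<gamma> w) \<le> M3"
      by (auto simp: bounded_iff)
    define M where "M = max 0 (max M1 (max M2 M3))"
    have M: "norm (\<alpha> w) \<le> M \<and> norm (\<beta> w) \<le> M \<and> norm (\<gamma> w) \<le> M" if "w \<in> K" for w
      using M123 that by (auto simp: M_def le_max_iff_disj)
    have M0: "0 \<le> M" by (simp add: M_def)
    have N0: "0 \<le> N" by (simp add: N_def)
    define D where "D = norm (x - c) + d"
    define h where "h = (\<lambda>n. N * (2 * M * D) ^ n / fact n)"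
    have "summable h"
      using summable_mult[OF summable_exp_generic[of "2 * M * D"], of N]
      by (simp add: h_def field_simps)
    moreover have "norm (p n y) \<le> h n \<and> norm (q n y) \<le> h n" if y: "y \<in> ball x d" for n y
    proof -
      have "norm (p n y) + norm (q n y) \<le> N * (2 * M * norm (y - c)) ^ n / fact n"
        using y segK[of y] d M by (intro bound) auto
      also have "\<dots> \<le> h n"
      proof -
        have "norm (y - c) \<le> D"
          using norm_triangle_ineq[of "y - x" "x - c"] y by (simp add: D_def dist_norm norm_minus_commute)
        then show ?thesis
          unfolding h_def using M0 N0 by (intro divide_right_mono mult_left_mono power_mono) auto
      qed
      finally have "norm (p n y) + norm (q n y) \<le> h n" .
      moreover have "0 \<le> norm (p n y)" "0 \<le> norm (q n y)" by auto
      ultimately show ?thesis by linarith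
    qed
    ultimately show ?thesis using d(1) by (intro exI[of _ d] exI[of _ h]) auto
  qed
  \<comment> \<open>The zeroth iterates are constant, hence the value 0; the shift by one index
    turns the series of derivatives into the right-hand side of the system.\<close>
  define p' where "p' = (\<lambda>n z. case n of 0 \<Rightarrow> 0 | Suc n \<Rightarrow> \<alpha> z * p n z + \<gamma> z * q n z)"
  define q' where "q' = (\<lambda>n z. case n of 0 \<Rightarrow> 0 | Suc n \<Rightarrow> \<beta> z * p n z - \<alpha> z * q n z)"
  have "\<exists>g g'. \<forall>x \<in> S. ((\<lambda>n. p n x) sums g x) \<and> ((\<lambda>n. p' n x) sums g' x) \<and> (g has_field_derivative g' x) (at x)"
  proof (rule series_and_derivative_comparison_local[OF S(1)])
    show "(p n has_field_derivative p' n x) (at x)" if "x \<in> S" for n x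
      using der that by (cases n) (auto simp: p'_def p0)
    show "\<exists>d h. 0 < d \<and> summable h \<and> (\<forall>\<^sub>F n in sequentially. \<forall>y\<in>ball x d \<inter> S. norm (p n y) \<le> h n)" if x: "x \<in> S" for x
    proof -
      obtain d h where "0 < d" "summable h" and ev: "\<forall>\<^sub>F n in sequentially. \<forall>y\<in>ball x d \<inter> S. norm (p n y) \<le> h n \<and> norm (q n y) \<le> h n"
        using loc[OF x] by blast
      moreover from ev have "\<forall>\<^sub>F n in sequentially. \<forall>y\<in>ball x d \<inter> S. norm (p n y) \<le> h n"
        by (rule eventually_mono) blast
      ultimately show ?thesis by blast
    qed
  qed
  then obtain \<psi> \<psi>' where psi: "\<And>x. x \<in> S \<Longrightarrow> (\<lambda>n. p n x) sums \<psi> x"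
    "\<And>x. x \<in> S \<Longrightarrow> (\<lambda>n. p' n x) sums \<psi>' x" "\<And>x. x \<in> S \<Longrightarrow> (\<psi> has_field_derivative \<psi>' x) (at x)"
    by blast
  have "\<exists>g g'. \<forall>x \<in> S. ((\<lambda>n. q n x) sums g x) \<and> ((\<lambda>n. q' n x) sums g' x) \<and> (g has_field_derivative g' x) (at x)"
  proof (rule series_and_derivative_comparison_local[OF S(1)])
    show "(q n has_field_derivative q' n x) (at x)" if "x \<in> S" for n x
      using der that by (cases n) (auto simp: q'_def q0)
    show "\<exists>d h. 0 < d \<and> summable h \<and> (\<forall>\<^sub>F n in sequentially. \<forall>y\<in>ball x d \<inter> S. norm (q n y) \<le> h n)" if x: "x \<in> S" for x
    proof -
      obtain d h where "0 < d" "summable h" and ev: "\<forall>\<^sub>F n in sequentially. \<forall>y\<in>ball x d \<inter> S. norm (p n y) \<le> h n \<and> norm (q n y) \<le> h n"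
        using loc[OF x] by blast
      moreover from ev have "\<forall>\<^sub>F n in sequentially. \<forall>y\<in>ball x d \<inter> S. norm (q n y) \<le> h n"
        by (rule eventually_mono) blast
      ultimately show ?thesis by blast
    qed
  qed
  then obtain \<eta> \<eta>' where chi: "\<And>x. x \<in> S \<Longrightarrow> (\<lambda>n. q n x) sums \<eta> x"
    "\<And>x. x \<in> S \<Longrightarrow> (\<lambda>n. q' n x) sums \<eta>' x" "\<And>x. x \<in> S \<Longrightarrow> (\<eta> has_field_derivative \<eta>' x) (at x)"
    by blast
  have "\<psi>' z = \<alpha> z * \<psi> z + \<gamma> z * \<eta> z" if "z \<in> S" for z
  proof -
    have "(\<lambda>n. \<alpha> z * p n z + \<gamma> z * q n z) sums (\<alpha> z * \<psi> z + \<gamma> z * \<eta> z)"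
      by (intro sums_add sums_mult psi chi that)
    then have "(\<lambda>n. p' (Suc n) z) sums (\<alpha> z * \<psi> z + \<gamma> z * \<eta> z)" by (simp add: p'_def)
    then have "(\<lambda>n. p' n z) sums (\<alpha> z * \<psi> z + \<gamma> z * \<eta> z + p' 0 z)" by (rule sums_Suc)
    from sums_unique2[OF this psi(2)[OF that]] show ?thesis by (simp add: p'_def)
  qed
  moreover have "\<eta>' z = \<beta> z * \<psi> z - \<alpha> z * \<eta> z" if "z \<in> S" for z
  proof -
    have "(\<lambda>n. \<beta> z * p n z - \<alpha> z * q n z) sums (\<beta> z * \<psi> z - \<alpha> z * \<eta> z)"
      by (intro sums_diff sums_mult psi chi that)
    then have "(\<lambda>n. q' (Suc n) z) sums (\<beta> z * \<psi> z - \<alpha> z * \<eta> z)" by (simp add: q'_def)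
    then have "(\<lambda>n. q' n z) sums (\<beta> z * \<psi> z - \<alpha> z * \<eta> z + q' 0 z)" by (rule sums_Suc)
    from sums_unique2[OF this chi(2)[OF that]] show ?thesis by (simp add: q'_def)
  qed
  ultimately have sol: "lin_sol \<alpha> \<beta> \<gamma> S \<psi> \<eta>"
    using psi(3) chi(3) by (auto simp: lin_sol_def)
  have "(\<lambda>n. p n c) sums (\<Sum>n\<in>{0}. p n c)" "(\<lambda>n. q n c) sums (\<Sum>n\<in>{0}. q n c)"
    by (rule sums_finite; use der(3,4)[OF S(2)] not0_implies_Suc in blast)+
  then have "\<psi> c = x0" "\<eta> c = y0"
    using sums_unique2[OF psi(1)[OF S(2)]] sums_unique2[OF chi(1)[OF S(2)]] by (auto simp: p0 q0)
  moreover have "norm (\<psi> z) + norm (\<eta> z) \<le> (norm x0 + norm y0) * exp (2 * M * norm (z - c))"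
    if z: "z \<in> S" and M: "\<And>w. w \<in> closed_segment c z \<Longrightarrow> norm (\<alpha> w) \<le> M \<and> norm (\<beta> w) \<le> M \<and> norm (\<gamma> w) \<le> M" for z M
  proof -
    let ?h = "\<lambda>n. N * (2 * M * norm (z - c)) ^ n / fact n"
    have hs: "?h sums (N * exp (2 * M * norm (z - c)))"
      using sums_mult[OF exp_converges[of "2 * M * norm (z - c)"], of N] by (simp add: field_simps)
    have b: "norm (p n z) + norm (q n z) \<le> ?h n" for n by (rule bound[OF z M])
    have np: "norm (p n z) \<le> ?h n" "norm (q n z) \<le> ?h n" for n
      using b[of n] norm_ge_zero[of "p n z"] norm_ge_zero[of "q n z"] by linarith+
    have sp: "summable (\<lambda>n. norm (p n z))" "summable (\<lambda>n. norm (q n z))"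
      by (rule summable_comparison_test'[OF sums_summable[OF hs]]; use np in auto)+
    have "norm (\<psi> z) \<le> (\<Sum>n. norm (p n z))" "norm (\<eta> z) \<le> (\<Sum>n. norm (q n z))"
      using summable_norm[OF sp(1)] summable_norm[OF sp(2)] sums_unique[OF psi(1)[OF z]] sums_unique[OF chi(1)[OF z]] by auto
    then have "norm (\<psi> z) + norm (\<eta> z) \<le> (\<Sum>n. norm (p n z) + norm (q n z))"
      using suminf_add[OF sp] by simp
    also have "\<dots> \<le> (\<Sum>n. ?h n)"
      by (intro suminf_le b summable_add sp sums_summable[OF hs])
    also have "\<dots> = N * exp (2 * M * norm (z - c))" using sums_unique[OF hs] by simp
    finally show ?thesis by (simp add: N_def)
  qed
  ultimately show ?thesis using that sol by blast
qed

text \<open>Variation of constants: the Wronskians of the perturbed solution with the two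
  unperturbed ones vary at rate at most \<open>\<delta> * B ^ 2\<close>, and Cramer's rule at
  \<open>e\<close> costs one more factor \<open>B\<close> for each of the two terms.\<close>

lemma lin_sol_perturb:
  assumes f1: "lin_sol \<alpha> \<beta> \<gamma> S \<psi>1 \<eta>1" and f2: "lin_sol \<alpha> \<beta> \<gamma> S \<psi>2 \<eta>2"
    and f: "lin_sol \<alpha>' \<beta>' \<gamma>' S p q" and S: "closed_segment c e \<subseteq> S" "open S" "connected S"
    and init: "\<psi>1 c = 1" "\<eta>1 c = 0" "\<psi>2 c = 0" "\<eta>2 c = 1"
    and \<delta>: "\<And>w. w \<in> closed_segment c e \<Longrightarrow> norm (\<alpha>' w - \<alpha> w) \<le> \<delta> \<and> norm (\<beta>' w - \<beta> w) \<le> \<delta> \<and> norm (\<gamma>' w - \<gamma> w) \<le> \<delta>"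
    and B: "\<And>w. w \<in> closed_segment c e \<Longrightarrow> norm (p w) + norm (q w) \<le> B \<and>
       norm (\<psi>1 w) + norm (\<eta>1 w) \<le> B \<and> norm (\<psi>2 w) + norm (\<eta>2 w) \<le> B"
  shows "norm (p e - (p c * \<psi>1 e + q c * \<psi>2 e)) \<le> 2 * \<delta> * B ^ 3 * norm (e - c)"
    and "norm (q e - (p c * \<eta>1 e + q c * \<eta>2 e)) \<le> 2 * \<delta> * B ^ 3 * norm (e - c)"
proof -
  have B0: "0 \<le> B" using B[of c] norm_ge_zero[of "p c"] norm_ge_zero[of "q c"] by (auto simp del: norm_ge_zero)
  have \<delta>0: "0 \<le> \<delta>" using \<delta>[of c] norm_ge_zero[of "\<alpha>' c - \<alpha> c"] order_trans by (auto simp del: norm_ge_zero)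
  have est: "norm ((p e * x e - q e * y e) - (p c * x c - q c * y c)) \<le> \<delta> * B ^ 2 * norm (e - c)"
    if xy: "lin_sol \<alpha> \<beta> \<gamma> S y x" "\<And>w. w \<in> closed_segment c e \<Longrightarrow> norm (y w) + norm (x w) \<le> B" for x y
  proof (rule field_differentiable_bound[of "closed_segment c e" "\<lambda>w. p w * x w - q w * y w"
        "\<lambda>w. (\<alpha>' w - \<alpha> w) * p w * x w + (\<gamma>' w - \<gamma> w) * q w * x w - (\<beta>' w - \<beta> w) * p w * y w + (\<alpha>' w - \<alpha> w) * q w * y w"])
    fix w assume w: "w \<in> closed_segment c e"
    then have wS: "w \<in> S" using S by blast
    then have "(p has_field_derivative \<alpha>' w * p w + \<gamma>' w * q w) (at w)"
      "(q has_field_derivative \<beta>' w * p w - \<alpha>' w * q w) (at w)"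
      "(y has_field_derivative \<alpha> w * y w + \<gamma> w * x w) (at w)"
      "(x has_field_derivative \<beta> w * y w - \<alpha> w * x w) (at w)"
      using f xy by (auto simp: lin_sol_def)
    note d = this[THEN has_field_derivative_at_within, of "closed_segment c e"]
    show "((\<lambda>w. p w * x w - q w * y w) has_field_derivative
        (\<alpha>' w - \<alpha> w) * p w * x w + (\<gamma>' w - \<gamma> w) * q w * x w - (\<beta>' w - \<beta> w) * p w * y w + (\<alpha>' w - \<alpha> w) * q w * y w)
        (at w within closed_segment c e)"
      by (rule derivative_eq_intros d refl)+ (simp add: algebra_simps)
    have "norm ((\<alpha>' w - \<alpha> w) * p w * x w + (\<gamma>' w - \<gamma> w) * q w * x w - (\<beta>' w - \<beta> w) * p w * y w + (\<alpha>' w - \<alpha> w) * q w * y w)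
       \<le> norm (\<alpha>' w - \<alpha> w) * norm (p w) * norm (x w) + norm (\<gamma>' w - \<gamma> w) * norm (q w) * norm (x w)
         + norm (\<beta>' w - \<beta> w) * norm (p w) * norm (y w) + norm (\<alpha>' w - \<alpha> w) * norm (q w) * norm (y w)"
      by (intro order_trans[OF norm_triangle_ineq] order_trans[OF norm_triangle_ineq4] add_mono)
         (auto simp: norm_mult)
    also have "\<dots> \<le> \<delta> * norm (p w) * norm (x w) + \<delta> * norm (q w) * norm (x w)
         + \<delta> * norm (p w) * norm (y w) + \<delta> * norm (q w) * norm (y w)"
      using \<delta>[OF w] by (intro add_mono mult_right_mono) auto
    also have "\<dots> = \<delta> * ((norm (p w) + norm (q w)) * (norm (y w) + norm (x w)))"
      by (simp add: algebra_simps)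
    also have "\<dots> \<le> \<delta> * (B * B)"
      using B[OF w] xy(2)[OF w] B0 \<delta>0 by (intro mult_left_mono mult_mono) auto
    finally show "norm ((\<alpha>' w - \<alpha> w) * p w * x w + (\<gamma>' w - \<gamma> w) * q w * x w - (\<beta>' w - \<beta> w) * p w * y w + (\<alpha>' w - \<alpha> w) * q w * y w)
       \<le> \<delta> * B ^ 2" by (simp add: power2_eq_square)
  qed auto
  define k1 where "k1 = p e * \<eta>2 e - q e * \<psi>2 e"
  define k2 where "k2 = q e * \<psi>1 e - p e * \<eta>1 e"
  have k1: "norm (k1 - p c) \<le> \<delta> * B ^ 2 * norm (e - c)"
    using est[OF f2] B init by (simp add: k1_def)
  have k2: "norm (k2 - q c) \<le> \<delta> * B ^ 2 * norm (e - c)"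
    using est[OF f1] B init by (simp add: k2_def norm_minus_commute algebra_simps)
  have e: "e \<in> S" "c \<in> S" using S by auto
  have det: "\<psi>1 e * \<eta>2 e - \<eta>1 e * \<psi>2 e = 1"
    using lin_sol_wronskian[OF f1 f2 S(2,3) e] init by simp
  have "k1 * \<psi>1 e + k2 * \<psi>2 e = p e * (\<psi>1 e * \<eta>2 e - \<eta>1 e * \<psi>2 e)"
    "k1 * \<eta>1 e + k2 * \<eta>2 e = q e * (\<psi>1 e * \<eta>2 e - \<eta>1 e * \<psi>2 e)"
    by (simp_all add: k1_def k2_def algebra_simps)
  then have eq: "p e = k1 * \<psi>1 e + k2 * \<psi>2 e" "q e = k1 * \<eta>1 e + k2 * \<eta>2 e" by (simp_all add: det)
  have Be: "norm (\<psi>1 e) \<le> B" "norm (\<psi>2 e) \<le> B" "norm (\<eta>1 e) \<le> B" "norm (\<eta>2 e) \<le> B"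
    using B[of e] norm_ge_zero[of "\<psi>1 e"] norm_ge_zero[of "\<psi>2 e"] norm_ge_zero[of "\<eta>1 e"] norm_ge_zero[of "\<eta>2 e"]
    by (auto simp del: norm_ge_zero)
  have fin: "norm ((k1 - p c) * x + (k2 - q c) * y) \<le> 2 * \<delta> * B ^ 3 * norm (e - c)"
    if "norm x \<le> B" "norm y \<le> B" for x y
  proof -
    have "norm ((k1 - p c) * x + (k2 - q c) * y) \<le> norm (k1 - p c) * norm x + norm (k2 - q c) * norm y"
      by (metis norm_mult norm_triangle_ineq)
    also have "\<dots> \<le> (\<delta> * B ^ 2 * norm (e - c)) * B + (\<delta> * B ^ 2 * norm (e - c)) * B"
      using k1 k2 that \<delta>0 B0 by (intro add_mono mult_mono) auto
    also have "\<dots> = 2 * \<delta> * B ^ 3 * norm (e - c)" by (simp add: power2_eq_square power3_eq_cube)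
    finally show ?thesis .
  qed
  show "norm (p e - (p c * \<psi>1 e + q c * \<psi>2 e)) \<le> 2 * \<delta> * B ^ 3 * norm (e - c)"
    using fin[OF Be(1,2)] by (simp add: eq algebra_simps)
  show "norm (q e - (p c * \<eta>1 e + q c * \<eta>2 e)) \<le> 2 * \<delta> * B ^ 3 * norm (e - c)"
    using fin[OF Be(3,4)] by (simp add: eq algebra_simps)
qed

section \<open>Laurent expansion of \<open>wp\<close> at the lattice points and its differential
  equations\<close>

abbreviation wp' :: "complex \<Rightarrow> complex" where
  "wp' \<equiv> deriv wp"

abbreviation wp_reg :: "complex \<Rightarrow> complex" where
  "wp_reg \<equiv> wp_tail (1/2)"

lemma wp_DERIV: "z \<notin> gaussL \<Longrightarrow> (wp has_field_derivative wp' z) (at z)"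
  using wp_holomorphic open_compl_gaussL by (auto intro: holomorphic_derivI)

lemma wp'_holomorphic: "wp' holomorphic_on - gaussL"
  by (rule holomorphic_deriv[OF wp_holomorphic open_compl_gaussL])

lemma wp'_DERIV: "z \<notin> gaussL \<Longrightarrow> (wp' has_field_derivative deriv wp' z) (at z)"
  using wp'_holomorphic open_compl_gaussL by (auto intro: holomorphic_derivI)

lemma wp'_minus: "z \<notin> gaussL \<Longrightarrow> wp' (- z) = - wp' z"
proof -
  assume z: "z \<notin> gaussL"
  have "((\<lambda>z. wp (- z)) has_field_derivative wp' (- z) * - 1) (at z)"
    by (rule DERIV_chain2[OF wp_DERIV]) (use z in \<open>auto intro!: derivative_eq_intros\<close>)
  then have "(wp has_field_derivative - wp' (- z)) (at z)" by (simp add: wp_minus)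
  from DERIV_unique[OF this wp_DERIV[OF z]] show ?thesis by (simp add: minus_equation_iff)
qed

lemma wp'_times_i: "z \<notin> gaussL \<Longrightarrow> wp' (\<i> * z) = \<i> * wp' z"
proof -
  assume z: "z \<notin> gaussL"
  have "((\<lambda>z. wp (\<i> * z)) has_field_derivative wp' (\<i> * z) * \<i>) (at z)"
    by (rule DERIV_chain2[OF wp_DERIV]) (use z in \<open>auto intro!: derivative_eq_intros\<close>)
  then have "((\<lambda>z. - (wp (\<i> * z))) has_field_derivative - (wp' (\<i> * z) * \<i>)) (at z)"
    by (rule DERIV_minus)
  then have "(wp has_field_derivative - (wp' (\<i> * z) * \<i>)) (at z)" by (simp add: wp_times_i)
  from DERIV_unique[OF this wp_DERIV[OF z]] have "wp' z = - (wp' (\<i> * z) * \<i>)" by simp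
  then show ?thesis by (simp add: algebra_simps)
qed

lemma wp'_cnj: "z \<notin> gaussL \<Longrightarrow> wp' (cnj z) = cnj (wp' z)"
proof -
  assume z: "z \<notin> gaussL"
  have "(cnj \<circ> wp \<circ> cnj has_field_derivative cnj (wp' z)) (at (cnj z))"
    using has_field_derivative_cnj_cnj[of wp "wp' z" "cnj z"] wp_DERIV[OF z] by simp
  moreover have "cnj \<circ> wp \<circ> cnj = wp" by (auto simp: wp_cnj)
  ultimately show ?thesis
    by (metis DERIV_imp_deriv)
qed

text \<open>Periodicity of the derivative leaves an additive constant \<open>k\<close>; evenness,
  applied at \<open>- z - w\<close>, yields \<open>k = - k\<close>.\<close>

lemma wp_periodic:
  assumes w: "w \<in> gaussL" and z: "z \<notin> gaussL"
  shows "wp (z + w) = wp z"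
proof -
  have "((\<lambda>z. wp (z + w) - wp z) has_field_derivative 0) (at y)" if "y \<in> - gaussL" for y
  proof -
    have "((\<lambda>z. wp (z + w)) has_field_derivative wp' (y + w) * 1) (at y)"
      by (rule DERIV_chain2[OF wp_DERIV]) (use that w in \<open>auto intro!: derivative_eq_intros simp: gaussL_add_iff\<close>)
    from DERIV_diff[OF this wp_DERIV[of y]] that show ?thesis
      using deriv_wp_periodic[OF w, of y] by simp
  qed
  then have "(\<lambda>z. wp (z + w) - wp z) constant_on - gaussL"
    by (rule has_field_derivative_0_imp_constant_on[OF _ connected_compl_gaussL open_compl_gaussL])
  then obtain k where k: "\<And>y. y \<notin> gaussL \<Longrightarrow> wp (y + w) - wp y = k"
    unfolding constant_on_def by blast
  have "- z - w \<notin> gaussL"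
    using z w gaussL_add_iff[of w "- z - w"] by simp
  then have "wp (- z) - wp (- z - w) = k" using k[of "- z - w"] by simp
  moreover have "wp (- z) = wp z" "wp (- z - w) = wp (z + w)"
    using wp_minus[of z] wp_minus[of "z + w"] by simp_all
  ultimately have "k = - k" using k[OF z] by (metis minus_diff_eq)
  then show ?thesis using k[OF z] by simp
qed

lemma wp_near_0: "norm z \<le> 1/2 \<Longrightarrow> wp z = 1 / z ^ 2 + wp_reg z"
proof -
  assume "norm z \<le> 1/2"
  moreover have "{w \<in> gaussL - {0}. norm w < 2 * (1/2)} = {}"
    using gaussL_norm_ge_1 by force
  ultimately show ?thesis using wp_split[of z "1/2"] by (simp only: sum.empty add_0_right)
qed

lemma wp_reg_holomorphic: "wp_reg holomorphic_on ball 0 (1/2)"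
proof (subst holomorphic_on_open, simp, intro ballI exI)
  fix z :: complex assume "z \<in> ball 0 (1/2)"
  then show "(wp_reg has_field_derivative
      (\<Sum>\<^sub>\<infinity>w\<in>{w \<in> gaussL - {0}. 2 * (1/2) \<le> norm w}. - 2 / (z - w) ^ 3)) (at z)"
    by (intro wp_tail_deriv) simp
qed

lemma wp_reg_0: "wp_reg 0 = 0"
  by (simp add: wp_tail_def)

lemma wp_reg_minus: "norm z \<le> 1/2 \<Longrightarrow> wp_reg (- z) = wp_reg z"
  using wp_near_0[of z] wp_near_0[of "- z"] by (simp add: wp_minus)

lemma small_not_gaussL: "norm z < 1 \<Longrightarrow> z \<noteq> 0 \<Longrightarrow> z \<notin> gaussL"
  using gaussL_norm_ge_1 by force

text \<open>The regular part is even and vanishes at 0, so its linear term vanishes too.\<close>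

lemma wp_reg_square:
  obtains s where "s holomorphic_on ball 0 (1/2)" "\<And>z. z \<in> ball 0 (1/2) \<Longrightarrow> wp_reg z = z ^ 2 * s z"
proof -
  let ?B = "ball 0 (1/2) :: complex set"
  have d0: "deriv wp_reg 0 = 0"
  proof -
    have d: "(wp_reg has_field_derivative deriv wp_reg 0) (at 0)"
      by (rule holomorphic_derivI[OF wp_reg_holomorphic]) auto
    have "((\<lambda>z. wp_reg (- z)) has_field_derivative deriv wp_reg 0 * - 1) (at 0)"
      by (rule DERIV_chain2[where g = uminus]) (use d in \<open>auto intro!: derivative_eq_intros\<close>)
    then have "((\<lambda>z. wp_reg (- z)) has_field_derivative - deriv wp_reg 0) (at 0)" by simp
    then have "(wp_reg has_field_derivative - deriv wp_reg 0) (at 0)"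
      by (rule has_field_derivative_transform_within_open[where S = ?B]) (auto simp: wp_reg_minus)
    from DERIV_unique[OF this d] show ?thesis by simp
  qed
  define s1 where "s1 = (\<lambda>z. if z = 0 then deriv wp_reg 0 else (wp_reg z - wp_reg 0) / (z - 0))"
  have "s1 holomorphic_on ?B"
    unfolding s1_def by (rule pole_lemma[OF wp_reg_holomorphic]) simp
  define s where "s = (\<lambda>z. if z = 0 then deriv s1 0 else (s1 z - s1 0) / (z - 0))"
  have "s holomorphic_on ?B"
    unfolding s_def by (rule pole_lemma[OF \<open>s1 holomorphic_on ?B\<close>]) simp
  moreover have "wp_reg z = z ^ 2 * s z" for z
    by (auto simp: s_def s1_def d0 wp_reg_0 power2_eq_square)
  ultimately show ?thesis using that by blast
qed

lemma wp'_near_0: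
  assumes "z \<in> ball 0 (1/2)" "z \<noteq> 0"
  shows "wp' z = - 2 / z ^ 3 + deriv wp_reg z" "deriv wp' z = 6 / z ^ 4 + deriv (deriv wp_reg) z"
proof -
  let ?B = "ball 0 (1/2) - {0} :: complex set"
  have r: "(wp_reg has_field_derivative deriv wp_reg z) (at z)" if "z \<in> ?B" for z
    by (rule holomorphic_derivI[OF wp_reg_holomorphic]) (use that in auto)
  have r': "(deriv wp_reg has_field_derivative deriv (deriv wp_reg) z) (at z)" if "z \<in> ?B" for z
    by (rule holomorphic_derivI[OF holomorphic_deriv[OF wp_reg_holomorphic]]) (use that in auto)
  have 1: "wp' z = - 2 / z ^ 3 + deriv wp_reg z" if z: "z \<in> ?B" for z
  proof -
    have "((\<lambda>z. 1 / z ^ 2 + wp_reg z) has_field_derivative - 2 / z ^ 3 + deriv wp_reg z) (at z)"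
      using DERIV_add[OF inverse_square_deriv[of z 0 0] r[OF z]] z by simp
    then have "(wp has_field_derivative - 2 / z ^ 3 + deriv wp_reg z) (at z)"
      by (rule has_field_derivative_transform_within_open[where S = ?B])
         (use z wp_near_0 in \<open>auto simp: open_delete less_imp_le\<close>)
    then show ?thesis by (rule DERIV_imp_deriv)
  qed
  show "wp' z = - 2 / z ^ 3 + deriv wp_reg z" using 1 assms by simp
  have "((\<lambda>z. - 2 / z ^ 3) has_field_derivative 6 / z ^ 4) (at z)"
    using assms by (auto intro!: derivative_eq_intros simp: field_simps power2_eq_square power3_eq_cube power4_eq_xxxx)
  then have "((\<lambda>z. - 2 / z ^ 3 + deriv wp_reg z) has_field_derivative 6 / z ^ 4 + deriv (deriv wp_reg) z) (at z)"
    by (rule DERIV_add[OF _ r']) (use assms in auto)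
  then have "(wp' has_field_derivative 6 / z ^ 4 + deriv (deriv wp_reg) z) (at z)"
    by (rule has_field_derivative_transform_within_open[where S = ?B])
       (use assms 1 in \<open>auto simp: open_delete\<close>)
  then show "deriv wp' z = 6 / z ^ 4 + deriv (deriv wp_reg) z" by (rule DERIV_imp_deriv)
qed

lemma deriv_wp'_periodic:
  assumes w: "w \<in> gaussL" and z: "z \<notin> gaussL"
  shows "deriv wp' (z + w) = deriv wp' z"
proof -
  have "((\<lambda>z. wp' (z + w)) has_field_derivative deriv wp' (z + w) * 1) (at z)"
    by (rule DERIV_chain2[OF wp'_DERIV]) (use z w in \<open>auto intro!: derivative_eq_intros simp: gaussL_add_iff\<close>)
  then have "(wp' has_field_derivative deriv wp' (z + w)) (at z)"
    by (auto intro: has_field_derivative_transform_within_open[where S = "- gaussL"]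
        simp: open_compl_gaussL z deriv_wp_periodic w)
  then show ?thesis by (metis DERIV_imp_deriv)
qed

text \<open>Since the regular part of \<open>wp\<close> is \<open>z ^ 2 * s z\<close>, the principal
  part of \<open>6 * wp z ^ 2\<close> is exactly \<open>6 / z ^ 4\<close>, that of the second
  derivative. The difference extends to a doubly periodic entire function, which is constant by
  Liouville.\<close>

lemma wp_second_order: "\<exists>k. \<forall>z. z \<notin> gaussL \<longrightarrow> deriv wp' z = 6 * wp z ^ 2 + k"
proof -
  obtain s where s: "s holomorphic_on ball 0 (1/2)" "\<And>z. z \<in> ball 0 (1/2) \<Longrightarrow> wp_reg z = z ^ 2 * s z"
    using wp_reg_square by blast
  \<comment> \<open>The difference written without poles; \<open>12 * s z\<close> is the mixed term
    of \<open>6 * (1 / z ^ 2 + z ^ 2 * s z) ^ 2\<close>.\<close>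
  define \<rho> where "\<rho> = (\<lambda>z. deriv (deriv wp_reg) z - 12 * s z - 6 * wp_reg z ^ 2)"
  have rho_hol: "\<rho> holomorphic_on ball 0 (1/2)"
    unfolding \<rho>_def by (intro holomorphic_intros s holomorphic_deriv wp_reg_holomorphic) auto
  have rho: "deriv wp' z - 6 * wp z ^ 2 = \<rho> z" if "z \<in> ball 0 (1/2)" "z \<noteq> 0" for z
  proof -
    have "wp z = 1 / z ^ 2 + z ^ 2 * s z" using wp_near_0[of z] s(2)[of z] that by auto
    then show ?thesis using that wp'_near_0(2)[OF that] s(2)[OF that(1)] by (simp add: \<rho>_def) (simp add: field_simps power2_eq_square power4_eq_xxxx)
  qed
  define h where "h = (\<lambda>z. if z \<in> gaussL then \<rho> 0 else deriv wp' z - 6 * wp z ^ 2)"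
  have per: "h (z + w) = h z" if "w \<in> gaussL" for z w
    using that by (auto simp: h_def gaussL_add_iff deriv_wp'_periodic wp_periodic)
  have near: "h z = \<rho> (z - w)" if "w \<in> gaussL" "z \<in> ball w (1/2)" for z w
  proof -
    have zw: "z - w \<in> ball 0 (1/2)" using that by (simp add: dist_norm norm_minus_commute)
    have "h z = h (z - w)" using per[OF that(1), of "z - w"] by simp
    also have "\<dots> = \<rho> (z - w)"
    proof (cases "z = w")
      case False
      then have "z - w \<notin> gaussL" using small_not_gaussL[of "z - w"] zw by simp
      then show ?thesis using rho[OF zw] False by (simp add: h_def)
    qed (simp add: h_def)
    finally show ?thesis .
  qed
  have "h holomorphic_on UNIV"
  proof (subst holomorphic_on_open, simp, intro ballI)
    fix z :: complex
    show "\<exists>d. (h has_field_derivative d) (at z)"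
    proof (cases "z \<in> gaussL")
      case True
      have "(\<lambda>y. \<rho> (y - z)) holomorphic_on ball z (1/2)"
        by (rule holomorphic_on_compose_gen[OF _ rho_hol, unfolded o_def])
           (auto intro!: holomorphic_intros simp: dist_norm norm_minus_commute)
      then have "h holomorphic_on ball z (1/2)"
        by (rule holomorphic_transform) (use near[OF True] in auto)
      then show ?thesis by (simp add: holomorphic_on_open)
    next
      case False
      have "(\<lambda>z. deriv wp' z - 6 * wp z ^ 2) holomorphic_on - gaussL"
        by (intro holomorphic_intros holomorphic_deriv wp'_holomorphic wp_holomorphic open_compl_gaussL)
      then have "h holomorphic_on - gaussL"
        by (rule holomorphic_transform) (auto simp: h_def)
      then show ?thesis using False open_compl_gaussL by (simp add: holomorphic_on_open)
    qed
  qed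
  moreover have "bounded (range h)"
  proof -
    let ?K = "cbox 0 (Complex 1 1)"
    have "continuous_on ?K h"
      using \<open>h holomorphic_on UNIV\<close> holomorphic_on_imp_continuous_on continuous_on_subset by blast
    then have "bounded (h ` ?K)"
      by (intro compact_imp_bounded compact_continuous_image compact_cbox)
    moreover have "range h \<subseteq> h ` ?K"
    proof
      fix y assume "y \<in> range h"
      then obtain z where y: "y = h z" by blast
      define w where "w = Complex (of_int \<lfloor>Re z\<rfloor>) (of_int \<lfloor>Im z\<rfloor>)"
      have "w \<in> gaussL" by (simp add: w_def gaussL_iff)
      then have "y = h (z - w)" using per[of w "z - w"] y by simp
      moreover have "z - w \<in> ?K"
        by (auto simp: w_def in_cbox_complex_iff) linarith+
      ultimately show "y \<in> h ` ?K" by blast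
    qed
    ultimately show ?thesis by (rule bounded_subset)
  qed
  ultimately obtain k where k: "\<And>z. h z = k"
    using Liouville_theorem by (metis constant_on_def UNIV_I)
  have "\<forall>z. z \<notin> gaussL \<longrightarrow> deriv wp' z = 6 * wp z ^ 2 + k"
    using k by (metis (no_types, lifting) diff_add_cancel add.commute h_def)
  then show ?thesis by blast
qed

lemma wp'_half_period:
  assumes "z \<notin> gaussL" "2 * z \<in> gaussL"
  shows "wp' z = 0"
proof -
  have "wp' (- z + 2 * z) = wp' (- z)"
    using assms by (intro deriv_wp_periodic) auto
  then show ?thesis using wp'_minus[OF assms(1)] by simp
qed

text \<open>The centre of the unit square, fixed by the quarter turn \<open>\<i> * z + 1\<close>; it
  is the base point of all solutions on the cell.\<close>

definition cellc :: complex where "cellc = (1 + \<i>) / 2"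

lemma cellc_simps [simp]: "Re cellc = 1/2" "Im cellc = 1/2" "\<i> * cellc = cellc - 1"
  by (auto simp: cellc_def complex_eq_iff)

lemma cellc_notin [simp]: "cellc \<notin> gaussL"
  by (simp add: gaussL_iff)

lemma half_notin [simp]: "1/2 \<notin> gaussL"
  by (simp add: gaussL_iff)

lemma wp_cellc [simp]: "wp cellc = 0"
proof -
  have "wp (cellc - 1) = wp cellc"
    using wp_periodic[of "-1" cellc] by (simp add: gaussL_iff)
  then show ?thesis using wp_times_i[of cellc] by simp
qed

lemma wp'_cellc [simp]: "wp' cellc = 0"
  by (rule wp'_half_period) (auto simp: gaussL_iff)

definition wp_e :: real where "wp_e = Re (wp (1/2))"

lemma wp_half: "wp (1/2) = of_real wp_e"
proof -
  have "cnj (wp (1/2)) = wp (1/2)" using wp_cnj[of "1/2"] by simp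
  then show ?thesis by (simp add: wp_e_def complex_eq_iff)
qed

text \<open>If \<open>wp\<close> vanished at \<open>1/2\<close>, then \<open>wp\<close> and its translate by \<open>\<i>/2\<close> would solve the same
  second-order equation with the same initial values at the centre of the cell.\<close>

lemma wp_e_nonzero: "wp_e \<noteq> 0"
proof
  assume "wp_e = 0"
  then have h0: "wp (1/2) = 0" by (simp add: wp_half)
  obtain k where k: "\<And>z. z \<notin> gaussL \<Longrightarrow> deriv wp' z = 6 * wp z ^ 2 + k"
    using wp_second_order by blast
  define V where "V = {z. 0 < Re z \<and> Re z < 1}"
  have V: "open V" "convex V" "cellc \<in> V"
  proof -
    have "V = {z. 0 < Re z} \<inter> {z. Re z < 1}" by (auto simp: V_def)
    then show "open V" "convex V" 
      by (auto intro!: open_Int convex_Int open_halfspace_Re_gt open_halfspace_Re_lt convex_halfspace_Re_gt convex_halfspace_Re_lt)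
  qed (simp add: V_def)
  have VL: "z \<notin> gaussL" "z - \<i>/2 \<notin> gaussL" if "z \<in> V" for z
    using that by (auto simp: V_def gaussL_iff elim!: Ints_cases)
  define d where "d = (\<lambda>z. wp z - wp (z - \<i>/2))"
  define d' where "d' = (\<lambda>z. wp' z - wp' (z - \<i>/2))"
  define \<beta> where "\<beta> = (\<lambda>z. 6 * (wp z + wp (z - \<i>/2)))"
  have sh: "((\<lambda>z. f (z - \<i>/2)) has_field_derivative D) (at z)" if "(f has_field_derivative D) (at (z - \<i>/2))" for f D z
  proof -
    have "((\<lambda>z. f (z - \<i>/2)) has_field_derivative D * 1) (at z)"
      by (rule DERIV_chain2[where f = f]) (use that in \<open>auto intro!: derivative_eq_intros\<close>)
    then show ?thesis by simp
  qed
  have sol: "lin_sol (\<lambda>_. 0) \<beta> (\<lambda>_. 1) V d d'"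
    unfolding lin_sol_def
  proof (intro ballI conjI)
    fix z assume z: "z \<in> V"
    show "(d has_field_derivative 0 * d z + 1 * d' z) (at z)"
      using DERIV_diff[OF wp_DERIV[OF VL(1)[OF z]] sh[OF wp_DERIV[OF VL(2)[OF z]]]]
      by (simp add: d_def d'_def)
    have "deriv wp' z - deriv wp' (z - \<i>/2) = \<beta> z * d z - 0 * d' z"
      using k[OF VL(1)[OF z]] k[OF VL(2)[OF z]] by (simp add: \<beta>_def d_def power2_eq_square algebra_simps)
    then show "(d' has_field_derivative \<beta> z * d z - 0 * d' z) (at z)"
      using DERIV_diff[OF wp'_DERIV[OF VL(1)[OF z]] sh[OF wp'_DERIV[OF VL(2)[OF z]]]]
      by (simp add: d'_def)
  qed
  have dc: "d cellc = 0" "d' cellc = 0"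
  proof -
    have "cellc - \<i>/2 = 1/2" by (simp add: complex_eq_iff)
    then show "d cellc = 0" "d' cellc = 0"
      unfolding d_def d'_def using h0 wp'_half_period[of "1/2"] by (simp_all only:) (auto simp: gaussL_iff)
  qed
  have hol\<beta>: "\<beta> holomorphic_on V"
  proof -
    have "wp holomorphic_on V" using VL by (auto intro: holomorphic_on_subset[OF wp_holomorphic])
    moreover have "(\<lambda>z. wp (z - \<i>/2)) holomorphic_on V"
      using sh[OF wp_DERIV[OF VL(2)]] V(1) by (auto simp: holomorphic_on_open)
    ultimately show ?thesis unfolding \<beta>_def by (intro holomorphic_intros)
  qed
  have seg: "closed_segment cellc z \<subseteq> V" if "z \<in> V" for z
    using V that by (simp add: closed_segment_subset)
  obtain a1 b1 where 1: "lin_sol (\<lambda>_. 0) \<beta> (\<lambda>_. 1) V a1 b1" "a1 cellc = 1" "b1 cellc = 0"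
    using lin_sol_exists[OF V(1,3) seg _ hol\<beta>, of "\<lambda>_. 0" "\<lambda>_. 1" 1 0] holomorphic_on_const by metis
  obtain a2 b2 where 2: "lin_sol (\<lambda>_. 0) \<beta> (\<lambda>_. 1) V a2 b2" "a2 cellc = 0" "b2 cellc = 1"
    using lin_sol_exists[OF V(1,3) seg _ hol\<beta>, of "\<lambda>_. 0" "\<lambda>_. 1" 0 1] holomorphic_on_const by metis
  have d0: "d z = 0" if "z \<in> V" for z
    using lin_sol_expand(1)[OF 1(1) 2(1) sol V(1) convex_connected[OF V(2)] V(3)] 1 2 dc that by simp
  \<comment> \<open>Along these points \<open>wp (y n + \<i>/2) = wp (y n)\<close>, with a finite
    limit on the left and a pole on the right; multiplied by \<open>y n ^ 2\<close>, the two sides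
    tend to 0 and 1. The offset 3 keeps \<open>y n\<close> within the range of the expansion at
    0.\<close>
  define y where "y = (\<lambda>n. complex_of_real (1 / real (n + 3)))"
  have ylim: "y \<longlonglongrightarrow> 0"
    unfolding y_def
    using tendsto_of_real[OF LIMSEQ_ignore_initial_segment[OF lim_1_over_n, of 3], where 'a = complex]
    by (simp only: of_real_0)
  have y: "y n \<noteq> 0" "norm (y n) \<le> 1/3" "y n + \<i>/2 \<in> V" for n
  proof -
    have r: "0 < 1 / real (n + 3)" "1 / real (n + 3) \<le> 1/3" by (auto simp: field_simps)
    show "y n \<noteq> 0" "norm (y n) \<le> 1/3" "y n + \<i>/2 \<in> V"
      unfolding y_def norm_of_real of_real_eq_0_iff using r by (simp_all add: V_def del: of_real_divide)
  qed
  have i2: "\<i>/2 \<notin> gaussL" by (simp add: gaussL_iff)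
  have eq: "wp (y n + \<i>/2) = 1 / y n ^ 2 + wp_reg (y n)" for n
    using d0[OF y(3)] wp_near_0[of "y n"] y(2)[of n] by (simp add: d_def)
  have eq2: "y n ^ 2 * wp (y n + \<i>/2) = 1 + y n ^ 2 * wp_reg (y n)" for n
    unfolding eq using y(1)[of n] by (simp add: distrib_left)
  have "isCont wp (0 + \<i>/2)" using wp_DERIV[OF i2] DERIV_isCont by auto
  then have "(\<lambda>n. wp (y n + \<i>/2)) \<longlonglongrightarrow> wp (0 + \<i>/2)"
    by (rule isCont_tendsto_compose) (intro tendsto_intros ylim)
  then have l1: "(\<lambda>n. y n ^ 2 * wp (y n + \<i>/2)) \<longlonglongrightarrow> 0 ^ 2 * wp (0 + \<i>/2)"
    by (intro tendsto_intros ylim)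
  have "isCont wp_reg 0"
    using wp_tail_deriv[of 0 "1/2"] DERIV_isCont by auto
  then have "(\<lambda>n. wp_reg (y n)) \<longlonglongrightarrow> wp_reg 0"
    by (rule isCont_tendsto_compose) (rule ylim)
  then have l2: "(\<lambda>n. 1 + y n ^ 2 * wp_reg (y n)) \<longlonglongrightarrow> 1 + 0 ^ 2 * wp_reg 0"
    by (intro tendsto_intros ylim)
  show False using LIMSEQ_unique[OF l1[unfolded eq2] l2] by simp
qed

text \<open>The second-order equation has a first integral. At \<open>cellc\<close> both
  \<open>wp\<close> and \<open>wp'\<close> vanish, so the integration constant is 0, and the zero of
  \<open>wp'\<close> at \<open>1/2\<close> determines \<open>k\<close> because \<open>wp_e\<close>
  is not zero.\<close>

lemma wp_ode:
  assumes z: "z \<notin> gaussL"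
  shows "wp' z ^ 2 = 4 * wp z ^ 3 - 4 * wp_e ^ 2 * wp z"
    and "deriv wp' z = 6 * wp z ^ 2 - 2 * wp_e ^ 2"
proof -
  obtain k where k: "\<And>z. z \<notin> gaussL \<Longrightarrow> deriv wp' z = 6 * wp z ^ 2 + k"
    using wp_second_order by blast
  have "((\<lambda>z. wp' z ^ 2 - 4 * wp z ^ 3 - 2 * k * wp z) has_field_derivative 0) (at z)" if "z \<in> - gaussL" for z
  proof -
    have d: "(wp has_field_derivative wp' z) (at z)" "(wp' has_field_derivative 6 * wp z ^ 2 + k) (at z)"
      using wp_DERIV[of z] wp'_DERIV[of z] k[of z] that by auto
    from DERIV_diff[OF DERIV_diff[OF DERIV_power[OF d(2), of 2] DERIV_cmult[OF DERIV_power[OF d(1), of 3], of 4]] DERIV_cmult[OF d(1), of "2 * k"]]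
    show ?thesis by (rule DERIV_cong) (simp add: algebra_simps power2_eq_square)
  qed
  then have "(\<lambda>z. wp' z ^ 2 - 4 * wp z ^ 3 - 2 * k * wp z) constant_on - gaussL"
    by (rule has_field_derivative_0_imp_constant_on[OF _ connected_compl_gaussL open_compl_gaussL])
  then have eq: "wp' z ^ 2 - 4 * wp z ^ 3 - 2 * k * wp z = 0" if "z \<notin> gaussL" for z
    using that cellc_notin wp_cellc wp'_cellc unfolding constant_on_def
    by (metis (no_types, lifting) ComplI diff_zero mult_zero_right power_zero_numeral)
  have "wp' (1/2) = 0" by (rule wp'_half_period) (auto simp: gaussL_iff)
  then have "of_real wp_e * (2 * of_real wp_e ^ 2 + k) = 0"
    using eq[OF half_notin] unfolding wp_half by (simp add: algebra_simps power2_eq_square power3_eq_cube) algebra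
  then have "k = - 2 * of_real wp_e ^ 2"
    using wp_e_nonzero by (simp add: eq_neg_iff_add_eq_0 add.commute)
  then show "wp' z ^ 2 = 4 * wp z ^ 3 - 4 * wp_e ^ 2 * wp z" "deriv wp' z = 6 * wp z ^ 2 - 2 * wp_e ^ 2"
    using eq[OF z] k[OF z] by (auto simp: algebra_simps)
qed

text \<open>A zero of \<open>wp'\<close> has \<open>wp z = 0\<close> or
  \<open>wp z ^ 2 = wp_e ^ 2\<close>; either value makes \<open>6 * wp z ^ 2 - 2 * wp_e ^ 2\<close>
  nonzero.\<close>

lemma wp'_zero_simple:
  assumes "z \<notin> gaussL" "wp' z = 0"
  shows "deriv wp' z \<noteq> 0"
proof
  assume d: "deriv wp' z = 0"
  have "6 * wp z ^ 2 = 2 * of_real wp_e ^ 2" using wp_ode(2)[OF assms(1)] d by simp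
  moreover have "wp z * (wp z ^ 2 - of_real wp_e ^ 2) = 0"
    using wp_ode(1)[OF assms(1)] assms(2) by (simp add: power2_eq_square power3_eq_cube) 
  ultimately have "of_real wp_e ^ 2 = (0::complex)" by auto
  then show False using wp_e_nonzero by simp
qed

section \<open>The linear system on the cell\<close>

text \<open>The system arises by setting \<open>eta = (psi' + b wp wp' psi) / wp'^2\<close> in the
  equation \<open>psi'' - 2 (wp''/wp') psi' = (t wp'^2 + b (wp wp'' - 3/2 wp'^2)) psi\<close>, where
  the bracket after \<open>b\<close> equals \<open>4 wp_e^2 wp\<close> by \<open>wp_ode\<close>. In
  the derivative of \<open>eta\<close> the terms with \<open>wp''\<close> cancel, and what is left
  has no poles at the zeros of \<open>wp'\<close>.\<close>

definition sysA :: "real \<Rightarrow> complex \<Rightarrow> complex" where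
  "sysA b z = - of_real b * wp z * wp' z"

definition sysB :: "real \<Rightarrow> real \<Rightarrow> complex \<Rightarrow> complex" where
  "sysB b t z = of_real t - of_real b / 2 - of_real b ^ 2 * wp z ^ 2"

definition sysC :: "complex \<Rightarrow> complex" where
  "sysC z = wp' z ^ 2"

abbreviation wsol :: "real \<Rightarrow> real \<Rightarrow> complex set \<Rightarrow> (complex \<Rightarrow> complex) \<Rightarrow> (complex \<Rightarrow> complex) \<Rightarrow> bool" where
  "wsol b t \<equiv> lin_sol (sysA b) (sysB b t) sysC"

text \<open>A region off the lattice, star-shaped about \<open>cellc\<close> and hence with
  single-valued solutions. It contains \<open>z - 1\<close> along with \<open>z\<close> in the
  horizontal strip and \<open>z - \<i>\<close> along with \<open>z\<close> in the vertical one, so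
  both translations can be read off from one branch.\<close>

definition cross :: "complex set" where
  "cross = {z. 0 < Re z \<and> Re z < 1 \<or> 0 < Im z \<and> Im z < 1}"

definition hstrip :: "complex set" where "hstrip = {z. 0 < Im z \<and> Im z < 1}"
definition vstrip :: "complex set" where "vstrip = {z. 0 < Re z \<and> Re z < 1}"

lemma cross_eq: "cross = vstrip \<union> hstrip"
  by (auto simp: cross_def hstrip_def vstrip_def)

lemma strips: "open hstrip" "convex hstrip" "open vstrip" "convex vstrip" "cellc \<in> hstrip" "cellc \<in> vstrip"
proof -
  have e: "hstrip = {z. 0 < Im z} \<inter> {z. Im z < 1}" "vstrip = {z. 0 < Re z} \<inter> {z. Re z < 1}"
    by (auto simp: hstrip_def vstrip_def)
  show "open hstrip" "convex hstrip" "open vstrip" "convex vstrip"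
    unfolding e by (intro open_Int convex_Int open_halfspace_Re_gt open_halfspace_Re_lt convex_halfspace_Re_gt
        convex_halfspace_Re_lt open_halfspace_Im_gt open_halfspace_Im_lt convex_halfspace_Im_gt convex_halfspace_Im_lt)+
qed (auto simp: hstrip_def vstrip_def)

lemma cross: "open cross" "cellc \<in> cross" "z \<in> cross \<Longrightarrow> closed_segment cellc z \<subseteq> cross"
  using strips by (auto simp: cross_eq dest: closed_segment_subset)

lemma connected_cross: "connected cross"
  by (rule starlike_imp_connected) (use cross in \<open>auto simp: starlike_def\<close>)

lemma cross_notin: "z \<in> cross \<Longrightarrow> z \<notin> gaussL"
  by (auto simp: cross_def gaussL_iff elim!: Ints_cases)

lemma sys_holomorphic:
  "sysA b holomorphic_on - gaussL" "sysB b t holomorphic_on - gaussL" "sysC holomorphic_on - gaussL"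
  unfolding sysA_def sysB_def sysC_def
  by (intro holomorphic_intros wp_holomorphic wp'_holomorphic)+

text \<open>The exponential bound is part of the choice, since the continuity of \<open>disc\<close>
  needs it uniformly in \<open>b\<close> and \<open>t\<close>.\<close>

definition wfund :: "real \<Rightarrow> real \<Rightarrow> complex \<Rightarrow> complex \<Rightarrow> (complex \<Rightarrow> complex) \<times> (complex \<Rightarrow> complex)" where
  "wfund b t x0 y0 = (SOME (\<psi>, \<eta>). wsol b t cross \<psi> \<eta> \<and> \<psi> cellc = x0 \<and> \<eta> cellc = y0 \<and>
     (\<forall>z M. z \<in> cross \<longrightarrow>
       (\<forall>w\<in>closed_segment cellc z. norm (sysA b w) \<le> M \<and> norm (sysB b t w) \<le> M \<and> norm (sysC w) \<le> M) \<longrightarrow>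
       norm (\<psi> z) + norm (\<eta> z) \<le> (norm x0 + norm y0) * exp (2 * M * norm (z - cellc))))"

lemma wfund:
  "wsol b t cross (fst (wfund b t x0 y0)) (snd (wfund b t x0 y0))"
  "fst (wfund b t x0 y0) cellc = x0" "snd (wfund b t x0 y0) cellc = y0"
  "z \<in> cross \<Longrightarrow>
    (\<And>w. w \<in> closed_segment cellc z \<Longrightarrow> norm (sysA b w) \<le> M \<and> norm (sysB b t w) \<le> M \<and> norm (sysC w) \<le> M) \<Longrightarrow>
    norm (fst (wfund b t x0 y0) z) + norm (snd (wfund b t x0 y0) z) \<le> (norm x0 + norm y0) * exp (2 * M * norm (z - cellc))"
proof -
  let ?P = "\<lambda>(\<psi>, \<eta>). wsol b t cross \<psi> \<eta> \<and> \<psi> cellc = x0 \<and> \<eta> cellc = y0 \<and>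
     (\<forall>z M. z \<in> cross \<longrightarrow>
       (\<forall>w\<in>closed_segment cellc z. norm (sysA b w) \<le> M \<and> norm (sysB b t w) \<le> M \<and> norm (sysC w) \<le> M) \<longrightarrow>
       norm (\<psi> z) + norm (\<eta> z) \<le> (norm x0 + norm y0) * exp (2 * M * norm (z - cellc)))"
  have hol: "sysA b holomorphic_on cross" "sysB b t holomorphic_on cross" "sysC holomorphic_on cross"
    using cross_notin by (auto intro: holomorphic_on_subset[OF sys_holomorphic(1)]
        holomorphic_on_subset[OF sys_holomorphic(2)] holomorphic_on_subset[OF sys_holomorphic(3)])
  obtain \<psi> \<eta> where "wsol b t cross \<psi> \<eta>" "\<psi> cellc = x0" "\<eta> cellc = y0"
    "\<And>z M. z \<in> cross \<Longrightarrow> (\<And>w. w \<in> closed_segment cellc z \<Longrightarrow> norm (sysA b w) \<le> M \<and> norm (sysB b t w) \<le> M \<and> norm (sysC w) \<le> M) \<Longrightarrow>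
       norm (\<psi> z) + norm (\<eta> z) \<le> (norm x0 + norm y0) * exp (2 * M * norm (z - cellc))"
    using lin_sol_exists[OF cross(1,2) cross(3) hol] by metis
  then have "?P (\<psi>, \<eta>)" by simp
  then have "?P (wfund b t x0 y0)" unfolding wfund_def by (rule someI[where P = ?P])
  then show "wsol b t cross (fst (wfund b t x0 y0)) (snd (wfund b t x0 y0))"
    "fst (wfund b t x0 y0) cellc = x0" "snd (wfund b t x0 y0) cellc = y0"
    "z \<in> cross \<Longrightarrow>
    (\<And>w. w \<in> closed_segment cellc z \<Longrightarrow> norm (sysA b w) \<le> M \<and> norm (sysB b t w) \<le> M \<and> norm (sysC w) \<le> M) \<Longrightarrow>
    norm (fst (wfund b t x0 y0) z) + norm (snd (wfund b t x0 y0) z) \<le> (norm x0 + norm y0) * exp (2 * M * norm (z - cellc))"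
    by (auto simp: case_prod_unfold)
qed

definition psi1 :: "real \<Rightarrow> real \<Rightarrow> complex \<Rightarrow> complex" where "psi1 b t = fst (wfund b t 1 0)"
definition eta1 :: "real \<Rightarrow> real \<Rightarrow> complex \<Rightarrow> complex" where "eta1 b t = snd (wfund b t 1 0)"
definition psi2 :: "real \<Rightarrow> real \<Rightarrow> complex \<Rightarrow> complex" where "psi2 b t = fst (wfund b t 0 1)"
definition eta2 :: "real \<Rightarrow> real \<Rightarrow> complex \<Rightarrow> complex" where "eta2 b t = snd (wfund b t 0 1)"

lemma fund_sol: "wsol b t cross (psi1 b t) (eta1 b t)" "wsol b t cross (psi2 b t) (eta2 b t)"
  by (simp_all add: psi1_def psi2_def eta1_def eta2_def wfund)

lemma fund_init [simp]: "psi1 b t cellc = 1" "eta1 b t cellc = 0" "psi2 b t cellc = 0" "eta2 b t cellc = 1"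
  by (simp_all add: psi1_def psi2_def eta1_def eta2_def wfund)

lemma fund_det: "z \<in> cross \<Longrightarrow> psi1 b t z * eta2 b t z - eta1 b t z * psi2 b t z = 1"
  using lin_sol_wronskian[OF fund_sol cross(1) connected_cross _ cross(2), of z b t] by simp

lemma wsol_cross_expand:
  assumes "wsol b t cross \<psi> \<eta>" "z \<in> cross"
  shows "\<psi> z = \<psi> cellc * psi1 b t z + \<eta> cellc * psi2 b t z"
    and "\<eta> z = \<psi> cellc * eta1 b t z + \<eta> cellc * eta2 b t z"
  using lin_sol_expand[OF fund_sol assms(1) cross(1) connected_cross cross(2) _ assms(2)] by simp_all

subsection \<open>Symmetries\<close>

lemma cross_rot: "z \<in> cross \<Longrightarrow> \<i> * z + 1 \<in> cross"
  by (auto simp: cross_def)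

lemma wp_rot:
  assumes "z \<notin> gaussL"
  shows "wp (\<i> * z + 1) = - wp z" "wp' (\<i> * z + 1) = \<i> * wp' z"
  using assms wp_periodic[of 1 "\<i> * z"] deriv_wp_periodic[of 1 "\<i> * z"] wp_times_i[of z] wp'_times_i[of z]
  by (auto simp: gaussL_iff)

text \<open>The quarter turn multiplies \<open>sysA\<close> by \<open>- \<i>\<close>, fixes
  \<open>sysB\<close> and negates \<open>sysC\<close>. With the factor \<open>\<i>\<close> of the
  chain rule, rescaling the second component by \<open>- \<i>\<close> restores the system.\<close>

lemma wsol_rot:
  assumes "wsol b t cross \<psi> \<eta>"
  shows "wsol b t cross (\<lambda>z. \<psi> (\<i> * z + 1)) (\<lambda>z. - \<i> * \<eta> (\<i> * z + 1))"
  unfolding lin_sol_def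
proof (intro ballI conjI)
  fix z assume z: "z \<in> cross"
  let ?w = "\<i> * z + 1"
  have d: "(\<psi> has_field_derivative sysA b ?w * \<psi> ?w + sysC ?w * \<eta> ?w) (at ?w)"
    "(\<eta> has_field_derivative sysB b t ?w * \<psi> ?w - sysA b ?w * \<eta> ?w) (at ?w)"
    using assms cross_rot[OF z] by (auto simp: lin_sol_def)
  have R: "((\<lambda>z. \<i> * z + 1) has_field_derivative \<i>) (at z)"
    by (auto intro!: derivative_eq_intros)
  have s: "sysA b ?w = - \<i> * sysA b z" "sysB b t ?w = sysB b t z" "sysC ?w = - sysC z"
    using wp_rot[OF cross_notin[OF z]] by (auto simp: sysA_def sysB_def sysC_def power_mult_distrib)
  show "((\<lambda>z. \<psi> (\<i> * z + 1)) has_field_derivative sysA b z * \<psi> ?w + sysC z * (- \<i> * \<eta> ?w)) (at z)"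
    by (rule DERIV_cong[OF DERIV_chain2[OF d(1) R]]) (simp only: s, simp add: algebra_simps)
  show "((\<lambda>z. - \<i> * \<eta> (\<i> * z + 1)) has_field_derivative sysB b t z * \<psi> ?w - sysA b z * (- \<i> * \<eta> ?w)) (at z)"
    by (rule DERIV_cong[OF DERIV_cmult[OF DERIV_chain2[OF d(2) R]]]) (simp only: s, simp add: algebra_simps)
qed

text \<open>As \<open>cellc\<close> is fixed, the quarter turn acts diagonally in the basis
  normalized there.\<close>

lemma fund_rot:
  assumes "z \<in> cross"
  shows "psi1 b t (\<i> * z + 1) = psi1 b t z" "eta1 b t (\<i> * z + 1) = \<i> * eta1 b t z"
    "psi2 b t (\<i> * z + 1) = - \<i> * psi2 b t z" "eta2 b t (\<i> * z + 1) = eta2 b t z"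
proof -
  have m: "- (\<i> * x) = y \<Longrightarrow> x = \<i> * y" for x y :: complex by auto
  show "psi1 b t (\<i> * z + 1) = psi1 b t z" "psi2 b t (\<i> * z + 1) = - \<i> * psi2 b t z"
    "eta1 b t (\<i> * z + 1) = \<i> * eta1 b t z" "eta2 b t (\<i> * z + 1) = eta2 b t z"
    using wsol_cross_expand[OF wsol_rot[OF fund_sol(1)] assms, of b t]
      wsol_cross_expand[OF wsol_rot[OF fund_sol(2)] assms, of b t] by (auto intro!: m)
qed

lemma cross_cnj: "z \<in> cross \<Longrightarrow> cnj z + \<i> \<in> cross"
  by (auto simp: cross_def)

text \<open>The reflection in the line \<open>Im z = 1/2\<close>, composed with conjugation of the
  values, preserves the system because \<open>b\<close> and \<open>t\<close> are real and
  \<open>wp\<close> commutes with conjugation.\<close>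

lemma wsol_cnj:
  assumes "wsol b t cross \<psi> \<eta>"
  shows "wsol b t cross (\<lambda>z. cnj (\<psi> (cnj z + \<i>))) (\<lambda>z. cnj (\<eta> (cnj z + \<i>)))"
  unfolding lin_sol_def
proof (intro ballI conjI)
  fix z assume z: "z \<in> cross"
  let ?w = "cnj z + \<i>"
  have d: "(\<psi> has_field_derivative sysA b ?w * \<psi> ?w + sysC ?w * \<eta> ?w) (at ?w)"
    "(\<eta> has_field_derivative sysB b t ?w * \<psi> ?w - sysA b ?w * \<eta> ?w) (at ?w)"
    using assms cross_cnj[OF z] by (auto simp: lin_sol_def)
  have T: "((\<lambda>z. f (z + \<i>)) has_field_derivative D) (at (cnj z))" if "(f has_field_derivative D) (at ?w)" for f D
  proof -
    have "((\<lambda>z. f (z + \<i>)) has_field_derivative D * 1) (at (cnj z))"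
      by (rule DERIV_chain2[where f = f]) (use that in \<open>auto intro!: derivative_eq_intros\<close>)
    then show ?thesis by simp
  qed
  have s: "sysA b ?w = cnj (sysA b z)" "sysB b t ?w = cnj (sysB b t z)" "sysC ?w = cnj (sysC z)"
    using wp_periodic[of \<i> "cnj z"] deriv_wp_periodic[of \<i> "cnj z"] wp_cnj[of z] wp'_cnj[of z] cross_notin[OF z]
    by (auto simp: sysA_def sysB_def sysC_def gaussL_iff)
  show "((\<lambda>z. cnj (\<psi> (cnj z + \<i>))) has_field_derivative sysA b z * cnj (\<psi> ?w) + sysC z * cnj (\<eta> ?w)) (at z)"
    using has_field_derivative_cnj_cnj[OF T[OF d(1)]] by (simp add: s o_def)
  show "((\<lambda>z. cnj (\<eta> (cnj z + \<i>))) has_field_derivative sysB b t z * cnj (\<psi> ?w) - sysA b z * cnj (\<eta> ?w)) (at z)"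
    using has_field_derivative_cnj_cnj[OF T[OF d(2)]] by (simp add: s o_def)
qed

lemma fund_cnj:
  assumes "z \<in> cross"
  shows "psi1 b t (cnj z + \<i>) = cnj (psi1 b t z)" "eta1 b t (cnj z + \<i>) = cnj (eta1 b t z)"
    "psi2 b t (cnj z + \<i>) = cnj (psi2 b t z)" "eta2 b t (cnj z + \<i>) = cnj (eta2 b t z)"
proof -
  have c: "cnj cellc + \<i> = cellc" by (simp add: complex_eq_iff)
  have m: "cnj x = y \<Longrightarrow> x = cnj y" for x y by auto
  show "psi1 b t (cnj z + \<i>) = cnj (psi1 b t z)" "eta1 b t (cnj z + \<i>) = cnj (eta1 b t z)"
    "psi2 b t (cnj z + \<i>) = cnj (psi2 b t z)" "eta2 b t (cnj z + \<i>) = cnj (eta2 b t z)"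
    using wsol_cross_expand[OF wsol_cnj[OF fund_sol(1)] assms, of b t]
      wsol_cross_expand[OF wsol_cnj[OF fund_sol(2)] assms, of b t] by (auto simp: c intro!: m)
qed

text \<open>The midpoint of the right edge of the square. The reflection fixes it, so the
  fundamental matrix is real there, and the half turn about \<open>cellc\<close> carries it to
  \<open>edgem - 1\<close>.\<close>

definition edgem :: complex where "edgem = 1 + \<i> / 2"

lemma edgem: "Re edgem = 1" "Im edgem = 1/2" "edgem \<in> hstrip" "edgem \<in> cross" "cnj edgem + \<i> = edgem"
  "\<i> * (\<i> * edgem + 1) + 1 = edgem - 1" "edgem \<notin> gaussL"
  by (auto simp: edgem_def hstrip_def cross_def complex_eq_iff gaussL_iff)

definition edge_p :: "real \<Rightarrow> real \<Rightarrow> real" where "edge_p b t = Re (psi1 b t edgem)"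
definition edge_q :: "real \<Rightarrow> real \<Rightarrow> real" where "edge_q b t = Re (eta1 b t edgem)"
definition edge_r :: "real \<Rightarrow> real \<Rightarrow> real" where "edge_r b t = Re (psi2 b t edgem)"
definition edge_s :: "real \<Rightarrow> real \<Rightarrow> real" where "edge_s b t = Re (eta2 b t edgem)"

text \<open>Half the trace of the translation by \<open>1\<close> in the fundamental basis, as
  \<open>fund_shift_1\<close> shows.\<close>

definition disc :: "real \<Rightarrow> real \<Rightarrow> real" where
  "disc b t = edge_p b t * edge_s b t + edge_q b t * edge_r b t"

lemma fund_edgem: "psi1 b t edgem = of_real (edge_p b t)" "eta1 b t edgem = of_real (edge_q b t)"
  "psi2 b t edgem = of_real (edge_r b t)" "eta2 b t edgem = of_real (edge_s b t)"
proof -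
  have m: "x = cnj x \<Longrightarrow> x = of_real (Re x)" for x by (simp add: complex_eq_iff)
  show "psi1 b t edgem = of_real (edge_p b t)" "eta1 b t edgem = of_real (edge_q b t)"
    "psi2 b t edgem = of_real (edge_r b t)" "eta2 b t edgem = of_real (edge_s b t)"
    using fund_cnj[OF edgem(4), of b t] m by (auto simp: edgem(5) edge_p_def edge_q_def edge_r_def edge_s_def)
qed

lemma fund_edgem_det: "edge_p b t * edge_s b t - edge_q b t * edge_r b t = 1"
proof -
  have "complex_of_real (edge_p b t * edge_s b t - edge_q b t * edge_r b t) = 1"
    using fund_det[OF edgem(4), of b t] by (simp add: fund_edgem)
  then show ?thesis by (metis of_real_eq_1_iff)
qed

lemma fund_edgem_left:
  "psi1 b t (edgem - 1) = of_real (edge_p b t)" "eta1 b t (edgem - 1) = - of_real (edge_q b t)"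
  "psi2 b t (edgem - 1) = - of_real (edge_r b t)" "eta2 b t (edgem - 1) = of_real (edge_s b t)"
  using fund_rot[OF cross_rot[OF edgem(4)], of b t] fund_rot[OF edgem(4), of b t]
  by (simp_all add: edgem(6) fund_edgem)

lemma hstrip_subset: "hstrip \<subseteq> cross" and vstrip_subset: "vstrip \<subseteq> cross"
  by (auto simp: cross_eq)

text \<open>At \<open>edgem - 1\<close> the fundamental matrix is the one at \<open>edgem\<close>
  with the signs of the off-diagonal entries changed. Multiplying it by the inverse of the latter
  gives the transition matrix, whose diagonal entries coincide.\<close>

lemma fund_shift_1:
  assumes "z \<in> hstrip"
  shows "psi1 b t (z - 1) = of_real (disc b t) * psi1 b t z - of_real (2 * edge_p b t * edge_q b t) * psi2 b t z"
    "eta1 b t (z - 1) = of_real (disc b t) * eta1 b t z - of_real (2 * edge_p b t * edge_q b t) * eta2 b t z"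
    "psi2 b t (z - 1) = - of_real (2 * edge_r b t * edge_s b t) * psi1 b t z + of_real (disc b t) * psi2 b t z"
    "eta2 b t (z - 1) = - of_real (2 * edge_r b t * edge_s b t) * eta1 b t z + of_real (disc b t) * eta2 b t z"
proof -
  have shift: "wsol b t hstrip (\<lambda>z. \<psi> (z - 1)) (\<lambda>z. \<eta> (z - 1))" if "wsol b t cross \<psi> \<eta>" for \<psi> \<eta>
    unfolding lin_sol_def
  proof (intro ballI conjI)
    fix z assume "z \<in> hstrip"
    then have z: "z - 1 \<in> cross" "z - 1 \<notin> gaussL"
      using cross_notin[of "z - 1"] by (auto simp: hstrip_def cross_def)
    have T: "((\<lambda>z. f (z - 1)) has_field_derivative D) (at z)" if "(f has_field_derivative D) (at (z - 1))" for f D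
    proof -
      have "((\<lambda>z. f (z - 1)) has_field_derivative D * 1) (at z)"
        by (rule DERIV_chain2[where f = f]) (use that in \<open>auto intro!: derivative_eq_intros\<close>)
      then show ?thesis by simp
    qed
    have s: "sysA b (z - 1) = sysA b z" "sysB b t (z - 1) = sysB b t z" "sysC (z - 1) = sysC z"
      using wp_periodic[of 1 "z - 1"] deriv_wp_periodic[of 1 "z - 1"] z(2)
      by (auto simp: sysA_def sysB_def sysC_def gaussL_iff)
    show "((\<lambda>z. \<psi> (z - 1)) has_field_derivative sysA b z * \<psi> (z - 1) + sysC z * \<eta> (z - 1)) (at z)"
      "((\<lambda>z. \<eta> (z - 1)) has_field_derivative sysB b t z * \<psi> (z - 1) - sysA b z * \<eta> (z - 1)) (at z)"
      using that z(1) T by (auto simp: lin_sol_def simp flip: s)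
  qed
  have f: "wsol b t hstrip (psi1 b t) (eta1 b t)" "wsol b t hstrip (psi2 b t) (eta2 b t)"
    by (rule lin_sol_subset[OF fund_sol(1) hstrip_subset], rule lin_sol_subset[OF fund_sol(2) hstrip_subset])
  note e = lin_sol_expand[OF f shift strips(1) convex_connected[OF strips(2)] edgem(3) fund_det[OF edgem(4)] assms]
  show "psi1 b t (z - 1) = of_real (disc b t) * psi1 b t z - of_real (2 * edge_p b t * edge_q b t) * psi2 b t z"
    "eta1 b t (z - 1) = of_real (disc b t) * eta1 b t z - of_real (2 * edge_p b t * edge_q b t) * eta2 b t z"
    using e[OF fund_sol(1)] by (simp_all add: fund_edgem fund_edgem_left disc_def algebra_simps)
  show "psi2 b t (z - 1) = - of_real (2 * edge_r b t * edge_s b t) * psi1 b t z + of_real (disc b t) * psi2 b t z"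
    "eta2 b t (z - 1) = - of_real (2 * edge_r b t * edge_s b t) * eta1 b t z + of_real (disc b t) * eta2 b t z"
    using e[OF fund_sol(2)] by (simp_all add: fund_edgem fund_edgem_left disc_def algebra_simps)
qed

text \<open>The quarter turn conjugates the translation by \<open>1\<close> into the one by
  \<open>\<i>\<close>, which multiplies the off-diagonal entries by \<open>\<i>\<close> and
  \<open>- \<i>\<close>.\<close>

lemma fund_shift_i:
  assumes "z \<in> vstrip"
  shows "psi1 b t (z - \<i>) = of_real (disc b t) * psi1 b t z - \<i> * of_real (2 * edge_p b t * edge_q b t) * psi2 b t z"
    "eta1 b t (z - \<i>) = of_real (disc b t) * eta1 b t z - \<i> * of_real (2 * edge_p b t * edge_q b t) * eta2 b t z"
    "psi2 b t (z - \<i>) = \<i> * of_real (2 * edge_r b t * edge_s b t) * psi1 b t z + of_real (disc b t) * psi2 b t z"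
    "eta2 b t (z - \<i>) = \<i> * of_real (2 * edge_r b t * edge_s b t) * eta1 b t z + of_real (disc b t) * eta2 b t z"
proof -
  define w where "w = - \<i> * z + \<i>"
  have w: "w \<in> hstrip" "z = \<i> * w + 1" "z - \<i> = \<i> * (w - 1) + 1"
    using assms by (auto simp: w_def hstrip_def vstrip_def algebra_simps)
  have wc: "w \<in> cross" "w - 1 \<in> cross" using w(1) by (auto simp: hstrip_def cross_def)
  note r = fund_rot[OF wc(1), of b t, folded w(2)] fund_rot[OF wc(2), of b t, folded w(3)]
  show "psi1 b t (z - \<i>) = of_real (disc b t) * psi1 b t z - \<i> * of_real (2 * edge_p b t * edge_q b t) * psi2 b t z"
    "eta1 b t (z - \<i>) = of_real (disc b t) * eta1 b t z - \<i> * of_real (2 * edge_p b t * edge_q b t) * eta2 b t z"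
    "psi2 b t (z - \<i>) = \<i> * of_real (2 * edge_r b t * edge_s b t) * psi1 b t z + of_real (disc b t) * psi2 b t z"
    "eta2 b t (z - \<i>) = \<i> * of_real (2 * edge_r b t * edge_s b t) * eta1 b t z + of_real (disc b t) * eta2 b t z"
    unfolding r fund_shift_1[OF w(1), of b t] by (simp_all add: algebra_simps)
qed

subsection \<open>Choice of the accessory parameter\<close>

text \<open>The value with \<open>b * wp_e ^ 2 = 3/2\<close>, for which the equation
  \<open>\<rho>^2 - 5/2 \<rho> = b wp_e^2\<close> of the growth exponent has the root 3 and one
  solution is algebraic.\<close>

definition bmax :: real where "bmax = 3 / (2 * wp_e ^ 2)"

lemma bmax_pos: "bmax > 0"
  using wp_e_nonzero by (simp add: bmax_def)

lemma disc_0: "disc 0 0 = 1"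
proof -
  have "wsol 0 0 cross (\<lambda>_. 1) (\<lambda>_. 0)"
    by (simp add: lin_sol_def sysA_def sysB_def)
  from wsol_cross_expand[OF this edgem(4)] have "psi1 0 0 edgem = 1" "eta1 0 0 edgem = 0" by auto
  then have "edge_p 0 0 = 1" "edge_q 0 0 = 0" by (auto simp: edge_p_def edge_q_def)
  then show ?thesis using fund_edgem_det[of 0 0] by (simp add: disc_def)
qed

text \<open>For this value of the parameter the system is solved by \<open>\<psi> = (wp_e\<^sup>2 - wp\<^sup>2) powr (3/2)\<close>.\<close>

lemma disc_bmax: "disc bmax 0 = -1"
proof -
  \<comment> \<open>The root is used only near \<open>cellc\<close>, where \<open>wp\<close> is
    smaller than \<open>wp_e\<close> in modulus and the principal branch is holomorphic.\<close>
  define q where "q = (\<lambda>z. csqrt (of_real wp_e ^ 2 - wp z ^ 2))"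
  have a0: "wp_e \<noteq> 0" by (rule wp_e_nonzero)
  have "isCont wp cellc" using wp_DERIV[OF cellc_notin] DERIV_isCont by blast
  then have "\<forall>\<^sub>F z in at cellc. dist (wp z) (wp cellc) < \<bar>wp_e\<bar>"
    using a0 unfolding isCont_def by (intro tendstoD) auto
  then obtain d0 where d0: "d0 > 0" "\<And>z. z \<noteq> cellc \<Longrightarrow> dist z cellc < d0 \<Longrightarrow> norm (wp z) < \<bar>wp_e\<bar>"
    by (auto simp: eventually_at)
  obtain d1 where d1: "d1 > 0" "ball cellc d1 \<subseteq> cross"
    using cross(1,2) open_contains_ball by blast
  define U where "U = ball cellc (min d0 d1)"
  have U: "open U" "connected U" "cellc \<in> U" "U \<subseteq> cross"
    using d0 d1 by (auto simp: U_def)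
  have wU: "norm (wp z) < \<bar>wp_e\<bar>" if "z \<in> U" for z
    using d0(2)[of z] that a0 by (cases "z = cellc") (auto simp: U_def dist_commute)
  have Re: "0 < Re (of_real wp_e ^ 2 - wp z ^ 2)" if "z \<in> U" for z
  proof -
    have "Re (wp z ^ 2) \<le> norm (wp z ^ 2)" by (rule complex_Re_le_cmod)
    also have "\<dots> < \<bar>wp_e\<bar> ^ 2"
      unfolding norm_power using wU[OF that] by (intro power_strict_mono) auto
    finally show ?thesis by (simp flip: of_real_power)
  qed
  have q2: "q z ^ 2 = of_real wp_e ^ 2 - wp z ^ 2" for z by (simp add: q_def)
  have q0: "q z \<noteq> 0" if "z \<in> U" for z
  proof
    assume "q z = 0"
    then have "of_real wp_e ^ 2 - wp z ^ 2 = 0" using q2[of z] by simp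
    then show False using Re[OF that] by (metis less_irrefl zero_complex.sel(1))
  qed
  have qd: "(q has_field_derivative - wp z * wp' z / q z) (at z)" if z: "z \<in> U" for z
  proof -
    have zL: "z \<notin> gaussL" using U cross_notin z by blast
    have "((\<lambda>z. of_real wp_e ^ 2 - wp z ^ 2) has_field_derivative - (2 * wp z * wp' z)) (at z)"
      using DERIV_diff[OF DERIV_const DERIV_power[OF wp_DERIV[OF zL], of 2]] by (simp add: algebra_simps)
    moreover have "of_real wp_e ^ 2 - wp z ^ 2 \<notin> \<real>\<^sub>\<le>\<^sub>0"
      using Re[OF z] by (auto simp: complex_nonpos_Reals_iff)
    ultimately have "(q has_field_derivative inverse (2 * csqrt (of_real wp_e ^ 2 - wp z ^ 2)) * (- (2 * wp z * wp' z))) (at z)"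
      unfolding q_def by (intro DERIV_chain2[OF has_field_derivative_csqrt])
    then show ?thesis by (rule DERIV_cong) (simp add: q_def field_simps)
  qed
  have p2: "wp' z ^ 2 = - 4 * wp z * q z ^ 2" if "z \<notin> gaussL" for z
    unfolding q2 wp_ode(1)[OF that] by (simp add: algebra_simps power2_eq_square power3_eq_cube)
  define B where "B = complex_of_real bmax"
  have Ba: "B * of_real wp_e ^ 2 = 3/2"
  proof -
    have "bmax * wp_e ^ 2 = 3/2" using a0 by (simp add: bmax_def)
    then have "complex_of_real (bmax * wp_e ^ 2) = of_real (3/2)" by (simp only:)
    then show ?thesis by (simp add: B_def)
  qed
  have "wsol bmax 0 U (\<lambda>z. q z ^ 3) (\<lambda>z. wp' z * (3 - B * q z ^ 2) / (4 * q z))"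
    unfolding lin_sol_def
  proof (intro ballI conjI)
    fix z assume z: "z \<in> U"
    then have zL: "z \<notin> gaussL" using U cross_notin by blast
    note qn = q0[OF z]
    have "(- B * wp z * wp' z) * q z ^ 3 + wp' z ^ 2 * (wp' z * (3 - B * q z ^ 2) / (4 * q z))
        = 3 * q z ^ 2 * (- wp z * wp' z / q z)"
      unfolding p2[OF zL] using qn by (simp add: field_simps power2_eq_square power3_eq_cube)
    then have e: "sysA bmax z * q z ^ 3 + sysC z * (wp' z * (3 - B * q z ^ 2) / (4 * q z))
        = 3 * q z ^ 2 * (- wp z * wp' z / q z)"
      by (simp only: sysA_def sysC_def B_def)
    show "((\<lambda>z. q z ^ 3) has_field_derivative sysA bmax z * q z ^ 3 +
        sysC z * (wp' z * (3 - B * q z ^ 2) / (4 * q z))) (at z)"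
      unfolding e by (rule DERIV_cong[OF DERIV_power[OF qd[OF z], of 3]]) simp
    have d2: "(wp' has_field_derivative 6 * wp z ^ 2 - 2 * of_real wp_e ^ 2) (at z)"
      using wp'_DERIV[OF zL] wp_ode(2)[OF zL] by simp
    have "((\<lambda>z. wp' z * (3 - B * q z ^ 2) / (4 * q z)) has_field_derivative
       (((6 * wp z ^ 2 - 2 * of_real wp_e ^ 2) * (3 - B * q z ^ 2) + (0 - B * (2 * q z * (- wp z * wp' z / q z))) * wp' z) * (4 * q z)
         - wp' z * (3 - B * q z ^ 2) * (4 * (- wp z * wp' z / q z))) / ((4 * q z) * (4 * q z))) (at z)"
      using qn
      by (intro DERIV_divide DERIV_mult d2 DERIV_diff DERIV_const DERIV_cmult qd[OF z])
        (use DERIV_power[OF qd[OF z], of 2] in \<open>simp_all add: mult_ac\<close>)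
    moreover have "(((6 * wp z ^ 2 - 2 * of_real wp_e ^ 2) * (3 - B * q z ^ 2) + (0 - B * (2 * q z * (- wp z * wp' z / q z))) * wp' z) * (4 * q z)
         - wp' z * (3 - B * q z ^ 2) * (4 * (- wp z * wp' z / q z))) / ((4 * q z) * (4 * q z))
       = sysB bmax 0 z * q z ^ 3 - sysA bmax z * (wp' z * (3 - B * q z ^ 2) / (4 * q z))" (is "?l = ?r")
    proof -
      define u Q a2 where "u = wp z" and "Q = q z ^ 2" and "a2 = complex_of_real wp_e ^ 2"
      have Qa: "Q = a2 - u ^ 2" by (simp add: Q_def q2 u_def a2_def)
      have w2: "wp' z ^ 2 = - 4 * u * Q" using p2[OF zL] by (simp add: u_def Q_def)
      have Ba2: "B * a2 = 3/2" using Ba by (simp add: a2_def)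
      have "?l * (4 * q z) = (6 * u ^ 2 - 2 * a2) * (3 - B * Q) + 2 * B * u * wp' z ^ 2 + wp' z ^ 2 * (3 - B * Q) * u / Q"
        using qn by (simp add: u_def Q_def a2_def divide_simps) (simp add: algebra_simps power2_eq_square)
      also have "\<dots> = (6 * u ^ 2 - 2 * a2) * (3 - B * Q) - 8 * B * u ^ 2 * Q - 4 * u ^ 2 * (3 - B * Q)"
        using qn unfolding w2 by (simp add: Q_def power2_eq_square)
      also have "\<dots> = (- B / 2 - B ^ 2 * u ^ 2) * (4 * Q ^ 2) + B * u * (- 4 * u * Q) * (3 - B * Q)"
      proof -
        have "(6 * u ^ 2 - 2 * a2) * (3 - B * Q) - 8 * B * u ^ 2 * Q - 4 * u ^ 2 * (3 - B * Q)
          - ((- B / 2 - B ^ 2 * u ^ 2) * (4 * Q ^ 2) + B * u * (- 4 * u * Q) * (3 - B * Q))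
          = 4 * Q * (B * a2 - 3 / 2)"
          unfolding Qa by (simp add: field_simps power2_eq_square)
        then show ?thesis using Ba2 by simp
      qed
      also have "\<dots> = (- B / 2 - B ^ 2 * u ^ 2) * (4 * Q ^ 2) + B * u * wp' z ^ 2 * (3 - B * Q)"
        by (simp add: w2)
      also have "\<dots> = ?r * (4 * q z)"
        using qn by (simp add: sysA_def sysB_def B_def u_def Q_def field_simps power2_eq_square power3_eq_cube)
      finally show ?thesis
        by (rule mult_right_cancel[THEN iffD1, rotated]) (use qn in simp)
    qed
    ultimately show "((\<lambda>z. wp' z * (3 - B * q z ^ 2) / (4 * q z)) has_field_derivative
       sysB bmax 0 z * q z ^ 3 - sysA bmax z * (wp' z * (3 - B * q z ^ 2) / (4 * q z))) (at z)"
      by simp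
  qed
  note sol = this
  have qc: "q cellc = of_real \<bar>wp_e\<bar>"
    by (simp add: q_def csqrt_of_real_nonneg real_sqrt_abs flip: of_real_power)
  have psi1U: "q z ^ 3 = of_real \<bar>wp_e\<bar> ^ 3 * psi1 bmax 0 z" if "z \<in> U" for z
    using lin_sol_expand(1)[OF lin_sol_subset[OF fund_sol(1) U(4)] lin_sol_subset[OF fund_sol(2) U(4)] sol U(1,2,3) _ that]
    by (simp add: qc)
  \<comment> \<open>The squared identity is free of roots, so it continues from \<open>U\<close> to
    all of \<open>cross\<close>, in particular to \<open>edgem\<close>, where
    \<open>wp = - wp_e\<close>.\<close>
  define F where "F = (\<lambda>z. of_real wp_e ^ 6 * psi1 bmax 0 z ^ 2 - (of_real wp_e ^ 2 - wp z ^ 2) ^ 3)"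
  have "F z = 0" if z: "z \<in> U" for z
  proof -
    have "(of_real wp_e ^ 2 - wp z ^ 2) ^ 3 = (q z ^ 3) ^ 2"
      unfolding q2[symmetric] by (simp flip: power_mult)
    also have "\<dots> = (complex_of_real \<bar>wp_e\<bar> ^ 2) ^ 3 * psi1 bmax 0 z ^ 2"
      unfolding psi1U[OF z] by (simp add: power_mult_distrib flip: power_mult)
    also have "complex_of_real \<bar>wp_e\<bar> ^ 2 = of_real wp_e ^ 2" by (simp flip: of_real_power)
    finally show ?thesis by (simp add: F_def flip: power_mult)
  qed
  moreover have "F holomorphic_on cross"
    unfolding F_def using cross_notin
    by (intro holomorphic_intros lin_sol_holomorphic[OF fund_sol(1) cross(1)] holomorphic_on_subset[OF wp_holomorphic]) auto
  ultimately have "F edgem = 0"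
    using analytic_continuation_open[of U cross F "\<lambda>_. 0" edgem] U cross(1) connected_cross edgem(4) by auto
  moreover have "wp edgem = - of_real wp_e"
  proof -
    have "\<i> / 2 \<notin> gaussL" by (simp add: gaussL_iff)
    then have "wp edgem = wp (\<i> / 2)"
      using wp_periodic[of 1 "\<i>/2"] by (simp add: edgem_def add.commute gaussL_iff)
    also have "\<i> / 2 = \<i> * (1/2)" by simp
    also have "wp \<dots> = - of_real wp_e" using wp_times_i wp_half by metis
    finally show ?thesis .
  qed
  ultimately have "psi1 bmax 0 edgem = 0" using a0 by (simp add: F_def)
  \<comment> \<open>The determinant \<open>p s - q r = 1\<close> becomes \<open>- q r = 1\<close>,
    and \<open>disc = p s + q r\<close> becomes \<open>q r\<close>.\<close>
  then have "edge_p bmax 0 = 0" by (simp add: edge_p_def)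
  then show ?thesis using fund_edgem_det[of bmax 0] by (simp add: disc_def)
qed

text \<open>On the segment from \<open>cellc\<close> to \<open>edgem\<close> the coefficients are
  bounded and Lipschitz in \<open>(b, t)\<close>, uniformly on a compact parameter set. The
  perturbation lemma transfers this to the four edge values, and \<open>disc\<close> is a polynomial
  in them. Continuity in \<open>b\<close> serves the intermediate value theorem, that in
  \<open>t\<close> the comparison with \<open>t = 0\<close>.\<close>

lemma disc_lipschitz:
  obtains C where "C > 0" "\<And>b b' t t'. b \<in> {0..bmax} \<Longrightarrow> b' \<in> {0..bmax} \<Longrightarrow> \<bar>t\<bar> \<le> 1 \<Longrightarrow> \<bar>t'\<bar> \<le> 1 \<Longrightarrow>
    \<bar>disc b t - disc b' t'\<bar> \<le> C * (\<bar>b - b'\<bar> + \<bar>t - t'\<bar>)"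
proof -
  let ?S = "closed_segment cellc edgem"
  have segS: "?S \<subseteq> cross" using cross(3) edgem(4) by blast
  have segL: "w \<notin> gaussL" if "w \<in> ?S" for w using that segS cross_notin by blast
  have "bounded (wp ` ?S)" "bounded (wp' ` ?S)"
    using segL by (auto intro!: compact_imp_bounded compact_continuous_image
       continuous_on_subset[OF holomorphic_on_imp_continuous_on[OF wp_holomorphic]]
       continuous_on_subset[OF holomorphic_on_imp_continuous_on[OF wp'_holomorphic]])
  then obtain K1 K2 where "\<forall>w\<in>?S. norm (wp w) \<le> K1" "\<forall>w\<in>?S. norm (wp' w) \<le> K2"
    by (auto simp: bounded_iff)
  then obtain K where K: "\<And>w. w \<in> ?S \<Longrightarrow> norm (wp w) \<le> K" "\<And>w. w \<in> ?S \<Longrightarrow> norm (wp' w) \<le> K" "K > 0"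
    using that[of "max 1 (max K1 K2)"] by (metis le_max_iff_disj less_max_iff_disj zero_less_one)
  define M where "M = 1 + bmax + (1 + bmax + bmax ^ 2) * K ^ 2"
  have bp: "0 < bmax" by (rule bmax_pos)
  have M0: "M > 0" using bp by (auto simp: M_def intro!: add_pos_nonneg)
  have prod: "norm (wp w * wp' w) \<le> K ^ 2" "norm (wp w ^ 2) \<le> K ^ 2" "norm (wp' w ^ 2) \<le> K ^ 2" if "w \<in> ?S" for w
    using K(1,2)[OF that] K(3) by (auto simp: norm_mult norm_power power2_eq_square intro!: mult_mono)
  have coef: "norm (sysA b w) \<le> M \<and> norm (sysB b t w) \<le> M \<and> norm (sysC w) \<le> M"
    if b: "b \<in> {0..bmax}" "\<bar>t\<bar> \<le> 1" and w: "w \<in> ?S" for b t w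
  proof (intro conjI)
    have K2: "0 \<le> K ^ 2" by simp
    have "norm (sysA b w) = \<bar>b\<bar> * norm (wp w * wp' w)" by (simp add: sysA_def norm_mult)
    also have "\<dots> \<le> bmax * K ^ 2" using b prod(1)[OF w] bp by (intro mult_mono) auto
    also have "\<dots> \<le> M" using bp by (simp add: M_def algebra_simps)
    finally show "norm (sysA b w) \<le> M" .
    have "norm (sysB b t w) \<le> \<bar>t\<bar> + \<bar>b\<bar> / 2 + \<bar>b\<bar> ^ 2 * norm (wp w ^ 2)"
      unfolding sysB_def
      by (intro norm_triangle_le_diff add_mono) (auto simp: norm_mult norm_power norm_divide)
    also have "\<dots> \<le> 1 + bmax + bmax ^ 2 * K ^ 2"
      using b prod(2)[OF w] bp by (intro add_mono mult_mono power_mono) auto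
    also have "\<dots> \<le> M" using bp by (simp add: M_def algebra_simps)
    finally show "norm (sysB b t w) \<le> M" .
    have "norm (sysC w) \<le> K ^ 2" using prod(3)[OF w] by (simp add: sysC_def)
    also have "\<dots> \<le> M" using bp by (simp add: M_def algebra_simps)
    finally show "norm (sysC w) \<le> M" .
  qed
  define B where "B = exp (2 * M)"
  have B1: "1 \<le> B" using M0 by (simp add: B_def)
  have bnd: "norm (psi1 b t w) + norm (eta1 b t w) \<le> B \<and> norm (psi2 b t w) + norm (eta2 b t w) \<le> B"
    if b: "b \<in> {0..bmax}" "\<bar>t\<bar> \<le> 1" and w: "w \<in> ?S" for b t w
  proof -
    have sub: "closed_segment cellc w \<subseteq> ?S" using w by (simp add: subset_closed_segment)
    have "norm (w - cellc) \<le> norm (edgem - cellc)"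
      using segment_bound(1)[OF w] by (simp add: norm_minus_commute)
    also have "edgem - cellc = 1/2" by (simp add: complex_eq_iff edgem)
    finally have le: "2 * M * norm (w - cellc) \<le> 2 * M" using M0 by simp
    have "norm (psi1 b t w) + norm (eta1 b t w) \<le> (norm (1::complex) + norm (0::complex)) * exp (2 * M * norm (w - cellc))"
      unfolding psi1_def eta1_def using coef[OF b] sub w segS by (intro wfund(4)) blast+
    moreover have "norm (psi2 b t w) + norm (eta2 b t w) \<le> (norm (0::complex) + norm (1::complex)) * exp (2 * M * norm (w - cellc))"
      unfolding psi2_def eta2_def using coef[OF b] sub w segS by (intro wfund(4)) blast+
    ultimately show ?thesis using le unfolding B_def by (auto intro: order_trans)
  qed
  define L where "L = 1 + K ^ 2 + 2 * bmax * K ^ 2"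
  have L0: "L > 0" using bp by (auto simp: L_def intro!: add_pos_nonneg)
  have diff: "norm (sysA b' w - sysA b w) \<le> L * (\<bar>b - b'\<bar> + \<bar>t - t'\<bar>) \<and>
      norm (sysB b' t' w - sysB b t w) \<le> L * (\<bar>b - b'\<bar> + \<bar>t - t'\<bar>) \<and>
      norm (sysC w - sysC w) \<le> L * (\<bar>b - b'\<bar> + \<bar>t - t'\<bar>)"
    if b: "b \<in> {0..bmax}" "b' \<in> {0..bmax}" and w: "w \<in> ?S" for b b' t t' w
  proof (intro conjI)
    define x y where "x = \<bar>b - b'\<bar>" and "y = \<bar>t - t'\<bar>"
    have xy: "0 \<le> x" "0 \<le> y" by (auto simp: x_def y_def)
    have "sysA b' w - sysA b w = of_real (b - b') * (wp w * wp' w)" by (simp add: sysA_def algebra_simps)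
    then have "norm (sysA b' w - sysA b w) = x * norm (wp w * wp' w)"
      by (simp only: norm_mult norm_of_real x_def)
    also have "\<dots> \<le> x * K ^ 2" using prod(1)[OF w] xy by (intro mult_left_mono)
    also have "\<dots> \<le> L * (x + y)" using bp xy by (simp add: L_def algebra_simps)
    finally show "norm (sysA b' w - sysA b w) \<le> L * (\<bar>b - b'\<bar> + \<bar>t - t'\<bar>)" by (simp add: x_def y_def)
    have eqB: "sysB b' t' w - sysB b t w = of_real (t' - t) + of_real ((b - b') / 2) + of_real ((b - b') * (b + b')) * wp w ^ 2"
      by (simp add: sysB_def field_simps power2_eq_square)
    have "norm (sysB b' t' w - sysB b t w) \<le> y + x / 2 + (x * \<bar>b + b'\<bar>) * norm (wp w ^ 2)"
      unfolding eqB
    proof (intro norm_triangle_le add_mono)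
      show "norm (complex_of_real (t' - t)) \<le> y" unfolding norm_of_real by (simp add: y_def)
      show "norm (complex_of_real ((b - b') / 2)) \<le> x / 2" unfolding norm_of_real by (simp add: x_def)
      show "norm (complex_of_real ((b - b') * (b + b')) * wp w ^ 2) \<le> x * \<bar>b + b'\<bar> * norm (wp w ^ 2)"
        unfolding norm_mult norm_of_real by (simp add: x_def abs_mult)
    qed
    also have "\<dots> \<le> y + x / 2 + (x * (2 * bmax)) * K ^ 2"
      using b prod(2)[OF w] xy bp by (intro add_mono mult_mono order_refl) auto
    also have "\<dots> \<le> L * (x + y)" using bp xy by (simp add: L_def algebra_simps)
    finally show "norm (sysB b' t' w - sysB b t w) \<le> L * (\<bar>b - b'\<bar> + \<bar>t - t'\<bar>)" by (simp add: x_def y_def)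
    show "norm (sysC w - sysC w) \<le> L * (\<bar>b - b'\<bar> + \<bar>t - t'\<bar>)" using L0 by simp
  qed
  \<comment> \<open>Four products occur in a difference of values of \<open>disc\<close>; in each,
    one factor is at most \<open>B\<close> and the other changes by at most
    \<open>2 * L * B ^ 3\<close> times the parameter distance.\<close>
  define C where "C = 4 * (2 * L * B ^ 3) * B"
  have C0: "C > 0" using L0 B1 by (auto simp: C_def)
  have "\<bar>disc b t - disc b' t'\<bar> \<le> C * (\<bar>b - b'\<bar> + \<bar>t - t'\<bar>)"
    if b: "b \<in> {0..bmax}" "b' \<in> {0..bmax}" and t: "\<bar>t\<bar> \<le> 1" "\<bar>t'\<bar> \<le> 1" for b b' t t'
  proof -
    define e where "e = \<bar>b - b'\<bar> + \<bar>t - t'\<bar>"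
    have e0: "0 \<le> e" by (simp add: e_def)
    have half: "norm (edgem - cellc) \<le> 1"
    proof -
      have "edgem - cellc = 1/2" by (simp add: complex_eq_iff edgem)
      then show ?thesis by (simp only:) simp
    qed
    have bd: "\<And>w. w \<in> ?S \<Longrightarrow> norm (psi1 b' t' w) + norm (eta1 b' t' w) \<le> B \<and>
       norm (psi1 b t w) + norm (eta1 b t w) \<le> B \<and> norm (psi2 b t w) + norm (eta2 b t w) \<le> B"
      "\<And>w. w \<in> ?S \<Longrightarrow> norm (psi2 b' t' w) + norm (eta2 b' t' w) \<le> B \<and>
       norm (psi1 b t w) + norm (eta1 b t w) \<le> B \<and> norm (psi2 b t w) + norm (eta2 b t w) \<le> B"
      using bnd[OF b(1) t(1)] bnd[OF b(2) t(2)] by blast+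
    have p1: "norm (psi1 b' t' edgem - psi1 b t edgem) \<le> 2 * (L * e) * B ^ 3 * norm (edgem - cellc)"
      "norm (eta1 b' t' edgem - eta1 b t edgem) \<le> 2 * (L * e) * B ^ 3 * norm (edgem - cellc)"
      using lin_sol_perturb[OF fund_sol(1)[of b t] fund_sol(2)[of b t] fund_sol(1)[of b' t'] segS cross(1) connected_cross
        fund_init diff[OF b] bd(1)] by (simp_all add: e_def)
    have p2: "norm (psi2 b' t' edgem - psi2 b t edgem) \<le> 2 * (L * e) * B ^ 3 * norm (edgem - cellc)"
      "norm (eta2 b' t' edgem - eta2 b t edgem) \<le> 2 * (L * e) * B ^ 3 * norm (edgem - cellc)"
      using lin_sol_perturb[OF fund_sol(1)[of b t] fund_sol(2)[of b t] fund_sol(2)[of b' t'] segS cross(1) connected_cross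
        fund_init diff[OF b] bd(2)] by (simp_all add: e_def)
    define R where "R = 2 * L * B ^ 3 * e"
    have R: "2 * (L * e) * B ^ 3 * norm (edgem - cellc) \<le> R"
    proof -
      have "2 * (L * e) * B ^ 3 * norm (edgem - cellc) \<le> 2 * (L * e) * B ^ 3 * 1"
        using half L0 e0 B1 by (intro mult_left_mono) auto
      then show ?thesis by (simp add: R_def mult_ac)
    qed
    have r: "\<bar>Re x - Re y\<bar> \<le> R" if "norm (x - y) \<le> R" for x y
      using abs_Re_le_cmod[of "x - y"] that by simp
    have d: "\<bar>edge_p b' t' - edge_p b t\<bar> \<le> R" "\<bar>edge_q b' t' - edge_q b t\<bar> \<le> R" "\<bar>edge_r b' t' - edge_r b t\<bar> \<le> R" "\<bar>edge_s b' t' - edge_s b t\<bar> \<le> R"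
      unfolding edge_p_def edge_q_def edge_r_def edge_s_def
      by (rule r[OF order_trans[OF _ R]], rule p1 p2)+
    have eS: "edgem \<in> ?S" by simp
    have ab: "\<bar>Re x\<bar> \<le> B" "\<bar>Re y\<bar> \<le> B" if "norm x + norm y \<le> B" for x y :: complex
      using abs_Re_le_cmod[of x] abs_Re_le_cmod[of y] norm_ge_zero[of x] norm_ge_zero[of y] that by linarith+
    have n: "\<bar>edge_p b t\<bar> \<le> B" "\<bar>edge_q b' t'\<bar> \<le> B" "\<bar>edge_r b t\<bar> \<le> B" "\<bar>edge_s b' t'\<bar> \<le> B"
      using ab(1)[of "psi1 b t edgem" "eta1 b t edgem"] ab(2)[of "psi1 b' t' edgem" "eta1 b' t' edgem"]
        ab(1)[of "psi2 b t edgem" "eta2 b t edgem"] ab(2)[of "psi2 b' t' edgem" "eta2 b' t' edgem"]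
        bd(1)[OF eS] bd(2)[OF eS] by (simp_all add: edge_p_def edge_q_def edge_r_def edge_s_def)
    have "disc b t - disc b' t' = edge_p b t * (edge_s b t - edge_s b' t') + (edge_p b t - edge_p b' t') * edge_s b' t'
       + edge_q b' t' * (edge_r b t - edge_r b' t') + (edge_q b t - edge_q b' t') * edge_r b t"
      by (simp add: disc_def algebra_simps)
    also have "\<bar>\<dots>\<bar> \<le> \<bar>edge_p b t\<bar> * \<bar>edge_s b' t' - edge_s b t\<bar> + \<bar>edge_p b' t' - edge_p b t\<bar> * \<bar>edge_s b' t'\<bar>
       + \<bar>edge_q b' t'\<bar> * \<bar>edge_r b' t' - edge_r b t\<bar> + \<bar>edge_q b' t' - edge_q b t\<bar> * \<bar>edge_r b t\<bar>"
      by (intro order_trans[OF abs_triangle_ineq] add_mono) (simp_all add: abs_mult abs_minus_commute)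
    also have "\<dots> \<le> B * R + R * B + B * R + R * B"
      using d n B1 by (intro add_mono mult_mono) auto
    also have "\<dots> = C * e" by (simp add: C_def R_def)
    finally show ?thesis by (simp add: e_def)
  qed
  then show ?thesis using that C0 by blast
qed

text \<open>Here \<open>b2\<close> is the first parameter with \<open>disc b 0 = -1/2\<close> and
  \<open>b1\<close> the last one before it with value \<open>1/2\<close>, so that
  \<open>\<bar>disc b 0\<bar> \<le> 1/2\<close> in between. The levels leave room on both sides: a
  change by less than \<open>1/2\<close> keeps opposite signs at \<open>b1\<close> and
  \<open>b2\<close>, and the bound stays below 1.\<close>

theorem parameter_exists:
  obtains \<epsilon> where "\<epsilon> > 0" "\<And>t. \<bar>t\<bar> < \<epsilon> \<Longrightarrow> \<exists>b. b \<in> {0..bmax} \<and> disc b t = 0 \<and> \<bar>disc b 0\<bar> \<le> 1/2"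
proof -
  obtain C where C: "C > 0" "\<And>b b' t t'. b \<in> {0..bmax} \<Longrightarrow> b' \<in> {0..bmax} \<Longrightarrow> \<bar>t\<bar> \<le> 1 \<Longrightarrow> \<bar>t'\<bar> \<le> 1 \<Longrightarrow>
    \<bar>disc b t - disc b' t'\<bar> \<le> C * (\<bar>b - b'\<bar> + \<bar>t - t'\<bar>)"
    using disc_lipschitz by blast
  have cont: "continuous_on {0..bmax} (\<lambda>b. disc b t)" if "\<bar>t\<bar> \<le> 1" for t
    by (rule lipschitz_on_continuous_on[of C], rule lipschitz_onI)
       (use C(1) C(2)[OF _ _ that that] in \<open>auto simp: dist_real_def\<close>)
  note c0 = cont[of 0, simplified]
  have bp: "0 < bmax" by (rule bmax_pos)
  define Z2 where "Z2 = {b \<in> {0..bmax}. disc b 0 = -1/2}"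
  have "\<exists>b\<ge>0. b \<le> bmax \<and> disc b 0 = -1/2"
    by (rule IVT2') (use disc_0 disc_bmax bp c0 in auto)
  then have Z2: "Z2 \<noteq> {}" by (auto simp: Z2_def)
  have "compact Z2"
    unfolding Z2_def using continuous_closed_preimage_constant[OF c0, of "-1/2"]
    by (auto simp: compact_eq_bounded_closed intro: bounded_subset[of "{0..bmax}"])
  then obtain b2 where b2: "b2 \<in> Z2" "\<And>b. b \<in> Z2 \<Longrightarrow> b2 \<le> b"
    using compact_attains_inf[OF _ Z2] by blast
  have b2': "b2 \<in> {0..bmax}" "disc b2 0 = -1/2" using b2 by (auto simp: Z2_def)
  have c02: "continuous_on {0..b2} (\<lambda>b. disc b 0)"
    by (rule continuous_on_subset[OF c0]) (use b2' in auto)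
  define Z1 where "Z1 = {b \<in> {0..b2}. disc b 0 = 1/2}"
  have "\<exists>b\<ge>0. b \<le> b2 \<and> disc b 0 = 1/2"
    by (rule IVT2') (use disc_0 b2' c02 in auto)
  then have Z1: "Z1 \<noteq> {}" by (auto simp: Z1_def)
  have "compact Z1"
    unfolding Z1_def using continuous_closed_preimage_constant[OF c02, of "1/2"]
    by (auto simp: compact_eq_bounded_closed intro: bounded_subset[of "{0..b2}"])
  then obtain b1 where b1: "b1 \<in> Z1" "\<And>b. b \<in> Z1 \<Longrightarrow> b \<le> b1"
    using compact_attains_sup[OF _ Z1] by blast
  have b1': "0 \<le> b1" "b1 \<le> b2" "disc b1 0 = 1/2" using b1 by (auto simp: Z1_def)
  have upper: "disc b 0 \<le> 1/2" if "b1 \<le> b" "b \<le> b2" for b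
  proof (rule ccontr)
    assume n: "\<not> ?thesis"
    then have "\<exists>x\<ge>b. x \<le> b2 \<and> disc x 0 = 1/2"
      using that b1' b2' by (intro IVT2' continuous_on_subset[OF c02]) auto
    then obtain x where "b \<le> x" "x \<le> b2" "disc x 0 = 1/2" by blast
    then have "x \<in> Z1" using that b1' by (auto simp: Z1_def)
    then have "x = b" using b1(2)[of x] that \<open>b \<le> x\<close> by auto
    then show False using n \<open>disc x 0 = 1/2\<close> by simp
  qed
  have lower: "- 1/2 \<le> disc b 0" if "0 \<le> b" "b \<le> b2" for b
  proof (rule ccontr)
    assume n: "\<not> ?thesis"
    then have "\<exists>x\<ge>0. x \<le> b \<and> disc x 0 = - 1/2"
      using that disc_0 by (intro IVT2' continuous_on_subset[OF c02]) auto
    then obtain x where "0 \<le> x" "x \<le> b" "disc x 0 = - 1/2" by blast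
    then have "x \<in> Z2" using that b2' by (auto simp: Z2_def)
    then have "x = b" using b2(2)[of x] that \<open>x \<le> b\<close> by auto
    then show False using n \<open>disc x 0 = - 1/2\<close> by simp
  qed
  define \<epsilon> where "\<epsilon> = min 1 (1 / (2 * C))"
  have "\<exists>b. b \<in> {0..bmax} \<and> disc b t = 0 \<and> \<bar>disc b 0\<bar> \<le> 1/2" if t: "\<bar>t\<bar> < \<epsilon>" for t
  proof -
    have t1: "\<bar>t\<bar> \<le> 1" using t by (simp add: \<epsilon>_def)
    have "C * \<bar>t\<bar> < 1/2" using t C(1) by (simp add: \<epsilon>_def field_simps)
    then have near: "\<bar>disc b t - disc b 0\<bar> < 1/2" if "b \<in> {0..bmax}" for b
      using C(2)[OF that that t1, of 0] by simp
    have "b1 \<in> {0..bmax}" using b1' b2' by simp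
    then have "0 \<le> disc b1 t" "disc b2 t \<le> 0"
      using near[of b1] near[of b2] b1' b2' by linarith+
    then have "\<exists>b\<ge>b1. b \<le> b2 \<and> disc b t = 0"
      using b1' b2'
      by (intro IVT2' continuous_on_subset[OF cont[OF t1]]) auto
    then obtain b where b: "b1 \<le> b" "b \<le> b2" "disc b t = 0" by blast
    then show ?thesis using upper[of b] lower[of b] b1' b2' by (intro exI[of _ b]) auto
  qed
  moreover have "\<epsilon> > 0" using C(1) by (simp add: \<epsilon>_def)
  ultimately show ?thesis using that by blast
qed

section \<open>Surfaces given by null lifts\<close>

definition hol_mat :: "complex set \<Rightarrow> (complex \<Rightarrow> cmat2) \<Rightarrow> bool" where
  "hol_mat U A \<longleftrightarrow> (\<forall>i j. (\<lambda>z. A z $ i $ j) holomorphic_on U)"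

definition cscale :: "complex \<Rightarrow> cmat2 \<Rightarrow> cmat2" where
  "cscale c A = (\<chi> i j. c * A $ i $ j)"

lemma cscale_nth [simp]: "cscale c A $ i $ j = c * A $ i $ j"
  by (simp add: cscale_def)

lemma conj_transpose_nth [simp]: "conj_transpose A $ i $ j = cnj (A $ j $ i)"
  by (simp add: conj_transpose_def)

lemma mat_deriv_nth [simp]: "mat_deriv A z $ i $ j = deriv (\<lambda>w. A w $ i $ j) z"
  by (simp add: mat_deriv_def)

lemma mat2_nth [simp]: "mat2 a b c d $ 1 $ 1 = a" "mat2 a b c d $ 1 $ 2 = b"
  "mat2 a b c d $ 2 $ 1 = c" "mat2 a b c d $ 2 $ 2 = d"
  by (simp_all add: mat2_def)

lemma cmat2_eq_iff: "(A :: cmat2) = B \<longleftrightarrow> A$1$1 = B$1$1 \<and> A$1$2 = B$1$2 \<and> A$2$1 = B$2$1 \<and> A$2$2 = B$2$2"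
  by (auto simp: vec_eq_iff forall_2)

lemma matmul_nth: "((A :: cmat2) ** B) $ i $ j = A$i$1 * B$1$j + A$i$2 * B$2$j"
  by (simp add: matrix_matrix_mult_def sum_2)

lemma hol_mat_deriv: "hol_mat U A \<Longrightarrow> open U \<Longrightarrow> hol_mat U (mat_deriv A)"
  by (simp add: hol_mat_def holomorphic_deriv)

lemma hol_mat_cscale: "hol_mat U A \<Longrightarrow> hol_mat U (\<lambda>z. cscale c (A z))"
  by (auto simp: hol_mat_def intro!: holomorphic_intros)

text \<open>Derivatives and continuity of matrix functions are reduced to their entries through
  these bounded linear embeddings.\<close>

definition entry_mat :: "2 \<Rightarrow> 2 \<Rightarrow> complex \<Rightarrow> cmat2" where
  "entry_mat i j w = (\<chi> k l. if k = i \<and> l = j then w else 0)"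

lemma bounded_linear_entry_mat: "bounded_linear (entry_mat i j)"
  unfolding linear_conv_bounded_linear[symmetric]
  by (rule linearI) (auto simp: entry_mat_def vec_eq_iff)

lemma cmat2_decomp: "A = (\<Sum>i\<in>UNIV. \<Sum>j\<in>UNIV. entry_mat i j (A $ i $ j))"
  by (auto simp: sum_2 vec_eq_iff forall_2 entry_mat_def)

lemma has_derivative_cmat2:
  fixes f :: "complex \<Rightarrow> cmat2"
  assumes "\<And>i j. ((\<lambda>z. f z $ i $ j) has_derivative (\<lambda>v. f' v $ i $ j)) (at z)"
  shows "(f has_derivative f') (at z)"
proof -
  have "((\<lambda>z. \<Sum>i\<in>UNIV. \<Sum>j\<in>UNIV. entry_mat i j (f z $ i $ j)) has_derivative
      (\<lambda>v. \<Sum>i\<in>UNIV. \<Sum>j\<in>UNIV. entry_mat i j (f' v $ i $ j))) (at z)"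
    by (intro has_derivative_sum bounded_linear.has_derivative[OF bounded_linear_entry_mat] assms)
  then show ?thesis by (simp flip: cmat2_decomp)
qed

lemma pd_eqI: "(X has_derivative D) (at z) \<Longrightarrow> pd v X z = D v"
  by (simp add: pd_def frechet_derivative_at[symmetric])

lemma hol_has_derivative:
  assumes "f holomorphic_on U" "open U" "z \<in> U"
  shows "(f has_derivative (\<lambda>v. v * deriv f z)) (at z)"
  using holomorphic_derivI[OF assms] by (simp add: has_field_derivative_def mult.commute[of _ "deriv f z"])

lemma sesq_has_derivative:
  assumes "hol_mat U A" "hol_mat U B" "open U" "z \<in> U"
  shows "((\<lambda>z. A z ** conj_transpose (B z)) has_derivative
     (\<lambda>v. cscale v (mat_deriv A z) ** conj_transpose (B z) + A z ** conj_transpose (cscale v (mat_deriv B z)))) (at z)"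
proof (rule has_derivative_cmat2)
  fix i j :: 2
  have d: "((\<lambda>z. A z $ i $ k) has_derivative (\<lambda>v. v * deriv (\<lambda>w. A w $ i $ k) z)) (at z)"
    "((\<lambda>z. cnj (B z $ j $ k)) has_derivative (\<lambda>v. cnj (v * deriv (\<lambda>w. B w $ j $ k) z))) (at z)" for k
    by (intro bounded_linear.has_derivative[OF bounded_linear_cnj] hol_has_derivative[OF _ assms(3,4)];
        use assms(1,2) in \<open>simp add: hol_mat_def\<close>)+
  show "((\<lambda>z. (A z ** conj_transpose (B z)) $ i $ j) has_derivative
     (\<lambda>v. (cscale v (mat_deriv A z) ** conj_transpose (B z) + A z ** conj_transpose (cscale v (mat_deriv B z))) $ i $ j)) (at z)"
    unfolding matmul_nth vector_add_component conj_transpose_nth cscale_nth mat_deriv_nth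
    by (rule has_derivative_eq_rhs[OF has_derivative_add[OF has_derivative_mult[OF d(1)[of 1] d(2)[of 1]]
          has_derivative_mult[OF d(1)[of 2] d(2)[of 2]]]]) (auto simp: fun_eq_iff algebra_simps)
qed

text \<open>Sums of products of a holomorphic matrix with an adjoint one are closed under
  directional derivatives; smoothness then follows by induction on the order, without explicit
  higher derivatives.\<close>

definition sesq_sum :: "((complex \<Rightarrow> cmat2) \<times> (complex \<Rightarrow> cmat2)) list \<Rightarrow> complex \<Rightarrow> cmat2" where
  "sesq_sum xs z = (\<Sum>(A, B)\<leftarrow>xs. A z ** conj_transpose (B z))"

definition sesq_pd :: "complex \<Rightarrow> ((complex \<Rightarrow> cmat2) \<times> (complex \<Rightarrow> cmat2)) list \<Rightarrow> ((complex \<Rightarrow> cmat2) \<times> (complex \<Rightarrow> cmat2)) list" where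
  "sesq_pd v xs = concat (map (\<lambda>(A, B). [(\<lambda>z. cscale v (mat_deriv A z), B), (A, \<lambda>z. cscale v (mat_deriv B z))]) xs)"

lemma sesq_sum_has_derivative:
  assumes "\<forall>(A, B)\<in>set xs. hol_mat U A \<and> hol_mat U B" "open U" "z \<in> U"
  shows "(sesq_sum xs has_derivative (\<lambda>v. sesq_sum (sesq_pd v xs) z)) (at z)"
  using assms
proof (induction xs)
  case Nil
  then show ?case by (simp add: sesq_sum_def[abs_def] sesq_pd_def)
next
  case (Cons p xs)
  obtain A B where p: "p = (A, B)" by fastforce
  have "((\<lambda>z. A z ** conj_transpose (B z) + sesq_sum xs z) has_derivative
     (\<lambda>v. (cscale v (mat_deriv A z) ** conj_transpose (B z) + A z ** conj_transpose (cscale v (mat_deriv B z)))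
        + sesq_sum (sesq_pd v xs) z)) (at z)"
    by (intro has_derivative_add sesq_has_derivative[of U]) (use Cons p in auto)
  then show ?case by (simp add: sesq_sum_def[abs_def] sesq_pd_def p add.assoc)
qed

lemma sesq_pd_hol:
  assumes "\<forall>(A, B)\<in>set xs. hol_mat U A \<and> hol_mat U B" "open U"
  shows "\<forall>(A, B)\<in>set (sesq_pd v xs). hol_mat U A \<and> hol_mat U B"
  using assms by (fastforce simp: sesq_pd_def intro: hol_mat_deriv hol_mat_cscale)

lemma Ck_sesq_sum:
  assumes "\<forall>(A, B)\<in>set xs. hol_mat U A \<and> hol_mat U B" "open U" "\<And>z. z \<in> U \<Longrightarrow> X z = sesq_sum xs z"
  shows "Ck_on k X U"
  using assms
proof (induction k arbitrary: X xs)
  case 0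
  have "continuous_on U (sesq_sum xs)"
    by (intro continuous_at_imp_continuous_on ballI has_derivative_continuous[OF sesq_sum_has_derivative[OF 0(1,2)]])
  then show ?case using 0(3) by (simp cong: continuous_on_cong)
next
  case (Suc k)
  have d: "(X has_derivative (\<lambda>v. sesq_sum (sesq_pd v xs) z)) (at z)" if "z \<in> U" for z
    by (rule has_derivative_transform_within_open[OF sesq_sum_has_derivative[OF Suc.prems(1,2) that] Suc.prems(2) that])
       (simp add: Suc.prems(3))
  have "Ck_on k (pd v X) U" for v
    using sesq_pd_hol[OF Suc.prems(1,2)] Suc.prems(2) pd_eqI[OF d] by (rule Suc.IH)
  moreover have "\<forall>z\<in>U. X differentiable (at z)" using d by (auto simp: differentiable_def)
  ultimately show ?case by simp
qed

lemma Ck_on_local: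
  assumes "\<And>z. z \<in> S \<Longrightarrow> \<exists>V. open V \<and> z \<in> V \<and> Ck_on k X V"
  shows "Ck_on k X S"
  using assms
proof (induction k arbitrary: X)
  case 0
  then have "isCont X z" if "z \<in> S" for z
    using that by (metis Ck_on.simps(1) continuous_on_eq_continuous_at)
  then show ?case by (simp add: continuous_at_imp_continuous_on)
next
  case (Suc k)
  have "Ck_on k (pd v X) S" for v
  proof (rule Suc.IH)
    fix z assume "z \<in> S"
    then show "\<exists>V. open V \<and> z \<in> V \<and> Ck_on k (pd v X) V"
      using Suc.prems by fastforce
  qed
  then show ?case using Suc.prems by fastforce
qed

text \<open>The local data of a surface: a null lift \<open>F\<close>, homogeneous coordinates \<open>(a1, a2)\<close> and
  \<open>(Y1, Y2)\<close> of the secondary and of the hyperbolic Gauss map, and the Hopf differential \<open>t q\<close>.\<close>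

definition bryant :: "real \<Rightarrow> (complex \<Rightarrow> complex) \<Rightarrow> complex set \<Rightarrow> (complex \<Rightarrow> cmat2) \<Rightarrow> (complex \<Rightarrow> complex) \<Rightarrow>
    (complex \<Rightarrow> complex) \<Rightarrow> (complex \<Rightarrow> complex) \<Rightarrow> (complex \<Rightarrow> complex) \<Rightarrow> bool" where
  "bryant t q U F a1 a2 Y1 Y2 \<longleftrightarrow> open U \<and> hol_mat U F \<and>
     a1 holomorphic_on U \<and> a2 holomorphic_on U \<and> Y1 holomorphic_on U \<and> Y2 holomorphic_on U \<and>
     (\<forall>z\<in>U. det (F z) = 1 \<and>
        mat_deriv F z = mat2 (- of_real t * Y1 z * a2 z) (of_real t * Y1 z * a1 z)
                             (- of_real t * Y2 z * a2 z) (of_real t * Y2 z * a1 z) \<and>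
        Y1 z = F z $ 1 $ 1 * a1 z + F z $ 1 $ 2 * a2 z \<and>
        Y2 z = F z $ 2 $ 1 * a1 z + F z $ 2 $ 2 * a2 z \<and>
        a1 z * deriv a2 z - deriv a1 z * a2 z = q z \<and> (a1 z \<noteq> 0 \<or> a2 z \<noteq> 0))"

definition norm2 :: "complex \<Rightarrow> complex \<Rightarrow> real" where
  "norm2 x y = (norm x)\<^sup>2 + (norm y)\<^sup>2"

lemma norm2_pos: "x \<noteq> 0 \<or> y \<noteq> 0 \<Longrightarrow> norm2 x y > 0"
  by (auto simp: norm2_def add_pos_nonneg add_nonneg_pos)

lemma of_real_norm2: "complex_of_real (norm2 x y) = x * cnj x + y * cnj y"
  unfolding norm2_def of_real_add complex_norm_square ..

context
  fixes t :: real and q U F a1 a2 Y1 Y2 X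
  assumes br: "bryant t q U F a1 a2 Y1 Y2"
    and X: "\<And>z. z \<in> U \<Longrightarrow> X z = F z ** conj_transpose (F z)"
begin

lemma br_open: "open U" and br_hol: "hol_mat U F"
  using br by (auto simp: bryant_def)

lemma br_pd:
  assumes "z \<in> U"
  shows "pd v X z = cscale v (mat_deriv F z) ** conj_transpose (F z) + F z ** conj_transpose (cscale v (mat_deriv F z))"
  by (rule pd_eqI, rule has_derivative_transform_within_open[OF sesq_has_derivative[OF br_hol br_hol br_open assms] br_open assms])
     (simp add: X)

lemma br_Ck: "Ck_on k X U"
  by (rule Ck_sesq_sum[where xs = "[(F, F)]"]) (auto simp: br_open br_hol X sesq_sum_def)

text \<open>The second column of \<open>F\<close> times the matrix with columns \<open>a\<close> and \<open>(- cnj a2, cnj a1)\<close>,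
  which is unitary up to the factor \<open>sqrt (norm2 a1 a2)\<close>.\<close>

definition Z1 :: "complex \<Rightarrow> complex" where "Z1 z = - F z $ 1 $ 1 * cnj (a2 z) + F z $ 1 $ 2 * cnj (a1 z)"
definition Z2 :: "complex \<Rightarrow> complex" where "Z2 z = - F z $ 2 $ 1 * cnj (a2 z) + F z $ 2 $ 2 * cnj (a1 z)"

text \<open>\<open>F\<close> has determinant 1, and the matrix with columns \<open>(a1, a2)\<close>
  and \<open>(- cnj a2, cnj a1)\<close> has determinant \<open>norm2\<close>.\<close>

lemma br_YZ:
  assumes "z \<in> U"
  shows "Y1 z * Z2 z - Y2 z * Z1 z = of_real (norm2 (a1 z) (a2 z))"
proof -
  have "Y1 z * Z2 z - Y2 z * Z1 z = det (F z) * (a1 z * cnj (a1 z) + a2 z * cnj (a2 z))"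
    using br assms by (simp add: bryant_def Z1_def Z2_def det_2 algebra_simps)
  then show ?thesis using br assms by (simp add: bryant_def of_real_norm2)
qed

text \<open>The derivative of \<open>F\<close> is \<open>t\<close> times the column \<open>Y\<close>
  times the row \<open>(- a2, a1)\<close>, and that row times the adjoint of \<open>F\<close> is the
  adjoint of the column \<open>Z\<close>.\<close>

lemma br_pd_YZ:
  assumes "z \<in> U"
  shows "pd v X z = cscale (of_real t) (mat2
     (v * Y1 z * cnj (Z1 z) + cnj v * Z1 z * cnj (Y1 z)) (v * Y1 z * cnj (Z2 z) + cnj v * Z1 z * cnj (Y2 z))
     (v * Y2 z * cnj (Z1 z) + cnj v * Z2 z * cnj (Y1 z)) (v * Y2 z * cnj (Z2 z) + cnj v * Z2 z * cnj (Y2 z)))"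
proof -
  have m: "mat_deriv F z = mat2 (- of_real t * Y1 z * a2 z) (of_real t * Y1 z * a1 z)
                             (- of_real t * Y2 z * a2 z) (of_real t * Y2 z * a1 z)"
    using br assms by (auto simp: bryant_def)
  show ?thesis
    unfolding br_pd[OF assms] m
    by (simp add: cmat2_eq_iff matmul_nth Z1_def Z2_def algebra_simps)
qed

lemma br_norm2_pos: "z \<in> U \<Longrightarrow> norm2 (a1 z) (a2 z) > 0"
  using br by (auto simp: bryant_def intro!: norm2_pos)

text \<open>In the frame \<open>Y\<close>, \<open>Z\<close> the tangent vectors are off-diagonal, so
  the quadratic form \<open>- det\<close> sees only the product of their entries and the determinant
  of the frame, which is \<open>norm2\<close> by \<open>br_YZ\<close>. The metric is
  \<open>t^2 norm2^2 |dz|^2\<close>.\<close>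

lemma br_first_form:
  assumes "z \<in> U"
  shows "first_form X z u v = t ^ 2 * norm2 (a1 z) (a2 z) ^ 2 * Re (u * cnj v)"
proof -
  define D where "D = Y1 z * Z2 z - Y2 z * Z1 z"
  have D: "D * cnj D = of_real (norm2 (a1 z) (a2 z) ^ 2)"
    unfolding D_def br_YZ[OF assms] by (simp add: power2_eq_square)
  let ?P = "\<lambda>A B. A $ 1 $ 1 * B $ 2 $ 2 + A $ 2 $ 2 * B $ 1 $ 1 - A $ 1 $ 2 * B $ 2 $ 1 - A $ 2 $ 1 * B $ 1 $ 2"
  have "?P (pd u X z) (pd v X z) = - (of_real t ^ 2 * (D * cnj D) * (u * cnj v + cnj u * v))"
    unfolding br_pd_YZ[OF assms] by (simp add: D_def algebra_simps power2_eq_square)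
  also have "\<dots> = of_real (- (2 * t ^ 2 * norm2 (a1 z) (a2 z) ^ 2 * Re (u * cnj v)))"
    unfolding D by (simp add: complex_eq_iff)
  finally show ?thesis
    unfolding first_form_def mink_def by simp
qed

lemma br_X_YZ:
  assumes "z \<in> U"
  shows "cscale (of_real (norm2 (a1 z) (a2 z))) (X z) = mat2
     (Y1 z * cnj (Y1 z) + Z1 z * cnj (Z1 z)) (Y1 z * cnj (Y2 z) + Z1 z * cnj (Z2 z))
     (Y2 z * cnj (Y1 z) + Z2 z * cnj (Z1 z)) (Y2 z * cnj (Y2 z) + Z2 z * cnj (Z2 z))"
  using br assms
  by (simp add: X[OF assms] cmat2_eq_iff matmul_nth Z1_def Z2_def of_real_norm2 bryant_def algebra_simps)

lemma br_hyperbolic: "z \<in> U \<Longrightarrow> X z \<in> hyperbolic_space"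
  using br X by (auto simp: bryant_def hyperbolic_space_def)

text \<open>As \<open>norm2\<close> times \<open>X\<close> is \<open>Y Y^* + Z Z^*\<close>, the
  normal is proportional to \<open>Y Y^* - Z Z^*\<close>. The form in the hypothesis avoids
  \<open>Z\<close> and is therefore expressible by quantities that glue globally.\<close>

lemma br_normal_eq:
  assumes z: "z \<in> U"
    and N: "N = cscale (2 / of_real (norm2 (a1 z) (a2 z))) (mat2 (Y1 z * cnj (Y1 z)) (Y1 z * cnj (Y2 z))
       (Y2 z * cnj (Y1 z)) (Y2 z * cnj (Y2 z))) - X z"
  shows "N = cscale (1 / of_real (norm2 (a1 z) (a2 z))) (mat2
     (Y1 z * cnj (Y1 z) - Z1 z * cnj (Z1 z)) (Y1 z * cnj (Y2 z) - Z1 z * cnj (Z2 z))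
     (Y2 z * cnj (Y1 z) - Z2 z * cnj (Z1 z)) (Y2 z * cnj (Y2 z) - Z2 z * cnj (Z2 z)))"
proof -
  define n where "n = complex_of_real (norm2 (a1 z) (a2 z))"
  have n0: "n \<noteq> 0" using br_norm2_pos[OF z] by (simp add: n_def)
  have "X z = cscale (1 / n) (cscale n (X z))" using n0 by (simp add: vec_eq_iff)
  also have "cscale n (X z) = mat2
     (Y1 z * cnj (Y1 z) + Z1 z * cnj (Z1 z)) (Y1 z * cnj (Y2 z) + Z1 z * cnj (Z2 z))
     (Y2 z * cnj (Y1 z) + Z2 z * cnj (Z1 z)) (Y2 z * cnj (Y2 z) + Z2 z * cnj (Z2 z))"
    unfolding n_def by (rule br_X_YZ[OF z])
  finally show ?thesis
    unfolding N n_def[symmetric] using n0 by (simp add: cmat2_eq_iff field_simps)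
qed

text \<open>Up to scaling, in the frame \<open>Y\<close>, \<open>Z\<close> the point is the
  identity, the normal is \<open>diag(1, -1)\<close> and the tangent vectors are off-diagonal; these
  are mutually Lorentz-orthogonal.\<close>

lemma br_unit_normal:
  assumes z: "z \<in> U"
    and N: "N = cscale (2 / of_real (norm2 (a1 z) (a2 z))) (mat2 (Y1 z * cnj (Y1 z)) (Y1 z * cnj (Y2 z))
       (Y2 z * cnj (Y1 z)) (Y2 z * cnj (Y2 z))) - X z"
  shows "unit_normal_at X z N"
proof -
  define n where "n = complex_of_real (norm2 (a1 z) (a2 z))"
  have n0: "n \<noteq> 0" "cnj n = n" using br_norm2_pos[OF z] by (auto simp: n_def)
  note Neq = br_normal_eq[OF z N, folded n_def]
  define D where "D = Y1 z * Z2 z - Y2 z * Z1 z"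
  have D: "D = n" unfolding D_def n_def by (rule br_YZ[OF z])
  have D': "Y1 z * Z2 z - Y2 z * Z1 z = n" "cnj (Y1 z) * cnj (Z2 z) - cnj (Y2 z) * cnj (Z1 z) = n"
    using D n0(2) unfolding D_def by (auto simp flip: complex_cnj_mult complex_cnj_diff)
  have Xeq: "X z = cscale (1 / n) (mat2
     (Y1 z * cnj (Y1 z) + Z1 z * cnj (Z1 z)) (Y1 z * cnj (Y2 z) + Z1 z * cnj (Z2 z))
     (Y2 z * cnj (Y1 z) + Z2 z * cnj (Z1 z)) (Y2 z * cnj (Y2 z) + Z2 z * cnj (Z2 z)))"
    unfolding br_X_YZ[OF z, folded n_def, symmetric] using n0 by (simp add: vec_eq_iff)
  let ?P = "\<lambda>A B. A $ 1 $ 1 * B $ 2 $ 2 + A $ 2 $ 2 * B $ 1 $ 1 - A $ 1 $ 2 * B $ 2 $ 1 - A $ 2 $ 1 * B $ 1 $ (2::2)"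
  have "conj_transpose N = N"
    unfolding Neq by (simp add: cmat2_eq_iff n0 algebra_simps)
  moreover have "mink N N = 1"
  proof -
    have "?P N N = - 2 * (Y1 z * Z2 z - Y2 z * Z1 z) * (cnj (Y1 z) * cnj (Z2 z) - cnj (Y2 z) * cnj (Z1 z)) / n ^ 2"
      unfolding Neq using n0(1) by (simp add: field_simps power2_eq_square)
    also have "\<dots> = -2" unfolding D' using n0(1) by (simp add: power2_eq_square)
    finally show ?thesis unfolding mink_def by simp
  qed
  moreover have "mink N (X z) = 0"
  proof -
    have "?P N (X z) = 0"
      unfolding Neq Xeq using n0(1) by (simp add: field_simps power2_eq_square)
    then show ?thesis unfolding mink_def by simp
  qed
  moreover have "mink N (pd v X z) = 0" for v
  proof -
    have "?P N (pd v X z) = 0"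
      unfolding Neq br_pd_YZ[OF z] using n0(1) by (simp add: field_simps power2_eq_square)
    then show ?thesis unfolding mink_def by simp
  qed
  ultimately show ?thesis by (simp add: unit_normal_at_def)
qed

text \<open>Since \<open>F\<close> is holomorphic, the Laplacian of \<open>F F^*\<close> is four
  times the derivative of \<open>F\<close> times its adjoint.\<close>

lemma br_laplace:
  assumes z: "z \<in> U"
  shows "pd 1 (pd 1 X) z + pd \<i> (pd \<i> X) z = cscale (4 * of_real (t ^ 2 * norm2 (a1 z) (a2 z)))
     (mat2 (Y1 z * cnj (Y1 z)) (Y1 z * cnj (Y2 z)) (Y2 z * cnj (Y1 z)) (Y2 z * cnj (Y2 z)))"
proof -
  have pp: "pd v (pd v X) z = sesq_sum (sesq_pd v (sesq_pd v [(F, F)])) z" for v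
  proof (rule pd_eqI, rule has_derivative_transform_within_open[OF sesq_sum_has_derivative br_open z])
    show "\<forall>(A, B)\<in>set (sesq_pd v [(F, F)]). hol_mat U A \<and> hol_mat U B"
      by (rule sesq_pd_hol) (use br_hol br_open in auto)
    show "sesq_sum (sesq_pd v [(F, F)]) w = pd v X w" if "w \<in> U" for w
      using br_pd[OF that] by (simp add: sesq_sum_def sesq_pd_def)
  qed (use z br_open in auto)
  have sc: "mat_deriv (\<lambda>z. cscale v (mat_deriv F z)) z = cscale v (mat_deriv (mat_deriv F) z)" for v
  proof -
    have "(\<lambda>z. mat_deriv F z $ i $ j) field_differentiable at z" for i j
      using hol_mat_deriv[OF br_hol br_open] z br_open
      by (auto simp: hol_mat_def holomorphic_on_open field_differentiable_def)
    then show ?thesis by (auto simp: vec_eq_iff deriv_cmult)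
  qed
  have "pd 1 (pd 1 X) z + pd \<i> (pd \<i> X) z = cscale 4 (mat_deriv F z ** conj_transpose (mat_deriv F z))"
    unfolding pp by (simp add: sesq_sum_def sesq_pd_def sc cmat2_eq_iff matmul_nth algebra_simps)
  moreover have m: "mat_deriv F z = mat2 (- of_real t * Y1 z * a2 z) (of_real t * Y1 z * a1 z)
                             (- of_real t * Y2 z * a2 z) (of_real t * Y2 z * a1 z)"
    using br z by (auto simp: bryant_def)
  ultimately show ?thesis
    unfolding m by (simp add: cmat2_eq_iff matmul_nth of_real_norm2 algebra_simps power2_eq_square)
qed

text \<open>Because \<open>2 Y Y^* = norm2 (X + N)\<close>, the Laplacian of \<open>X\<close> is
  \<open>2 E (X + N)\<close> with the conformal factor \<open>E = t^2 norm2^2\<close>. In conformal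
  coordinates its normal component is \<open>2 E\<close> times the mean curvature.\<close>

lemma br_mean_curvature:
  assumes z: "z \<in> U" and t: "t \<noteq> 0"
    and N: "N = cscale (2 / of_real (norm2 (a1 z) (a2 z))) (mat2 (Y1 z * cnj (Y1 z)) (Y1 z * cnj (Y2 z))
       (Y2 z * cnj (Y1 z)) (Y2 z * cnj (Y2 z))) - X z"
  shows "mean_curvature X N z = 1"
proof -
  define p where "p = norm2 (a1 z) (a2 z)"
  have p: "p > 0" unfolding p_def by (rule br_norm2_pos[OF z])
  define n where "n = complex_of_real p"
  have n0: "n \<noteq> 0" using p by (simp add: n_def)
  note Neq = br_normal_eq[OF z N, folded p_def, folded n_def]
  have D': "Y1 z * Z2 z - Y2 z * Z1 z = n"
    using br_YZ[OF z] unfolding n_def p_def .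
  have D'': "cnj (Y1 z) * cnj (Z2 z) - cnj (Y2 z) * cnj (Z1 z) = n"
    using arg_cong[OF D', of cnj] by (simp add: n_def)
  let ?P = "\<lambda>A B. A $ 1 $ 1 * B $ 2 $ 2 + A $ 2 $ 2 * B $ 1 $ 1 - A $ 1 $ 2 * B $ 2 $ 1 - A $ 2 $ 1 * B $ 1 $ (2::2)"
  have "?P (pd 1 (pd 1 X) z + pd \<i> (pd \<i> X) z) N
     = - 4 * of_real (t ^ 2) * ((Y1 z * Z2 z - Y2 z * Z1 z) * (cnj (Y1 z) * cnj (Z2 z) - cnj (Y2 z) * cnj (Z1 z)))"
    unfolding br_laplace[OF z, folded p_def, unfolded of_real_mult, folded n_def] Neq
    using n0 by (simp add: field_simps)
  also have "\<dots> = of_real (- 4 * t ^ 2 * p ^ 2)"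
    unfolding D' D'' by (simp add: n_def power2_eq_square)
  finally have "mink (pd 1 (pd 1 X) z + pd \<i> (pd \<i> X) z) N = 2 * t ^ 2 * p ^ 2"
    unfolding mink_def by simp
  then have sf: "second_form X N z 1 1 + second_form X N z \<i> \<i> = 2 * t ^ 2 * p ^ 2"
    by (simp add: second_form_def mink_def field_simps)
  define E where "E = t ^ 2 * p ^ 2"
  have E0: "E \<noteq> 0" using t p by (simp add: E_def)
  have ff: "first_form X z 1 1 = E" "first_form X z \<i> \<i> = E" "first_form X z 1 \<i> = 0"
    unfolding br_first_form[OF z, folded p_def] by (auto simp: E_def)
  have "mean_curvature X N z = E * (second_form X N z 1 1 + second_form X N z \<i> \<i>) / (2 * (E * E))"
    unfolding mean_curvature_def ff by (simp add: algebra_simps)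
  also have "\<dots> = 1"
    unfolding sf using E0 by (simp add: E_def field_simps)
  finally show ?thesis .
qed

lemma br_conformal:
  assumes "t \<noteq> 0" "z \<in> U"
  shows "first_form X z 1 1 > 0" "first_form X z 1 1 = first_form X z \<i> \<i>" "first_form X z 1 \<i> = 0"
  using br_norm2_pos[OF assms(2)] assms(1) by (auto simp: br_first_form[OF assms(2)])

text \<open>The logarithm of the conformal factor is \<open>2 ln \<phi>\<close> up to a constant. By
  Lagrange's identity the Laplacian of \<open>ln \<phi>\<close> is
  \<open>4 |q|^2 / \<phi>^2\<close>, where \<open>q\<close> is the Wronskian of \<open>a1\<close>,
  \<open>a2\<close>; this is the density of the spherical metric pulled back under
  \<open>a1 / a2\<close>.\<close>

lemma br_gauss_curvature:
  assumes z: "z \<in> U" and t: "t \<noteq> 0"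
  shows "- gauss_curvature X z * first_form X z 1 1 = 4 * norm (q z) ^ 2 / norm2 (a1 z) (a2 z) ^ 2"
proof -
  define \<phi> where "\<phi> = (\<lambda>z. norm2 (a1 z) (a2 z))"
  have hol: "a1 holomorphic_on U" "a2 holomorphic_on U" using br by (auto simp: bryant_def)
  note hol' = holomorphic_deriv[OF hol(1) br_open] holomorphic_deriv[OF hol(2) br_open]
  have phi_eq: "\<phi> = (\<lambda>z. Re (a1 z * cnj (a1 z) + a2 z * cnj (a2 z)))"
    by (auto simp: \<phi>_def norm2_def simp flip: complex_norm_square of_real_power)
  have pos: "\<phi> w > 0" if "w \<in> U" for w using br_norm2_pos[OF that] by (simp add: \<phi>_def)
  define \<phi>1 where "\<phi>1 = (\<lambda>v w. 2 * Re (v * deriv a1 w * cnj (a1 w) + v * deriv a2 w * cnj (a2 w)))"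
  have sesq: "((\<lambda>z. f z * cnj (g z)) has_derivative (\<lambda>v. f w * cnj (v * deriv g w) + v * deriv f w * cnj (g w))) (at w)"
    if "f holomorphic_on U" "g holomorphic_on U" "w \<in> U" for f g w
    by (intro has_derivative_mult bounded_linear.has_derivative[OF bounded_linear_cnj] hol_has_derivative[OF _ br_open] that)
  have dphi: "(\<phi> has_derivative (\<lambda>v. \<phi>1 v w)) (at w)" if "w \<in> U" for w
    unfolding phi_eq
    by (rule has_derivative_eq_rhs[OF bounded_linear.has_derivative[OF bounded_linear_Re has_derivative_add[OF sesq[OF hol(1,1) that] sesq[OF hol(2,2) that]]]])
       (auto simp: \<phi>1_def fun_eq_iff algebra_simps)
  define \<phi>2 where "\<phi>2 = (\<lambda>v w. 2 * Re (v * deriv a1 w * cnj (v * deriv a1 w) + v * deriv a2 w * cnj (v * deriv a2 w)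
      + v * v * deriv (deriv a1) w * cnj (a1 w) + v * v * deriv (deriv a2) w * cnj (a2 w)))"
  have dphi1: "(\<phi>1 v has_derivative (\<lambda>u. 2 * Re (v * (deriv a1 w * cnj (u * deriv a1 w) + u * deriv (deriv a1) w * cnj (a1 w)) +
       v * (deriv a2 w * cnj (u * deriv a2 w) + u * deriv (deriv a2) w * cnj (a2 w))))) (at w)" if "w \<in> U" for v w
    unfolding \<phi>1_def mult.assoc[of v]
    by (intro has_derivative_mult_right bounded_linear.has_derivative[OF bounded_linear_Re] has_derivative_add
        sesq[OF hol'(1) hol(1) that] sesq[OF hol'(2) hol(2) that])
  define l where "l = (\<lambda>w. ln (first_form X w 1 1))"
  have l_eq: "l w = ln (t ^ 2) + 2 * ln (\<phi> w)" if "w \<in> U" for w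
    using pos[OF that] t by (simp add: l_def br_first_form[OF that] ln_mult ln_realpow \<phi>_def)
  have dl: "(l has_derivative (\<lambda>v. 2 * (\<phi>1 v w / \<phi> w))) (at w)" if w: "w \<in> U" for w
  proof (rule has_derivative_transform_within_open[OF _ br_open w])
    show "((\<lambda>w. ln (t ^ 2) + 2 * ln (\<phi> w)) has_derivative (\<lambda>v. 2 * (\<phi>1 v w / \<phi> w))) (at w)"
      by (rule derivative_eq_intros dphi[OF w] refl | use pos[OF w] in \<open>simp add: field_simps\<close>)+
  qed (simp add: l_eq)
  have pl: "pd v l w = 2 * (\<phi>1 v w / \<phi> w)" if "w \<in> U" for v w
    by (rule pd_eqI[OF dl[OF that]])
  have ppl: "pd v (pd v l) z = 2 * ((\<phi>2 v z * \<phi> z - \<phi>1 v z * \<phi>1 v z) / (\<phi> z * \<phi> z))" for v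
  proof (rule pd_eqI[THEN trans])
    have "\<phi> z \<noteq> 0" using pos[OF z] by simp
    then have "((\<lambda>w. 2 * (\<phi>1 v w / \<phi> w)) has_derivative (\<lambda>u. 2 * ((2 * Re (v * (deriv a1 z * cnj (u * deriv a1 z) + u * deriv (deriv a1) z * cnj (a1 z)) +
       v * (deriv a2 z * cnj (u * deriv a2 z) + u * deriv (deriv a2) z * cnj (a2 z))) * \<phi> z - \<phi>1 v z * \<phi>1 u z) / (\<phi> z * \<phi> z)))) (at z)"
      by (intro has_derivative_mult_right has_derivative_divide' dphi dphi1 z)
    then show "(pd v l has_derivative (\<lambda>u. 2 * ((2 * Re (v * (deriv a1 z * cnj (u * deriv a1 z) + u * deriv (deriv a1) z * cnj (a1 z)) +
       v * (deriv a2 z * cnj (u * deriv a2 z) + u * deriv (deriv a2) z * cnj (a2 z))) * \<phi> z - \<phi>1 v z * \<phi>1 u z) / (\<phi> z * \<phi> z)))) (at z)"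
      by (rule has_derivative_transform_within_open[OF _ br_open z]) (simp add: pl)
    show "2 * ((2 * Re (v * (deriv a1 z * cnj (v * deriv a1 z) + v * deriv (deriv a1) z * cnj (a1 z)) +
       v * (deriv a2 z * cnj (v * deriv a2 z) + v * deriv (deriv a2) z * cnj (a2 z))) * \<phi> z - \<phi>1 v z * \<phi>1 v z) / (\<phi> z * \<phi> z))
      = 2 * ((\<phi>2 v z * \<phi> z - \<phi>1 v z * \<phi>1 v z) / (\<phi> z * \<phi> z))"
      by (simp add: \<phi>2_def algebra_simps)
  qed
  define s where "s = deriv a1 z * cnj (a1 z) + deriv a2 z * cnj (a2 z)"
  have q: "q z = a1 z * deriv a2 z - deriv a1 z * a2 z" using br z by (simp add: bryant_def)
  have "\<phi>2 1 z + \<phi>2 \<i> z = 4 * (norm (deriv a1 z) ^ 2 + norm (deriv a2 z) ^ 2)"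
    unfolding \<phi>2_def cmod_power2 by (simp add: power2_eq_square algebra_simps)
  moreover have "\<phi>1 1 z * \<phi>1 1 z + \<phi>1 \<i> z * \<phi>1 \<i> z = 4 * norm s ^ 2"
    unfolding \<phi>1_def s_def cmod_power2 by (simp add: power2_eq_square algebra_simps)
  moreover have "(norm (deriv a1 z) ^ 2 + norm (deriv a2 z) ^ 2) * \<phi> z - norm s ^ 2 = norm (q z) ^ 2"
    unfolding \<phi>_def norm2_def s_def q cmod_power2 by (simp add: power2_eq_square algebra_simps)
  ultimately have num: "(\<phi>2 1 z + \<phi>2 \<i> z) * \<phi> z - (\<phi>1 1 z * \<phi>1 1 z + \<phi>1 \<i> z * \<phi>1 \<i> z) = 4 * norm (q z) ^ 2"
    by (simp add: algebra_simps)
  have "pd 1 (pd 1 l) z + pd \<i> (pd \<i> l) z = 2 * (((\<phi>2 1 z + \<phi>2 \<i> z) * \<phi> z - (\<phi>1 1 z * \<phi>1 1 z + \<phi>1 \<i> z * \<phi>1 \<i> z)) / (\<phi> z * \<phi> z))"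
    unfolding ppl by (simp add: add_divide_distrib diff_divide_distrib algebra_simps)
  then have lap: "pd 1 (pd 1 l) z + pd \<i> (pd \<i> l) z = 8 * norm (q z) ^ 2 / \<phi> z ^ 2"
    unfolding num by (simp add: power2_eq_square)
  have "first_form X z 1 1 \<noteq> 0" using br_conformal(1)[OF t z] by simp
  then have "- gauss_curvature X z * first_form X z 1 1 = (pd 1 (pd 1 l) z + pd \<i> (pd \<i> l) z) / 2"
    by (simp add: gauss_curvature_def Let_def l_def[symmetric] field_simps)
  then show ?thesis unfolding lap by (simp add: \<phi>_def)
qed

end

section \<open>Gluing along the lattice\<close>

text \<open>An integer power of an involution \<open>\<tau>\<close>; the distinction by parity
  covers negative exponents as well.\<close>

definition tpow :: "('a \<Rightarrow> 'a) \<Rightarrow> int \<Rightarrow> 'a \<Rightarrow> 'a" where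
  "tpow \<tau> n x = (if even n then x else \<tau> x)"

text \<open>Every point off the lattice lies in a unit translate of one of the two strips;
  \<open>glue\<close> extends a function on \<open>cross\<close> that is equivariant under the translations by \<open>1\<close> and \<open>\<i>\<close>.\<close>

definition glue :: "('a \<Rightarrow> 'a) \<Rightarrow> ('a \<Rightarrow> 'a) \<Rightarrow> (complex \<Rightarrow> 'a) \<Rightarrow> complex \<Rightarrow> 'a" where
  "glue \<tau> \<tau>' f z = (if Im z \<notin> \<int> then tpow \<tau>' \<lfloor>Im z\<rfloor> (f (z - \<i> * of_int \<lfloor>Im z\<rfloor>))
     else tpow \<tau> \<lfloor>Re z\<rfloor> (f (z - of_int \<lfloor>Re z\<rfloor>)))"

locale equivariant =
  fixes \<tau> \<tau>' :: "'a \<Rightarrow> 'a" and f :: "complex \<Rightarrow> 'a"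
  assumes inv: "\<tau> (\<tau> x) = x" "\<tau>' (\<tau>' x) = x" and comm: "\<tau> (\<tau>' x) = \<tau>' (\<tau> x)"
    and shift: "z \<in> hstrip \<Longrightarrow> f (z - 1) = \<tau> (f z)"
    and shift': "z \<in> vstrip \<Longrightarrow> f (z - \<i>) = \<tau>' (f z)"
begin

lemma tpow_Suc: "tpow \<tau> (n + 1) x = \<tau> (tpow \<tau> n x)" "tpow \<tau>' (n + 1) x = \<tau>' (tpow \<tau>' n x)"
  by (auto simp: tpow_def inv)

lemma tpow_pred: "tpow \<tau> (n - 1) x = \<tau> (tpow \<tau> n x)" "tpow \<tau>' (n - 1) x = \<tau>' (tpow \<tau>' n x)"
  by (auto simp: tpow_def inv)

lemma tpow_comm: "tpow \<tau> m (tpow \<tau>' n x) = tpow \<tau>' n (tpow \<tau> m x)"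
  by (auto simp: tpow_def comm)

lemma shift_int: "z \<in> hstrip \<Longrightarrow> f (z - of_int m) = tpow \<tau> m (f z)"
proof (induction m rule: int_induct[of _ 0])
  case (step1 i)
  have "z - of_int i \<in> hstrip" using step1 by (simp add: hstrip_def)
  from shift[OF this] step1 show ?case by (simp add: tpow_Suc diff_diff_eq)
next
  case (step2 i)
  have "z - of_int i + 1 \<in> hstrip" using step2 by (simp add: hstrip_def)
  from shift[OF this] have "f (z - of_int i + 1) = \<tau> (f (z - of_int i))" by (simp add: inv)
  then show ?case using step2 by (simp add: tpow_pred algebra_simps)
qed (simp add: tpow_def)

lemma shift_int': "z \<in> vstrip \<Longrightarrow> f (z - \<i> * of_int m) = tpow \<tau>' m (f z)"
proof (induction m rule: int_induct[of _ 0])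
  case (step1 i)
  have "z - \<i> * of_int i \<in> vstrip" using step1 by (simp add: vstrip_def)
  moreover have "z - \<i> * of_int (i + 1) = z - \<i> * of_int i - \<i>" by (simp add: algebra_simps)
  ultimately show ?case using shift' step1 by (simp only: tpow_Suc)
next
  case (step2 i)
  have "z - \<i> * of_int i + \<i> \<in> vstrip" using step2 by (simp add: vstrip_def)
  from shift'[OF this] have "f (z - \<i> * of_int i + \<i>) = \<tau>' (f (z - \<i> * of_int i))" by (simp add: inv)
  then show ?case using step2 by (simp add: tpow_pred algebra_simps)
qed (simp add: tpow_def)

lemma tpow_inv: "tpow \<tau> m (tpow \<tau> m x) = x" "tpow \<tau>' m (tpow \<tau>' m x) = x"
  by (auto simp: tpow_def inv)

lemma strip_floor: "z - \<i> * of_int n \<in> hstrip \<Longrightarrow> Im z \<notin> \<int> \<and> \<lfloor>Im z\<rfloor> = n"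
proof
  assume "z - \<i> * of_int n \<in> hstrip"
  then have b: "of_int n < Im z" "Im z < of_int n + 1" by (auto simp: hstrip_def)
  then show "Im z \<notin> \<int>" by (auto elim!: Ints_cases)
  show "\<lfloor>Im z\<rfloor> = n" using b by (simp add: floor_eq_iff)
qed

lemma strip_floor': "z - of_int n \<in> vstrip \<Longrightarrow> Re z \<notin> \<int> \<and> \<lfloor>Re z\<rfloor> = n"
proof
  assume "z - of_int n \<in> vstrip"
  then have b: "of_int n < Re z" "Re z < of_int n + 1" by (auto simp: vstrip_def)
  then show "Re z \<notin> \<int>" by (auto elim!: Ints_cases)
  show "\<lfloor>Re z\<rfloor> = n" using b by (simp add: floor_eq_iff)
qed

lemma glue_h: "z - \<i> * of_int n \<in> hstrip \<Longrightarrow> glue \<tau> \<tau>' f z = tpow \<tau>' n (f (z - \<i> * of_int n))"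
  using strip_floor[of z n] by (simp add: glue_def)

lemma frac_floor: "x \<notin> \<int> \<Longrightarrow> 0 < x - of_int \<lfloor>x\<rfloor> \<and> x - of_int \<lfloor>x\<rfloor> < 1" for x :: real
proof
  assume "x \<notin> \<int>"
  then have "x \<noteq> of_int \<lfloor>x\<rfloor>" by (metis Ints_of_int)
  then show "0 < x - of_int \<lfloor>x\<rfloor>" using of_int_floor_le[of x] by linarith
  show "x - of_int \<lfloor>x\<rfloor> < 1" by linarith
qed

text \<open>\<open>glue\<close> gives precedence to the horizontal strips. On an overlap the same
  point of \<open>cross\<close> is reached by the two translations in either order, and the two
  descriptions agree because the involutions commute.\<close>

lemma glue_v:
  assumes z: "z - of_int m \<in> vstrip"
  shows "glue \<tau> \<tau>' f z = tpow \<tau> m (f (z - of_int m))"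
proof (cases "Im z \<in> \<int>")
  case True
  then show ?thesis using strip_floor'[OF z] by (simp add: glue_def)
next
  case False
  define n where "n = \<lfloor>Im z\<rfloor>"
  have w: "z - \<i> * of_int n \<in> hstrip" using frac_floor[OF False] by (simp add: hstrip_def n_def)
  define v where "v = z - \<i> * of_int n - of_int m"
  have 1: "f v = tpow \<tau> m (f (z - \<i> * of_int n))" unfolding v_def by (rule shift_int[OF w])
  have 2: "f v = tpow \<tau>' n (f (z - of_int m))"
    using shift_int'[OF z, of n] by (simp add: v_def algebra_simps)
  have "glue \<tau> \<tau>' f z = tpow \<tau>' n (f (z - \<i> * of_int n))" by (rule glue_h[OF w])
  also have "f (z - \<i> * of_int n) = tpow \<tau> m (tpow \<tau>' n (f (z - of_int m)))"
    using 1 2 tpow_inv(1) by metis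
  finally show ?thesis by (simp add: tpow_comm tpow_inv)
qed

lemma notin_gaussL_cases:
  assumes "z \<notin> gaussL"
  obtains n where "z - \<i> * of_int n \<in> hstrip" | m where "z - of_int m \<in> vstrip"
proof (cases "Im z \<in> \<int>")
  case False
  then show ?thesis using frac_floor[OF False] that(1)[of "\<lfloor>Im z\<rfloor>"] by (simp add: hstrip_def)
next
  case True
  then have "Re z \<notin> \<int>" using assms by (simp add: gaussL_iff)
  then show ?thesis using frac_floor that(2)[of "\<lfloor>Re z\<rfloor>"] by (simp add: vstrip_def)
qed

lemma glue_shift:
  assumes "z \<notin> gaussL"
  shows "glue \<tau> \<tau>' f (z + 1) = \<tau> (glue \<tau> \<tau>' f z)" "glue \<tau> \<tau>' f (z + \<i>) = \<tau>' (glue \<tau> \<tau>' f z)"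
proof -
  consider n where "z - \<i> * of_int n \<in> hstrip" | m where "z - of_int m \<in> vstrip"
    using notin_gaussL_cases[OF assms] by metis
  then have "glue \<tau> \<tau>' f (z + 1) = \<tau> (glue \<tau> \<tau>' f z) \<and> glue \<tau> \<tau>' f (z + \<i>) = \<tau>' (glue \<tau> \<tau>' f z)"
  proof cases
    case 1
    have w: "z + 1 - \<i> * of_int n \<in> hstrip" "z + \<i> - \<i> * of_int (n + 1) \<in> hstrip"
      using 1 by (auto simp: hstrip_def)
    have "f (z + 1 - \<i> * of_int n) = \<tau> (f (z - \<i> * of_int n))"
      using shift[OF w(1)] inv(1) by (metis add_diff_cancel_right' add_diff_eq diff_add_eq diff_right_commute)
    then have "glue \<tau> \<tau>' f (z + 1) = \<tau> (glue \<tau> \<tau>' f z)"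
      unfolding glue_h[OF 1] glue_h[OF w(1)] by (simp add: tpow_def comm)
    moreover have e: "z + \<i> - \<i> * of_int (n + 1) = z - \<i> * of_int n" by (simp add: algebra_simps)
    ultimately show ?thesis
      unfolding glue_h[OF 1] glue_h[OF w(2)] e tpow_Suc by simp
  next
    case 2
    have w: "z + \<i> - of_int m \<in> vstrip" "z + 1 - of_int (m + 1) \<in> vstrip"
      using 2 by (auto simp: vstrip_def)
    have "f (z + \<i> - of_int m) = \<tau>' (f (z - of_int m))"
      using shift'[OF w(1)] inv(2) by (metis add_diff_cancel_right' add_diff_eq diff_add_eq diff_right_commute)
    then have "glue \<tau> \<tau>' f (z + \<i>) = \<tau>' (glue \<tau> \<tau>' f z)"
      unfolding glue_v[OF 2] glue_v[OF w(1)] by (simp add: tpow_def comm)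
    moreover have e: "z + 1 - of_int (m + 1) = z - of_int m" by (simp add: algebra_simps)
    ultimately show ?thesis
      unfolding glue_v[OF 2] glue_v[OF w(2)] e tpow_Suc by simp
  qed
  then show "glue \<tau> \<tau>' f (z + 1) = \<tau> (glue \<tau> \<tau>' f z)" "glue \<tau> \<tau>' f (z + \<i>) = \<tau>' (glue \<tau> \<tau>' f z)" by auto
qed

end

section \<open>The surface\<close>

locale surface =
  fixes b t :: real
  assumes t0: "t \<noteq> 0" and b_range: "0 \<le> b" "b \<le> bmax"
    and disc_t: "disc b t = 0" and disc_0_lt: "\<bar>disc b 0\<bar> < 1"
begin

text \<open>Rescaling the basis by \<open>lam\<close> and \<open>1 / lam\<close> gives the
  off-diagonal entries of the translation matrix equal modulus and opposite sign, which requires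
  \<open>lam ^ 4 * p * q = - r * s\<close>; their common modulus is that of
  \<open>kap\<close>.\<close>

definition lam :: real where
  "lam = root 4 (- (edge_r b 0 * edge_s b 0) / (edge_p b 0 * edge_q b 0))"

definition kap :: real where "kap = 2 * edge_p b 0 * edge_q b 0 * lam ^ 2"

text \<open>The determinant and \<open>disc\<close> give \<open>p s = (1 + D) / 2\<close> and
  \<open>q r = (D - 1) / 2\<close>. For \<open>\<bar>D\<bar> < 1\<close> these have opposite signs,
  which makes the radicand of \<open>lam\<close> positive. The last identity says that the rescaled
  translation matrix is a rotation, hence unitary.\<close>

lemma lam_facts: "lam > 0" "2 * edge_r b 0 * edge_s b 0 = - kap * lam ^ 2" "(disc b 0)\<^sup>2 + kap ^ 2 = 1"
proof -
  define p q r s where "p = edge_p b 0" and "q = edge_q b 0" and "r = edge_r b 0" and "s = edge_s b 0"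
  define D where "D = disc b 0"
  have ps: "p * s = (1 + D) / 2" and qr: "q * r = (D - 1) / 2"
    using fund_edgem_det[of b 0] by (auto simp: D_def disc_def p_def q_def r_def s_def field_simps)
  have D: "\<bar>D\<bar> < 1" using disc_0_lt by (simp add: D_def)
  have psp: "p * s > 0" "q * r < 0" using D by (auto simp: ps qr)
  then have nz: "p \<noteq> 0" "q \<noteq> 0" "r \<noteq> 0" "s \<noteq> 0" by auto
  have "(p * s) * (q * r) < 0" using psp by (rule mult_pos_neg)
  then have "(p * q) * (r * s) < 0" by (simp add: mult_ac)
  then have pos: "- (r * s) / (p * q) > 0"
  proof -
    have "r * s / (p * q) = (p * q) * (r * s) / (p * q) ^ 2" using nz by (simp add: power2_eq_square)
    also have "\<dots> < 0" using \<open>(p * q) * (r * s) < 0\<close> nz by (intro divide_neg_pos) auto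
    finally show ?thesis by simp
  qed
  then show lam: "lam > 0"
    by (simp add: lam_def p_def q_def r_def s_def)
  have lam4: "lam ^ 4 = - (r * s) / (p * q)"
    using pos by (simp add: lam_def p_def q_def r_def s_def)
  then have "lam ^ 2 * lam ^ 2 * (p * q) = - (r * s)"
    using nz by (simp add: field_simps flip: power_add)
  then show rs: "2 * edge_r b 0 * edge_s b 0 = - kap * lam ^ 2"
    by (simp add: kap_def p_def q_def r_def s_def algebra_simps)
  have "kap ^ 2 = 4 * (p * q) * (lam ^ 4 * (p * q))"
    by (simp add: kap_def p_def q_def power2_eq_square power4_eq_xxxx)
  also have "\<dots> = - 4 * (p * s) * (q * r)"
    using nz by (simp add: lam4)
  also have "\<dots> = 1 - D ^ 2" by (simp add: ps qr power2_eq_square field_simps)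
  finally show "(disc b 0)\<^sup>2 + kap ^ 2 = 1" by (simp add: D_def)
qed

text \<open>The sign of the radicand is not controlled, but a complex rescaling is harmless: the
  monodromy of the solutions for \<open>t\<close> only has to take the form \<open>Tm\<close>,
  \<open>Tm'\<close>, and any conjugation may achieve this.\<close>

definition mu :: complex where "mu = csqrt (of_real (2 * edge_p b t * edge_q b t))"

text \<open>From \<open>disc b t = 0\<close> follow \<open>p s = 1/2\<close> and
  \<open>q r = - 1/2\<close>, so \<open>(2 p q) (2 r s) = - 1\<close>.\<close>

lemma mu_facts: "mu \<noteq> 0" "of_real (2 * edge_p b t * edge_q b t) = mu ^ 2"
  "of_real (2 * edge_r b t * edge_s b t) = - 1 / mu ^ 2"
proof -
  define p q r s where "p = edge_p b t" and "q = edge_q b t" and "r = edge_r b t" and "s = edge_s b t"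
  have ps: "p * s = 1 / 2" and qr: "q * r = - 1 / 2"
    using fund_edgem_det[of b t] disc_t by (auto simp: disc_def p_def q_def r_def s_def field_simps)
  show 2: "of_real (2 * edge_p b t * edge_q b t) = mu ^ 2" by (simp add: mu_def)
  have nz: "p * q \<noteq> 0" using ps qr by auto
  have m2: "mu ^ 2 \<noteq> 0" using nz 2 by (metis (no_types) mult_eq_0_iff of_real_eq_0_iff p_def q_def zero_neq_numeral)
  then show "mu \<noteq> 0" by auto
  have "(2 * p * q) * (2 * r * s) = 4 * (p * s) * (q * r)" by simp
  also have "\<dots> = -1" by (simp add: ps qr)
  finally have e: "(2 * p * q) * (2 * r * s) = - 1" .
  have "complex_of_real (2 * p * q) * of_real (2 * r * s) = - 1"
    unfolding of_real_mult[symmetric] e by simp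
  then have "mu ^ 2 * of_real (2 * r * s) = - 1"
    using 2 by (simp only: p_def q_def)
  then show "of_real (2 * edge_r b t * edge_s b t) = - 1 / mu ^ 2"
    using m2 by (simp add: r_def s_def field_simps)
qed

definition A1 :: "complex \<Rightarrow> complex" where "A1 z = of_real lam * psi1 b 0 z"
definition B1 :: "complex \<Rightarrow> complex" where "B1 z = of_real lam * eta1 b 0 z"
definition A2 :: "complex \<Rightarrow> complex" where "A2 z = psi2 b 0 z / of_real lam"
definition B2 :: "complex \<Rightarrow> complex" where "B2 z = eta2 b 0 z / of_real lam"
definition V1 :: "complex \<Rightarrow> complex" where "V1 z = psi1 b t z / mu"
definition E1 :: "complex \<Rightarrow> complex" where "E1 z = eta1 b t z / mu"
definition V2 :: "complex \<Rightarrow> complex" where "V2 z = mu * psi2 b t z"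
definition E2 :: "complex \<Rightarrow> complex" where "E2 z = mu * eta2 b t z"

lemma AB_sol: "wsol b 0 cross A1 B1" "wsol b 0 cross A2 B2" "wsol b t cross V1 E1" "wsol b t cross V2 E2"
proof -
  have s: "wsol b t' cross (\<lambda>z. k * \<psi> z) (\<lambda>z. k * \<eta> z)" if "wsol b t' cross \<psi> \<eta>" for t' k \<psi> \<eta>
    using lin_sol_comb[OF that that, of k 0] by simp
  show "wsol b 0 cross A1 B1" "wsol b 0 cross A2 B2" "wsol b t cross V1 E1" "wsol b t cross V2 E2"
    using s[OF fund_sol(1)[of b 0], of "of_real lam"] s[OF fund_sol(2)[of b 0], of "1 / of_real lam"]
      s[OF fund_sol(1)[of b t], of "1 / mu"] s[OF fund_sol(2)[of b t], of mu]
    by (simp_all add: A1_def[abs_def] B1_def[abs_def] A2_def[abs_def] B2_def[abs_def]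
        V1_def[abs_def] E1_def[abs_def] V2_def[abs_def] E2_def[abs_def])
qed

lemma AB_det:
  assumes "z \<in> cross"
  shows "A1 z * B2 z - B1 z * A2 z = 1" "V1 z * E2 z - E1 z * V2 z = 1"
  using fund_det[OF assms, of b 0] fund_det[OF assms, of b t] lam_facts(1) mu_facts(1)
  by (simp_all add: A1_def B1_def A2_def B2_def V1_def E1_def V2_def E2_def)

lemma AB_shift:
  assumes "z \<in> hstrip"
  shows "A1 (z - 1) = of_real (disc b 0) * A1 z - of_real kap * A2 z"
    "A2 (z - 1) = of_real kap * A1 z + of_real (disc b 0) * A2 z"
    "B1 (z - 1) = of_real (disc b 0) * B1 z - of_real kap * B2 z"
    "B2 (z - 1) = of_real kap * B1 z + of_real (disc b 0) * B2 z"
proof -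
  have k1: "complex_of_real (2 * edge_p b 0 * edge_q b 0) * of_real lam = of_real kap / of_real lam"
    using lam_facts(1) by (simp add: kap_def power2_eq_square)
  have k2: "complex_of_real (2 * edge_r b 0 * edge_s b 0) / of_real lam = - of_real kap * of_real lam"
    unfolding lam_facts(2) using lam_facts(1) by (simp add: power2_eq_square)
  have k1': "of_real lam * (complex_of_real (2 * edge_p b 0 * edge_q b 0) * x) = of_real kap * (x / of_real lam)" for x
    using arg_cong[OF k1, of "\<lambda>y. x * y"] by (simp add: mult_ac)
  have k2': "- complex_of_real (2 * edge_r b 0 * edge_s b 0) * x / of_real lam = of_real kap * (of_real lam * x)" for x
    using arg_cong[OF k2, of "\<lambda>y. - x * y"] by (simp add: mult_ac)
  show "A1 (z - 1) = of_real (disc b 0) * A1 z - of_real kap * A2 z"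
    "B1 (z - 1) = of_real (disc b 0) * B1 z - of_real kap * B2 z"
    unfolding A1_def A2_def B1_def B2_def fund_shift_1[OF assms, of b 0] right_diff_distrib k1' by simp_all
  show "A2 (z - 1) = of_real kap * A1 z + of_real (disc b 0) * A2 z"
    "B2 (z - 1) = of_real kap * B1 z + of_real (disc b 0) * B2 z"
    unfolding A1_def A2_def B1_def B2_def fund_shift_1[OF assms, of b 0] add_divide_distrib k2' by simp_all
qed

lemma AB_shift':
  assumes "z \<in> vstrip"
  shows "A1 (z - \<i>) = of_real (disc b 0) * A1 z - \<i> * of_real kap * A2 z"
    "A2 (z - \<i>) = - \<i> * of_real kap * A1 z + of_real (disc b 0) * A2 z"
    "B1 (z - \<i>) = of_real (disc b 0) * B1 z - \<i> * of_real kap * B2 z"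
    "B2 (z - \<i>) = - \<i> * of_real kap * B1 z + of_real (disc b 0) * B2 z"
proof -
  have k1: "complex_of_real (2 * edge_p b 0 * edge_q b 0) * of_real lam = of_real kap / of_real lam"
    using lam_facts(1) by (simp add: kap_def power2_eq_square)
  have k2: "complex_of_real (2 * edge_r b 0 * edge_s b 0) / of_real lam = - of_real kap * of_real lam"
    unfolding lam_facts(2) using lam_facts(1) by (simp add: power2_eq_square)
  have k1': "of_real lam * (\<i> * complex_of_real (2 * edge_p b 0 * edge_q b 0) * x) = \<i> * of_real kap * (x / of_real lam)" for x
    using arg_cong[OF k1, of "\<lambda>y. \<i> * x * y"] by (simp add: mult_ac)
  have k2': "\<i> * complex_of_real (2 * edge_r b 0 * edge_s b 0) * x / of_real lam = - \<i> * of_real kap * (of_real lam * x)" for x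
    using arg_cong[OF k2, of "\<lambda>y. \<i> * x * y"] by (simp add: mult_ac)
  show "A1 (z - \<i>) = of_real (disc b 0) * A1 z - \<i> * of_real kap * A2 z"
    "B1 (z - \<i>) = of_real (disc b 0) * B1 z - \<i> * of_real kap * B2 z"
    unfolding A1_def A2_def B1_def B2_def fund_shift_i[OF assms, of b 0] right_diff_distrib k1' by simp_all
  show "A2 (z - \<i>) = - \<i> * of_real kap * A1 z + of_real (disc b 0) * A2 z"
    "B2 (z - \<i>) = - \<i> * of_real kap * B1 z + of_real (disc b 0) * B2 z"
    unfolding A1_def A2_def B1_def B2_def fund_shift_i[OF assms, of b 0] add_divide_distrib k2' by simp_all
qed

lemma VE_shift:
  assumes "z \<in> hstrip"
  shows "V1 (z - 1) = - V2 z" "V2 (z - 1) = V1 z" "E1 (z - 1) = - E2 z" "E2 (z - 1) = E1 z"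
  unfolding V1_def V2_def E1_def E2_def fund_shift_1[OF assms, of b t] disc_t mu_facts(2,3)
  using mu_facts(1) by (simp_all add: power2_eq_square)

lemma VE_shift':
  assumes "z \<in> vstrip"
  shows "V1 (z - \<i>) = - \<i> * V2 z" "V2 (z - \<i>) = - \<i> * V1 z" "E1 (z - \<i>) = - \<i> * E2 z" "E2 (z - \<i>) = - \<i> * E1 z"
  unfolding V1_def V2_def E1_def E2_def fund_shift_i[OF assms, of b t] disc_t mu_facts(2,3)
  using mu_facts(1) by (simp_all add: power2_eq_square)

text \<open>This is \<open>W_t W_0^-1\<close>, where the inverse is the adjugate because
  \<open>W_0\<close> has determinant 1.\<close>

definition F0 :: "complex \<Rightarrow> cmat2" where
  "F0 z = mat2 (V1 z * B2 z - E1 z * A2 z) (E1 z * A1 z - V1 z * B1 z)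
               (V2 z * B2 z - E2 z * A2 z) (E2 z * A1 z - V2 z * B1 z)"

text \<open>The two systems share \<open>sysA\<close> and \<open>sysC\<close>, and
  \<open>sysB\<close> differs by the constant \<open>t\<close>; in the product rule everything else
  cancels.\<close>

lemma F0_deriv:
  assumes z: "z \<in> cross"
  shows "mat_deriv F0 z = mat2 (- of_real t * V1 z * A2 z) (of_real t * V1 z * A1 z)
                             (- of_real t * V2 z * A2 z) (of_real t * V2 z * A1 z)"
proof -
  have d1: "((\<lambda>z. V z * B z - E z * A z) has_field_derivative - of_real t * V z * A z) (at z)"
    if "wsol b t cross V E" "wsol b 0 cross A B" for V E A B
  proof -
    have d: "(V has_field_derivative sysA b z * V z + sysC z * E z) (at z)"
      "(E has_field_derivative sysB b t z * V z - sysA b z * E z) (at z)"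
      "(A has_field_derivative sysA b z * A z + sysC z * B z) (at z)"
      "(B has_field_derivative sysB b 0 z * A z - sysA b z * B z) (at z)"
      using that z by (auto simp: lin_sol_def)
    have sB: "sysB b t z = sysB b 0 z + of_real t" by (simp add: sysB_def)
    from DERIV_diff[OF DERIV_mult[OF d(1,4)] DERIV_mult[OF d(2,3)]] show ?thesis
      by (rule DERIV_cong) (simp only: sB, simp add: algebra_simps)
  qed
  have d2: "((\<lambda>z. E z * A z - V z * B z) has_field_derivative of_real t * V z * A z) (at z)"
    if "wsol b t cross V E" "wsol b 0 cross A B" for V E A B
    using DERIV_minus[OF d1[OF that]] by simp
  show ?thesis
    unfolding cmat2_eq_iff mat_deriv_nth F0_def mat2_nth
    by (intro conjI DERIV_imp_deriv d1 d2 AB_sol)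
qed

text \<open>The shifts \<open>z - 1\<close> and \<open>z - \<i>\<close> act on the column
  \<open>(V1, V2)\<close> by these matrices. They have square \<open>-1\<close> and anticommute, so
  \<open>tau\<close> and \<open>tau'\<close>, blind to signs, are commuting involutions.\<close>

definition Tm :: cmat2 where "Tm = mat2 0 (-1) 1 0"
definition Tm' :: cmat2 where "Tm' = mat2 0 (-\<i>) (-\<i>) 0"

definition tau :: "cmat2 \<Rightarrow> cmat2" where "tau M = Tm ** M ** conj_transpose Tm"
definition tau' :: "cmat2 \<Rightarrow> cmat2" where "tau' M = Tm' ** M ** conj_transpose Tm'"

lemma i_times_i_right [simp]: "\<i> * z * \<i> = - z" "\<i> * z * (\<i> * w) = - (z * w)"
  by (simp_all add: mult_ac)

lemma tau_eq: "tau M = mat2 (M$2$2) (- M$2$1) (- M$1$2) (M$1$1)"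
  "tau' M = mat2 (M$2$2) (M$2$1) (M$1$2) (M$1$1)"
  by (auto simp: tau_def tau'_def Tm_def Tm'_def cmat2_eq_iff matmul_nth)

definition X0 :: "complex \<Rightarrow> cmat2" where "X0 z = F0 z ** conj_transpose (F0 z)"
text \<open>The column \<open>(V1, V2)\<close> is multiplied by \<open>Tm\<close> and
  \<open>Tm'\<close>, whose squares are \<open>-1\<close>, and does not descend to the doubled
  lattice. Its product with its adjoint transforms like \<open>X0\<close>; it carries the unit
  normal and the hyperbolic Gauss map.\<close>

definition VV0 :: "complex \<Rightarrow> cmat2" where
  "VV0 z = mat2 (V1 z * cnj (V1 z)) (V1 z * cnj (V2 z)) (V2 z * cnj (V1 z)) (V2 z * cnj (V2 z))"
definition phi0 :: "complex \<Rightarrow> real" where "phi0 z = norm2 (A1 z) (A2 z)"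

definition X :: "complex \<Rightarrow> cmat2" where "X = glue tau tau' X0"
definition VV :: "complex \<Rightarrow> cmat2" where "VV = glue tau tau' VV0"
definition phi :: "complex \<Rightarrow> real" where "phi = glue id id phi0"

lemma disc_kap_complex: "of_real (disc b 0) * of_real (disc b 0) + of_real kap * of_real kap = (1::complex)"
  using lam_facts(3) by (simp add: power2_eq_square flip: of_real_mult of_real_add)

lemma F0_shift:
  assumes "z \<in> hstrip"
  shows "F0 (z - 1) = Tm ** F0 z ** mat2 (of_real (disc b 0)) (of_real kap) (- of_real kap) (of_real (disc b 0))"
  unfolding F0_def AB_shift[OF assms] VE_shift[OF assms]
  by (simp add: Tm_def cmat2_eq_iff matmul_nth algebra_simps)

lemma F0_shift':
  assumes "z \<in> vstrip"
  shows "F0 (z - \<i>) = Tm' ** F0 z ** mat2 (of_real (disc b 0)) (\<i> * of_real kap) (\<i> * of_real kap) (of_real (disc b 0))"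
  unfolding F0_def AB_shift'[OF assms] VE_shift'[OF assms]
  by (simp add: Tm'_def cmat2_eq_iff matmul_nth algebra_simps)

lemma conj_transpose_mult: "conj_transpose (A ** B) = conj_transpose B ** conj_transpose A"
  by (simp add: cmat2_eq_iff matmul_nth mult.commute)

lemma unitary_cancel:
  assumes "U ** conj_transpose U = mat 1"
  shows "(T ** F ** U) ** conj_transpose (T ** F ** U) = T ** (F ** conj_transpose F) ** conj_transpose T"
proof -
  have "(T ** F ** U) ** conj_transpose (T ** F ** U) = T ** F ** (U ** conj_transpose U) ** conj_transpose F ** conj_transpose T"
    by (simp add: conj_transpose_mult matrix_mul_assoc)
  then show ?thesis by (simp add: assms matrix_mul_assoc)
qed

lemma equiv_X: "equivariant tau tau' X0"
proof
  show "X0 (z - 1) = tau (X0 z)" if "z \<in> hstrip" for z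
    unfolding X0_def F0_shift[OF that] tau_def
    by (rule unitary_cancel) (use disc_kap_complex in \<open>simp add: cmat2_eq_iff matmul_nth mat_def add.commute\<close>)
  show "X0 (z - \<i>) = tau' (X0 z)" if "z \<in> vstrip" for z
    unfolding X0_def F0_shift'[OF that] tau'_def
    by (rule unitary_cancel) (use disc_kap_complex in \<open>simp add: cmat2_eq_iff matmul_nth mat_def add.commute\<close>)
qed (simp_all add: tau_eq cmat2_eq_iff)

lemma equiv_VV: "equivariant tau tau' VV0"
proof
  show "VV0 (z - 1) = tau (VV0 z)" if "z \<in> hstrip" for z
    by (simp add: VV0_def tau_eq VE_shift[OF that] cmat2_eq_iff)
  show "VV0 (z - \<i>) = tau' (VV0 z)" if "z \<in> vstrip" for z
    by (simp add: VV0_def tau_eq VE_shift'[OF that] cmat2_eq_iff)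
qed (simp_all add: tau_eq cmat2_eq_iff)

text \<open>The pair \<open>(A1, A2)\<close> is transformed by unitary matrices, which preserve
  \<open>norm2\<close>.\<close>

lemma equiv_phi: "equivariant id id phi0"
proof
  have *: "x = y" if "complex_of_real x = of_real y" for x y using that by simp
  show "phi0 (z - 1) = id (phi0 z)" if "z \<in> hstrip" for z
  proof (rule *)
    define d k where "d = complex_of_real (disc b 0)" and "k = complex_of_real kap"
    have c: "cnj d = d" "cnj k = k" by (auto simp: d_def k_def)
    have "complex_of_real (phi0 (z - 1)) = (d * d + k * k) * (A1 z * cnj (A1 z) + A2 z * cnj (A2 z))"
      unfolding phi0_def of_real_norm2 AB_shift[OF that] d_def[symmetric] k_def[symmetric]
      by (simp add: c algebra_simps)
    then show "complex_of_real (phi0 (z - 1)) = of_real (id (phi0 z))"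
      using disc_kap_complex by (simp add: d_def k_def phi0_def of_real_norm2)
  qed
  show "phi0 (z - \<i>) = id (phi0 z)" if "z \<in> vstrip" for z
  proof (rule *)
    define d k where "d = complex_of_real (disc b 0)" and "k = complex_of_real kap"
    have c: "cnj d = d" "cnj k = k" by (auto simp: d_def k_def)
    have "complex_of_real (phi0 (z - \<i>)) = (d * d + k * k) * (A1 z * cnj (A1 z) + A2 z * cnj (A2 z))"
      unfolding phi0_def of_real_norm2 AB_shift'[OF that] d_def[symmetric] k_def[symmetric]
      by (simp add: c algebra_simps)
    then show "complex_of_real (phi0 (z - \<i>)) = of_real (id (phi0 z))"
      using disc_kap_complex by (simp add: d_def k_def phi0_def of_real_norm2)
  qed
qed auto

text \<open>A left factor \<open>T\<close> changes \<open>Y\<close> but neither \<open>a1\<close>,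
  \<open>a2\<close> nor the Hopf differential, and a shift by a lattice vector preserves the
  coefficients. The second claim keeps \<open>Y2\<close> tied to the linear system, as the study of
  the ends requires.\<close>

lemma branch:
  assumes W: "open W" "\<And>z. z \<in> W \<Longrightarrow> z - \<gamma> \<in> cross" and \<gamma>: "\<gamma> \<in> gaussL" and T: "det T = 1"
  shows "bryant t (\<lambda>z. wp' z ^ 2) W (\<lambda>z. T ** F0 (z - \<gamma>)) (\<lambda>z. A1 (z - \<gamma>)) (\<lambda>z. A2 (z - \<gamma>))
      (\<lambda>z. T$1$1 * V1 (z - \<gamma>) + T$1$2 * V2 (z - \<gamma>)) (\<lambda>z. T$2$1 * V1 (z - \<gamma>) + T$2$2 * V2 (z - \<gamma>))"
    and "wsol b t W (\<lambda>z. T$2$1 * V1 (z - \<gamma>) + T$2$2 * V2 (z - \<gamma>)) (\<lambda>z. T$2$1 * E1 (z - \<gamma>) + T$2$2 * E2 (z - \<gamma>))"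
proof -
  have sh: "((\<lambda>z. f (z - \<gamma>)) has_field_derivative D) (at z)" if "(f has_field_derivative D) (at (z - \<gamma>))" for f D z
  proof -
    have "((\<lambda>z. f (z - \<gamma>)) has_field_derivative D * 1) (at z)"
      by (rule DERIV_chain2[where f = f]) (use that in \<open>auto intro!: derivative_eq_intros\<close>)
    then show ?thesis by simp
  qed
  have WL: "z - \<gamma> \<notin> gaussL" if "z \<in> W" for z using W(2)[OF that] cross_notin by blast
  have per: "wp (z - \<gamma>) = wp z" "wp' (z - \<gamma>) = wp' z" if "z \<in> W" for z
    using wp_periodic[OF \<gamma> WL[OF that]] deriv_wp_periodic[OF \<gamma> WL[OF that]] by auto
  have shol: "(\<lambda>z. f (z - \<gamma>)) holomorphic_on W" if "f holomorphic_on cross" for f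
  proof (subst holomorphic_on_open[OF W(1)], intro ballI)
    fix z assume "z \<in> W"
    then have "(f has_field_derivative deriv f (z - \<gamma>)) (at (z - \<gamma>))"
      using W(2) by (intro holomorphic_derivI[OF that cross(1)])
    then show "\<exists>f'. ((\<lambda>z. f (z - \<gamma>)) has_field_derivative f') (at z)" using sh by blast
  qed
  have holc: "A1 holomorphic_on cross" "A2 holomorphic_on cross" "B1 holomorphic_on cross" "B2 holomorphic_on cross"
    "V1 holomorphic_on cross" "V2 holomorphic_on cross" "E1 holomorphic_on cross" "E2 holomorphic_on cross"
    using AB_sol[THEN lin_sol_holomorphic(1)] AB_sol[THEN lin_sol_holomorphic(2)] cross(1) by auto
  have F0hol: "(\<lambda>z. F0 z $ i $ j) holomorphic_on cross" for i j
  proof -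
    have "\<forall>i j. (\<lambda>z. F0 z $ i $ j) holomorphic_on cross"
      unfolding forall_2 F0_def mat2_nth by (intro conjI holomorphic_intros holc)
    then show ?thesis by blast
  qed
  have F0d: "((\<lambda>w. F0 w $ i $ j) has_field_derivative mat_deriv F0 z $ i $ j) (at z)" if "z \<in> cross" for z i j
    unfolding mat_deriv_nth by (rule holomorphic_derivI[OF F0hol cross(1) that])
  have Fd: "mat_deriv (\<lambda>z. T ** F0 (z - \<gamma>)) z = T ** mat_deriv F0 (z - \<gamma>)" if "z \<in> W" for z
  proof -
    have "((\<lambda>w. (T ** F0 (w - \<gamma>)) $ i $ j) has_field_derivative (T ** mat_deriv F0 (z - \<gamma>)) $ i $ j) (at z)" for i j
      unfolding matmul_nth by (intro DERIV_add DERIV_cmult sh F0d W(2) that)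
    then show ?thesis by (auto simp: vec_eq_iff DERIV_imp_deriv)
  qed
  have wron: "A1 w * deriv A2 w - deriv A1 w * A2 w = wp' w ^ 2" if w: "w \<in> cross" for w
  proof -
    have d: "deriv A1 w = sysA b w * A1 w + sysC w * B1 w" "deriv A2 w = sysA b w * A2 w + sysC w * B2 w"
      using AB_sol w by (auto simp: lin_sol_def intro!: DERIV_imp_deriv)
    have "A1 w * deriv A2 w - deriv A1 w * A2 w = sysC w * (A1 w * B2 w - B1 w * A2 w)"
      unfolding d by (simp add: algebra_simps)
    then show ?thesis using AB_det(1)[OF w] by (simp add: sysC_def)
  qed
  show "bryant t (\<lambda>z. wp' z ^ 2) W (\<lambda>z. T ** F0 (z - \<gamma>)) (\<lambda>z. A1 (z - \<gamma>)) (\<lambda>z. A2 (z - \<gamma>))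
      (\<lambda>z. T$1$1 * V1 (z - \<gamma>) + T$1$2 * V2 (z - \<gamma>)) (\<lambda>z. T$2$1 * V1 (z - \<gamma>) + T$2$2 * V2 (z - \<gamma>))"
    unfolding bryant_def
  proof (intro conjI ballI)
    show "hol_mat W (\<lambda>z. T ** F0 (z - \<gamma>))"
      unfolding hol_mat_def matmul_nth by (intro allI holomorphic_intros shol F0hol)
    fix z assume zW: "z \<in> W"
    define w where "w = z - \<gamma>"
    have w: "w \<in> cross" using W(2)[OF zW] by (simp add: w_def)
    have det0: "det (F0 w) = 1"
    proof -
      have "det (F0 w) = (V1 w * E2 w - E1 w * V2 w) * (A1 w * B2 w - B1 w * A2 w)"
        by (simp add: det_2 F0_def algebra_simps)
      then show ?thesis by (simp add: AB_det[OF w])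
    qed
    then show "det (T ** F0 (z - \<gamma>)) = 1" by (simp add: det_mul T w_def)
    show "mat_deriv (\<lambda>z. T ** F0 (z - \<gamma>)) z = mat2
       (- of_real t * (T$1$1 * V1 (z - \<gamma>) + T$1$2 * V2 (z - \<gamma>)) * A2 (z - \<gamma>))
       (of_real t * (T$1$1 * V1 (z - \<gamma>) + T$1$2 * V2 (z - \<gamma>)) * A1 (z - \<gamma>))
       (- of_real t * (T$2$1 * V1 (z - \<gamma>) + T$2$2 * V2 (z - \<gamma>)) * A2 (z - \<gamma>))
       (of_real t * (T$2$1 * V1 (z - \<gamma>) + T$2$2 * V2 (z - \<gamma>)) * A1 (z - \<gamma>))"
      unfolding Fd[OF zW] w_def[symmetric] F0_deriv[OF w]
      by (simp add: cmat2_eq_iff matmul_nth algebra_simps)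
    have V: "F0 w $ 1 $ 1 * A1 w + F0 w $ 1 $ 2 * A2 w = V1 w" "F0 w $ 2 $ 1 * A1 w + F0 w $ 2 $ 2 * A2 w = V2 w"
    proof -
      have "F0 w $ 1 $ 1 * A1 w + F0 w $ 1 $ 2 * A2 w = V1 w * (A1 w * B2 w - B1 w * A2 w)"
        "F0 w $ 2 $ 1 * A1 w + F0 w $ 2 $ 2 * A2 w = V2 w * (A1 w * B2 w - B1 w * A2 w)"
        by (simp_all add: F0_def algebra_simps)
      then show "F0 w $ 1 $ 1 * A1 w + F0 w $ 1 $ 2 * A2 w = V1 w" "F0 w $ 2 $ 1 * A1 w + F0 w $ 2 $ 2 * A2 w = V2 w"
        by (simp_all add: AB_det[OF w])
    qed
    show "T$1$1 * V1 (z - \<gamma>) + T$1$2 * V2 (z - \<gamma>) =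
        (T ** F0 (z - \<gamma>)) $ 1 $ 1 * A1 (z - \<gamma>) + (T ** F0 (z - \<gamma>)) $ 1 $ 2 * A2 (z - \<gamma>)"
      "T$2$1 * V1 (z - \<gamma>) + T$2$2 * V2 (z - \<gamma>) =
        (T ** F0 (z - \<gamma>)) $ 2 $ 1 * A1 (z - \<gamma>) + (T ** F0 (z - \<gamma>)) $ 2 $ 2 * A2 (z - \<gamma>)"
      unfolding w_def[symmetric] V[symmetric] matmul_nth by (simp_all add: algebra_simps)
    have dA: "deriv (\<lambda>z. A1 (z - \<gamma>)) z = deriv A1 w" "deriv (\<lambda>z. A2 (z - \<gamma>)) z = deriv A2 w"
      unfolding w_def by (intro DERIV_imp_deriv sh holomorphic_derivI[OF _ cross(1)] holc w[unfolded w_def])+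
    show "A1 (z - \<gamma>) * deriv (\<lambda>z. A2 (z - \<gamma>)) z - deriv (\<lambda>z. A1 (z - \<gamma>)) z * A2 (z - \<gamma>) = wp' z ^ 2"
      unfolding dA w_def[symmetric] wron[OF w] using per[OF zW] by (simp add: w_def)
    show "A1 (z - \<gamma>) \<noteq> 0 \<or> A2 (z - \<gamma>) \<noteq> 0"
      using AB_det(1)[OF w] by (auto simp: w_def)
  qed (intro W holomorphic_intros shol holc)+
  have base: "wsol b t cross (\<lambda>z. T$2$1 * V1 z + T$2$2 * V2 z) (\<lambda>z. T$2$1 * E1 z + T$2$2 * E2 z)"
    by (rule lin_sol_comb[OF AB_sol(3,4)])
  show "wsol b t W (\<lambda>z. T$2$1 * V1 (z - \<gamma>) + T$2$2 * V2 (z - \<gamma>)) (\<lambda>z. T$2$1 * E1 (z - \<gamma>) + T$2$2 * E2 (z - \<gamma>))"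
    unfolding lin_sol_def
  proof (intro ballI conjI)
    fix z assume z: "z \<in> W"
    have s: "sysA b (z - \<gamma>) = sysA b z" "sysB b t (z - \<gamma>) = sysB b t z" "sysC (z - \<gamma>) = sysC z"
      using per[OF z] by (auto simp: sysA_def sysB_def sysC_def)
    note d = base[unfolded lin_sol_def, rule_format, OF W(2)[OF z], unfolded s]
    show "((\<lambda>z. T$2$1 * V1 (z - \<gamma>) + T$2$2 * V2 (z - \<gamma>)) has_field_derivative
      sysA b z * (T$2$1 * V1 (z - \<gamma>) + T$2$2 * V2 (z - \<gamma>)) + sysC z * (T$2$1 * E1 (z - \<gamma>) + T$2$2 * E2 (z - \<gamma>))) (at z)"
      "((\<lambda>z. T$2$1 * E1 (z - \<gamma>) + T$2$2 * E2 (z - \<gamma>)) has_field_derivative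
      sysB b t z * (T$2$1 * V1 (z - \<gamma>) + T$2$2 * V2 (z - \<gamma>)) - sysA b z * (T$2$1 * E1 (z - \<gamma>) + T$2$2 * E2 (z - \<gamma>))) (at z)"
      by (rule sh[OF conjunct1[OF d]], rule sh[OF conjunct2[OF d]])
  qed
qed

text \<open>Links the global objects \<open>X\<close>, \<open>phi\<close> and \<open>VV\<close> to
  one branch of the null lift. \<open>H2\<close> is the second component of the solution whose first
  component is \<open>Y2\<close>.\<close>

definition local_data :: "complex set \<Rightarrow> (complex \<Rightarrow> cmat2) \<Rightarrow>
    (complex \<Rightarrow> complex) \<Rightarrow> (complex \<Rightarrow> complex) \<Rightarrow> (complex \<Rightarrow> complex) \<Rightarrow> (complex \<Rightarrow> complex) \<Rightarrow> (complex \<Rightarrow> complex) \<Rightarrow> bool" where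
  "local_data W F a1 a2 Y1 Y2 H2 \<longleftrightarrow> W \<subseteq> - gaussL \<and> bryant t (\<lambda>z. wp' z ^ 2) W F a1 a2 Y1 Y2 \<and> wsol b t W Y2 H2 \<and>
     (\<forall>z\<in>W. X z = F z ** conj_transpose (F z) \<and> phi z = norm2 (a1 z) (a2 z) \<and>
        VV z = mat2 (Y1 z * cnj (Y1 z)) (Y1 z * cnj (Y2 z)) (Y2 z * cnj (Y1 z)) (Y2 z * cnj (Y2 z)))"

lemma local_data_aux:
  assumes W: "open W" "\<And>z. z \<in> W \<Longrightarrow> z - \<gamma> \<in> cross" and \<gamma>: "\<gamma> \<in> gaussL" and T: "det T = 1"
    and eq: "\<And>z. z \<in> W \<Longrightarrow> X z = T ** X0 (z - \<gamma>) ** conj_transpose T"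
      "\<And>z. z \<in> W \<Longrightarrow> VV z = T ** VV0 (z - \<gamma>) ** conj_transpose T" "\<And>z. z \<in> W \<Longrightarrow> phi z = phi0 (z - \<gamma>)"
  shows "\<exists>F a1 a2 Y1 Y2 H2. local_data W F a1 a2 Y1 Y2 H2"
proof -
  have WL: "W \<subseteq> - gaussL"
    using W(2) cross_notin gaussL_diff \<gamma> by blast
  have "local_data W (\<lambda>z. T ** F0 (z - \<gamma>)) (\<lambda>z. A1 (z - \<gamma>)) (\<lambda>z. A2 (z - \<gamma>))
      (\<lambda>z. T$1$1 * V1 (z - \<gamma>) + T$1$2 * V2 (z - \<gamma>)) (\<lambda>z. T$2$1 * V1 (z - \<gamma>) + T$2$2 * V2 (z - \<gamma>))
      (\<lambda>z. T$2$1 * E1 (z - \<gamma>) + T$2$2 * E2 (z - \<gamma>))"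
    unfolding local_data_def
  proof (intro conjI ballI WL branch[OF W \<gamma> T])
    fix z assume z: "z \<in> W"
    show "X z = T ** F0 (z - \<gamma>) ** conj_transpose (T ** F0 (z - \<gamma>))"
      unfolding eq(1)[OF z] X0_def conj_transpose_mult by (simp add: matrix_mul_assoc)
    show "phi z = norm2 (A1 (z - \<gamma>)) (A2 (z - \<gamma>))" unfolding eq(3)[OF z] phi0_def ..
    show "VV z = mat2
       ((T$1$1 * V1 (z - \<gamma>) + T$1$2 * V2 (z - \<gamma>)) * cnj (T$1$1 * V1 (z - \<gamma>) + T$1$2 * V2 (z - \<gamma>)))
       ((T$1$1 * V1 (z - \<gamma>) + T$1$2 * V2 (z - \<gamma>)) * cnj (T$2$1 * V1 (z - \<gamma>) + T$2$2 * V2 (z - \<gamma>)))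
       ((T$2$1 * V1 (z - \<gamma>) + T$2$2 * V2 (z - \<gamma>)) * cnj (T$1$1 * V1 (z - \<gamma>) + T$1$2 * V2 (z - \<gamma>)))
       ((T$2$1 * V1 (z - \<gamma>) + T$2$2 * V2 (z - \<gamma>)) * cnj (T$2$1 * V1 (z - \<gamma>) + T$2$2 * V2 (z - \<gamma>)))"
      unfolding eq(2)[OF z] VV0_def by (simp add: cmat2_eq_iff matmul_nth algebra_simps)
  qed
  then show ?thesis by blast
qed

lemma local_data_exists:
  assumes "z \<notin> gaussL"
  obtains W F a1 a2 Y1 Y2 H2 where "z \<in> W" "local_data W F a1 a2 Y1 Y2 H2"
proof -
  interpret eX: equivariant tau tau' X0 by (rule equiv_X)
  interpret eV: equivariant tau tau' VV0 by (rule equiv_VV)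
  interpret ep: equivariant id id phi0 by (rule equiv_phi)
  have dT: "det Tm = 1" "det Tm' = 1" "det (mat 1 :: cmat2) = 1"
    by (simp_all add: Tm_def Tm'_def det_2[of "mat2 _ _ _ _"] det_I)
  have c1: "conj_transpose (mat 1) = mat 1" by (simp add: cmat2_eq_iff mat_def)
  have tp: "tpow id n x = x" for n :: int and x :: real by (simp add: tpow_def)
  consider n where "z - \<i> * of_int n \<in> hstrip" | m where "z - of_int m \<in> vstrip"
    using eX.notin_gaussL_cases[OF assms] by metis
  then show ?thesis
  proof cases
    case 1
    define W where "W = (\<lambda>w. w - \<i> * of_int n) -` hstrip"
    \<comment> \<open>Up to sign the left factor depends only on the parity of \<open>n\<close>, in
      accordance with \<open>tpow\<close>.\<close>
    define T where "T = (if even n then mat 1 else Tm')"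
    have "\<exists>F a1 a2 Y1 Y2 H2. local_data W F a1 a2 Y1 Y2 H2"
    proof (rule local_data_aux[of W "\<i> * of_int n" T])
      show "open W" unfolding W_def by (intro open_vimage strips continuous_intros)
      show "w - \<i> * of_int n \<in> cross" if "w \<in> W" for w using that hstrip_subset by (auto simp: W_def)
      show "det T = 1" using dT by (simp add: T_def)
      fix w assume "w \<in> W"
      then have w: "w - \<i> * of_int n \<in> hstrip" by (simp add: W_def)
      show "X w = T ** X0 (w - \<i> * of_int n) ** conj_transpose T"
        unfolding X_def eX.glue_h[OF w] by (simp add: tpow_def T_def tau'_def c1)
      show "VV w = T ** VV0 (w - \<i> * of_int n) ** conj_transpose T"
        unfolding VV_def eV.glue_h[OF w] by (simp add: tpow_def T_def tau'_def c1)
      show "phi w = phi0 (w - \<i> * of_int n)"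
        unfolding phi_def ep.glue_h[OF w] by (simp add: tp)
    qed (simp add: gaussL_iff)
    moreover have "z \<in> W" using 1 by (simp add: W_def)
    ultimately show ?thesis using that by blast
  next
    case 2
    define W where "W = (\<lambda>w. w - of_int m) -` vstrip"
    define T where "T = (if even m then mat 1 else Tm)"
    have "\<exists>F a1 a2 Y1 Y2 H2. local_data W F a1 a2 Y1 Y2 H2"
    proof (rule local_data_aux[of W "of_int m" T])
      show "open W" unfolding W_def by (intro open_vimage strips continuous_intros)
      show "w - of_int m \<in> cross" if "w \<in> W" for w using that vstrip_subset by (auto simp: W_def)
      show "det T = 1" using dT by (simp add: T_def)
      fix w assume "w \<in> W"
      then have w: "w - of_int m \<in> vstrip" by (simp add: W_def)
      show "X w = T ** X0 (w - of_int m) ** conj_transpose T"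
        unfolding X_def eX.glue_v[OF w] by (simp add: tpow_def T_def tau_def c1)
      show "VV w = T ** VV0 (w - of_int m) ** conj_transpose T"
        unfolding VV_def eV.glue_v[OF w] by (simp add: tpow_def T_def tau_def c1)
      show "phi w = phi0 (w - of_int m)"
        unfolding phi_def ep.glue_v[OF w] by (simp add: tp)
    qed (simp add: gaussL_iff)
    moreover have "z \<in> W" using 2 by (simp add: W_def)
    ultimately show ?thesis using that by blast
  qed
qed

text \<open>A unit shift acts on \<open>X\<close> by \<open>tau\<close> or \<open>tau'\<close>,
  which are involutions different from the identity; this is why the torus is that of the doubled
  lattice.\<close>

lemma X_periodic:
  assumes "z \<notin> gaussL"
  shows "X (z + 2) = X z" "X (z + 2 * \<i>) = X z"
proof -
  interpret eX: equivariant tau tau' X0 by (rule equiv_X)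
  have n: "z + 1 \<notin> gaussL" "z + \<i> \<notin> gaussL" using assms gaussL_add_iff[of 1 z] gaussL_add_iff[of \<i> z] by (auto simp: gaussL_iff)
  have "X (z + 1 + 1) = X z" "X (z + \<i> + \<i>) = X z"
    unfolding X_def eX.glue_shift(1)[OF n(1)] eX.glue_shift(2)[OF n(2)] eX.glue_shift[OF assms] eX.inv by simp_all
  moreover have "z + 1 + 1 = z + 2" "z + \<i> + \<i> = z + 2 * \<i>" by simp_all
  ultimately show "X (z + 2) = X z" "X (z + 2 * \<i>) = X z" by (simp_all only:)
qed

lemma phi_periodic:
  assumes "z \<notin> gaussL" "w \<in> gaussL"
  shows "phi (z + w) = phi z"
proof -
  interpret ep: equivariant id id phi0 by (rule equiv_phi)
  have s: "phi (z + 1) = phi z" "phi (z + \<i>) = phi z" if "z \<notin> gaussL" for z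
    unfolding phi_def using ep.glue_shift[OF that] by auto
  have 1: "phi (z + of_int m) = phi z" if z: "z \<notin> gaussL" for z m
  proof (induction m rule: int_induct[of _ 0])
    case (step1 i)
    have "z + of_int i \<notin> gaussL" using z gaussL_add_iff[of "of_int i" z] by (simp add: gaussL_iff)
    from s(1)[OF this] step1 show ?case by (simp add: add.assoc)
  next
    case (step2 i)
    have "z + of_int (i - 1) \<notin> gaussL" using z gaussL_add_iff[of "of_int (i - 1)" z] by (simp add: gaussL_iff)
    from s(1)[OF this] step2 show ?case by simp
  qed simp
  have 2: "phi (z + \<i> * of_int m) = phi z" if z: "z \<notin> gaussL" for z m
  proof (induction m rule: int_induct[of _ 0])
    case (step1 i)
    have "z + \<i> * of_int i \<notin> gaussL" using z gaussL_add_iff[of "\<i> * of_int i" z] by (simp add: gaussL_iff)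
    from s(2)[OF this] step1 show ?case by (simp add: algebra_simps)
  next
    case (step2 i)
    have "z + \<i> * of_int (i - 1) \<notin> gaussL" using z gaussL_add_iff[of "\<i> * of_int (i - 1)" z] by (simp add: gaussL_iff)
    from s(2)[OF this] step2 show ?case by (simp add: algebra_simps)
  qed simp
  obtain m n where w: "w = of_int m + of_int n * \<i>" using assms(2) by (auto simp: lattice_def)
  have "z + of_int m \<notin> gaussL" using assms gaussL_add_iff[of "of_int m" z] by (simp add: gaussL_iff)
  from 2[OF this, of n] 1[OF assms(1), of m] show ?thesis by (simp add: w algebra_simps)
qed

end

section \<open>Growth at the lattice points\<close>

text \<open>\<open>\<rho>\<close> is the larger exponent in the variable \<open>u = wp z\<close> and
  \<open>m\<close> the difference of the two exponents. The bounds on \<open>m\<close> exclude the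
  values 2 and 4, at which a denominator of the recursion would vanish.\<close>

locale frobenius =
  fixes \<rho> m :: real
  assumes m: "5/2 \<le> m" "m \<le> 7/2" and rho: "\<rho> = (5/2 + m) / 2"
begin

text \<open>Coefficients of the hypergeometric series
  \<open>2F1(- \<rho>/2, 3/4 - \<rho>/2; 1 - m/2; x)\<close>.\<close>

primrec cf :: "nat \<Rightarrow> complex" where
  "cf 0 = 1"
| "cf (Suc n) = cf n * of_real ((\<rho> - 2 * real n) * (\<rho> - 2 * real n - 3/2) / (2 * real (Suc n) * (2 * real (Suc n) - m)))"

lemma denom_ge: "real (Suc n) / 4 \<le> \<bar>2 * real (Suc n) - m\<bar>"
proof -
  consider "n = 0" | "n = 1" | "n \<ge> 2" by linarith
  then show ?thesis using m by cases auto
qed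

text \<open>A ratio of consecutive coefficients has numerator at most \<open>25 (n+1)^2\<close> and
  denominator at least \<open>(n+1)^2 / 2\<close> in modulus.\<close>

lemma cf_bound: "norm (cf n) \<le> 50 ^ n"
proof (induction n)
  case (Suc n)
  have "\<bar>(\<rho> - 2 * real n) * (\<rho> - 2 * real n - 3/2)\<bar> \<le> (5 * real (Suc n)) * (5 * real (Suc n))"
  proof -
    have "\<bar>\<rho> - 2 * real n\<bar> \<le> 5 * real (Suc n)" "\<bar>\<rho> - 2 * real n - 3/2\<bar> \<le> 5 * real (Suc n)"
      using m unfolding rho abs_le_iff by (simp_all add: field_simps)
    then show ?thesis unfolding abs_mult by (intro mult_mono) auto
  qed
  moreover have "2 * real (Suc n) * (real (Suc n) / 4) \<le> \<bar>2 * real (Suc n) * (2 * real (Suc n) - m)\<bar>"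
    unfolding abs_mult using denom_ge[of n] by (intro mult_mono) auto
  ultimately have "\<bar>(\<rho> - 2 * real n) * (\<rho> - 2 * real n - 3/2)\<bar> / \<bar>2 * real (Suc n) * (2 * real (Suc n) - m)\<bar>
      \<le> (5 * real (Suc n)) * (5 * real (Suc n)) / (2 * real (Suc n) * (real (Suc n) / 4))"
    by (intro frac_le) auto
  also have "\<dots> = 50" by (simp del: of_nat_Suc)
  finally have le: "\<bar>(\<rho> - 2 * real n) * (\<rho> - 2 * real n - 3/2)\<bar> / \<bar>2 * real (Suc n) * (2 * real (Suc n) - m)\<bar> \<le> 50" .
  have "norm (cf (Suc n)) \<le> 50 ^ n * 50"
    unfolding cf.simps norm_mult norm_of_real abs_divide by (rule mult_mono[OF Suc le]) simp_all
  then show ?case by simp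
qed simp

definition f0 :: "complex fps" where "f0 = Abs_fps cf"
definition f1 :: "complex fps" where "f1 = fps_X * fps_deriv f0"
definition f2 :: "complex fps" where "f2 = fps_X * fps_deriv f1"

lemma fps_nths: "fps_nth f0 n = cf n" "fps_nth f1 n = of_nat n * cf n" "fps_nth f2 n = of_nat n * (of_nat n * cf n)"
proof -
  show 0: "fps_nth f0 n = cf n" for n by (simp add: f0_def)
  show 1: "fps_nth f1 n = of_nat n * cf n" for n
    by (cases n) (simp_all add: f1_def 0 del: cf.simps(2) of_nat_Suc)
  show "fps_nth f2 n = of_nat n * (of_nat n * cf n)"
    by (cases n) (simp_all add: f2_def 1 del: cf.simps(2) of_nat_Suc)
qed

lemma radius: "fps_conv_radius f0 \<ge> ereal (1/100)" "fps_conv_radius f1 \<ge> ereal (1/100)" "fps_conv_radius f2 \<ge> ereal (1/100)"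
proof -
  have "summable (\<lambda>n. cf n * (1/100) ^ n)"
  proof (rule summable_comparison_test')
    show "summable (\<lambda>n. (1/2::real) ^ n)" by (rule summable_geometric) simp
    fix n :: nat
    have "norm (cf n * (1/100) ^ n) \<le> 50 ^ n * (1/100) ^ n"
      unfolding norm_mult norm_power using cf_bound[of n] by (intro mult_mono) auto
    also have "\<dots> = (1/2) ^ n" by (simp flip: power_mult_distrib)
    finally show "norm (cf n * (1/100) ^ n) \<le> (1/2) ^ n" .
  qed
  from conv_radius_geI[OF this] show 0: "fps_conv_radius f0 \<ge> ereal (1/100)"
    by (simp add: fps_conv_radius_def fps_nths(1)[abs_def])
  have step: "fps_conv_radius (fps_X * fps_deriv f) \<ge> ereal (1/100)" if "fps_conv_radius f \<ge> ereal (1/100)" for f :: "complex fps"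
    by (rule order_trans[OF _ fps_conv_radius_mult]) (simp add: order_trans[OF that fps_conv_radius_deriv])
  show 1: "fps_conv_radius f1 \<ge> ereal (1/100)" unfolding f1_def by (rule step[OF 0])
  show "fps_conv_radius f2 \<ge> ereal (1/100)" unfolding f2_def by (rule step[OF 1])
qed

lemma in_radius:
  assumes "norm (x::complex) < 1/100"
  shows "ereal (norm x) < fps_conv_radius f0" "ereal (norm x) < fps_conv_radius f1" "ereal (norm x) < fps_conv_radius f2"
proof -
  have *: "ereal (norm x) < ereal (1/100)" using assms by simp
  show "ereal (norm x) < fps_conv_radius f0" "ereal (norm x) < fps_conv_radius f1" "ereal (norm x) < fps_conv_radius f2"
    by (rule less_le_trans[OF * radius(1)], rule less_le_trans[OF * radius(2)], rule less_le_trans[OF * radius(3)])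
qed

lemma eval_derivs:
  assumes x: "norm (x::complex) < 1/100"
  obtains d0 d1 where "(eval_fps f0 has_field_derivative d0) (at x)" "x * d0 = eval_fps f1 x"
    "(eval_fps f1 has_field_derivative d1) (at x)" "x * d1 = eval_fps f2 x"
proof -
  have e: "x * eval_fps (fps_deriv f) x = eval_fps (fps_X * fps_deriv f) x"
    if "ereal (norm x) < fps_conv_radius f" for f :: "complex fps"
    using eval_fps_mult[of x fps_X "fps_deriv f"] less_le_trans[OF that fps_conv_radius_deriv] by simp
  show ?thesis
    by (rule that[OF has_field_derivative_eval_fps[OF in_radius(1)[OF x]] _
          has_field_derivative_eval_fps[OF in_radius(2)[OF x]]])
       (unfold e[OF in_radius(1)[OF x]] e[OF in_radius(2)[OF x]] f1_def[symmetric] f2_def[symmetric], rule refl, rule refl)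
qed

text \<open>The hypergeometric equation in terms of the Euler operator \<open>x d/dx\<close>, whose
  first and second powers produce \<open>f1\<close> and \<open>f2\<close> from \<open>f0\<close>.
  The coefficient of \<open>x ^ Suc n\<close> is the recursion of \<open>cf\<close>; the constant
  term is 0 on both sides.\<close>

lemma eval_ode:
  assumes x: "norm (x::complex) < 1/100"
  shows "4 * eval_fps f2 x - 2 * of_real m * eval_fps f1 x =
    x * (of_real (\<rho> * (\<rho> - 3/2)) * eval_fps f0 x - of_real (4 * \<rho> - 3) * eval_fps f1 x + 4 * eval_fps f2 x)"
proof -
  note s = sums_eval_fps[OF in_radius(1)[OF x], unfolded fps_nths] sums_eval_fps[OF in_radius(2)[OF x], unfolded fps_nths]
    sums_eval_fps[OF in_radius(3)[OF x], unfolded fps_nths]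
  let ?l = "\<lambda>n. 4 * (of_nat n * (of_nat n * cf n) * x ^ n) - 2 * of_real m * (of_nat n * cf n * x ^ n)"
  let ?r = "\<lambda>n. x * (of_real (\<rho> * (\<rho> - 3/2)) * (cf n * x ^ n) - of_real (4 * \<rho> - 3) * (of_nat n * cf n * x ^ n)
      + 4 * (of_nat n * (of_nat n * cf n) * x ^ n))"
  have l: "?l sums (4 * eval_fps f2 x - 2 * of_real m * eval_fps f1 x)"
    by (intro sums_diff sums_mult s)
  have r: "?r sums (x * (of_real (\<rho> * (\<rho> - 3/2)) * eval_fps f0 x - of_real (4 * \<rho> - 3) * eval_fps f1 x + 4 * eval_fps f2 x))"
    by (intro sums_diff sums_mult sums_add s)
  have "?l (Suc n) = ?r n" for n
  proof -
    define N :: complex where "N = of_nat (Suc n)"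
    define M where "M = complex_of_real m"
    define R where "R = complex_of_real \<rho>"
    have "2 * real (Suc n) - m \<noteq> 0" using denom_ge[of n] by auto
    moreover have "2 * N - M = complex_of_real (2 * real (Suc n) - m)" by (simp add: N_def M_def)
    ultimately have nz: "2 * N - M \<noteq> 0" by (simp only: of_real_eq_0_iff not_False_eq_True)
    have N0: "N \<noteq> 0" unfolding N_def by (metis of_nat_eq_0_iff nat.distinct(2))
    have n: "of_nat n = N - 1" by (simp add: N_def)
    have c: "cf (Suc n) = cf n * ((R - 2 * (N - 1)) * (R - 2 * (N - 1) - 3/2) / (2 * N * (2 * N - M)))"
      unfolding n[symmetric] by (simp add: R_def M_def N_def)
    have "?l (Suc n) = 2 * N * (2 * N - M) * cf (Suc n) * x ^ Suc n"
      unfolding N_def[symmetric] M_def[symmetric] by (simp add: algebra_simps del: cf.simps)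
    also have "\<dots> = (R - 2 * (N - 1)) * (R - 2 * (N - 1) - 3/2) * cf n * x ^ Suc n"
      unfolding c using N0 nz by simp
    also have "\<dots> = ?r n"
      unfolding n by (simp add: R_def algebra_simps)
    finally show ?thesis .
  qed
  then have eq: "(\<lambda>n. ?l (Suc n)) = ?r" by (rule ext)
  have "(\<lambda>n. ?l (Suc n)) sums (x * (of_real (\<rho> * (\<rho> - 3/2)) * eval_fps f0 x - of_real (4 * \<rho> - 3) * eval_fps f1 x + 4 * eval_fps f2 x))"
    unfolding eq by (rule r)
  from sums_unique2[OF l sums_Suc[OF this]] show ?thesis
    by (simp only: of_nat_0 mult_zero_left mult_zero_right diff_zero add_0_right diff_self)
qed

end

definition half_disc :: "real \<Rightarrow> complex set" where
  "half_disc \<delta> = {z. 0 < Re z} \<inter> ball 0 \<delta>"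

lemma half_disc: "open (half_disc \<delta>)" "convex (half_disc \<delta>)" "z \<in> half_disc \<delta> \<Longrightarrow> z \<noteq> 0"
  unfolding half_disc_def by (auto intro!: open_Int convex_Int open_halfspace_Re_gt convex_halfspace_Re_gt)

lemma half_disc_vstrip: "\<delta> \<le> 1 \<Longrightarrow> half_disc \<delta> \<subseteq> vstrip"
proof
  fix z assume \<delta>: "\<delta> \<le> 1" and "z \<in> half_disc \<delta>"
  then have "0 < Re z" "norm z < \<delta>" by (auto simp: half_disc_def)
  then show "z \<in> vstrip" using complex_Re_le_cmod[of z] \<delta> by (simp add: vstrip_def)
qed

text \<open>The dominant solution for \<open>t = 0\<close> at a puncture: in the coordinate \<open>u = wp z\<close> it is
  \<open>u powr \<rho>\<close> times a power series in \<open>x = wp_e\<^sup>2 / u\<^sup>2\<close>, where \<open>\<rho>\<close> is the larger root of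
  \<open>\<rho>\<^sup>2 - 5/2 \<rho> = b wp_e\<^sup>2\<close>.\<close>

theorem growing_solution:
  assumes b: "0 \<le> b" "b \<le> bmax"
  obtains \<delta> \<psi> \<eta> where "0 < \<delta>" "\<delta> \<le> 1/2" "wsol b 0 (half_disc \<delta>) \<psi> \<eta>"
    "\<And>z. z \<in> half_disc \<delta> \<Longrightarrow> 1 / (8 * norm z ^ 4) \<le> norm (\<psi> z)"
proof -
  define \<kappa> where "\<kappa> = b * wp_e ^ 2"
  define m where "m = sqrt (25/4 + 4 * \<kappa>)"
  define \<rho> where "\<rho> = (5/2 + m) / 2"
  have kap: "0 \<le> \<kappa>" "\<kappa> \<le> 3/2"
    using b wp_e_nonzero by (auto simp: \<kappa>_def bmax_def field_simps)
  have m2: "m ^ 2 = 25/4 + 4 * \<kappa>" using kap by (simp add: m_def)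
  have "sqrt ((5/2)\<^sup>2) \<le> m" "m \<le> sqrt ((7/2)\<^sup>2)"
    unfolding m_def using kap by (auto intro!: real_sqrt_le_mono simp: power2_eq_square)
  then have m: "5/2 \<le> m" "m \<le> 7/2" by (simp_all add: real_sqrt_abs)
  interpret frobenius \<rho> m by unfold_locales (use m in \<open>auto simp: \<rho>_def\<close>)
  have rhoeq: "\<rho> ^ 2 - 5/2 * \<rho> = \<kappa>"
    using m2 by (simp add: \<rho>_def power2_eq_square field_simps)
  have rho2: "\<rho> \<ge> 2" using m by (simp add: \<rho>_def)
  define a2 where "a2 = complex_of_real wp_e ^ 2"
  have c0: "isCont (eval_fps f0) 0"
    using has_field_derivative_eval_fps[OF in_radius(1), of 0 UNIV] DERIV_isCont by auto
  have "\<forall>\<^sub>F x in at 0. dist (eval_fps f0 x) (eval_fps f0 0) < 1/2"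
    using c0 unfolding isCont_def by (rule tendstoD) simp
  then obtain x0 where x0: "x0 > 0" "\<And>x. x \<noteq> 0 \<Longrightarrow> dist x 0 < x0 \<Longrightarrow> dist (eval_fps f0 x) (eval_fps f0 0) < 1/2"
    by (auto simp: eventually_at)
  have f0ge: "1/2 \<le> norm (eval_fps f0 x)" if "norm x < x0" for x
  proof -
    have e0: "eval_fps f0 0 = 1" by (simp add: eval_fps_at_0 fps_nths)
    show ?thesis
    proof (cases "x = 0")
      case False
      then have "norm (eval_fps f0 x - 1) < 1/2" using x0(2)[of x] that by (simp add: e0 dist_norm)
      then show ?thesis using norm_triangle_ineq2[of 1 "1 - eval_fps f0 x"] by (simp add: norm_minus_commute)
    qed (simp add: e0)
  qed
  have "isCont wp_reg 0" using wp_tail_deriv[of 0 "1/2"] DERIV_isCont by auto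
  then have "\<forall>\<^sub>F x in at 0. dist (wp_reg x) (wp_reg 0) < 1"
    unfolding isCont_def by (rule tendstoD) simp
  then obtain r0 where r0: "r0 > 0" "\<And>x. x \<noteq> 0 \<Longrightarrow> dist x 0 < r0 \<Longrightarrow> norm (wp_reg x) < 1"
    by (auto simp: eventually_at wp_reg_0)
  \<comment> \<open>On the half disc the modulus of \<open>wp z\<close> is at least
    \<open>1 / (2 norm z ^ 2)\<close>, so that of \<open>wp_e^2 / wp^2\<close> is at most
    \<open>4 wp_e^2 norm z ^ 4\<close>, which is less than \<open>K * \<delta> \<le> y\<close>.
    Below \<open>y\<close> the power series converges and \<open>f0\<close> has modulus at least
    \<open>1/2\<close>.\<close>
  define K where "K = 4 * wp_e ^ 2 + 1"
  define y where "y = min x0 (1/100)"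
  define \<delta> where "\<delta> = min (1/2) (min r0 (y / K))"
  have Kp: "K \<ge> 1" "y > 0" "y \<le> 1/100" "y \<le> x0" using x0(1) by (auto simp: K_def y_def)
  have \<delta>: "0 < \<delta>" "\<delta> \<le> 1/2" "\<delta> \<le> r0" "\<delta> \<le> y / K" 
  proof -
    show "0 < \<delta>" using r0(1) Kp by (simp add: \<delta>_def)
    show "\<delta> \<le> 1/2" unfolding \<delta>_def by (rule min.cobounded1)
    show "\<delta> \<le> r0" unfolding \<delta>_def by (rule min.coboundedI2[OF min.cobounded1])
    show "\<delta> \<le> y / K" unfolding \<delta>_def by (rule min.coboundedI2[OF min.cobounded2])
  qed
  let ?H = "half_disc \<delta>"
  have zH: "z \<noteq> 0" "norm z < \<delta>" "0 < Re z" "z \<notin> gaussL" "norm z < 1/2" "norm (wp_reg z) < 1" if "z \<in> ?H" for z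
  proof -
    have z: "0 < Re z" "norm z < \<delta>" using that by (auto simp: half_disc_def)
    then show z0: "z \<noteq> 0" by auto
    show "norm z < \<delta>" "0 < Re z" by (rule z(2), rule z(1))
    show "norm z < 1/2" using z \<delta> by linarith
    then show "z \<notin> gaussL" using z0 by (intro small_not_gaussL) auto
    show "norm (wp_reg z) < 1" using r0(2)[OF z0] z \<delta> by simp
  qed
  have small: "norm (z ^ 2 * wp_reg z) \<le> 1/4" if z: "z \<in> ?H" for z
  proof -
    have "norm z ^ 2 \<le> (1/2) ^ 2" using zH(5)[OF z] by (intro power_mono) auto
    then have "norm z ^ 2 * norm (wp_reg z) \<le> (1/2) ^ 2 * 1" using zH(6)[OF z] by (intro mult_mono) auto
    then show ?thesis by (simp add: norm_mult norm_power power2_eq_square)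
  qed
  have u_eq: "wp z = (1 + z ^ 2 * wp_reg z) / z ^ 2" if z: "z \<in> ?H" for z
    using wp_near_0[of z] zH[OF z] by (simp add: field_simps)
  have nz1: "1 + z ^ 2 * wp_reg z \<notin> \<real>\<^sub>\<le>\<^sub>0" if z: "z \<in> ?H" for z
  proof -
    have "\<bar>Re (z ^ 2 * wp_reg z)\<bar> \<le> 1/4" using small[OF z] abs_Re_le_cmod order_trans by blast
    then show ?thesis by (auto simp: complex_nonpos_Reals_iff)
  qed
  have u_ge: "1 / (2 * norm z ^ 2) \<le> norm (wp z)" if z: "z \<in> ?H" for z
  proof -
    have "1/2 \<le> norm (1 + z ^ 2 * wp_reg z)"
      using norm_triangle_ineq2[of 1 "- (z ^ 2 * wp_reg z)"] small[OF z] by simp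
    then show ?thesis
      unfolding u_eq[OF z] norm_divide norm_power using zH(1)[OF z] by (simp add: field_simps)
  qed
  have u1: "1 \<le> norm (wp z)" if z: "z \<in> ?H" for z
  proof -
    have "norm z ^ 2 \<le> (1/2) ^ 2" using zH(5)[OF z] by (intro power_mono) auto
    then have "1 \<le> 1 / (2 * norm z ^ 2)" using zH(1)[OF z] by (simp add: field_simps power2_eq_square)
    then show ?thesis using u_ge[OF z] by linarith
  qed
  then have u0: "wp z \<noteq> 0" if z: "z \<in> ?H" for z using that by force
  define X where "X = (\<lambda>z. a2 / wp z ^ 2)"
  have Xs: "norm (X z) < y" if z: "z \<in> ?H" for z
  proof -
    have zp: "0 < norm z" using zH(1)[OF z] by simp
    have "norm (X z) = wp_e ^ 2 / norm (wp z) ^ 2"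
      by (simp add: X_def a2_def norm_divide norm_power)
    also have "\<dots> \<le> wp_e ^ 2 / (1 / (2 * norm z ^ 2)) ^ 2"
      using u_ge[OF z] zp by (intro divide_left_mono power_mono mult_pos_pos zero_less_power) (use u0[OF z] in auto)
    also have "\<dots> = 4 * wp_e ^ 2 * norm z ^ 4"
      using zp by (simp add: field_simps power2_eq_square power4_eq_xxxx)
    also have "\<dots> \<le> 4 * wp_e ^ 2 * norm z"
    proof (intro mult_left_mono)
      have "norm z ^ 4 \<le> norm z ^ 1" using zH(5)[OF z] by (intro power_decreasing) auto
      then show "norm z ^ 4 \<le> norm z" by simp
    qed simp
    also have "\<dots> < K * \<delta>"
      using zp zH(2)[OF z] by (intro mult_less_le_imp_less) (auto simp: K_def)
    also have "\<dots> \<le> y" using \<delta>(4) Kp by (simp add: field_simps)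
    finally show ?thesis .
  qed
  have X100: "norm (X z) < 1/100" "norm (X z) < x0" if "z \<in> ?H" for z using Xs[OF that] Kp by auto
  have p_eq: "wp' z ^ 2 = 4 * wp z ^ 3 * (1 - X z)" "deriv wp' z = wp z ^ 2 * (6 - 2 * X z)" if z: "z \<in> ?H" for z
    unfolding wp_ode[OF zH(4)[OF z]] using u0[OF z]
    by (simp_all add: X_def a2_def field_simps power2_eq_square power3_eq_cube)
  have p0: "wp' z \<noteq> 0" if z: "z \<in> ?H" for z
  proof
    assume "wp' z = 0"
    then have "X z = 1" using p_eq(1)[OF z] u0[OF z] by simp
    then show False using X100(1)[OF z] by simp
  qed
  \<comment> \<open>A holomorphic logarithm of \<open>wp\<close>, needed for the power
    \<open>\<rho>\<close>, which is in general not integral. It is single-valued on the half disc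
    but not around the puncture.\<close>
  define L where "L = (\<lambda>z. - 2 * Ln z + Ln (1 + z ^ 2 * wp_reg z))"
  have expL: "exp (L z) = wp z" if z: "z \<in> ?H" for z
  proof -
    have "1 + z ^ 2 * wp_reg z \<noteq> 0" using nz1[OF z] by auto
    moreover have "exp (- 2 * Ln z) = 1 / z ^ 2"
      using zH(1)[OF z] by (simp add: exp_minus exp_double inverse_eq_divide)
    ultimately show ?thesis unfolding L_def exp_add u_eq[OF z] by simp
  qed
  have holL: "L holomorphic_on ?H"
  proof -
    have r: "wp_reg holomorphic_on ?H"
      by (rule holomorphic_on_subset[OF wp_reg_holomorphic]) (use zH(5) in auto)
    have "z \<notin> \<real>\<^sub>\<le>\<^sub>0" if "z \<in> ?H" for z using zH(3)[OF that] by (auto simp: complex_nonpos_Reals_iff)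
    then have 1: "Ln holomorphic_on ?H" by (intro holomorphic_on_Ln) auto
    have "(\<lambda>z. 1 + z ^ 2 * wp_reg z) holomorphic_on ?H" by (intro holomorphic_intros r)
    then have "(Ln \<circ> (\<lambda>z. 1 + z ^ 2 * wp_reg z)) holomorphic_on ?H"
      by (rule holomorphic_on_compose) (use nz1 in \<open>auto intro!: holomorphic_on_Ln\<close>)
    then show ?thesis unfolding L_def o_def by (intro holomorphic_on_add holomorphic_on_mult holomorphic_on_const 1)
  qed
  have dL: "(L has_field_derivative wp' z / wp z) (at z)" if z: "z \<in> ?H" for z
  proof -
    obtain d where d: "(L has_field_derivative d) (at z)"
      using holL z by (auto simp: holomorphic_on_open half_disc(1))
    have "((\<lambda>z. exp (L z)) has_field_derivative exp (L z) * d) (at z)"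
      by (rule DERIV_chain2[OF DERIV_exp d])
    then have "(wp has_field_derivative exp (L z) * d) (at z)"
      by (rule has_field_derivative_transform_within_open[where S = ?H]) (use half_disc z expL in auto)
    from DERIV_unique[OF this wp_DERIV[OF zH(4)[OF z]]] have "wp z * d = wp' z" by (simp add: expL[OF z])
    then have "d = wp' z / wp z" using u0[OF z] by (simp add: field_simps)
    then show ?thesis using d by simp
  qed
  have dX: "(X has_field_derivative - 2 * X z * (wp' z / wp z)) (at z)" if z: "z \<in> ?H" for z
  proof -
    have sq: "((\<lambda>z. wp z ^ 2) has_field_derivative of_nat 2 * (wp' z * wp z ^ (2 - 1))) (at z)"
      by (rule DERIV_cong[OF DERIV_power[OF wp_DERIV[OF zH(4)[OF z]]]]) simp
    have "(X has_field_derivative (0 * wp z ^ 2 - a2 * (of_nat 2 * (wp' z * wp z ^ (2 - 1)))) / (wp z ^ 2 * wp z ^ 2)) (at z)"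
      unfolding X_def by (rule DERIV_divide[OF DERIV_const sq]) (use u0[OF z] in simp)
    then show ?thesis
      by (rule DERIV_cong) (use u0[OF z] in \<open>simp add: X_def field_simps power2_eq_square power3_eq_cube\<close>)
  qed
  define E where "E = (\<lambda>z. exp (of_real \<rho> * L z))"
  have dE: "(E has_field_derivative of_real \<rho> * (wp' z / wp z) * E z) (at z)" if z: "z \<in> ?H" for z
    unfolding E_def
    by (rule DERIV_cong[OF DERIV_chain2[OF DERIV_exp DERIV_cmult[OF dL[OF z]]]]) simp
  define F0 F1 F2 where "F0 = (\<lambda>z. eval_fps f0 (X z))" and "F1 = (\<lambda>z. eval_fps f1 (X z))" and "F2 = (\<lambda>z. eval_fps f2 (X z))"
  have dF: "(F0 has_field_derivative - 2 * (wp' z / wp z) * F1 z) (at z)"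
    "(F1 has_field_derivative - 2 * (wp' z / wp z) * F2 z) (at z)" if z: "z \<in> ?H" for z
  proof -
    obtain d0 d1 where d: "(eval_fps f0 has_field_derivative d0) (at (X z))" "X z * d0 = F1 z"
      "(eval_fps f1 has_field_derivative d1) (at (X z))" "X z * d1 = F2 z"
      using eval_derivs[OF X100(1)[OF z]] unfolding F1_def F2_def by metis
    show "(F0 has_field_derivative - 2 * (wp' z / wp z) * F1 z) (at z)"
      unfolding F0_def by (rule DERIV_cong[OF DERIV_chain2[OF d(1) dX[OF z]]]) (simp add: d(2)[symmetric])
    show "(F1 has_field_derivative - 2 * (wp' z / wp z) * F2 z) (at z)"
      unfolding F1_def by (rule DERIV_cong[OF DERIV_chain2[OF d(3) dX[OF z]]]) (simp add: d(4)[symmetric])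
  qed
  define R where "R = complex_of_real \<rho>"
  define \<psi> where "\<psi> = (\<lambda>z. E z * F0 z)"
  \<comment> \<open>With \<open>u = wp z\<close> as variable, \<open>g\<close> and \<open>h\<close>
    are the first and second images of \<open>\<psi>\<close> under the Euler operator
    \<open>u d/du\<close>; it acts as \<open>\<rho>\<close> on \<open>E\<close> and as
    \<open>-2 x d/dx\<close> on functions of \<open>x\<close>.\<close>
  define g where "g = (\<lambda>z. E z * (R * F0 z - 2 * F1 z))"
  define h where "h = (\<lambda>z. E z * (R ^ 2 * F0 z - 4 * R * F1 z + 4 * F2 z))"
  have dpsi: "(\<psi> has_field_derivative (wp' z / wp z) * g z) (at z)" if z: "z \<in> ?H" for z
    unfolding \<psi>_def
    by (rule DERIV_cong[OF DERIV_mult[OF dE[OF z] dF(1)[OF z]]]) (simp add: g_def R_def algebra_simps add_divide_distrib diff_divide_distrib)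
  have dg: "(g has_field_derivative (wp' z / wp z) * h z) (at z)" if z: "z \<in> ?H" for z
    unfolding g_def
    by (rule DERIV_cong[OF DERIV_mult[OF dE[OF z] DERIV_diff[OF DERIV_cmult[OF dF(1)[OF z]] DERIV_cmult[OF dF(2)[OF z]]]]])
       (simp add: h_def R_def algebra_simps power2_eq_square add_divide_distrib diff_divide_distrib)
  define B where "B = complex_of_real b"
  \<comment> \<open>Obtained by solving the first equation of the system for
    \<open>\<eta>\<close>.\<close>
  define \<eta> where "\<eta> = (\<lambda>z. (g z / wp z + B * (wp z * \<psi> z)) / wp' z)"
  have Ba2: "B * a2 = of_real \<kappa>" by (simp add: B_def a2_def \<kappa>_def)
  \<comment> \<open>The second-order equation for \<open>\<psi>\<close> in the variable
    \<open>u\<close>. The left side is the indicial part; \<open>rhoeq\<close> and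
    \<open>m = 2 \<rho> - 5/2\<close> reduce it to a multiple of the left side of
    \<open>eval_ode\<close>.\<close>
  have key: "4 * h z - 10 * g z - 4 * of_real \<kappa> * \<psi> z = X z * (4 * h z - 6 * g z)" if z: "z \<in> ?H" for z
  proof -
    have RR: "R ^ 2 - 5/2 * R = of_real \<kappa>" unfolding R_def rhoeq[symmetric] by simp
    have M: "complex_of_real m = 2 * R - 5/2" by (simp add: R_def \<rho>_def field_simps)
    have "4 * h z - 10 * g z - 4 * of_real \<kappa> * \<psi> z = E z * (4 * (R ^ 2 - 5/2 * R - of_real \<kappa>) * F0 z
        + 4 * (4 * F2 z - 2 * of_real m * F1 z))"
      unfolding M by (simp add: h_def g_def \<psi>_def algebra_simps)
    also have "\<dots> = E z * (4 * (4 * F2 z - 2 * of_real m * F1 z))" unfolding RR by simp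
    also have "4 * F2 z - 2 * of_real m * F1 z =
        X z * (of_real (\<rho> * (\<rho> - 3/2)) * F0 z - of_real (4 * \<rho> - 3) * F1 z + 4 * F2 z)"
      unfolding F0_def F1_def F2_def by (rule eval_ode[OF X100(1)[OF z]])
    also have "E z * (4 * (X z * (of_real (\<rho> * (\<rho> - 3/2)) * F0 z - of_real (4 * \<rho> - 3) * F1 z + 4 * F2 z)))
        = X z * (4 * h z - 6 * g z)"
      by (simp add: h_def g_def R_def algebra_simps power2_eq_square)
    finally show ?thesis .
  qed
  have "wsol b 0 ?H \<psi> \<eta>"
    unfolding lin_sol_def
  proof (intro ballI conjI)
    fix z assume z: "z \<in> ?H"
    define u p where "u = wp z" and "p = wp' z"
    have nz: "u \<noteq> 0" "p \<noteq> 0" using u0[OF z] p0[OF z] by (auto simp: u_def p_def)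
    have psi': "sysA b z * \<psi> z + sysC z * \<eta> z = (wp' z / wp z) * g z"
      using nz by (simp add: sysA_def sysC_def \<eta>_def B_def u_def[symmetric] p_def[symmetric] field_simps power2_eq_square)
    then show "(\<psi> has_field_derivative sysA b z * \<psi> z + sysC z * \<eta> z) (at z)"
      using dpsi[OF z] by simp
    have dp: "(wp' has_field_derivative deriv wp' z) (at z)" by (rule wp'_DERIV[OF zH(4)[OF z]])
    have d: "(\<eta> has_field_derivative
       (((p / u * h z * u - g z * p) / (u * u) + B * (p * \<psi> z + (p / u * g z) * u)) * p
          - (g z / u + B * (u * \<psi> z)) * deriv wp' z) / (p * p)) (at z)"
      unfolding \<eta>_def u_def p_def
      by (intro DERIV_divide DERIV_add DERIV_cmult DERIV_mult dp dg dpsi wp_DERIV zH(4) z)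
         (use nz in \<open>auto simp: u_def p_def\<close>)
    have "((p / u * h z * u - g z * p) / (u * u) + B * (p * \<psi> z + (p / u * g z) * u)) * p
          - (g z / u + B * (u * \<psi> z)) * deriv wp' z
       = (sysB b 0 z * \<psi> z - sysA b z * \<eta> z) * (p * p)"
    proof -
      define x where "x = X z"
      have x: "a2 = x * u ^ 2" using nz by (simp add: x_def X_def u_def)
      have p2: "p * p = 4 * u ^ 3 * (1 - x)" using p_eq(1)[OF z] by (simp add: p_def u_def x_def power2_eq_square)
      have u'': "deriv wp' z = u ^ 2 * (6 - 2 * x)" using p_eq(2)[OF z] by (simp add: u_def x_def)
      have "((p / u * h z * u - g z * p) / (u * u) + B * (p * \<psi> z + (p / u * g z) * u)) * p
          - (g z / u + B * (u * \<psi> z)) * deriv wp' z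
         = (h z - g z) * (p * p) / (u * u) + B * (\<psi> z + g z) * (p * p) - (g z / u + B * (u * \<psi> z)) * deriv wp' z"
        using nz by (simp add: field_simps)
      also have "\<dots> = u * (4 * (1 - x) * (h z - g z) - (6 - 2 * x) * g z) + B * g z * (p * p)
           + B * \<psi> z * u ^ 3 * (4 * (1 - x) - (6 - 2 * x))"
        unfolding p2 u'' using nz by (simp add: field_simps power2_eq_square power3_eq_cube)
      also have "4 * (1 - x) * (h z - g z) - (6 - 2 * x) * g z = 4 * (B * a2) * \<psi> z"
        using key[OF z] unfolding Ba2 x_def[symmetric] by (simp add: algebra_simps)
      also have "u * (4 * (B * a2) * \<psi> z) + B * g z * (p * p) + B * \<psi> z * u ^ 3 * (4 * (1 - x) - (6 - 2 * x))
          = B * g z * (p * p) - B / 2 * \<psi> z * (p * p)"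
        unfolding x p2 by (simp add: field_simps power2_eq_square power3_eq_cube)
      also have "\<dots> = (sysB b 0 z * \<psi> z - sysA b z * \<eta> z) * (p * p)"
      proof -
        have "sysA b z * \<eta> z = - B * g z - B ^ 2 * u ^ 2 * \<psi> z"
          using nz by (simp add: sysA_def \<eta>_def B_def u_def[symmetric] p_def[symmetric] field_simps power2_eq_square)
        then show ?thesis by (simp add: sysB_def B_def u_def[symmetric] algebra_simps)
      qed
      finally show ?thesis .
    qed
    then show "(\<eta> has_field_derivative sysB b 0 z * \<psi> z - sysA b z * \<eta> z) (at z)"
      using d nz by simp
  qed
  moreover have "1 / (8 * norm z ^ 4) \<le> norm (\<psi> z)" if z: "z \<in> ?H" for z
  proof -
    have nu: "exp (Re (L z)) = norm (wp z)" by (metis expL[OF z] norm_exp_eq_Re)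
    then have "0 \<le> Re (L z)" using u1[OF z] by (metis one_le_exp_iff)
    \<comment> \<open>Since \<open>wp\<close> has modulus at least 1 here, \<open>\<rho>\<close> may
      be lowered to 2, which gives the order -4 in \<open>z\<close>.\<close>
    then have "exp (2 * Re (L z)) \<le> norm (E z)"
      using rho2 by (simp add: E_def norm_exp_eq_Re mult_right_mono)
    moreover have "exp (2 * Re (L z)) = norm (wp z) ^ 2" unfolding nu[symmetric] by (simp add: exp_double)
    moreover have "(1 / (2 * norm z ^ 2)) ^ 2 \<le> norm (wp z) ^ 2" using u_ge[OF z] by (intro power_mono) auto
    ultimately have "1 / (4 * norm z ^ 4) \<le> norm (E z)"
      by (simp add: power_divide power_mult_distrib flip: power_mult)
    then have "1 / (4 * norm z ^ 4) * (1/2) \<le> norm (E z) * norm (F0 z)"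
      using f0ge[OF X100(2)[OF z]] by (intro mult_mono) (auto simp: F0_def)
    then show ?thesis by (simp add: \<psi>_def norm_mult)
  qed
  ultimately show ?thesis using that \<delta> by blast
qed

context surface
begin

lemma phi_vstrip: "z \<in> vstrip \<Longrightarrow> phi z = phi0 z"
proof -
  assume z: "z \<in> vstrip"
  interpret ep: equivariant id id phi0 by (rule equiv_phi)
  from ep.glue_v[of z 0] z show ?thesis by (simp add: phi_def tpow_def)
qed

lemma phi_pos: "z \<notin> gaussL \<Longrightarrow> phi z > 0"
  using local_data_exists br_norm2_pos unfolding local_data_def by metis

lemma phi_continuous: "continuous_on (- gaussL) phi"
proof (intro continuous_at_imp_continuous_on ballI)
  fix z assume "z \<in> - gaussL"
  then obtain W F a1 a2 Y1 Y2 H2 where W: "z \<in> W" "local_data W F a1 a2 Y1 Y2 H2"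
    using local_data_exists by blast
  then have hol: "open W" "a1 holomorphic_on W" "a2 holomorphic_on W" and eq: "\<And>w. w \<in> W \<Longrightarrow> phi w = norm2 (a1 w) (a2 w)"
    by (auto simp: local_data_def bryant_def)
  have "continuous_on W (\<lambda>w. norm2 (a1 w) (a2 w))"
    unfolding norm2_def using hol by (intro continuous_intros holomorphic_on_imp_continuous_on)
  then have "continuous_on W phi" using eq by (simp cong: continuous_on_cong)
  then show "isCont phi z" using W(1) hol(1) by (simp add: continuous_on_eq_continuous_at)
qed

lemma phi0_rot: "z \<in> cross \<Longrightarrow> phi0 (\<i> * z + 1) = phi0 z"
  by (simp add: phi0_def A1_def A2_def fund_rot norm2_def norm_mult norm_divide)

text \<open>The quarter turn about \<open>cellc\<close> multiplies the basis solutions by factors of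
  modulus 1; the period \<open>1\<close> of \<open>phi\<close> then moves its centre to 0.\<close>

lemma phi_times_i:
  assumes "z \<notin> gaussL"
  shows "phi (\<i> * z) = phi z"
proof -
  interpret ep: equivariant id id phi0 by (rule equiv_phi)
  have tp: "tpow id n x = x" for n :: int and x :: real by (simp add: tpow_def)
  have h: "phi w = phi0 (w - \<i> * of_int n)" if "w - \<i> * of_int n \<in> hstrip" for w n
    unfolding phi_def ep.glue_h[OF that] by (simp add: tp)
  have v: "phi w = phi0 (w - of_int n)" if "w - of_int n \<in> vstrip" for w n
    unfolding phi_def ep.glue_v[OF that] by (simp add: tp)
  have "phi (\<i> * z + 1) = phi z"
  proof -
    consider n where "z - \<i> * of_int n \<in> hstrip" | n where "z - of_int n \<in> vstrip"
      using ep.notin_gaussL_cases[OF assms] by metis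
    then show ?thesis
    proof cases
      case 1
      have e: "\<i> * z + 1 - of_int (- n) = \<i> * (z - \<i> * of_int n) + 1" by (simp add: algebra_simps)
      have "\<i> * z + 1 - of_int (- n) \<in> vstrip" using 1 by (auto simp: hstrip_def vstrip_def)
      from v[OF this] have "phi (\<i> * z + 1) = phi0 (\<i> * (z - \<i> * of_int n) + 1)" unfolding e .
      also have "\<dots> = phi0 (z - \<i> * of_int n)" using phi0_rot 1 hstrip_subset by blast
      finally show ?thesis using h[OF 1] by simp
    next
      case 2
      have e: "\<i> * z + 1 - \<i> * of_int n = \<i> * (z - of_int n) + 1" by (simp add: algebra_simps)
      have "\<i> * z + 1 - \<i> * of_int n \<in> hstrip" using 2 by (auto simp: hstrip_def vstrip_def)
      from h[OF this] have "phi (\<i> * z + 1) = phi0 (\<i> * (z - of_int n) + 1)" unfolding e .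
      also have "\<dots> = phi0 (z - of_int n)" using phi0_rot 2 vstrip_subset by blast
      finally show ?thesis using v[OF 2] by simp
    qed
  qed
  moreover have "phi (\<i> * z + 1) = phi (\<i> * z)"
    using assms by (intro phi_periodic) (auto simp: gaussL_iff)
  ultimately show ?thesis by simp
qed

text \<open>The growing solution is a combination of \<open>A1\<close> and \<open>A2\<close>, so
  Cauchy-Schwarz turns its lower bound of order -4 into one of order -8 for \<open>phi\<close>.
  Quarter turns about 0 preserve \<open>phi\<close> and move every point of the punctured disc into
  the half disc.\<close>

theorem phi_growth:
  obtains \<delta> c where "0 < \<delta>" "\<delta> \<le> 1/2" "0 < c"
    "\<And>z w. w \<in> gaussL \<Longrightarrow> z \<noteq> w \<Longrightarrow> norm (z - w) < \<delta> \<Longrightarrow> c / norm (z - w) ^ 8 \<le> phi z"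
proof -
  obtain \<delta> \<psi> \<eta> where \<delta>: "0 < \<delta>" "\<delta> \<le> 1/2" and sol: "wsol b 0 (half_disc \<delta>) \<psi> \<eta>"
    and ge: "\<And>z. z \<in> half_disc \<delta> \<Longrightarrow> 1 / (8 * norm z ^ 4) \<le> norm (\<psi> z)"
    using growing_solution[OF b_range] by metis
  let ?H = "half_disc \<delta>"
  have Hv: "?H \<subseteq> vstrip" by (rule half_disc_vstrip) (use \<delta> in simp)
  then have Hc: "?H \<subseteq> cross" using vstrip_subset by blast
  define e where "e = complex_of_real (\<delta> / 2)"
  have e: "e \<in> ?H" using \<delta> by (simp add: e_def half_disc_def)
  define l1 where "l1 = \<psi> e * B2 e - \<eta> e * A2 e"
  define l2 where "l2 = A1 e * \<eta> e - B1 e * \<psi> e"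
  have psi: "\<psi> z = l1 * A1 z + l2 * A2 z" if "z \<in> ?H" for z
    using lin_sol_expand(1)[OF lin_sol_subset[OF AB_sol(1) Hc] lin_sol_subset[OF AB_sol(2) Hc] sol
       half_disc(1) convex_connected[OF half_disc(2)] e AB_det(1) that] e Hc
    unfolding l1_def l2_def by blast
  define C where "C = norm l1 ^ 2 + norm l2 ^ 2 + 1"
  have C: "C > 0" by (auto simp: C_def add_nonneg_pos)
  have half: "1 / (64 * C) / norm z ^ 8 \<le> phi z" if z: "z \<in> ?H" for z
  proof -
    have "(1 / (8 * norm z ^ 4)) ^ 2 \<le> norm (\<psi> z) ^ 2" using ge[OF z] by (intro power_mono) auto
    also have "\<dots> \<le> (norm l1 * norm (A1 z) + norm l2 * norm (A2 z)) ^ 2"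
      unfolding psi[OF z] by (intro power_mono order_trans[OF norm_triangle_ineq]) (auto simp: norm_mult)
    also have "\<dots> \<le> (norm l1 ^ 2 + norm l2 ^ 2) * (norm (A1 z) ^ 2 + norm (A2 z) ^ 2)"
    proof -
      have "(norm l1 ^ 2 + norm l2 ^ 2) * (norm (A1 z) ^ 2 + norm (A2 z) ^ 2)
         - (norm l1 * norm (A1 z) + norm l2 * norm (A2 z)) ^ 2 = (norm l1 * norm (A2 z) - norm l2 * norm (A1 z)) ^ 2"
        by (simp add: power2_eq_square algebra_simps)
      then show ?thesis by (metis diff_ge_0_iff_ge zero_le_power2)
    qed
    also have "\<dots> \<le> C * phi z"
      using phi_vstrip[of z] z Hv by (intro mult_mono) (auto simp: C_def phi0_def norm2_def)
    finally have "1 / (64 * norm z ^ 8) \<le> C * phi z"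
      by (simp add: power_divide power_mult_distrib flip: power_mult)
    then have "1 / (64 * norm z ^ 8) / C \<le> phi z"
      using C by (subst pos_divide_le_eq) (auto simp: mult.commute)
    then show ?thesis by (simp add: mult_ac)
  qed
  have zero: "1 / (64 * C) / norm z ^ 8 \<le> phi z" if z: "z \<noteq> 0" "norm z < \<delta>" for z
  proof -
    have zL: "z \<notin> gaussL" using z \<delta> by (intro small_not_gaussL) auto
    have "z \<in> ?H \<or> \<i> * z \<in> ?H \<or> - z \<in> ?H \<or> - (\<i> * z) \<in> ?H"
      using z by (auto simp: half_disc_def norm_mult complex_eq_iff)
    moreover have "phi (\<i> * z) = phi z" "phi (- z) = phi z" "phi (- (\<i> * z)) = phi z"
      using phi_times_i[OF zL] phi_times_i[of "\<i> * z"] phi_times_i[of "- z"] zL by (auto simp: minus_mult_right[symmetric])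
    ultimately show ?thesis
      using half[of z] half[of "\<i> * z"] half[of "- z"] half[of "- (\<i> * z)"] by (auto simp: norm_mult)
  qed
  show ?thesis
  proof (rule that[OF \<delta>])
    show "0 < 1 / (64 * C)" using C by simp
    fix z w assume w: "w \<in> gaussL" and z: "z \<noteq> w" "norm (z - w) < \<delta>"
    have "z - w \<notin> gaussL" using z \<delta> by (intro small_not_gaussL) auto
    from phi_periodic[OF this w] zero[of "z - w"] z show "1 / (64 * C) / norm (z - w) ^ 8 \<le> phi z" by simp
  qed
qed

end

section \<open>The punctured torus\<close>

lemma lattice_add:
  assumes "x \<in> lattice w1 w2" "y \<in> lattice w1 w2"
  shows "x + y \<in> lattice w1 w2"
proof -
  obtain m n m' n' where "x = of_int m * w1 + of_int n * w2" "y = of_int m' * w1 + of_int n' * w2"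
    using assms unfolding lattice_def by blast
  then have "x + y = of_int (m + m') * w1 + of_int (n + n') * w2" by (simp add: algebra_simps)
  then show ?thesis unfolding lattice_def by blast
qed

lemma lattice_minus:
  assumes "x \<in> lattice w1 w2"
  shows "- x \<in> lattice w1 w2"
proof -
  obtain m n where "x = of_int m * w1 + of_int n * w2"
    using assms unfolding lattice_def by blast
  then have "- x = of_int (- m) * w1 + of_int (- n) * w2" by simp
  then show ?thesis unfolding lattice_def by blast
qed

lemma lattice_0: "0 \<in> lattice w1 w2"
  unfolding lattice_def by (auto intro!: exI[of _ 0])

lemma proj_mem: "w \<in> proj w1 w2 z \<longleftrightarrow> w - z \<in> lattice w1 w2"
  by (simp add: proj_def lattice_rel_def)

lemma proj_eq_iff: "proj w1 w2 z = proj w1 w2 w \<longleftrightarrow> w - z \<in> lattice w1 w2"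
proof
  assume "proj w1 w2 z = proj w1 w2 w"
  then show "w - z \<in> lattice w1 w2"
    using proj_mem[of w w1 w2 w] proj_mem[of w w1 w2 z] lattice_0 by auto
next
  assume d: "w - z \<in> lattice w1 w2"
  have "x - z \<in> lattice w1 w2 \<longleftrightarrow> x - w \<in> lattice w1 w2" for x
    using lattice_add[OF _ d, of "x - w"] lattice_add[OF _ lattice_minus[OF d], of "x - z"] by auto
  then show "proj w1 w2 z = proj w1 w2 w" by (auto simp: proj_mem)
qed

lemma proj_in_torus: "proj w1 w2 z \<in> torus w1 w2"
  by (auto simp: torus_def proj_def intro: quotientI)

lemma lattice2_iff: "z \<in> lattice 2 (2 * \<i>) \<longleftrightarrow> (\<exists>m n. z = 2 * of_int m + 2 * of_int n * \<i>)"
  by (auto simp: lattice_def mult_ac)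

definition ends :: "complex set set" where
  "ends = {proj 2 (2 * \<i>) 0, proj 2 (2 * \<i>) 1, proj 2 (2 * \<i>) (1 + \<i>), proj 2 (2 * \<i>) \<i>}"

lemma lattice2_subset: "z \<in> lattice 2 (2 * \<i>) \<Longrightarrow> z \<in> gaussL"
  by (auto simp: lattice2_iff gaussL_iff)

text \<open>Modulo the doubled lattice a Gaussian integer is determined by the parities of its
  coordinates, and the four ends realize all of them.\<close>

lemma proj_in_ends: "proj 2 (2 * \<i>) z \<in> ends \<longleftrightarrow> z \<in> gaussL"
proof
  assume "proj 2 (2 * \<i>) z \<in> ends"
  then obtain e where e: "e \<in> {0, 1, 1 + \<i>, \<i>}" "proj 2 (2 * \<i>) z = proj 2 (2 * \<i>) e"
    by (auto simp: ends_def)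
  then have "e - z \<in> gaussL" using lattice2_subset by (simp add: proj_eq_iff)
  moreover have "e \<in> gaussL" using e(1) by (auto simp: gaussL_iff)
  ultimately show "z \<in> gaussL"
    using gaussL_diff[of e "e - z"] by (simp only: diff_diff_eq2 add_diff_cancel_left')
next
  assume "z \<in> gaussL"
  then obtain m n where z: "z = of_int m + of_int n * \<i>" by (auto simp: lattice_def)
  define e where "e = (of_int (m mod 2) + of_int (n mod 2) * \<i> :: complex)"
  have "e - z = 2 * of_int (- (m div 2)) + 2 * of_int (- (n div 2)) * \<i>"
  proof -
    define q r q' r' where "q = m div 2" and "r = m mod 2" and "q' = n div 2" and "r' = n mod 2"
    have "m = 2 * q + r" "n = 2 * q' + r'" by (simp_all add: q_def r_def q'_def r'_def)
    then show ?thesis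
      unfolding z e_def q_def[symmetric] r_def[symmetric] q'_def[symmetric] r'_def[symmetric]
      by (simp add: algebra_simps)
  qed
  then have "e - z \<in> lattice 2 (2 * \<i>)" unfolding lattice2_iff by blast
  then have "proj 2 (2 * \<i>) z = proj 2 (2 * \<i>) e" by (simp add: proj_eq_iff)
  moreover have "e \<in> {0, 1, 1 + \<i>, \<i>}"
  proof -
    have "m mod 2 = 0 \<or> m mod 2 = 1" "n mod 2 = 0 \<or> n mod 2 = 1" by presburger+
    then show ?thesis by (auto simp: e_def)
  qed
  ultimately show "proj 2 (2 * \<i>) z \<in> ends" by (auto simp: ends_def)
qed

lemma cover_domain_ends: "cover_domain 2 (2 * \<i>) ends = - gaussL"
  by (auto simp: cover_domain_def proj_in_ends)

lemma ends_subset: "p \<in> ends \<Longrightarrow> z \<in> p \<Longrightarrow> z \<in> gaussL"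
proof -
  assume p: "p \<in> ends" "z \<in> p"
  then obtain e where "p = proj 2 (2 * \<i>) e" by (auto simp: ends_def)
  then have "p = proj 2 (2 * \<i>) z" using p(2) by (simp add: proj_mem proj_eq_iff)
  then show "z \<in> gaussL" using p(1) proj_in_ends by simp
qed

lemma card_ends: "card ends = 4"
proof -
  have odd: "\<not> (\<exists>m n. e = 2 * of_int m + 2 * of_int n * \<i>)" if "Re e = 1 \<or> Re e = -1 \<or> Im e = 1 \<or> Im e = -1" for e
  proof
    assume "\<exists>m n. e = 2 * of_int m + 2 * of_int n * \<i>"
    then obtain m n where "Re e = of_int (2 * m)" "Im e = of_int (2 * n)" by auto
    then have "2 * m = 1 \<or> 2 * m = -1 \<or> 2 * n = 1 \<or> 2 * n = (-1 :: int)"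
      using that by (metis of_int_1 of_int_eq_iff of_int_minus)
    then show False by presburger
  qed
  have "proj 2 (2 * \<i>) 0 \<noteq> proj 2 (2 * \<i>) 1" "proj 2 (2 * \<i>) 0 \<noteq> proj 2 (2 * \<i>) (1 + \<i>)"
    "proj 2 (2 * \<i>) 0 \<noteq> proj 2 (2 * \<i>) \<i>" "proj 2 (2 * \<i>) 1 \<noteq> proj 2 (2 * \<i>) (1 + \<i>)"
    "proj 2 (2 * \<i>) 1 \<noteq> proj 2 (2 * \<i>) \<i>" "proj 2 (2 * \<i>) (1 + \<i>) \<noteq> proj 2 (2 * \<i>) \<i>"
    unfolding proj_eq_iff lattice2_iff by (rule odd, simp)+
  then show ?thesis by (simp add: ends_def)
qed

section \<open>Completeness and total curvature\<close>

lemma unit_square_reduce: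
  obtains w where "w \<in> gaussL" "z - w \<in> cbox 0 (Complex 1 1)"
proof
  let ?w = "Complex (of_int \<lfloor>Re z\<rfloor>) (of_int \<lfloor>Im z\<rfloor>)"
  show "?w \<in> gaussL" by (simp add: gaussL_iff)
  show "z - ?w \<in> cbox 0 (Complex 1 1)" by (auto simp: in_cbox_complex_iff) linarith+
qed

text \<open>Estimates on this part of a unit square come from compactness; the remaining points are
  covered by the growth at the lattice.\<close>

lemma compact_cell:
  assumes "0 < \<delta>"
  defines "K \<equiv> cbox 0 (Complex 1 1) \<inter> {z. \<forall>w\<in>gaussL. \<delta> \<le> norm (z - w)}"
  shows "compact K" "K \<subseteq> - gaussL"
proof -
  have "{z. \<forall>w\<in>gaussL. \<delta> \<le> norm (z - w)} = (\<Inter>w\<in>gaussL. {z. \<delta> \<le> norm (z - w)})" by auto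
  moreover have "closed {z. \<delta> \<le> norm (z - w)}" for w :: complex
    by (intro closed_Collect_le continuous_intros)
  ultimately have "closed {z. \<forall>w\<in>gaussL. \<delta> \<le> norm (z - w)}" by auto
  then show "compact K" unfolding K_def by (intro compact_Int_closed compact_cbox)
  show "K \<subseteq> - gaussL" using assms(1) by (force simp: K_def)
qed

lemma wp'_growth:
  obtains C where "C > 0" "\<And>z w. w \<in> gaussL \<Longrightarrow> z \<noteq> w \<Longrightarrow> norm (z - w) \<le> 1/4 \<Longrightarrow> norm (wp' z) \<le> C / norm (z - w) ^ 3"
proof -
  have hol: "deriv wp_reg holomorphic_on ball 0 (1/2)"
    by (intro holomorphic_deriv wp_reg_holomorphic) simp
  have "continuous_on (cball 0 (1/4)) (deriv wp_reg)"
    by (rule continuous_on_subset[OF holomorphic_on_imp_continuous_on[OF hol]]) auto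
  then have "bounded (deriv wp_reg ` cball 0 (1/4))"
    by (intro compact_imp_bounded compact_continuous_image compact_cball)
  then obtain B where "\<forall>x\<in>cball 0 (1/4). norm (deriv wp_reg x) \<le> B" by (auto simp: bounded_iff)
  then have B: "norm (deriv wp_reg z) \<le> B" if "norm z \<le> 1/4" for z
    using that by (metis mem_cball_0)
  have B0: "0 \<le> B" using B[of 0] norm_ge_zero order_trans by (metis norm_zero divide_nonneg_nonneg zero_le_numeral zero_le_one)
  show ?thesis
  proof (rule that[of "2 + B"])
    fix z w :: complex assume w: "w \<in> gaussL" and z: "z \<noteq> w" "norm (z - w) \<le> 1/4"
    define y where "y = z - w"
    have y: "y \<noteq> 0" "norm y \<le> 1/4" using z by (auto simp: y_def)
    have "y \<notin> gaussL" using y by (intro small_not_gaussL) auto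
    then have "wp' z = wp' y" using deriv_wp_periodic[OF w, of y] by (simp add: y_def)
    also have "\<dots> = - 2 / y ^ 3 + deriv wp_reg y" using y by (intro wp'_near_0) auto
    finally have "norm (wp' z) \<le> norm (- 2 / y ^ 3) + norm (deriv wp_reg y)" by (simp only: norm_triangle_ineq)
    also have "\<dots> \<le> 2 / norm y ^ 3 + B / norm y ^ 3"
    proof (intro add_mono)
      show "norm (- 2 / y ^ 3) \<le> 2 / norm y ^ 3" by (simp add: norm_divide norm_power)
      have "norm y ^ 3 \<le> 1" using y by (intro power_le_one) auto
      then have "B * norm y ^ 3 \<le> B * 1" using B0 by (intro mult_left_mono)
      moreover have "norm (deriv wp_reg y) \<le> B" using B y by blast
      ultimately have "B \<le> B / norm y ^ 3" using y by (simp add: le_divide_eq)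
      then show "norm (deriv wp_reg y) \<le> B / norm y ^ 3" using \<open>norm (deriv wp_reg y) \<le> B\<close> by linarith
    qed
    finally show "norm (wp' z) \<le> (2 + B) / norm (z - w) ^ 3" by (simp add: y_def add_divide_distrib)
  qed (use B0 in simp)
qed

text \<open>A curve of finite length in a metric that dominates the Euclidean one and, near the lattice
  points, the metric \<open>|dz| / |z - w|\<close>, stays in a compact subset.\<close>

lemma finite_length_stays:
  fixes \<gamma> :: "real \<Rightarrow> complex" and \<rho> :: "complex \<Rightarrow> real"
  assumes C1: "\<gamma> C1_differentiable_on {0..<1}" and sub: "\<gamma> ` {0..<1} \<subseteq> - gaussL"
    and rho: "continuous_on (- gaussL) \<rho>" and c: "c > 0" and \<delta>: "0 < \<delta>" "\<delta> \<le> 1/2"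
    and lower: "\<And>z. z \<notin> gaussL \<Longrightarrow> c \<le> \<rho> z"
    and near: "\<And>z w. w \<in> gaussL \<Longrightarrow> z \<noteq> w \<Longrightarrow> norm (z - w) < \<delta> \<Longrightarrow> c / norm (z - w) \<le> \<rho> z"
    and fin: "(\<integral>\<^sup>+s\<in>{0..<1}. ennreal (\<rho> (\<gamma> s) * norm (vector_derivative \<gamma> (at s))) \<partial>lborel) \<noteq> \<infinity>"
  obtains a K where "0 < a" "a < 1" "compact K" "K \<subseteq> - gaussL" "\<gamma> ` {a..<1} \<subseteq> K"
proof -
  define \<gamma>' where "\<gamma>' = (\<lambda>s. vector_derivative \<gamma> (at s))"
  have der: "(\<gamma> has_vector_derivative \<gamma>' s) (at s)" if "s \<in> {0..<1}" for s
    using C1 that by (auto simp: C1_differentiable_on_eq \<gamma>'_def vector_derivative_works[symmetric])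
  have cont': "continuous_on {0..<1} \<gamma>'" using C1 by (auto simp: C1_differentiable_on_eq \<gamma>'_def)
  have cont: "continuous_on {0..<1} \<gamma>"
    by (intro continuous_at_imp_continuous_on ballI has_vector_derivative_continuous[OF der])
  define h where "h = (\<lambda>s. \<rho> (\<gamma> s) * norm (\<gamma>' s))"
  have conth: "continuous_on {0..<1} h"
    unfolding h_def using sub by (intro continuous_intros cont' continuous_on_compose2[OF rho cont])
  have h0: "0 \<le> h s" if "s \<in> {0..<1}" for s
    unfolding h_def using lower[of "\<gamma> s"] sub that c by (intro mult_nonneg_nonneg) force+
  have sp: "c * norm (\<gamma>' s) \<le> h s" if "s \<in> {0..<1}" for s
    unfolding h_def using lower[of "\<gamma> s"] sub that by (intro mult_right_mono) force+
  define T where "T = (\<lambda>a b. integral {a..b} h)"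
  have hint: "h integrable_on {a..b}" if "0 \<le> a" "b < 1" for a b
    by (rule integrable_continuous_real, rule continuous_on_subset[OF conth]) (use that in auto)
  define J where "J = enn2real (\<integral>\<^sup>+s\<in>{0..<1}. ennreal (h s) \<partial>lborel)"
  have J: "ennreal J = (\<integral>\<^sup>+s\<in>{0..<1}. ennreal (h s) \<partial>lborel)"
    using fin unfolding J_def h_def \<gamma>'_def by (simp add: top.not_eq_extremum)
  have TJ: "T 0 b \<le> J" if b: "0 \<le> b" "b < 1" for b
  proof -
    have "ennreal (T 0 b) = (\<integral>\<^sup>+s. ennreal (h s) * indicator {0..b} s \<partial>lborel)"
      unfolding T_def
      by (rule nn_integral_has_integral_lebesgue'[symmetric]) (use h0 b integrable_integral[OF hint[of 0 b]] in auto)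
    also have "\<dots> \<le> (\<integral>\<^sup>+s. ennreal (h s) * indicator {0..<1} s \<partial>lborel)"
      by (intro nn_integral_mono mult_left_mono) (use b in \<open>auto simp: indicator_def\<close>)
    finally have "ennreal (T 0 b) \<le> ennreal J" by (simp add: J)
    moreover have "0 \<le> J" by (simp add: J_def)
    ultimately show ?thesis by (simp add: ennreal_le_iff)
  qed
  \<comment> \<open>A tail of length \<open>\<epsilon>\<close> has Euclidean length at most
    \<open>\<epsilon> / c = \<delta> / 4\<close>. It stays either in a ball of that radius off the
    lattice or within \<open>3/4 * \<delta>\<close> of one lattice point, where \<open>near\<close>
    applies.\<close>
  define \<epsilon> where "\<epsilon> = c * \<delta> / 4"
  have e0: "\<epsilon> > 0" using c \<delta> by (simp add: \<epsilon>_def)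
  obtain a where a: "0 < a" "a < 1" "\<And>b. a \<le> b \<Longrightarrow> b < 1 \<Longrightarrow> T a b \<le> \<epsilon>"
  proof -
    define M where "M = Sup (T 0 ` {0..<1})"
    have bdd: "bdd_above (T 0 ` {0..<1})" using TJ by (intro bdd_aboveI[of _ J]) auto
    have "\<exists>x\<in>T 0 ` {0..<1}. M - \<epsilon> < x"
      unfolding M_def using e0 by (intro less_cSupD) auto
    then obtain a0 where a0: "0 \<le> a0" "a0 < 1" "M - \<epsilon> < T 0 a0" by auto
    define a where "a = max a0 (1/2)"
    have a: "0 < a" "a < 1" "a0 \<le> a" using a0 by (auto simp: a_def)
    have comb: "T 0 x + T x y = T 0 y" if "0 \<le> x" "x \<le> y" "y < 1" for x y
      unfolding T_def using that by (intro Henstock_Kurzweil_Integration.integral_combine hint) auto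
    have nn: "0 \<le> T x y" if "0 \<le> x" "y < 1" for x y
      unfolding T_def using that h0 by (intro integral_nonneg hint) auto
    have "T a b \<le> \<epsilon>" if b: "a \<le> b" "b < 1" for b
    proof -
      have "T 0 b \<le> M" unfolding M_def using b a bdd by (intro cSup_upper) auto
      moreover have "T 0 a0 + T a0 a = T 0 a" "T 0 a + T a b = T 0 b" using comb a a0 b by auto
      moreover have "0 \<le> T a0 a" using nn a a0 by auto
      ultimately show ?thesis using a0(3) by linarith
    qed
    then show ?thesis using that a by blast
  qed
  have dist: "norm (\<gamma> b - \<gamma> a) \<le> \<delta> / 4" if b: "a \<le> b" "b < 1" for b
  proof -
    have sub2: "{a..b} \<subseteq> {0..<1}" using a b by auto
    have i: "(\<gamma>' has_integral (\<gamma> b - \<gamma> a)) {a..b}"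
      using b(1) sub2 by (intro fundamental_theorem_of_calculus has_vector_derivative_at_within[OF der]) auto
    have "norm (integral {a..b} \<gamma>') \<le> integral {a..b} (\<lambda>s. h s / c)"
    proof (rule Henstock_Kurzweil_Integration.integral_norm_bound_integral)
      show "\<gamma>' integrable_on {a..b}" using i by blast
      show "(\<lambda>s. h s / c) integrable_on {a..b}" using hint[of a b] a b by (intro integrable_on_divide) auto
      show "norm (\<gamma>' s) \<le> h s / c" if "s \<in> {a..b}" for s
        using sp[of s] that sub2 c by (auto simp: field_simps)
    qed
    also have "\<dots> = T a b / c" by (simp add: T_def)
    also have "\<dots> \<le> \<delta> / 4" using a(3)[OF b] c by (simp add: \<epsilon>_def field_simps)
    finally show ?thesis using integral_unique[OF i] by simp
  qed
  show ?thesis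
  proof (cases "\<exists>w\<in>gaussL. norm (\<gamma> a - w) < \<delta> / 2")
    case False
    have "cball (\<gamma> a) (\<delta> / 4) \<subseteq> - gaussL"
    proof
      fix y assume y: "y \<in> cball (\<gamma> a) (\<delta> / 4)"
      show "y \<in> - gaussL"
      proof
        assume "y \<in> gaussL"
        then have "\<delta> / 2 \<le> norm (\<gamma> a - y)" using False by force
        then show False using y \<delta> by (simp add: dist_norm)
      qed
    qed
    moreover have "\<gamma> ` {a..<1} \<subseteq> cball (\<gamma> a) (\<delta> / 4)"
      using dist by (auto simp: dist_norm norm_minus_commute)
    ultimately show ?thesis using that a(1,2) compact_cball by blast
  next
    case True
    then obtain w where w: "w \<in> gaussL" "norm (\<gamma> a - w) < \<delta> / 2" by blast
    have ball: "norm (\<gamma> s - w) \<le> 3 / 4 * \<delta>" if "a \<le> s" "s < 1" for s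
      using norm_triangle_ineq[of "\<gamma> s - \<gamma> a" "\<gamma> a - w"] dist[OF that] w(2) by simp
    have nw: "\<gamma> s \<noteq> w" if "s \<in> {0..<1}" for s using sub that w(1) by blast
    \<comment> \<open>The squared distance is differentiable along the curve. Its logarithm changes
      by at most \<open>2 * \<epsilon> / c\<close>, because
      \<open>norm (\<gamma>' s) / norm (\<gamma> s - w)\<close> is bounded by
      \<open>h s / c\<close>; hence the curve keeps a positive distance from
      \<open>w\<close>.\<close>
    define r where "r = (\<lambda>s. norm (\<gamma> s - w) ^ 2)"
    have r0: "0 < r s" if "s \<in> {0..<1}" for s using nw[OF that] by (simp add: r_def)
    have dr: "((\<lambda>s. ln (r s)) has_vector_derivative (2 * ((\<gamma> s - w) \<bullet> \<gamma>' s)) / r s) (at s)" if s: "s \<in> {0..<1}" for s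
    proof -
      have dw: "((\<lambda>s. \<gamma> s - w) has_vector_derivative \<gamma>' s) (at s)"
        using has_vector_derivative_diff[OF der[OF s] has_vector_derivative_const[of w]] by simp
      have "((\<lambda>s. (\<gamma> s - w) \<bullet> (\<gamma> s - w)) has_derivative (\<lambda>x. (\<gamma> s - w) \<bullet> (x *\<^sub>R \<gamma>' s) + (x *\<^sub>R \<gamma>' s) \<bullet> (\<gamma> s - w))) (at s)"
        using dw unfolding has_vector_derivative_def by (intro has_derivative_inner)
      then have "(r has_real_derivative 2 * ((\<gamma> s - w) \<bullet> \<gamma>' s)) (at s)"
        unfolding r_def power2_norm_eq_inner has_field_derivative_def
        by (rule has_derivative_eq_rhs) (auto simp: fun_eq_iff inner_commute)
      from DERIV_chain2[OF DERIV_ln_divide[OF r0[OF s]] this] show ?thesis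
        by (simp flip: has_real_derivative_iff_has_vector_derivative)
    qed
    have logb: "\<bar>ln (r b) - ln (r a)\<bar> \<le> 2 * \<epsilon> / c" if b: "a \<le> b" "b < 1" for b
    proof -
      have sub2: "{a..b} \<subseteq> {0..<1}" using a b by auto
      have i: "((\<lambda>s. (2 * ((\<gamma> s - w) \<bullet> \<gamma>' s)) / r s) has_integral (ln (r b) - ln (r a))) {a..b}"
        using b(1) sub2 by (intro fundamental_theorem_of_calculus has_vector_derivative_at_within[OF dr]) auto
      have "norm (integral {a..b} (\<lambda>s. (2 * ((\<gamma> s - w) \<bullet> \<gamma>' s)) / r s)) \<le> integral {a..b} (\<lambda>s. h s * (2 / c))"
      proof (rule Henstock_Kurzweil_Integration.integral_norm_bound_integral)
        show "(\<lambda>s. (2 * ((\<gamma> s - w) \<bullet> \<gamma>' s)) / r s) integrable_on {a..b}" using i by blast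
        show "(\<lambda>s. h s * (2 / c)) integrable_on {a..b}" using hint[of a b] a b by (intro integrable_on_mult_left) auto
        fix s assume s: "s \<in> {a..b}"
        then have s1: "s \<in> {0..<1}" using sub2 by blast
        define n where "n = norm (\<gamma> s - w)"
        have n: "n > 0" using nw[OF s1] by (simp add: n_def)
        have "c / n \<le> \<rho> (\<gamma> s)"
          unfolding n_def using ball[of s] s b \<delta> nw[OF s1] w(1) by (intro near) auto
        then have "c / n * norm (\<gamma>' s) \<le> h s" unfolding h_def by (intro mult_right_mono) auto
        then have le: "norm (\<gamma>' s) / n \<le> h s / c" using c by (simp add: field_simps)
        have "norm ((2 * ((\<gamma> s - w) \<bullet> \<gamma>' s)) / r s) = 2 * \<bar>(\<gamma> s - w) \<bullet> \<gamma>' s\<bar> / n ^ 2"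
          by (simp add: r_def n_def abs_mult)
        also have "\<dots> \<le> 2 * (n * norm (\<gamma>' s)) / n ^ 2"
          unfolding n_def by (intro divide_right_mono mult_left_mono Cauchy_Schwarz_ineq2) auto
        also have "\<dots> = 2 * (norm (\<gamma>' s) / n)" using n by (simp add: power2_eq_square)
        also have "\<dots> \<le> 2 * (h s / c)" using le by linarith
        also have "\<dots> = h s * (2 / c)" by simp
        finally show "norm ((2 * ((\<gamma> s - w) \<bullet> \<gamma>' s)) / r s) \<le> h s * (2 / c)" .
      qed
      also have "\<dots> = T a b * (2 / c)" by (simp add: T_def)
      also have "\<dots> \<le> \<epsilon> * (2 / c)" using a(3)[OF b] c by (intro mult_right_mono) auto
      finally show ?thesis using integral_unique[OF i] by (simp add: mult.commute)
    qed
    define m where "m = exp (ln (r a) - 2 * \<epsilon> / c)"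
    have rm: "m \<le> r s" if s: "a \<le> s" "s < 1" for s
    proof -
      have "ln (r a) - 2 * \<epsilon> / c \<le> ln (r s)" using logb[OF s] by linarith
      then have "m \<le> exp (ln (r s))" by (simp add: m_def)
      then show ?thesis using r0[of s] a s by simp
    qed
    define K where "K = cball w (3 / 4 * \<delta>) \<inter> {z. m \<le> norm (z - w) ^ 2}"
    have "closed {z. m \<le> norm (z - w) ^ 2}" by (intro closed_Collect_le continuous_intros)
    then have "compact K" unfolding K_def by (intro compact_Int_closed compact_cball)
    moreover have "K \<subseteq> - gaussL"
    proof
      fix y assume y: "y \<in> K"
      have "m > 0" by (simp add: m_def)
      then have "y \<noteq> w" using y by (auto simp: K_def)
      moreover have "norm (y - w) < 1" using y \<delta> by (auto simp: K_def dist_norm norm_minus_commute)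
      ultimately have "y - w \<notin> gaussL" by (intro small_not_gaussL) auto
      then show "y \<in> - gaussL" using w(1) gaussL_diff by blast
    qed
    moreover have "\<gamma> ` {a..<1} \<subseteq> K"
      using ball rm by (auto simp: K_def r_def dist_norm norm_minus_commute)
    ultimately show ?thesis using that a(1,2) by blast
  qed
qed

lemma continuous_on_cmat2:
  fixes f :: "complex \<Rightarrow> cmat2"
  assumes "\<And>i j. continuous_on S (\<lambda>z. f z $ i $ j)"
  shows "continuous_on S f"
proof -
  have "continuous_on S (\<lambda>z. \<Sum>i\<in>UNIV. \<Sum>j\<in>UNIV. entry_mat i j (f z $ i $ j))"
    by (intro continuous_on_sum bounded_linear.continuous_on[OF bounded_linear_entry_mat] assms)
  then show ?thesis by (simp flip: cmat2_decomp)
qed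

context surface
begin

text \<open>Off the lattice \<open>X\<close> is constant on residue classes of the doubled lattice,
  so the representative does not matter there.\<close>

definition f :: "complex set \<Rightarrow> cmat2" where
  "f p = X (SOME z. z \<in> p)"

lemma X_lattice2:
  assumes z: "z \<notin> gaussL" and w: "w \<in> lattice 2 (2 * \<i>)"
  shows "X (z + w) = X z"
proof -
  have nL: "z + v \<notin> gaussL" if "v \<in> gaussL" for v using z that by (simp add: gaussL_add_iff)
  have 1: "X (z + 2 * of_int m) = X z" if z: "z \<notin> gaussL" for z m
  proof (induction m rule: int_induct[of _ 0])
    case (step1 i)
    have "z + 2 * of_int i \<notin> gaussL" using z gaussL_add_iff[of "2 * of_int i" z] by (simp add: gaussL_iff)
    from X_periodic(1)[OF this] step1 show ?case by (simp add: algebra_simps)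
  next
    case (step2 i)
    have "z + 2 * of_int (i - 1) \<notin> gaussL" using z gaussL_add_iff[of "2 * of_int (i - 1)" z] by (simp add: gaussL_iff)
    from X_periodic(1)[OF this] step2 show ?case by (simp add: algebra_simps)
  qed simp
  have 2: "X (z + 2 * of_int m * \<i>) = X z" if z: "z \<notin> gaussL" for z m
  proof (induction m rule: int_induct[of _ 0])
    case (step1 i)
    have "z + 2 * of_int i * \<i> \<notin> gaussL" using z gaussL_add_iff[of "2 * of_int i * \<i>" z] by (simp add: gaussL_iff)
    from X_periodic(2)[OF this] step1 show ?case by (simp add: algebra_simps)
  next
    case (step2 i)
    have "z + 2 * of_int (i - 1) * \<i> \<notin> gaussL" using z gaussL_add_iff[of "2 * of_int (i - 1) * \<i>" z] by (simp add: gaussL_iff)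
    from X_periodic(2)[OF this] step2 show ?case by (simp add: algebra_simps)
  qed simp
  obtain m n where w': "w = 2 * of_int m + 2 * of_int n * \<i>" using w by (auto simp: lattice2_iff)
  have "z + 2 * of_int m \<notin> gaussL" by (rule nL) (simp add: gaussL_iff)
  from 2[OF this, of n] 1[OF z, of m] show ?thesis by (simp add: w' add.assoc)
qed

lemma f_proj:
  assumes z: "z \<notin> gaussL"
  shows "f (proj 2 (2 * \<i>) z) = X z"
proof -
  have "z \<in> proj 2 (2 * \<i>) z" by (simp add: proj_mem lattice_0)
  then have "(SOME w. w \<in> proj 2 (2 * \<i>) z) \<in> proj 2 (2 * \<i>) z" by (rule someI)
  then have "(SOME w. w \<in> proj 2 (2 * \<i>) z) - z \<in> lattice 2 (2 * \<i>)" by (simp add: proj_mem)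
  from X_lattice2[OF z this] show ?thesis by (simp add: f_def)
qed

abbreviation Xf :: "complex \<Rightarrow> cmat2" where
  "Xf \<equiv> (\<lambda>z. f (proj 2 (2 * \<i>) z))"

lemma local_dataD:
  assumes "local_data W F a1 a2 Y1 Y2 H2"
  shows "W \<subseteq> - gaussL" "bryant t (\<lambda>z. wp' z ^ 2) W F a1 a2 Y1 Y2" "wsol b t W Y2 H2"
    "\<And>w. w \<in> W \<Longrightarrow> Xf w = F w ** conj_transpose (F w)" "\<And>w. w \<in> W \<Longrightarrow> phi w = norm2 (a1 w) (a2 w)"
    "\<And>w. w \<in> W \<Longrightarrow> VV w = mat2 (Y1 w * cnj (Y1 w)) (Y1 w * cnj (Y2 w)) (Y2 w * cnj (Y1 w)) (Y2 w * cnj (Y2 w))"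
proof -
  show 1: "W \<subseteq> - gaussL" "bryant t (\<lambda>z. wp' z ^ 2) W F a1 a2 Y1 Y2" "wsol b t W Y2 H2"
    "\<And>w. w \<in> W \<Longrightarrow> phi w = norm2 (a1 w) (a2 w)"
    "\<And>w. w \<in> W \<Longrightarrow> VV w = mat2 (Y1 w * cnj (Y1 w)) (Y1 w * cnj (Y2 w)) (Y2 w * cnj (Y1 w)) (Y2 w * cnj (Y2 w))"
    using assms unfolding local_data_def by blast+
  show "Xf w = F w ** conj_transpose (F w)" if "w \<in> W" for w
  proof -
    have "w \<notin> gaussL" using 1(1) that by blast
    moreover have "X w = F w ** conj_transpose (F w)" using assms that unfolding local_data_def by blast
    ultimately show ?thesis by (simp add: f_proj)
  qed
qed

lemma conformal: "conformal_immersion_on Xf (- gaussL)"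
  unfolding conformal_immersion_on_def smooth_on_def
proof (intro conjI allI ballI)
  fix k show "Ck_on k Xf (- gaussL)"
  proof (rule Ck_on_local)
    fix z assume "z \<in> - gaussL"
    then obtain W F a1 a2 Y1 Y2 H2 where W0: "z \<in> W" "local_data W F a1 a2 Y1 Y2 H2"
      using local_data_exists by blast
    note W = W0(1) local_dataD(2,4-6)[OF W0(2)]
    show "\<exists>V. open V \<and> z \<in> V \<and> Ck_on k Xf V"
      using br_Ck[OF W(2,3)] br_open[OF W(2,3)] W(1) by blast
  qed
next
  show "Xf ` (- gaussL) \<subseteq> hyperbolic_space"
  proof clarify
    fix z assume "z \<notin> gaussL"
    then obtain W F a1 a2 Y1 Y2 H2 where W0: "z \<in> W" "local_data W F a1 a2 Y1 Y2 H2"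
      using local_data_exists by blast
    note W = W0(1) local_dataD(2,4-6)[OF W0(2)]
    show "Xf z \<in> hyperbolic_space" by (rule br_hyperbolic[OF W(2,3,1)])
  qed
next
  fix z assume "z \<in> - gaussL"
  then obtain W F a1 a2 Y1 Y2 H2 where W0: "z \<in> W" "local_data W F a1 a2 Y1 Y2 H2"
    using local_data_exists by blast
  note W = W0(1) local_dataD(2,4-6)[OF W0(2)]
  show "0 < first_form Xf z 1 1" "first_form Xf z 1 1 = first_form Xf z \<i> \<i>" "first_form Xf z 1 \<i> = 0"
    using br_conformal[OF W(2,3) t0 W(1)] by auto
qed

lemma cmc1: "cmc1_on Xf (- gaussL)"
  unfolding cmc1_on_def
proof (intro exI conjI ballI)
  let ?N = "\<lambda>z. cscale (2 / of_real (phi z)) (VV z) - Xf z"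
  show "continuous_on (- gaussL) ?N"
  proof (rule continuous_on_cmat2)
    fix i j :: 2
    show "continuous_on (- gaussL) (\<lambda>z. ?N z $ i $ j)"
    proof (intro continuous_at_imp_continuous_on ballI)
      fix z assume "z \<in> - gaussL"
      then obtain W F a1 a2 Y1 Y2 H2 where W0: "z \<in> W" "local_data W F a1 a2 Y1 Y2 H2"
        using local_data_exists by blast
      note W = W0(1) local_dataD(2,4-6)[OF W0(2)]
      have c: "continuous_on W a1" "continuous_on W a2" "continuous_on W Y1" "continuous_on W Y2"
        "continuous_on W (\<lambda>z. F z $ i' $ j')" for i' j'
        by (rule holomorphic_on_imp_continuous_on; use W(2) in \<open>unfold bryant_def hol_mat_def, blast\<close>)+
      have pos: "norm2 (a1 w) (a2 w) \<noteq> 0" if "w \<in> W" for w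
        using br_norm2_pos[OF W(2,3) that] by simp
      have n: "continuous_on W (\<lambda>w. norm2 (a1 w) (a2 w))"
        unfolding norm2_def by (intro continuous_intros c)
      have m: "continuous_on W (\<lambda>w. mat2 (Y1 w * cnj (Y1 w)) (Y1 w * cnj (Y2 w)) (Y2 w * cnj (Y1 w)) (Y2 w * cnj (Y2 w)) $ i $ j)"
      proof -
        consider "i = 1" "j = 1" | "i = 1" "j = 2" | "i = 2" "j = 1" | "i = 2" "j = 2"
          using exhaust_2[of i] exhaust_2[of j] by blast
        then show ?thesis by cases (simp_all only: mat2_nth, (intro continuous_intros c)+)
      qed
      have x: "continuous_on W (\<lambda>w. (F w ** conj_transpose (F w)) $ i $ j)"
        unfolding matmul_nth conj_transpose_nth by (intro continuous_intros c)
      have "continuous_on W (\<lambda>w. 2 / of_real (norm2 (a1 w) (a2 w)) *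
          mat2 (Y1 w * cnj (Y1 w)) (Y1 w * cnj (Y2 w)) (Y2 w * cnj (Y1 w)) (Y2 w * cnj (Y2 w)) $ i $ j
          - (F w ** conj_transpose (F w)) $ i $ j)"
        by (intro continuous_on_diff continuous_on_mult continuous_on_divide continuous_on_const continuous_on_of_real n m x)
           (use pos in auto)
      then have "continuous_on W (\<lambda>z. ?N z $ i $ j)"
        by (rule continuous_on_eq) (simp add: W(3-5))
      then show "isCont (\<lambda>z. ?N z $ i $ j) z"
        using br_open[OF W(2,3)] W(1) by (simp add: continuous_on_eq_continuous_at)
    qed
  qed
  fix z assume "z \<in> - gaussL"
  then obtain W F a1 a2 Y1 Y2 H2 where W0: "z \<in> W" "local_data W F a1 a2 Y1 Y2 H2"
    using local_data_exists by blast
  note W = W0(1) local_dataD(2,4-6)[OF W0(2)]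
  have N: "?N z = cscale (2 / of_real (norm2 (a1 z) (a2 z))) (mat2 (Y1 z * cnj (Y1 z)) (Y1 z * cnj (Y2 z))
       (Y2 z * cnj (Y1 z)) (Y2 z * cnj (Y2 z))) - Xf z"
    using W(1,4,5) by simp
  show "unit_normal_at Xf z (?N z)" by (rule br_unit_normal[OF W(2,3,1) N])
  show "mean_curvature Xf (?N z) z = 1" by (rule br_mean_curvature[OF W(2,3,1) t0 N])
qed

text \<open>Makes the metric dominate a multiple of the Euclidean one. The bound near the lattice
  and a minimum over a compact part of the unit square combine by periodicity.\<close>

lemma phi_lower:
  obtains c where "c > 0" "\<And>z. z \<notin> gaussL \<Longrightarrow> c \<le> phi z"
proof -
  obtain \<delta> c where \<delta>: "0 < \<delta>" "\<delta> \<le> 1/2" "0 < c"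
    and near: "\<And>z w. w \<in> gaussL \<Longrightarrow> z \<noteq> w \<Longrightarrow> norm (z - w) < \<delta> \<Longrightarrow> c / norm (z - w) ^ 8 \<le> phi z"
    using phi_growth by blast
  define K where "K = cbox 0 (Complex 1 1) \<inter> {z. \<forall>w\<in>gaussL. \<delta> \<le> norm (z - w)}"
  have K: "compact K" "K \<subseteq> - gaussL" using compact_cell[OF \<delta>(1)] by (auto simp: K_def)
  have "\<exists>c'>0. \<forall>z\<in>K. c' \<le> phi z"
  proof (cases "K = {}")
    case False
    obtain x where "x \<in> K" "\<forall>y\<in>K. phi x \<le> phi y"
      using continuous_attains_inf[OF K(1) False continuous_on_subset[OF phi_continuous K(2)]] by blast
    then show ?thesis using phi_pos K(2) by (intro exI[of _ "phi x"]) auto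
  qed (auto intro!: exI[of _ 1])
  then obtain c' where c': "c' > 0" "\<And>z. z \<in> K \<Longrightarrow> c' \<le> phi z" by blast
  have "min c c' \<le> phi z" if z: "z \<notin> gaussL" for z
  proof (cases "\<exists>w\<in>gaussL. norm (z - w) < \<delta>")
    case True
    then obtain w where w: "w \<in> gaussL" "norm (z - w) < \<delta>" by blast
    have zw: "z \<noteq> w" using z w by auto
    then have "norm (z - w) ^ 8 \<le> 1" using w \<delta> by (intro power_le_one) auto
    then have "c * norm (z - w) ^ 8 \<le> c * 1" using \<delta> by (intro mult_left_mono) auto
    then have "c \<le> c / norm (z - w) ^ 8" using zw by (simp add: le_divide_eq)
    also have "\<dots> \<le> phi z" using near[OF w(1) zw w(2)] .
    finally show ?thesis by simp
  next
    case False
    obtain w where w: "w \<in> gaussL" "z - w \<in> cbox 0 (Complex 1 1)" using unit_square_reduce by blast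
    have "z - w \<in> K"
      unfolding K_def
    proof (intro IntI w CollectI ballI)
      fix v assume "v \<in> gaussL"
      then have "w + v \<in> gaussL" using w gaussL_add by blast
      then have "\<delta> \<le> norm (z - (w + v))" using False by force
      then show "\<delta> \<le> norm (z - w - v)" by (simp add: diff_diff_eq)
    qed
    then have "c' \<le> phi (z - w)" using c' by blast
    also have "phi (z - w) = phi z"
      using phi_periodic[of "z - w" w] w \<open>z - w \<in> K\<close> K(2) by auto
    finally show ?thesis by simp
  qed
  then show ?thesis using that[of "min c c'"] \<delta> c' by auto
qed

lemma first_form_Xf:
  assumes "z \<notin> gaussL"
  shows "first_form Xf z u v = t ^ 2 * phi z ^ 2 * Re (u * cnj v)"
proof -
  obtain W F a1 a2 Y1 Y2 H2 where W0: "z \<in> W" "local_data W F a1 a2 Y1 Y2 H2"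
    using local_data_exists[OF assms] by blast
  note W = W0(1) local_dataD(2,4-6)[OF W0(2)]
  show ?thesis using br_first_form[OF W(2,3,1)] W(1,4) by simp
qed

text \<open>The length element is \<open>\<bar>t\<bar> * phi * |dz|\<close>. Growth of order -8 at
  the lattice points exceeds the order -1 that forces infinite length, and a tail inside a compact
  set contradicts divergence.\<close>

lemma complete: "complete_metric 2 (2 * \<i>) ends Xf"
  unfolding complete_metric_def cover_domain_ends
proof (intro allI impI)
  fix \<gamma> :: "real \<Rightarrow> complex"
  assume C1: "\<gamma> C1_differentiable_on {0..<1}" and sub: "\<gamma> ` {0..<1} \<subseteq> - gaussL"
    and div: "\<forall>K. compact K \<longrightarrow> K \<subseteq> - gaussL \<longrightarrow> (\<forall>\<^sub>F s in at_left 1. proj 2 (2 * \<i>) (\<gamma> s) \<notin> proj 2 (2 * \<i>) ` K)"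
  define I where "I = (\<integral>\<^sup>+s\<in>{0..<1}. ennreal (\<bar>t\<bar> * phi (\<gamma> s) * norm (vector_derivative \<gamma> (at s))) \<partial>lborel)"
  have eq: "(\<integral>\<^sup>+s\<in>{0..<1}. ennreal (sqrt (first_form Xf (\<gamma> s) (vector_derivative \<gamma> (at s)) (vector_derivative \<gamma> (at s)))) \<partial>lborel) = I"
    unfolding I_def
  proof (rule nn_integral_cong)
    fix s :: real
    show "ennreal (sqrt (first_form Xf (\<gamma> s) (vector_derivative \<gamma> (at s)) (vector_derivative \<gamma> (at s)))) * indicator {0..<1} s
        = ennreal (\<bar>t\<bar> * phi (\<gamma> s) * norm (vector_derivative \<gamma> (at s))) * indicator {0..<1} s"
    proof (cases "s \<in> {0..<1}")
      case True
      then have L: "\<gamma> s \<notin> gaussL" using sub by blast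
      have "first_form Xf (\<gamma> s) (vector_derivative \<gamma> (at s)) (vector_derivative \<gamma> (at s))
          = (t * phi (\<gamma> s) * norm (vector_derivative \<gamma> (at s))) ^ 2"
        unfolding first_form_Xf[OF L]
        by (simp add: power_mult_distrib flip: complex_norm_square of_real_power)
      then show ?thesis using phi_pos[OF L] by (simp add: abs_mult)
    qed simp
  qed
  have "I = \<infinity>"
  proof (rule ccontr)
    assume fin: "I \<noteq> \<infinity>"
    obtain c1 where c1: "c1 > 0" "\<And>z. z \<notin> gaussL \<Longrightarrow> c1 \<le> phi z" using phi_lower by blast
    obtain \<delta> c2 where \<delta>: "0 < \<delta>" "\<delta> \<le> 1/2" "0 < c2"
      and near: "\<And>z w. w \<in> gaussL \<Longrightarrow> z \<noteq> w \<Longrightarrow> norm (z - w) < \<delta> \<Longrightarrow> c2 / norm (z - w) ^ 8 \<le> phi z"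
      using phi_growth by blast
    define c where "c = \<bar>t\<bar> * min c1 c2"
    have c0: "c > 0" using t0 c1 \<delta> by (simp add: c_def)
    obtain a K where aK: "0 < a" "a < 1" "compact K" "K \<subseteq> - gaussL" "\<gamma> ` {a..<1} \<subseteq> K"
    proof (rule finite_length_stays[OF C1 sub _ c0 \<delta>(1,2)])
      show "continuous_on (- gaussL) (\<lambda>z. \<bar>t\<bar> * phi z)" by (intro continuous_intros phi_continuous)
      show "c \<le> \<bar>t\<bar> * phi z" if "z \<notin> gaussL" for z
        unfolding c_def using c1(2)[OF that] by (intro mult_left_mono) auto
      show "c / norm (z - w) \<le> \<bar>t\<bar> * phi z" if w: "w \<in> gaussL" "z \<noteq> w" "norm (z - w) < \<delta>" for z w
      proof -
        have "norm (z - w) ^ 8 \<le> norm (z - w) ^ 1" using w \<delta> by (intro power_decreasing) auto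
        then have "min c1 c2 / norm (z - w) \<le> c2 / norm (z - w) ^ 8"
          using w \<delta> c1 by (intro frac_le) auto
        also have "\<dots> \<le> phi z" by (rule near[OF w])
        finally show ?thesis unfolding c_def times_divide_eq_right[symmetric] by (intro mult_left_mono) auto
      qed
      show "(\<integral>\<^sup>+s\<in>{0..<1}. ennreal (\<bar>t\<bar> * phi (\<gamma> s) * norm (vector_derivative \<gamma> (at s))) \<partial>lborel) \<noteq> \<infinity>"
        using fin by (simp add: I_def)
    qed
    have "\<forall>\<^sub>F s in at_left 1. proj 2 (2 * \<i>) (\<gamma> s) \<notin> proj 2 (2 * \<i>) ` K" using div aK by blast
    moreover have "\<forall>\<^sub>F s in at_left 1. s \<in> {a<..<1}" by (rule eventually_at_left_real[OF aK(2)])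
    ultimately have "\<forall>\<^sub>F s in at_left (1::real). False"
      by eventually_elim (use aK(5) in force)
    then show False by simp
  qed
  then show "(\<integral>\<^sup>+s\<in>{0..<1}. ennreal (sqrt (first_form Xf (\<gamma> s) (vector_derivative \<gamma> (at s)) (vector_derivative \<gamma> (at s)))) \<partial>lborel) = \<infinity>"
    using eq by simp
qed

text \<open>Near a lattice point the numerator is at most of order -12 and \<open>phi z ^ 2\<close>
  at least of order -16, so the quotient even tends to 0; elsewhere it is continuous and
  periodic.\<close>

lemma curvature_bounded:
  obtains B where "\<And>z. z \<notin> gaussL \<Longrightarrow> 4 * norm (wp' z) ^ 4 / phi z ^ 2 \<le> B"
proof -
  obtain \<delta>0 c where \<delta>0: "0 < \<delta>0" "\<delta>0 \<le> 1/2" "0 < c"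
    and near0: "\<And>z w. w \<in> gaussL \<Longrightarrow> z \<noteq> w \<Longrightarrow> norm (z - w) < \<delta>0 \<Longrightarrow> c / norm (z - w) ^ 8 \<le> phi z"
    using phi_growth by blast
  define \<delta> where "\<delta> = min \<delta>0 (1/4)"
  have \<delta>: "0 < \<delta>" using \<delta>0 by (simp add: \<delta>_def)
  obtain C where C: "C > 0" "\<And>z w. w \<in> gaussL \<Longrightarrow> z \<noteq> w \<Longrightarrow> norm (z - w) \<le> 1/4 \<Longrightarrow> norm (wp' z) \<le> C / norm (z - w) ^ 3"
    using wp'_growth by blast
  define g where "g = (\<lambda>z. 4 * norm (wp' z) ^ 4 / phi z ^ 2)"
  define K where "K = cbox 0 (Complex 1 1) \<inter> {z. \<forall>w\<in>gaussL. \<delta> \<le> norm (z - w)}"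
  have K: "compact K" "K \<subseteq> - gaussL" using compact_cell[OF \<delta>] by (auto simp: K_def)
  have "continuous_on K g"
    unfolding g_def using phi_pos K(2)
    by (intro continuous_intros continuous_on_subset[OF phi_continuous K(2)]
        continuous_on_subset[OF holomorphic_on_imp_continuous_on[OF wp'_holomorphic] K(2)]) force
  then have "bounded (g ` K)" by (intro compact_imp_bounded compact_continuous_image K)
  then obtain B1 where B1: "\<And>z. z \<in> K \<Longrightarrow> norm (g z) \<le> B1" by (auto simp: bounded_iff)
  have "g z \<le> max B1 (4 * C ^ 4 / c ^ 2)" if z: "z \<notin> gaussL" for z
  proof (cases "\<exists>w\<in>gaussL. norm (z - w) < \<delta>")
    case True
    then obtain w where w: "w \<in> gaussL" "norm (z - w) < \<delta>" by blast
    have zw: "z \<noteq> w" using z w by auto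
    define n where "n = norm (z - w)"
    have n: "0 < n" "n \<le> 1" using zw w by (auto simp: n_def \<delta>_def)
    have "norm (wp' z) \<le> C / n ^ 3" unfolding n_def using w zw by (intro C(2)) (auto simp: \<delta>_def)
    then have 1: "norm (wp' z) ^ 4 \<le> (C / n ^ 3) ^ 4" by (intro power_mono) auto
    have "c / n ^ 8 \<le> phi z" unfolding n_def using w zw by (intro near0) (auto simp: \<delta>_def)
    then have 2: "(c / n ^ 8) ^ 2 \<le> phi z ^ 2" using \<delta>0 n by (intro power_mono) auto
    have "g z \<le> 4 * (C / n ^ 3) ^ 4 / (c / n ^ 8) ^ 2"
      unfolding g_def using 1 2 \<delta>0 n by (intro frac_le) auto
    also have "\<dots> = 4 * C ^ 4 / c ^ 2 * n ^ 4"
      using n \<delta>0 by (simp add: power_divide field_simps flip: power_mult power_add)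
    also have "\<dots> \<le> 4 * C ^ 4 / c ^ 2 * 1"
      using n C \<delta>0 by (intro mult_left_mono power_le_one) auto
    finally show ?thesis by simp
  next
    case False
    obtain w where w: "w \<in> gaussL" "z - w \<in> cbox 0 (Complex 1 1)" using unit_square_reduce by blast
    have zK: "z - w \<in> K"
      unfolding K_def
    proof (intro IntI w CollectI ballI)
      fix v assume "v \<in> gaussL"
      then have "w + v \<in> gaussL" using w gaussL_add by blast
      then have "\<delta> \<le> norm (z - (w + v))" using False by force
      then show "\<delta> \<le> norm (z - w - v)" by (simp add: diff_diff_eq)
    qed
    then have L: "z - w \<notin> gaussL" using K(2) by auto
    have "g z = g (z - w)"
      using phi_periodic[OF L w(1)] deriv_wp_periodic[OF w(1) L] by (simp add: g_def)
    then show ?thesis using B1[OF zK] by simp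
  qed
  then show ?thesis unfolding g_def by (rule that)
qed

lemma total_curvature: "finite_total_curvature 2 (2 * \<i>) ends Xf"
  unfolding finite_total_curvature_def cover_domain_ends
proof -
  let ?A = "fundamental_parallelogram 2 (2 * \<i>) \<inter> - gaussL"
  define g where "g = (\<lambda>z. 4 * norm (wp' z) ^ 4 / phi z ^ 2)"
  have fp: "fundamental_parallelogram 2 (2 * \<i>) = {z. 0 \<le> Re z} \<inter> {z. Re z < 2} \<inter> {z. 0 \<le> Im z} \<inter> {z. Im z < 2}"
  proof (intro set_eqI iffI)
    fix z assume "z \<in> {z. 0 \<le> Re z} \<inter> {z. Re z < 2} \<inter> {z. 0 \<le> Im z} \<inter> {z. Im z < 2}"
    then have "z = of_real (Re z / 2) * 2 + of_real (Im z / 2) * (2 * \<i>) \<and> 0 \<le> Re z / 2 \<and> Re z / 2 < 1 \<and> 0 \<le> Im z / 2 \<and> Im z / 2 < 1"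
      by (auto simp: complex_eq_iff)
    then show "z \<in> fundamental_parallelogram 2 (2 * \<i>)" unfolding fundamental_parallelogram_def by blast
  qed (auto simp: fundamental_parallelogram_def)
  have Ab: "?A \<in> sets borel"
    unfolding fp using open_compl_gaussL
    by (intro sets.Int borel_closed borel_open closed_halfspace_Re_ge closed_halfspace_Im_ge
        open_halfspace_Re_lt open_halfspace_Im_lt) auto
  have bd: "bounded ?A"
  proof (rule bounded_subset[of "cbox 0 (Complex 2 2)"])
    show "?A \<subseteq> cbox 0 (Complex 2 2)" unfolding fp by (auto simp: in_cbox_complex_iff)
  qed simp
  obtain B where B: "\<And>z. z \<notin> gaussL \<Longrightarrow> g z \<le> B" unfolding g_def using curvature_bounded by blast
  have g0: "0 \<le> g z" for z by (simp add: g_def)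
  have contg: "continuous_on (- gaussL) g"
    unfolding g_def using phi_pos
    by (intro continuous_intros phi_continuous holomorphic_on_imp_continuous_on[OF wp'_holomorphic]) force
  have "integrable lborel (\<lambda>x. indicator ?A x *\<^sub>R (indicator (- gaussL) x *\<^sub>R g x))"
  proof (rule integrableI_bounded_set_indicator)
    show "?A \<in> sets lborel" using Ab by simp
    show "(\<lambda>x. indicator (- gaussL) x *\<^sub>R g x) \<in> borel_measurable lborel"
      using borel_measurable_continuous_on_indicator[OF _ contg] open_compl_gaussL by simp
    show "emeasure lborel ?A < \<infinity>" using emeasure_bounded_finite[OF bd] by simp
    show "AE x in lborel. x \<in> ?A \<longrightarrow> norm (indicator (- gaussL) x *\<^sub>R g x) \<le> B"
      using B g0 by (intro AE_I2) auto
  qed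
  moreover have "(\<lambda>x. indicator ?A x *\<^sub>R (indicator (- gaussL) x *\<^sub>R g x))
      = (\<lambda>x. indicator ?A x *\<^sub>R (- gauss_curvature Xf x * first_form Xf x 1 1))"
  proof
    fix z
    show "indicator ?A z *\<^sub>R (indicator (- gaussL) z *\<^sub>R g z) = indicator ?A z *\<^sub>R (- gauss_curvature Xf z * first_form Xf z 1 1)"
    proof (cases "z \<in> ?A")
      case True
      then have L: "z \<notin> gaussL" by simp
      then obtain W F a1 a2 Y1 Y2 H2 where W0: "z \<in> W" "local_data W F a1 a2 Y1 Y2 H2"
        using local_data_exists by blast
      note W = W0(1) local_dataD(2,4-6)[OF W0(2)]
      have "- gauss_curvature Xf z * first_form Xf z 1 1 = g z"
        using br_gauss_curvature[OF W(2,3,1) t0] by (simp add: g_def W(4)[OF W(1)] norm_power flip: power_mult)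
      then show ?thesis using L by simp
    qed simp
  qed
  ultimately show "set_integrable lborel ?A (\<lambda>z. - gauss_curvature Xf z * first_form Xf z 1 1)"
    by (simp add: set_integrable_def)
qed

lemma complete_cmc1: "complete_cmc1_ftc 2 (2 * \<i>) ends f"
  unfolding complete_cmc1_ftc_def Let_def cover_domain_ends
  using conformal cmc1 complete total_curvature by blast

end

section \<open>The two Gauss maps\<close>

lemma eventually_zero_or_nonzero:
  assumes "f holomorphic_on W" "open W" "z \<in> W"
  shows "(\<forall>\<^sub>F v in nhds z. f v = 0) \<or> (\<forall>\<^sub>F v in at z. f v \<noteq> 0)"
proof (cases "\<exists>\<^sub>F v in at z. f v = 0")
  case True
  have an: "f analytic_on {z}" using assms analytic_at by blast
  have ev: "\<forall>\<^sub>F v in at z. f v = 0"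
    using True an by (intro not_essential_frequently_0_imp_eventually_0
        isolated_singularity_at_analytic not_essential_analytic)
  then have "f \<midarrow>z\<rightarrow> 0" by (rule tendsto_eventually)
  moreover have "f \<midarrow>z\<rightarrow> f z" using an analytic_at_imp_isCont isContD by blast
  ultimately have "f z = 0" using LIM_unique by blast
  with ev show ?thesis unfolding eventually_at_filter by (auto elim: eventually_mono)
qed (simp add: frequently_def)

text \<open>Covers both Gauss maps: \<open>(a1, a2)\<close> and \<open>(Y1, Y2)\<close> are pairs
  without common zeros and with the same Wronskian \<open>wp'^2\<close>.\<close>

locale wronskian =
  fixes W :: "complex set" and y1 y2 q :: "complex \<Rightarrow> complex"
  assumes opn: "open W" and hol1: "y1 holomorphic_on W" and hol2: "y2 holomorphic_on W"
    and wron: "z \<in> W \<Longrightarrow> y1 z * deriv y2 z - deriv y1 z * y2 z = q z"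
    and nz: "z \<in> W \<Longrightarrow> y1 z \<noteq> 0 \<or> y2 z \<noteq> 0"
    and q: "z \<in> W \<Longrightarrow> \<forall>\<^sub>F v in at z. q v \<noteq> 0"
begin

text \<open>If \<open>y2\<close> vanished on an open set, so would the Wronskian \<open>q\<close>,
  whose zeros are isolated.\<close>

lemma y2_isolated:
  assumes z: "z \<in> W"
  shows "\<forall>\<^sub>F v in at z. y2 v \<noteq> 0"
proof (rule ccontr)
  assume "\<not> ?thesis"
  then have "\<forall>\<^sub>F v in nhds z. y2 v = 0"
    using eventually_zero_or_nonzero[OF hol2 opn z] by blast
  then have "\<forall>\<^sub>F v in nhds z. (\<forall>\<^sub>F u in nhds v. y2 u = 0) \<and> v \<in> W"
    using opn z by (intro eventually_conj eventually_nhds_in_open) (simp_all add: eventually_eventually)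
  then have "\<forall>\<^sub>F v in nhds z. q v = 0"
  proof (rule eventually_mono, elim conjE)
    fix v assume v: "\<forall>\<^sub>F u in nhds v. y2 u = 0" "v \<in> W"
    then have "deriv y2 v = deriv (\<lambda>_. 0) v" by (intro deriv_cong_ev) auto
    moreover have "y2 v = 0" using v(1) by (rule eventually_nhds_x_imp_x)
    ultimately show "q v = 0" using wron[OF v(2)] by simp
  qed
  then have "\<forall>\<^sub>F v in at z. q v = 0" by (rule filter_leD[OF at_within_le_nhds])
  with q[OF z] have "\<forall>\<^sub>F v in at z. False" by eventually_elim simp
  then show False by simp
qed

lemma ratio_pole:
  assumes "z \<in> W" "y2 z = 0"
  shows "is_pole (\<lambda>z. y1 z / y2 z) z"
proof (rule is_pole_divide)
  have c: "isCont y1 z" "isCont y2 z"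
    using hol1 hol2 opn assms(1) holomorphic_on_imp_continuous_on continuous_on_eq_continuous_at by blast+
  then show "isCont y1 z" by simp
  show "filterlim y2 (at 0) (at z)"
    using c(2) assms(2) y2_isolated[OF assms(1)] by (simp add: filterlim_at isCont_def)
  show "y1 z \<noteq> 0" using nz[OF assms(1)] assms(2) by simp
qed

lemma ratio_analytic:
  assumes "z \<in> W" "y2 z \<noteq> 0"
  shows "(\<lambda>z. y1 z / y2 z) analytic_on {z}"
  using assms hol1 hol2 opn analytic_at by (intro analytic_on_divide) blast+

lemma ratio_pole_iff: "z \<in> W \<Longrightarrow> is_pole (\<lambda>z. y1 z / y2 z) z \<longleftrightarrow> y2 z = 0"
  using ratio_pole ratio_analytic analytic_at_imp_no_pole by blast

lemma ratio_deriv: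
  assumes "z \<in> W" "y2 z \<noteq> 0"
  shows "deriv (\<lambda>z. y1 z / y2 z) z = - q z / y2 z ^ 2"
proof -
  have "((\<lambda>z. y1 z / y2 z) has_field_derivative (deriv y1 z * y2 z - y1 z * deriv y2 z) / (y2 z * y2 z)) (at z)"
    by (rule DERIV_divide[OF holomorphic_derivI[OF hol1 opn assms(1)] holomorphic_derivI[OF hol2 opn assms(1)] assms(2)])
  moreover have "deriv y1 z * y2 z - y1 z * deriv y2 z = - q z" using wron[OF assms(1)] by (simp add: algebra_simps)
  ultimately show ?thesis by (simp add: DERIV_imp_deriv power2_eq_square)
qed

text \<open>Division by zero yields 0 at a pole, the value that nicely meromorphic functions take
  there.\<close>

lemma ratio_nicely: "(\<lambda>z. y1 z / y2 z) nicely_meromorphic_on W"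
  unfolding nicely_meromorphic_on_def
proof (intro conjI ballI)
  have "y1 analytic_on W" "y2 analytic_on W" using hol1 hol2 opn by (simp_all add: analytic_on_open)
  then show "(\<lambda>z. y1 z / y2 z) meromorphic_on W"
    by (intro meromorphic_on_divide analytic_on_imp_meromorphic_on)
  fix z assume z: "z \<in> W"
  show "is_pole (\<lambda>z. y1 z / y2 z) z \<and> y1 z / y2 z = 0 \<or> (\<lambda>z. y1 z / y2 z) \<midarrow>z\<rightarrow> y1 z / y2 z"
  proof (cases "y2 z = 0")
    case False
    from analytic_at_imp_isCont[OF ratio_analytic[OF z this]] show ?thesis by (simp add: isCont_def)
  qed (simp add: ratio_pole[OF z])
qed

end

lemma wp'_isolated:
  assumes "z \<notin> gaussL"
  shows "\<forall>\<^sub>F v in at z. wp' v ^ 2 \<noteq> 0"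
proof -
  have "\<not> (\<forall>\<^sub>F v in nhds z. wp' v = 0)"
  proof
    assume ev: "\<forall>\<^sub>F v in nhds z. wp' v = 0"
    then have "deriv wp' z = deriv (\<lambda>_. 0) z" by (intro deriv_cong_ev) auto
    moreover have "wp' z = 0" using ev by (rule eventually_nhds_x_imp_x)
    ultimately show False using wp'_zero_simple[OF assms] by simp
  qed
  then show ?thesis
    using eventually_zero_or_nonzero[OF wp'_holomorphic open_compl_gaussL, of z] assms by auto
qed

lemma matrix_inv_mult_left:
  assumes "det (A :: cmat2) = 1"
  shows "matrix_inv A ** (A ** B) = B"
proof -
  have "invertible A" using assms by (simp add: invertible_det_nz)
  then have "matrix_inv A ** A = mat 1"
    unfolding matrix_inv_def invertible_def by (rule someI2_ex) simp
  then show ?thesis by (simp add: matrix_mul_assoc)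
qed

context surface begin

text \<open>\<open>Y = F a\<close>, and the derivative of \<open>F\<close> annihilates
  \<open>a\<close>. Hence \<open>Y' = F a'\<close>, and \<open>det F = 1\<close> carries the
  Wronskian over from \<open>a\<close> to \<open>Y\<close>; invertibility of \<open>F\<close>
  excludes common zeros.\<close>

lemma bryant_wronskian:
  assumes "local_data W F a1 a2 Y1 Y2 H2"
  shows "wronskian W a1 a2 (\<lambda>z. wp' z ^ 2)" "wronskian W Y1 Y2 (\<lambda>z. wp' z ^ 2)"
proof -
  note W = local_dataD[OF assms]
  have h: "open W" "a1 holomorphic_on W" "a2 holomorphic_on W" "Y1 holomorphic_on W" "Y2 holomorphic_on W" "hol_mat W F"
    using W(2) by (auto simp: bryant_def)
  have q: "\<forall>\<^sub>F v in at z. wp' v ^ 2 \<noteq> 0" if "z \<in> W" for z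
    using W(1) that by (intro wp'_isolated) blast
  show "wronskian W a1 a2 (\<lambda>z. wp' z ^ 2)"
    by unfold_locales (use h q W(2) in \<open>auto simp: bryant_def\<close>)
  show "wronskian W Y1 Y2 (\<lambda>z. wp' z ^ 2)"
  proof unfold_locales
    fix z assume z: "z \<in> W"
    have b: "det (F z) = 1" "mat_deriv F z = mat2 (- of_real t * Y1 z * a2 z) (of_real t * Y1 z * a1 z)
                             (- of_real t * Y2 z * a2 z) (of_real t * Y2 z * a1 z)"
        "Y1 z = F z $ 1 $ 1 * a1 z + F z $ 1 $ 2 * a2 z" "Y2 z = F z $ 2 $ 1 * a1 z + F z $ 2 $ 2 * a2 z"
        "a1 z * deriv a2 z - deriv a1 z * a2 z = wp' z ^ 2" "a1 z \<noteq> 0 \<or> a2 z \<noteq> 0"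
      using W(2) z by (auto simp: bryant_def)
    have d: "F z $ 1 $ 1 * F z $ 2 $ 2 - F z $ 1 $ 2 * F z $ 2 $ 1 = 1" using b(1) by (simp add: det_2)
    have dF: "((\<lambda>z. F z $ i $ j) has_field_derivative mat_deriv F z $ i $ j) (at z)" for i j
      unfolding mat_deriv_nth using h(1,6) z by (intro holomorphic_derivI[of _ W]) (auto simp: hol_mat_def)
    have da: "(a1 has_field_derivative deriv a1 z) (at z)" "(a2 has_field_derivative deriv a2 z) (at z)"
      using h z by (auto intro: holomorphic_derivI)
    have "deriv Y z = F z $ i $ 1 * deriv a1 z + F z $ i $ 2 * deriv a2 z"
      if Y: "\<And>z. z \<in> W \<Longrightarrow> Y z = F z $ i $ 1 * a1 z + F z $ i $ 2 * a2 z"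
        and m: "mat_deriv F z $ i $ 1 * a1 z + mat_deriv F z $ i $ 2 * a2 z = 0" for Y i
    proof -
      have "((\<lambda>z. F z $ i $ 1 * a1 z + F z $ i $ 2 * a2 z) has_field_derivative
          (mat_deriv F z $ i $ 1 * a1 z + deriv a1 z * F z $ i $ 1) + (mat_deriv F z $ i $ 2 * a2 z + deriv a2 z * F z $ i $ 2)) (at z)"
        by (intro DERIV_add DERIV_mult dF da)
      then have "(Y has_field_derivative
          (mat_deriv F z $ i $ 1 * a1 z + deriv a1 z * F z $ i $ 1) + (mat_deriv F z $ i $ 2 * a2 z + deriv a2 z * F z $ i $ 2)) (at z)"
        by (rule has_field_derivative_transform_within_open[OF _ h(1) z]) (simp add: Y)
      then have "deriv Y z = (mat_deriv F z $ i $ 1 * a1 z + deriv a1 z * F z $ i $ 1) + (mat_deriv F z $ i $ 2 * a2 z + deriv a2 z * F z $ i $ 2)"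
        by (rule DERIV_imp_deriv)
      also have "\<dots> = (mat_deriv F z $ i $ 1 * a1 z + mat_deriv F z $ i $ 2 * a2 z) + (F z $ i $ 1 * deriv a1 z + F z $ i $ 2 * deriv a2 z)"
        by (simp only: algebra_simps)
      finally show ?thesis unfolding m by simp
    qed
    note dY = this
    have Y: "Y1 v = F v $ 1 $ 1 * a1 v + F v $ 1 $ 2 * a2 v" "Y2 v = F v $ 2 $ 1 * a1 v + F v $ 2 $ 2 * a2 v" if "v \<in> W" for v
      using W(2) that by (auto simp: bryant_def)
    have 1: "deriv Y1 z = F z $ 1 $ 1 * deriv a1 z + F z $ 1 $ 2 * deriv a2 z"
      by (rule dY[OF Y(1)]) (simp_all only: b(2) mat2_nth, simp add: algebra_simps)
    have 2: "deriv Y2 z = F z $ 2 $ 1 * deriv a1 z + F z $ 2 $ 2 * deriv a2 z"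
      by (rule dY[OF Y(2)]) (simp_all only: b(2) mat2_nth, simp add: algebra_simps)
    have "Y1 z * deriv Y2 z - deriv Y1 z * Y2 z
        = (F z $ 1 $ 1 * F z $ 2 $ 2 - F z $ 1 $ 2 * F z $ 2 $ 1) * (a1 z * deriv a2 z - deriv a1 z * a2 z)"
      unfolding 1 2 b(3,4) by (simp add: algebra_simps)
    then show "Y1 z * deriv Y2 z - deriv Y1 z * Y2 z = wp' z ^ 2" unfolding d b(5) by simp
    show "Y1 z \<noteq> 0 \<or> Y2 z \<noteq> 0"
    proof (rule ccontr)
      assume "\<not> ?thesis"
      then have e: "F z $ 1 $ 1 * a1 z + F z $ 1 $ 2 * a2 z = 0" "F z $ 2 $ 1 * a1 z + F z $ 2 $ 2 * a2 z = 0"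
        using b(3,4) by auto
      have "a1 z = (F z $ 1 $ 1 * F z $ 2 $ 2 - F z $ 1 $ 2 * F z $ 2 $ 1) * a1 z"
        "a2 z = (F z $ 1 $ 1 * F z $ 2 $ 2 - F z $ 1 $ 2 * F z $ 2 $ 1) * a2 z" unfolding d by simp_all
      moreover have "(F z $ 1 $ 1 * F z $ 2 $ 2 - F z $ 1 $ 2 * F z $ 2 $ 1) * a1 z
          = F z $ 2 $ 2 * (F z $ 1 $ 1 * a1 z + F z $ 1 $ 2 * a2 z) - F z $ 1 $ 2 * (F z $ 2 $ 1 * a1 z + F z $ 2 $ 2 * a2 z)"
        "(F z $ 1 $ 1 * F z $ 2 $ 2 - F z $ 1 $ 2 * F z $ 2 $ 1) * a2 z
          = F z $ 1 $ 1 * (F z $ 2 $ 1 * a1 z + F z $ 2 $ 2 * a2 z) - F z $ 2 $ 1 * (F z $ 1 $ 1 * a1 z + F z $ 1 $ 2 * a2 z)"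
        by (simp_all add: algebra_simps)
      ultimately show False using b(6) unfolding e by simp
    qed
  qed (use h q in auto)
qed

lemma null_lift:
  assumes "local_data W F a1 a2 Y1 Y2 H2"
  shows "null_lift_on W Xf F"
  unfolding null_lift_on_def
proof (intro conjI allI ballI)
  note W = local_dataD[OF assms]
  interpret Y: wronskian W Y1 Y2 "\<lambda>z. wp' z ^ 2" by (rule bryant_wronskian(2)[OF assms])
  show "(\<lambda>z. F z $ i $ j) holomorphic_on W" for i j using W(2) by (auto simp: bryant_def hol_mat_def)
  fix z assume z: "z \<in> W"
  have b: "det (F z) = 1" "mat_deriv F z = mat2 (- of_real t * Y1 z * a2 z) (of_real t * Y1 z * a1 z)
                             (- of_real t * Y2 z * a2 z) (of_real t * Y2 z * a1 z)" "a1 z \<noteq> 0 \<or> a2 z \<noteq> 0"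
    using W(2) z by (auto simp: bryant_def)
  show "det (F z) = 1" by (rule b(1))
  show "det (mat_deriv F z) = 0" unfolding b(2) det_2[of "mat2 _ _ _ _"] by simp
  show "mat_deriv F z \<noteq> 0"
    using Y.nz[OF z] b(3) t0 unfolding b(2) cmat2_eq_iff by auto
  show "Xf z = F z ** conj_transpose (F z)" by (rule W(4)[OF z])
qed

text \<open>The logarithmic derivative of \<open>F\<close> is \<open>t\<close> times the column
  \<open>a\<close> times the row \<open>(- a2, a1)\<close>, which means \<open>g = a1 / a2\<close>
  and \<open>\<omega> = - t a2^2\<close>. As \<open>g' = - wp'^2 / a2^2\<close>, the product is
  \<open>t wp'^2\<close>.\<close>

lemma hopf: "hopf_differential 2 (2 * \<i>) ends f (\<lambda>z. of_real t * wp' z ^ 2)"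
  unfolding hopf_differential_def Let_def cover_domain_ends
proof (intro conjI ballI)
  show "(\<lambda>z. of_real t * wp' z ^ 2) holomorphic_on - gaussL"
    by (intro holomorphic_intros wp'_holomorphic)
  fix z assume "z \<in> - gaussL"
  then obtain W F a1 a2 Y1 Y2 H2 where W0: "z \<in> W" "local_data W F a1 a2 Y1 Y2 H2"
    using local_data_exists by blast
  note W = local_dataD[OF W0(2)]
  interpret a: wronskian W a1 a2 "\<lambda>z. wp' z ^ 2" by (rule bryant_wronskian(1)[OF W0(2)])
  define \<omega> where "\<omega> = (\<lambda>z. - of_real t * a2 z ^ 2)"
  have "weierstrass_data_on W F (\<lambda>z. a1 z / a2 z) \<omega>"
    unfolding weierstrass_data_on_def
  proof (intro conjI ballI impI a.ratio_nicely)
    show "\<omega> holomorphic_on W" unfolding \<omega>_def by (intro holomorphic_intros a.hol2)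
    fix v assume v: "v \<in> W" "\<not> is_pole (\<lambda>z. a1 z / a2 z) v"
    have a2: "a2 v \<noteq> 0" using v a.ratio_pole_iff by blast
    have b: "det (F v) = 1" "mat_deriv F v = mat2 (- of_real t * Y1 v * a2 v) (of_real t * Y1 v * a1 v)
                             (- of_real t * Y2 v * a2 v) (of_real t * Y2 v * a1 v)"
        "Y1 v = F v $ 1 $ 1 * a1 v + F v $ 1 $ 2 * a2 v" "Y2 v = F v $ 2 $ 1 * a1 v + F v $ 2 $ 2 * a2 v"
      using W(2) v(1) by (auto simp: bryant_def)
    let ?M = "mat2 (- of_real t * a1 v * a2 v) (of_real t * a1 v ^ 2) (- of_real t * a2 v ^ 2) (of_real t * a1 v * a2 v)"
    have "mat_deriv F v = F v ** ?M"
      unfolding b(2) cmat2_eq_iff matmul_nth mat2_nth b(3,4) by (simp add: algebra_simps power2_eq_square)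
    then have "matrix_inv (F v) ** mat_deriv F v = ?M" using matrix_inv_mult_left[OF b(1)] by simp
    then show "matrix_inv (F v) ** mat_deriv F v = mat2 (a1 v / a2 v * \<omega> v) (- (a1 v / a2 v)\<^sup>2 * \<omega> v) (\<omega> v) (- (a1 v / a2 v) * \<omega> v)"
      using a2 by (simp add: \<omega>_def power2_eq_square cmat2_eq_iff)
  qed
  moreover have "\<omega> v * deriv (\<lambda>z. a1 z / a2 z) v = of_real t * wp' v ^ 2"
    if v: "v \<in> W" "\<not> is_pole (\<lambda>z. a1 z / a2 z) v" for v
    using v a.ratio_pole_iff[OF v(1)] a.ratio_deriv[OF v(1)] by (simp add: \<omega>_def)
  ultimately show "\<exists>U F g \<omega>. open U \<and> z \<in> U \<and> U \<subseteq> - gaussL \<and> null_lift_on U Xf F \<and>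
      weierstrass_data_on U F g \<omega> \<and> (\<forall>w\<in>U. \<not> is_pole g w \<longrightarrow> \<omega> w * deriv g w = of_real t * wp' w ^ 2)"
    using a.opn W0(1) W(1) null_lift[OF W0(2)] by blast
qed

text \<open>The two entries of \<open>VV\<close> are \<open>Y1 cnj Y2\<close> and
  \<open>Y2 cnj Y2\<close>, so the quotient is \<open>Y1 / Y2\<close> in every branch and is defined
  globally. Where \<open>Y2 = 0\<close> it takes the value 0, as required at poles.\<close>

definition G :: "complex \<Rightarrow> complex" where "G z = VV z $ 1 $ 2 / VV z $ 2 $ 2"

lemma G_local:
  assumes "local_data W F a1 a2 Y1 Y2 H2" "z \<in> W"
  shows "G z = Y1 z / Y2 z"
  using local_dataD(6)[OF assms] by (simp add: G_def)

lemma G_local_cong: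
  assumes "local_data W F a1 a2 Y1 Y2 H2" "z \<in> W"
  shows "\<forall>\<^sub>F v in nhds z. G v = Y1 v / Y2 v"
proof -
  have "open W" using local_dataD(2)[OF assms(1)] by (simp add: bryant_def)
  from eventually_nhds_in_open[OF this assms(2)] show ?thesis
    by eventually_elim (rule G_local[OF assms(1)])
qed

lemma G_pole_iff:
  assumes "local_data W F a1 a2 Y1 Y2 H2" "z \<in> W"
  shows "is_pole G z \<longleftrightarrow> Y2 z = 0"
proof -
  interpret Y: wronskian W Y1 Y2 "\<lambda>z. wp' z ^ 2" by (rule bryant_wronskian(2)[OF assms(1)])
  have "is_pole G z \<longleftrightarrow> is_pole (\<lambda>z. Y1 z / Y2 z) z"
    by (intro is_pole_cong filter_leD[OF at_within_le_nhds G_local_cong[OF assms]] refl)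
  then show ?thesis using Y.ratio_pole_iff[OF assms(2)] by simp
qed

lemma hyperbolic_gauss_map_G: "hyperbolic_gauss_map 2 (2 * \<i>) ends f G"
  unfolding hyperbolic_gauss_map_def Let_def cover_domain_ends
proof (intro conjI ballI)
  have loc: "G meromorphic_on {z}" "is_pole G z \<and> G z = 0 \<or> G \<midarrow>z\<rightarrow> G z"
    "\<exists>U F. open U \<and> z \<in> U \<and> U \<subseteq> - gaussL \<and> null_lift_on U Xf F \<and>
           (\<forall>w\<in>U. \<not> is_pole G w \<longrightarrow>
              mat_deriv F w $ 1 $ 1 = G w * mat_deriv F w $ 2 $ 1 \<and>
              mat_deriv F w $ 1 $ 2 = G w * mat_deriv F w $ 2 $ 2)" if "z \<in> - gaussL" for z
  proof -
    obtain W F a1 a2 Y1 Y2 H2 where W0: "z \<in> W" "local_data W F a1 a2 Y1 Y2 H2"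
      using local_data_exists \<open>z \<in> - gaussL\<close> by blast
    note W = local_dataD[OF W0(2)]
    interpret Y: wronskian W Y1 Y2 "\<lambda>z. wp' z ^ 2" by (rule bryant_wronskian(2)[OF W0(2)])
    have at: "\<forall>\<^sub>F v in at z. G v = Y1 v / Y2 v"
      by (rule filter_leD[OF at_within_le_nhds G_local_cong[OF W0(2,1)]])
    have n: "(\<lambda>z. Y1 z / Y2 z) nicely_meromorphic_on {z}"
      using nicely_meromorphic_on_subset[OF Y.ratio_nicely] W0(1) by blast
    have "G meromorphic_on {z} \<longleftrightarrow> (\<lambda>z. Y1 z / Y2 z) meromorphic_on {z}"
      by (rule meromorphic_on_cong) (use at in auto)
    then show "G meromorphic_on {z}" using n by (simp add: nicely_meromorphic_on_def)
    have "is_pole G z \<longleftrightarrow> is_pole (\<lambda>z. Y1 z / Y2 z) z" by (rule is_pole_cong[OF at refl])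
    moreover have "G \<midarrow>z\<rightarrow> G z \<longleftrightarrow> (\<lambda>z. Y1 z / Y2 z) \<midarrow>z\<rightarrow> G z" by (rule tendsto_cong[OF at])
    ultimately show "is_pole G z \<and> G z = 0 \<or> G \<midarrow>z\<rightarrow> G z"
      using n G_local[OF W0(2,1)] by (auto simp: nicely_meromorphic_on_def)
    have "mat_deriv F w $ 1 $ 1 = G w * mat_deriv F w $ 2 $ 1 \<and> mat_deriv F w $ 1 $ 2 = G w * mat_deriv F w $ 2 $ 2"
      if w: "w \<in> W" "\<not> is_pole G w" for w
    proof -
      have "mat_deriv F w = mat2 (- of_real t * Y1 w * a2 w) (of_real t * Y1 w * a1 w)
                             (- of_real t * Y2 w * a2 w) (of_real t * Y2 w * a1 w)"
        using W(2) w(1) by (auto simp: bryant_def)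
      moreover have "Y2 w \<noteq> 0" using G_pole_iff[OF W0(2) w(1)] w(2) by simp
      ultimately show ?thesis by (simp only: G_local[OF W0(2) w(1)] mat2_nth) (simp add: field_simps)
    qed
    then show "\<exists>U F. open U \<and> z \<in> U \<and> U \<subseteq> - gaussL \<and> null_lift_on U Xf F \<and>
           (\<forall>w\<in>U. \<not> is_pole G w \<longrightarrow>
              mat_deriv F w $ 1 $ 1 = G w * mat_deriv F w $ 2 $ 1 \<and>
              mat_deriv F w $ 1 $ 2 = G w * mat_deriv F w $ 2 $ 2)"
      using Y.opn W0(1) W(1) null_lift[OF W0(2)] by blast
  qed
  show "G nicely_meromorphic_on - gaussL"
    unfolding nicely_meromorphic_on_def
  proof (intro conjI ballI)
    show "G meromorphic_on - gaussL" using loc(1) unfolding meromorphic_on_def by blast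
  qed (rule loc(2))
  fix z assume "z \<in> - gaussL"
  then show "\<exists>U F. open U \<and> z \<in> U \<and> U \<subseteq> - gaussL \<and> null_lift_on U Xf F \<and>
           (\<forall>w\<in>U. \<not> is_pole G w \<longrightarrow>
              mat_deriv F w $ 1 $ 1 = G w * mat_deriv F w $ 2 $ 1 \<and>
              mat_deriv F w $ 1 $ 2 = G w * mat_deriv F w $ 2 $ 2)" by (rule loc(3))
qed

end

section \<open>Irregularity of the ends\<close>

text \<open>The Gauss map determines \<open>Y2\<close> only up to sign, so the second-order equation
  is rewritten for the square. The left side is \<open>4 Y^3 (wp'^2 Y'' - 2 wp' wp'' Y')\<close>,
  and the result no longer mentions \<open>Y\<close>.\<close>

lemma square_of_solution:
  assumes sol: "wsol b t W Y H" and W: "open W" "W \<subseteq> - gaussL" and z: "z \<in> W"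
  defines "B \<equiv> (\<lambda>z. Y z ^ 2)"
  shows "wp' z ^ 2 * (2 * B z * deriv (deriv B) z - deriv B z ^ 2) - 4 * wp' z * deriv wp' z * B z * deriv B z
    = 4 * wp' z ^ 2 * (of_real t * wp' z ^ 2 + of_real b * (wp z * deriv wp' z - 3 / 2 * wp' z ^ 2)) * B z ^ 2"
proof -
  define Y' where "Y' = (\<lambda>z. sysA b z * Y z + sysC z * H z)"
  have dY: "(Y has_field_derivative Y' v) (at v)"
    and dH: "(H has_field_derivative sysB b t v * Y v - sysA b v * H v) (at v)" if "v \<in> W" for v
    using sol that by (auto simp: lin_sol_def Y'_def)
  have B1: "deriv B v = 2 * Y v * Y' v" if "v \<in> W" for v
    unfolding B_def by (rule DERIV_imp_deriv, rule DERIV_cong[OF DERIV_power[OF dY[OF that], of 2]]) simp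
  have zL: "z \<notin> gaussL" using z W(2) by blast
  have dA: "(sysA b has_field_derivative - of_real b * (wp' z ^ 2 + wp z * deriv wp' z)) (at z)"
  proof -
    have "((\<lambda>z. - of_real b * (wp z * wp' z)) has_field_derivative - of_real b * (wp' z * wp' z + deriv wp' z * wp z)) (at z)"
      by (intro DERIV_cmult DERIV_mult wp_DERIV wp'_DERIV zL)
    moreover have "sysA b = (\<lambda>z. - of_real b * (wp z * wp' z))" by (simp add: fun_eq_iff sysA_def)
    ultimately show ?thesis by (simp add: power2_eq_square mult.commute)
  qed
  have dC: "(sysC has_field_derivative 2 * wp' z * deriv wp' z) (at z)"
    unfolding sysC_def[abs_def] by (rule DERIV_cong[OF DERIV_power[OF wp'_DERIV[OF zL], of 2]]) simp
  define Y'' where "Y'' = (- of_real b * (wp' z ^ 2 + wp z * deriv wp' z)) * Y z + Y' z * sysA b z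
      + ((2 * wp' z * deriv wp' z) * H z + (sysB b t z * Y z - sysA b z * H z) * sysC z)"
  have "(Y' has_field_derivative Y'') (at z)"
    unfolding Y'_def Y''_def by (intro DERIV_add DERIV_mult dA dC dH[OF z] dY[OF z, unfolded Y'_def])
  then have "((\<lambda>v. 2 * (Y v * Y' v)) has_field_derivative 2 * (Y' z * Y' z + Y'' * Y z)) (at z)"
    by (intro DERIV_cmult DERIV_mult dY[OF z])
  then have "(deriv B has_field_derivative 2 * (Y' z * Y' z + Y'' * Y z)) (at z)"
    by (rule has_field_derivative_transform_within_open[OF _ W(1) z]) (simp add: B1)
  then have B2: "deriv (deriv B) z = 2 * (Y' z * Y' z + Y'' * Y z)" by (rule DERIV_imp_deriv)
  have "wp' z ^ 2 * Y'' - 2 * wp' z * deriv wp' z * Y' z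
      = wp' z ^ 2 * (of_real t * wp' z ^ 2 + of_real b * (wp z * deriv wp' z - 3 / 2 * wp' z ^ 2)) * Y z"
    unfolding Y''_def Y'_def sysA_def sysB_def sysC_def by (simp add: field_simps power2_eq_square)
  then have "4 * Y z ^ 3 * (wp' z ^ 2 * Y'' - 2 * wp' z * deriv wp' z * Y' z)
      = 4 * Y z ^ 3 * (wp' z ^ 2 * (of_real t * wp' z ^ 2 + of_real b * (wp z * deriv wp' z - 3 / 2 * wp' z ^ 2)) * Y z)"
    by simp
  then show ?thesis unfolding B1[OF z] B2 unfolding B_def
    by (simp add: algebra_simps power2_eq_square power3_eq_cube)
qed

lemma wp'_meromorphic:
  assumes "\<gamma> \<in> gaussL"
  shows "wp' meromorphic_on {\<gamma>}"
proof -
  have sub: "wp' v = - 2 / (v - \<gamma>) ^ 3 + deriv wp_reg (v - \<gamma>)" if v: "v \<in> ball \<gamma> (1/2) - {\<gamma>}" for v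
  proof -
    have s: "v - \<gamma> \<in> ball 0 (1/2)" "v - \<gamma> \<noteq> 0" using v by (auto simp: dist_norm norm_minus_commute)
    then have "v - \<gamma> \<notin> gaussL" by (intro small_not_gaussL) auto
    from deriv_wp_periodic[OF assms this] show ?thesis using wp'_near_0(1)[OF s] by simp
  qed
  have "(\<lambda>v. deriv wp_reg (v - \<gamma>)) analytic_on {\<gamma>}"
  proof -
    have "(deriv wp_reg \<circ> (\<lambda>v. v - \<gamma>)) holomorphic_on ball \<gamma> (1/2)"
      by (rule holomorphic_on_compose_gen[where t = "ball 0 (1/2)"])
        (auto intro!: holomorphic_intros holomorphic_deriv wp_reg_holomorphic simp: dist_norm norm_minus_commute)
    then show ?thesis unfolding analytic_at o_def by (intro exI[of _ "ball \<gamma> (1/2)"]) auto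
  qed
  then have "(\<lambda>v. - 2 / (v - \<gamma>) ^ 3 + deriv wp_reg (v - \<gamma>)) meromorphic_on {\<gamma>}"
    by (intro meromorphic_intros analytic_on_imp_meromorphic_on)
  moreover have "\<forall>\<^sub>F v in at \<gamma>. wp' v = - 2 / (v - \<gamma>) ^ 3 + deriv wp_reg (v - \<gamma>)"
    by (rule eventually_mono[OF eventually_at_in_open[of "ball \<gamma> (1/2)" \<gamma>]]) (use sub in auto)
  moreover have "wp' meromorphic_on {\<gamma>} \<longleftrightarrow> (\<lambda>v. - 2 / (v - \<gamma>) ^ 3 + deriv wp_reg (v - \<gamma>)) meromorphic_on {\<gamma>}"
    using calculation(2) by (intro meromorphic_on_cong) simp_all
  ultimately show ?thesis by blast
qed

text \<open>Divided by \<open>B\<^sup>2 wp'\<^sup>2\<close>, the left hand side of the equation has a pole of order at most two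
  if \<open>B\<close> is meromorphic, but the right hand side has one of order six.\<close>

lemma no_meromorphic_square:
  assumes \<gamma>: "\<gamma> \<in> gaussL" and t0: "t \<noteq> 0" and mer: "B meromorphic_on {\<gamma>}"
    and nz: "\<forall>\<^sub>F z in at \<gamma>. B z \<noteq> 0"
    and ode: "\<forall>\<^sub>F z in at \<gamma>. wp' z ^ 2 * (2 * B z * deriv (deriv B) z - deriv B z ^ 2) - 4 * wp' z * deriv wp' z * B z * deriv B z
    = 4 * wp' z ^ 2 * (of_real t * wp' z ^ 2 + of_real b * (wp z * deriv wp' z - 3 / 2 * wp' z ^ 2)) * B z ^ 2"
  shows False
proof -
  define n where "n = zorder B \<gamma>"
  define h where "h = zor_poly B \<gamma>"
  have "isolated_singularity_at B \<gamma>" "not_essential B \<gamma>" using mer by (simp_all add: meromorphic_at_iff)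
  moreover have "\<exists>\<^sub>F z in at \<gamma>. B z \<noteq> 0" using nz by (rule eventually_frequently[rotated]) simp
  ultimately obtain r where h: "h \<gamma> \<noteq> 0" "r > 0" "h holomorphic_on cball \<gamma> r"
      "\<And>w. w \<in> cball \<gamma> r - {\<gamma>} \<Longrightarrow> B w = h w * (w - \<gamma>) powi n"
    using zorder_exist[of B \<gamma>] unfolding n_def h_def by blast
  define D where "D = ball \<gamma> (min r (1/2))"
  have D: "open D" "\<gamma> \<in> D" "D \<subseteq> cball \<gamma> r" "D \<subseteq> ball \<gamma> (1/2)" using h(2) by (auto simp: D_def)
  have hD: "h holomorphic_on D" using holomorphic_on_subset[OF h(3) D(3)] .
  \<comment> \<open>With \<open>B = h (z - \<gamma>)^n\<close>, the functions \<open>k\<close> and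
    \<open>m\<close> are the holomorphic factors of the first and second derivatives at the powers
    \<open>n - 1\<close> and \<open>n - 2\<close>; they may vanish at
    \<open>\<gamma>\<close>.\<close>
  define k where "k = (\<lambda>z. (z - \<gamma>) * deriv h z + of_int n * h z)"
  have kD: "k holomorphic_on D" unfolding k_def by (intro holomorphic_intros holomorphic_deriv hD D(1))
  define m where "m = (\<lambda>z. (z - \<gamma>) * deriv k z + of_int (n - 1) * k z)"
  have mD: "m holomorphic_on D" unfolding m_def by (intro holomorphic_intros holomorphic_deriv kD D(1))
  have opn: "open (D - {\<gamma>})" using D(1) by (rule open_delete)
  have dpow: "deriv F v = ((v - \<gamma>) * deriv u v + of_int j * u v) * (v - \<gamma>) powi (j - 1)"
    if F: "\<And>w. w \<in> D - {\<gamma>} \<Longrightarrow> F w = u w * (w - \<gamma>) powi j" and u: "u holomorphic_on D" and v: "v \<in> D - {\<gamma>}"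
    for F u j v
  proof -
    have vn: "v - \<gamma> \<noteq> 0" using v by simp
    have "((\<lambda>w. (w - \<gamma>) powi j) has_field_derivative of_int j * (v - \<gamma>) powi (j - 1) * (1 - 0)) (at v)"
      by (intro DERIV_power_int DERIV_diff DERIV_ident DERIV_const) (use vn in auto)
    moreover have "(u has_field_derivative deriv u v) (at v)" using holomorphic_derivI[OF u D(1)] v by blast
    ultimately have "((\<lambda>w. u w * (w - \<gamma>) powi j) has_field_derivative
        deriv u v * (v - \<gamma>) powi j + of_int j * (v - \<gamma>) powi (j - 1) * (1 - 0) * u v) (at v)"
      by (rule DERIV_mult[rotated])
    then have "(F has_field_derivative
        deriv u v * (v - \<gamma>) powi j + of_int j * (v - \<gamma>) powi (j - 1) * (1 - 0) * u v) (at v)"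
      by (rule has_field_derivative_transform_within_open[OF _ opn v]) (simp add: F)
    moreover have "(v - \<gamma>) powi j = (v - \<gamma>) * (v - \<gamma>) powi (j - 1)"
      using power_int_add_1'[of "v - \<gamma>" "j - 1"] vn by simp
    ultimately show ?thesis by (simp add: DERIV_imp_deriv algebra_simps)
  qed
  have B0: "B v = h v * (v - \<gamma>) powi n" if "v \<in> D - {\<gamma>}" for v using h(4) D(3) that by blast
  have B1: "deriv B v = k v * (v - \<gamma>) powi (n - 1)" if "v \<in> D - {\<gamma>}" for v
    unfolding k_def by (rule dpow[OF B0 hD that])
  have B2: "deriv (deriv B) v = m v * (v - \<gamma>) powi (n - 1 - 1)" if "v \<in> D - {\<gamma>}" for v
    unfolding m_def by (rule dpow[OF B1 kD that])
  \<comment> \<open>\<open>P\<close>, \<open>P1\<close>, \<open>P2\<close> are what remains of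
    \<open>wp\<close> and its first two derivatives when the poles of orders 2, 3, 4 are split off.
    \<open>L\<close> and \<open>4 P1^2 R h^2\<close> are the two sides of the equation without a
    common factor; the surplus of four pole orders on the right appears in \<open>L\<close> as
    \<open>(v - \<gamma>) ^ 4\<close>.\<close>
  define P where "P = (\<lambda>v. 1 + (v - \<gamma>) ^ 2 * wp_reg (v - \<gamma>))"
  define P1 where "P1 = (\<lambda>v. - 2 + (v - \<gamma>) ^ 3 * deriv wp_reg (v - \<gamma>))"
  define P2 where "P2 = (\<lambda>v. 6 + (v - \<gamma>) ^ 4 * deriv (deriv wp_reg) (v - \<gamma>))"
  define R where "R = (\<lambda>v. of_real t * P1 v ^ 2 + of_real b * (P v * P2 v - 3 / 2 * P1 v ^ 2))"
  define L where "L = (\<lambda>v. (v - \<gamma>) ^ 4 * (P1 v ^ 2 * (2 * h v * m v - k v ^ 2) - 4 * P1 v * P2 v * h v * k v))"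
  have near: "wp v = P v / (v - \<gamma>) ^ 2" "wp' v = P1 v / (v - \<gamma>) ^ 3" "deriv wp' v = P2 v / (v - \<gamma>) ^ 4"
    if v: "v \<in> D - {\<gamma>}" for v
  proof -
    have s: "v - \<gamma> \<in> ball 0 (1/2)" "v - \<gamma> \<noteq> 0" using v D(4) by (auto simp: dist_norm norm_minus_commute)
    then have g: "v - \<gamma> \<notin> gaussL" by (intro small_not_gaussL) auto
    have "norm (v - \<gamma>) \<le> 1/2" using s(1) by simp
    with wp_periodic[OF \<gamma> g] show "wp v = P v / (v - \<gamma>) ^ 2"
      using wp_near_0[of "v - \<gamma>"] s(2) by (simp add: P_def field_simps)
    show "wp' v = P1 v / (v - \<gamma>) ^ 3" "deriv wp' v = P2 v / (v - \<gamma>) ^ 4"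
      using deriv_wp_periodic[OF \<gamma> g] deriv_wp'_periodic[OF \<gamma> g] wp'_near_0[OF s] s(2)
      by (simp_all add: P1_def P2_def field_simps)
  qed
  have key: "\<forall>\<^sub>F v in at \<gamma>. L v = 4 * P1 v ^ 2 * R v * h v ^ 2"
    using ode eventually_at_in_open[OF D(1,2)]
  proof eventually_elim
    case (elim v)
    define s where "s = v - \<gamma>"
    define x where "x = s powi (n - 1 - 1)"
    have s0: "s \<noteq> 0" using elim(2) by (simp add: s_def)
    have x1: "s powi (n - 1) = s * x" and x2: "s powi n = s ^ 2 * x"
      using power_int_add_1'[of s "n - 1 - 1"] power_int_add_1'[of s "n - 1"] s0
      by (simp_all add: x_def power2_eq_square)
    have x0: "x \<noteq> 0" using s0 by (simp add: x_def)
    define A where "A = P1 v ^ 2 * (2 * h v * m v - k v ^ 2) - 4 * P1 v * P2 v * h v * k v"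
    define C where "C = 4 * P1 v ^ 2 * R v * h v ^ 2"
    note e = elim(1)[unfolded near[OF elim(2)] B0[OF elim(2)] B1[OF elim(2)] B2[OF elim(2)], folded s_def, folded x_def,
        unfolded x1 x2]
    have "P1 v ^ 2 * (2 * h v * m v - k v ^ 2) * (x ^ 2 / s ^ 4) - 4 * P1 v * P2 v * h v * k v * (x ^ 2 / s ^ 4)
        = 4 * P1 v ^ 2 * R v * h v ^ 2 * (x ^ 2 / s ^ 8)"
    proof -
      have "P1 v ^ 2 * (2 * h v * m v - k v ^ 2) * (x ^ 2 / s ^ 4) - 4 * P1 v * P2 v * h v * k v * (x ^ 2 / s ^ 4)
          = (P1 v / s ^ 3) ^ 2 * (2 * (h v * (s ^ 2 * x)) * (m v * x) - (k v * (s * x)) ^ 2)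
            - 4 * (P1 v / s ^ 3) * (P2 v / s ^ 4) * (h v * (s ^ 2 * x)) * (k v * (s * x))"
        using s0 by (simp add: field_simps eval_nat_numeral)
      also note e
      also have "4 * (P1 v / s ^ 3) ^ 2 * (of_real t * (P1 v / s ^ 3) ^ 2 + of_real b * (P v / s ^ 2 * (P2 v / s ^ 4)
            - 3 / 2 * (P1 v / s ^ 3) ^ 2)) * (h v * (s ^ 2 * x)) ^ 2 = 4 * P1 v ^ 2 * R v * h v ^ 2 * (x ^ 2 / s ^ 8)"
        using s0 unfolding R_def by (simp add: field_simps eval_nat_numeral)
      finally show ?thesis .
    qed
    then have e2: "A * (x ^ 2 / s ^ 4) = C * (x ^ 2 / s ^ 8)"
      by (simp only: A_def C_def left_diff_distrib)
    have "s ^ 4 * A = A * (x ^ 2 / s ^ 4) * (s ^ 8 / x ^ 2)" using s0 x0 by (simp add: divide_simps eval_nat_numeral)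
    also have "\<dots> = C" unfolding e2 using s0 x0 by simp
    finally show ?case unfolding L_def A_def C_def s_def .
  qed
  have c: "isCont h \<gamma>" "isCont k \<gamma>" "isCont m \<gamma>"
    using hD kD mD D(1,2) holomorphic_on_imp_continuous_on continuous_on_eq_continuous_at by blast+
  have sh: "isCont (\<lambda>v. u (v - \<gamma>)) \<gamma>" if "u holomorphic_on ball 0 (1/2)" for u
  proof -
    have "isCont u (\<gamma> - \<gamma>)"
      using that holomorphic_on_imp_continuous_on continuous_on_eq_continuous_at[of "ball 0 (1/2)" u] by auto
    moreover have "isCont (\<lambda>v. v - \<gamma>) \<gamma>" by (intro continuous_intros)
    ultimately show ?thesis by (rule isCont_o2[rotated])
  qed
  have r: "isCont (\<lambda>v. wp_reg (v - \<gamma>)) \<gamma>" "isCont (\<lambda>v. deriv wp_reg (v - \<gamma>)) \<gamma>" "isCont (\<lambda>v. deriv (deriv wp_reg) (v - \<gamma>)) \<gamma>"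
    by (intro sh wp_reg_holomorphic holomorphic_deriv open_ball)+
  have cP: "isCont P \<gamma>" "isCont P1 \<gamma>" "isCont P2 \<gamma>"
    unfolding P_def P1_def P2_def by (intro continuous_intros r)+
  have cL: "isCont L \<gamma>" "isCont (\<lambda>v. 4 * P1 v ^ 2 * R v * h v ^ 2) \<gamma>"
    unfolding L_def R_def by (intro continuous_intros c cP)+
  have "L \<midarrow>\<gamma>\<rightarrow> 4 * P1 \<gamma> ^ 2 * R \<gamma> * h \<gamma> ^ 2"
    using cL(2) key by (subst tendsto_cong[OF key]) (simp add: isCont_def)
  moreover have "L \<midarrow>\<gamma>\<rightarrow> L \<gamma>" using cL(1) by (simp add: isCont_def)
  ultimately have "4 * P1 \<gamma> ^ 2 * R \<gamma> * h \<gamma> ^ 2 = L \<gamma>" by (rule LIM_unique)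
  \<comment> \<open>With the leading coefficients 1, -2, 6 the bracket after \<open>b\<close> is
    \<open>6 - 3/2 * 4 = 0\<close>: the term in \<open>b\<close> has a milder pole, and
    \<open>t\<close> alone makes the singularity irregular.\<close>
  moreover have "P1 \<gamma> = - 2" "R \<gamma> = 4 * of_real t" "L \<gamma> = 0"
    by (simp_all add: P_def P1_def P2_def R_def L_def)
  ultimately show False using h(1) t0 by simp
qed

context surface begin

text \<open>The Wronskian gives \<open>G' = - wp'^2 / Y2^2\<close>. Hence
  \<open>- wp'^2 / G'\<close> is a global expression for the squares of all local \<open>Y2\<close>,
  and it would be meromorphic along with \<open>G\<close>.\<close>

lemma G_not_meromorphic:
  assumes \<gamma>: "\<gamma> \<in> gaussL"
  shows "\<not> G meromorphic_on {\<gamma>}"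
proof
  assume mer: "G meromorphic_on {\<gamma>}"
  define B where "B = (\<lambda>z. - (wp' z ^ 2) / deriv G z)"
  have mB: "B meromorphic_on {\<gamma>}"
    unfolding B_def by (intro meromorphic_intros mer wp'_meromorphic \<gamma>)
  \<comment> \<open>Meromorphy excludes an accumulation of poles, so \<open>Y2\<close> has no zeros
    near \<open>\<gamma>\<close>.\<close>
  have "isolated_singularity_at G \<gamma>" using mer by (simp add: meromorphic_at_iff)
  then obtain r where r: "r > 0" "G analytic_on ball \<gamma> r - {\<gamma>}" unfolding isolated_singularity_at_def by blast
  have wpnz: "\<forall>\<^sub>F z in at \<gamma>. wp' z \<noteq> 0"
  proof (rule ccontr)
    assume "\<not> ?thesis"
    then have "\<exists>\<^sub>F z in at \<gamma>. wp' z = 0" by (simp add: frequently_def)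
    with wp'_meromorphic[OF \<gamma>] have "\<forall>\<^sub>F z in at \<gamma>. wp' z = 0"
      by (intro not_essential_frequently_0_imp_eventually_0) (simp_all add: meromorphic_at_iff)
    then obtain d where d: "d > 0" "\<And>z. z \<noteq> \<gamma> \<Longrightarrow> dist z \<gamma> < d \<Longrightarrow> wp' z = 0" by (auto simp: eventually_at)
    define v where "v = \<gamma> + of_real (min d (1/2) / 2)"
    have v: "v \<noteq> \<gamma>" "dist v \<gamma> < d" "v - \<gamma> \<noteq> 0" "norm (v - \<gamma>) < 1" using d(1) by (auto simp: v_def dist_norm)
    have "v \<notin> gaussL" using small_not_gaussL[OF v(4,3)] gaussL_add_iff[OF \<gamma>, of "v - \<gamma>"] by simp
    from wp'_isolated[OF this] have "\<forall>\<^sub>F u in at v. wp' u \<noteq> 0" by simp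
    moreover have "\<forall>\<^sub>F u in at v. u \<in> ball \<gamma> d - {\<gamma>} - {v}"
      using v by (intro eventually_at_in_open) (auto simp: dist_commute)
    ultimately have "\<forall>\<^sub>F u in at v. False" by eventually_elim (use d(2) in \<open>auto simp: dist_commute\<close>)
    then show False by simp
  qed
  then obtain d where d: "d > 0" "\<And>z. z \<noteq> \<gamma> \<Longrightarrow> dist z \<gamma> < d \<Longrightarrow> wp' z \<noteq> 0" by (auto simp: eventually_at)
  define D where "D = ball \<gamma> (min (min r d) 1) - {\<gamma>}"
  have D: "open D" "\<forall>\<^sub>F z in at \<gamma>. z \<in> D" "D \<subseteq> - gaussL" "D \<subseteq> ball \<gamma> r - {\<gamma>}" "\<And>z. z \<in> D \<Longrightarrow> wp' z \<noteq> 0"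
  proof -
    show "open D" "D \<subseteq> ball \<gamma> r - {\<gamma>}" by (auto simp: D_def intro: open_delete)
    show "\<forall>\<^sub>F z in at \<gamma>. z \<in> D" unfolding D_def using r(1) d(1) by (intro eventually_at_in_open) auto
    show "wp' z \<noteq> 0" if "z \<in> D" for z using that d(2)[of z] by (auto simp: D_def dist_commute)
    show "D \<subseteq> - gaussL"
    proof
      fix z assume z: "z \<in> D"
      then have "norm (z - \<gamma>) < 1" "z - \<gamma> \<noteq> 0" by (auto simp: D_def dist_norm norm_minus_commute)
      from small_not_gaussL[OF this] show "z \<in> - gaussL" using gaussL_add_iff[OF \<gamma>, of "z - \<gamma>"] by simp
    qed
  qed
  have loc: "\<exists>W Y H. open W \<and> z \<in> W \<and> W \<subseteq> - gaussL \<and> wsol b t W Y H \<and> (\<forall>v\<in>W. B v = Y v ^ 2 \<and> Y v \<noteq> 0)"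
    if z: "z \<in> D" for z
  proof -
    obtain W F a1 a2 Y1 Y2 H2 where W0: "z \<in> W" "local_data W F a1 a2 Y1 Y2 H2"
      using local_data_exists z D(3) by blast
    note W = local_dataD[OF W0(2)]
    interpret Y: wronskian W Y1 Y2 "\<lambda>z. wp' z ^ 2" by (rule bryant_wronskian(2)[OF W0(2)])
    have "B v = Y2 v ^ 2 \<and> Y2 v \<noteq> 0" if v: "v \<in> W \<inter> D" for v
    proof -
      have "G analytic_on {v}" using r(2) v D(4) analytic_on_subset by blast
      then have "\<not> is_pole G v" by (rule analytic_at_imp_no_pole)
      then have y: "Y2 v \<noteq> 0" using G_pole_iff[OF W0(2), of v] v by blast
      have "deriv G v = deriv (\<lambda>z. Y1 z / Y2 z) v"
        using v by (intro deriv_cong_ev G_local_cong[OF W0(2)]) auto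
      also have "\<dots> = - (wp' v ^ 2) / Y2 v ^ 2" using v y Y.ratio_deriv[of v] by simp
      finally show ?thesis using y D(5)[of v] v by (simp add: B_def)
    qed
    moreover have "wsol b t (W \<inter> D) Y2 H2" using lin_sol_subset[OF W(3)] by blast
    ultimately show ?thesis using Y.opn D(1) W(1) W0(1) z by (intro exI[of _ "W \<inter> D"] exI[of _ Y2] exI[of _ H2]) auto
  qed
  show False
  proof (rule no_meromorphic_square[OF \<gamma> t0 mB])
    show "\<forall>\<^sub>F z in at \<gamma>. B z \<noteq> 0" using D(2)
    proof eventually_elim
      case (elim z)
      then show ?case using loc[OF elim] by force
    qed
    show "\<forall>\<^sub>F z in at \<gamma>. wp' z ^ 2 * (2 * B z * deriv (deriv B) z - deriv B z ^ 2) - 4 * wp' z * deriv wp' z * B z * deriv B z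
    = 4 * wp' z ^ 2 * (of_real t * wp' z ^ 2 + of_real b * (wp z * deriv wp' z - 3 / 2 * wp' z ^ 2)) * B z ^ 2" using D(2)
    proof eventually_elim
      case (elim z)
      obtain W Y H where W: "open W" "z \<in> W" "W \<subseteq> - gaussL" "wsol b t W Y H" "\<And>v. v \<in> W \<Longrightarrow> B v = Y v ^ 2"
        using loc[OF elim] by blast
      have d1: "deriv B v = deriv (\<lambda>z. Y z ^ 2) v" if "v \<in> W" for v
        by (rule deriv_cong_ev[OF _ refl], rule eventually_mono[OF eventually_nhds_in_open[OF W(1) that]]) (rule W(5))
      have d2: "deriv (deriv B) z = deriv (deriv (\<lambda>z. Y z ^ 2)) z"
        by (rule deriv_cong_ev[OF _ refl], rule eventually_mono[OF eventually_nhds_in_open[OF W(1,2)]]) (rule d1)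
      from square_of_solution[OF W(4,1,3,2)] show ?case unfolding d2 d1[OF W(2)] W(5)[OF W(2)] .
    qed
  qed
qed

lemma irregular: "p \<in> ends \<Longrightarrow> irregular_end 2 (2 * \<i>) ends f p"
  unfolding irregular_end_def
  using hyperbolic_gauss_map_G G_not_meromorphic ends_subset by blast

end

section \<open>Existence of the family\<close>

theorem mainTheorem4:
  fixes P :: "complex set set" and Q :: "complex \<Rightarrow> complex"
  defines "P \<equiv> {proj 2 (2 * \<i>) 0, proj 2 (2 * \<i>) 1, proj 2 (2 * \<i>) (1 + \<i>), proj 2 (2 * \<i>) \<i>}"
    and "Q \<equiv> (\<lambda>z. (deriv (weierstrass_p 1 \<i>) z)\<^sup>2)"
  shows "(\<exists>\<epsilon>>0. \<exists>f :: real \<Rightarrow> complex set \<Rightarrow> cmat2. \<forall>t. 0 < \<bar>t\<bar> \<and> \<bar>t\<bar> < \<epsilon> \<longrightarrow>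
            complete_cmc1_ftc 2 (2 * \<i>) P (f t) \<and>
            hopf_differential 2 (2 * \<i>) P (f t) (\<lambda>z. of_real t * Q z) \<and>
            (\<forall>p\<in>P. irregular_end 2 (2 * \<i>) P (f t) p)) \<and>
         (\<exists>w1 w2 P' (f :: complex set \<Rightarrow> cmat2).
            w1 \<noteq> 0 \<and> Im (w2 / w1) \<noteq> 0 \<and> P' \<subseteq> torus w1 w2 \<and> card P' = 4 \<and>
            complete_cmc1_ftc w1 w2 P' f \<and>
            (\<forall>p\<in>P'. irregular_end w1 w2 P' f p))"
proof -
  obtain \<epsilon> where \<epsilon>: "\<epsilon> > 0" "\<And>t. \<bar>t\<bar> < \<epsilon> \<Longrightarrow> \<exists>b. b \<in> {0..bmax} \<and> disc b t = 0 \<and> \<bar>disc b 0\<bar> \<le> 1/2"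
    using parameter_exists by blast
  then obtain b where b: "b t \<in> {0..bmax}" "disc (b t) t = 0" "\<bar>disc (b t) 0\<bar> \<le> 1/2" if "\<bar>t\<bar> < \<epsilon>" for t
    by metis
  have P: "P = ends" unfolding P_def ends_def ..
  define fam where "fam = (\<lambda>t. surface.f (b t) t)"
  have main: "complete_cmc1_ftc 2 (2 * \<i>) P (fam t) \<and>
      hopf_differential 2 (2 * \<i>) P (fam t) (\<lambda>z. of_real t * Q z) \<and>
      (\<forall>p\<in>P. irregular_end 2 (2 * \<i>) P (fam t) p)" if "0 < \<bar>t\<bar> \<and> \<bar>t\<bar> < \<epsilon>" for t
  proof -
    interpret surface "b t" t
      using b[of t] that by unfold_locales auto
    show ?thesis unfolding P Q_def fam_def using complete_cmc1 hopf irregular by blast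
  qed
  moreover have "P \<subseteq> torus 2 (2 * \<i>)" unfolding P_def using proj_in_torus by auto
  moreover have "card P = 4" unfolding P by (rule card_ends)
  \<comment> \<open>The member \<open>t = \<epsilon> / 2\<close> of the family witnesses the second
    claim.\<close>
  moreover have "0 < \<bar>\<epsilon> / 2\<bar> \<and> \<bar>\<epsilon> / 2\<bar> < \<epsilon>" using \<epsilon>(1) by simp
  moreover have "(2 :: complex) \<noteq> 0" "Im (2 * \<i> / 2) \<noteq> 0" by simp_all
  ultimately show ?thesis using \<epsilon>(1) by blast
qed

end
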